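(* Let $n, N, \ell$ be integers with $n\ge 3$, $N\ge n$ and $0<\ell\le (n-1)/2$. Let $M_\ell\subset\mathbb C^n$ be a smooth ($C^\infty$) Levi-nondegenerate real hypersurface of signature $\ell$, and let $p\in M_\ell$. Let $U\subset\mathbb C^n$ be an open neighborhood of $p$ and let $F:U\to\mathbb C^N$ be a holomorphic map with $F(M_\ell\cap U)\subset\mathbb H^N_\ell$. Then either $F$ is CR transversal to $\mathbb H^N_\ell$ at $p$, or $F$ maps some neighborhood of $p$ in $\mathbb C^n$ into $\mathbb H^N_\ell$. Equivalently, if $F$ is not totally degenerate as a germ at $p$, then $F$ is a local CR embedding of $M_\ell$ into $\mathbb H^N_\ell$ near $p$.
   Context: The standard hyperquadric of signature $\ell$ in $\mathbb C^N$ is $$\mathbb H^N_\ell=\{(Z,W)\in\mathbb C^{N-1}\times\mathbb C:\ \operatorname{Im}W=|Z|_\ell^2\},$$ where $\langle a,\overline b\rangle_\ell=-\sum_{j=1}^{\ell}a_j\overline{b_j}+\sum_{j=\ell+1}^{N-1}a_j\overline{b_j}$ and $|a|_\ell^2=\langle a,\overline a\rangle_\ell$. A Levi-nondegenerate real hypersurface $M\subset\mathbb C^n$ has signature $\ell$ (with $\ell\le (n-1)/2$) if, at each of its points, after possibly replacing a local defining function $\rho$ by $-\rho$, the Levi form (a nondegenerate Hermitian form on the $(n-1)$-dimensional space $T^{1,0}M$) has exactly $\ell$ negative and $n-1-\ell$ positive eigenvalues. Let $M_1\subset\mathbb C^n$ and $M_2\subset\mathbb C^N$ be smooth real hypersurfaces,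 $p\in M_1$, and let $F$ be a holomorphic map from a neighborhood of $p$ in $\mathbb C^n$ to $\mathbb C^N$ sending $M_1$ (near $p$) into $M_2$. Then: - $F$ is CR transversal to $M_2$ at $p$ if $T^{1,0}_{F(p)}M_2+dF_p\bigl(T^{1,0}_p\mathbb C^n\bigr)=T^{1,0}_{F(p)}\mathbb C^N$. Here $T^{1,0}_qM_2$ is the space of $(1,0)$-vectors at $q$ tangent to $M_2$. - $F$ is totally degenerate as a germ at $p$ if it maps some neighborhood of $p$ in $\mathbb C^n$ into $M_2$. - $F$ is a local CR embedding near $p$ if, for some neighborhood $V$ of $p$, the restriction of $F$ to $M_1\cap V$ is a smooth embedding into $M_2$ which is a CR diffeomorphism onto its image, the image being a CR submanifold of $M_2$. *)

theory Defs
  imports "HOL-Analysis.Analysis"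
begin

section \<open>Smooth and holomorphic maps\<close>

(* Class C^k on an open set S: all iterated directional derivatives up to order k exist
   and are continuous.  Meaningful only for open S. *)
primrec C_k_on :: "nat \<Rightarrow> 'a::euclidean_space set \<Rightarrow> ('a \<Rightarrow> 'b::real_normed_vector) \<Rightarrow> bool" where
  "C_k_on 0 S = (\<lambda>f. continuous_on S f)"
| "C_k_on (Suc k) S = (\<lambda>f. (\<forall>x\<in>S. f differentiable (at x)) \<and>
      (\<forall>v. C_k_on k S (\<lambda>x. frechet_derivative f (at x) v)))"

definition smooth_on :: "'a::euclidean_space set \<Rightarrow> ('a \<Rightarrow> 'b::real_normed_vector) \<Rightarrow> bool" where
  "smooth_on S f \<longleftrightarrow> (\<forall>k. C_k_on k S f)"

(* Holomorphy in several variables: complex differentiability at each point of an open set,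
   i.e. the real Frechet derivative exists and is complex linear. *)
definition holomorphic_map_on ::
    "(complex^'n::finite) set \<Rightarrow> (complex^'n \<Rightarrow> complex^'k::finite) \<Rightarrow> bool" where
  "holomorphic_map_on U F \<longleftrightarrow>
     (\<forall>z\<in>U. \<exists>D. (F has_derivative D) (at z) \<and> (\<forall>c v. D (c *s v) = c *s D v))"

(* The partial derivatives d/dz_j = (d/dx_j - i d/dy_j)/2 and d/dzbar_j = (d/dx_j + i d/dy_j)/2. *)
definition wirtinger :: "'n \<Rightarrow> (complex^'n::finite \<Rightarrow> complex) \<Rightarrow> complex^'n \<Rightarrow> complex" where
  "wirtinger j f z = (frechet_derivative f (at z) (axis j 1)
                       - \<i> * frechet_derivative f (at z) (axis j \<i>)) / 2"

definition wirtinger_bar :: "'n \<Rightarrow> (complex^'n::finite \<Rightarrow> complex) \<Rightarrow> complex^'n \<Rightarrow> complex" where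
  "wirtinger_bar j f z = (frechet_derivative f (at z) (axis j 1)
                       + \<i> * frechet_derivative f (at z) (axis j \<i>)) / 2"


section \<open>Submanifolds and their tangent spaces\<close>

(* Smooth embedded submanifold of real dimension d: locally the common zero set of
   DIM('a) - d smooth real functions with linearly independent differentials. *)
definition smooth_submanifold :: "nat \<Rightarrow> 'a::euclidean_space set \<Rightarrow> bool" where
  "smooth_submanifold d S \<longleftrightarrow> d \<le> DIM('a) \<and>
     (\<forall>q\<in>S. \<exists>V (\<rho> :: nat \<Rightarrow> 'a \<Rightarrow> real). open V \<and> q \<in> V \<and>
        (\<forall>i < DIM('a) - d. smooth_on V (\<rho> i)) \<and>
        S \<inter> V = {z\<in>V. \<forall>i < DIM('a) - d. \<rho> i z = 0} \<and>
        (\<forall>z\<in>S \<inter> V. \<forall>c :: nat \<Rightarrow> real.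
           (\<forall>v. (\<Sum>i < DIM('a) - d. c i * frechet_derivative (\<rho> i) (at z) v) = 0)
           \<longrightarrow> (\<forall>i < DIM('a) - d. c i = 0)))"

definition local_defining_function ::
    "'a::euclidean_space set \<Rightarrow> 'a \<Rightarrow> 'a set \<Rightarrow> ('a \<Rightarrow> real) \<Rightarrow> bool" where
  "local_defining_function M q V \<rho> \<longleftrightarrow> open V \<and> q \<in> V \<and> smooth_on V \<rho> \<and>
     M \<inter> V = {z\<in>V. \<rho> z = 0} \<and> (\<forall>z\<in>M \<inter> V. \<exists>v. frechet_derivative \<rho> (at z) v \<noteq> 0)"

definition smooth_real_hypersurface :: "'a::euclidean_space set \<Rightarrow> bool" where
  "smooth_real_hypersurface M \<longleftrightarrow> (\<forall>q\<in>M. \<exists>V \<rho>. local_defining_function M q V \<rho>)"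

(* A vector is tangent to S at q iff it annihilates every smooth function near q vanishing on S. *)
definition tangent_space :: "'a::euclidean_space set \<Rightarrow> 'a \<Rightarrow> 'a set" where
  "tangent_space S q = {v. \<forall>V (f :: 'a \<Rightarrow> real).
      open V \<and> q \<in> V \<and> smooth_on V f \<and> (\<forall>z\<in>S \<inter> V. f z = 0)
      \<longrightarrow> frechet_derivative f (at q) v = 0}"

(* The space T^{1,0}_q S of (1,0)-vectors tangent to S.  The vector sum_j a_j d/dz_j
   is represented by its coefficient vector a; thus T^{1,0}_q C^n is all of complex^'n. *)
definition T10 :: "(complex^'n::finite) set \<Rightarrow> complex^'n \<Rightarrow> (complex^'n) set" where
  "T10 S q = {a. \<forall>V (f :: complex^'n \<Rightarrow> real).
      open V \<and> q \<in> V \<and> smooth_on V f \<and> (\<forall>z\<in>S \<inter> V. f z = 0)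
      \<longrightarrow> (\<Sum>j\<in>UNIV. a $ j * wirtinger j (\<lambda>z. complex_of_real (f z)) q) = 0}"


section \<open>Levi form and signature\<close>

definition levi_form ::
    "(complex^'n::finite \<Rightarrow> real) \<Rightarrow> complex^'n \<Rightarrow> complex^'n \<Rightarrow> complex^'n \<Rightarrow> complex" where
  "levi_form \<rho> q a b = (\<Sum>j\<in>UNIV. \<Sum>k\<in>UNIV.
      wirtinger j (wirtinger_bar k (\<lambda>z. complex_of_real (\<rho> z))) q * a $ j * cnj (b $ k))"

definition hermitian_inner :: "complex^'n::finite \<Rightarrow> complex^'n \<Rightarrow> complex" where
  "hermitian_inner a b = (\<Sum>j\<in>UNIV. a $ j * cnj (b $ j))"

(* Eigenvectors of a Hermitian form H on a subspace T, taken with respect to the standard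
   Hermitian inner product.  By Sylvester's law of inertia, the numbers of negative and of
   positive eigenvalues do not depend on the inner product. *)
definition form_eigenspace ::
    "(complex^'n::finite \<Rightarrow> complex^'n \<Rightarrow> complex) \<Rightarrow> (complex^'n) set \<Rightarrow> real \<Rightarrow> (complex^'n) set" where
  "form_eigenspace H T \<mu> = {v\<in>T. \<forall>w\<in>T. H v w = complex_of_real \<mu> * hermitian_inner v w}"

(* Eigenvalues are counted with multiplicity; the index sets of the two sums are finite. *)
definition num_neg_eigenvalues ::
    "(complex^'n::finite \<Rightarrow> complex^'n \<Rightarrow> complex) \<Rightarrow> (complex^'n) set \<Rightarrow> nat" where
  "num_neg_eigenvalues H T =
     (\<Sum>\<mu> | \<mu> < 0 \<and> (\<exists>v\<in>form_eigenspace H T \<mu>. v \<noteq> 0). vec.dim (form_eigenspace H T \<mu>))"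

definition num_pos_eigenvalues ::
    "(complex^'n::finite \<Rightarrow> complex^'n \<Rightarrow> complex) \<Rightarrow> (complex^'n) set \<Rightarrow> nat" where
  "num_pos_eigenvalues H T =
     (\<Sum>\<mu> | \<mu> > 0 \<and> (\<exists>v\<in>form_eigenspace H T \<mu>. v \<noteq> 0). vec.dim (form_eigenspace H T \<mu>))"

definition levi_nondegenerate :: "(complex^'n::finite) set \<Rightarrow> bool" where
  "levi_nondegenerate M \<longleftrightarrow> (\<forall>q\<in>M. \<forall>V \<rho>. local_defining_function M q V \<rho> \<longrightarrow>
     (\<forall>a\<in>T10 M q. (\<forall>b\<in>T10 M q. levi_form \<rho> q a b = 0) \<longrightarrow> a = 0))"

definition has_signature :: "(complex^'n::finite) set \<Rightarrow> nat \<Rightarrow> bool" where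
  "has_signature M l \<longleftrightarrow> (\<forall>q\<in>M. \<forall>V \<rho>. local_defining_function M q V \<rho> \<longrightarrow>
     (\<exists>\<sigma>\<in>{\<rho>, \<lambda>z. - \<rho> z}.
        num_neg_eigenvalues (levi_form \<sigma> q) (T10 M q) = l \<and>
        num_pos_eigenvalues (levi_form \<sigma> q) (T10 M q) = CARD('n) - 1 - l))"


section \<open>The standard hyperquadric\<close>

(* Type-indexed vectors carry no order on their coordinates.  A bijection e from
   {1..N}, N = CARD('k), to 'k numbers them: Z_j = z $ e j for 1 <= j <= N - 1, W = z $ e N. *)
definition quadric_form ::
    "(nat \<Rightarrow> 'k) \<Rightarrow> nat \<Rightarrow> complex^'k::finite \<Rightarrow> complex^'k \<Rightarrow> complex" where
  "quadric_form e l a b = - (\<Sum>j = 1..l. a $ e j * cnj (b $ e j))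
                          + (\<Sum>j = l + 1..CARD('k) - 1. a $ e j * cnj (b $ e j))"

definition hyperquadric :: "(nat \<Rightarrow> 'k) \<Rightarrow> nat \<Rightarrow> (complex^'k::finite) set" where
  "hyperquadric e l = {z. complex_of_real (Im (z $ e CARD('k))) = quadric_form e l z z}"


section \<open>Properties of maps at a point\<close>

definition CR_transversal_at ::
    "(complex^'n::finite \<Rightarrow> complex^'k::finite) \<Rightarrow> (complex^'k) set \<Rightarrow> complex^'n \<Rightarrow> bool" where
  "CR_transversal_at F M' p \<longleftrightarrow>
     {u + frechet_derivative F (at p) v | u v. u \<in> T10 M' (F p)} = UNIV"

(* This and local_CR_embedding_near depend only on the germ of F at p: the neighborhood V
   may always be shrunk into the domain on which F is given. *)
definition totally_degenerate_at ::
    "(complex^'n::finite \<Rightarrow> complex^'k::finite) \<Rightarrow> (complex^'k) set \<Rightarrow> complex^'n \<Rightarrow> bool" where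
  "totally_degenerate_at F M' p \<longleftrightarrow> (\<exists>V. open V \<and> p \<in> V \<and> F ` V \<subseteq> M')"

(* As usual, a map on a subset S is smooth if it locally extends to a smooth map of the
   ambient space; the differential on tangent vectors of S does not depend on the extension. *)
definition smooth_extension_at ::
    "'a::euclidean_space set \<Rightarrow> ('a \<Rightarrow> 'b::euclidean_space) \<Rightarrow> 'a \<Rightarrow> ('a \<Rightarrow> 'b) \<Rightarrow> bool" where
  "smooth_extension_at S f q g \<longleftrightarrow>
     (\<exists>V. open V \<and> q \<in> V \<and> smooth_on V g \<and> (\<forall>z\<in>S \<inter> V. g z = f z))"

definition smooth_embedding ::
    "'a::euclidean_space set \<Rightarrow> 'b::euclidean_space set \<Rightarrow> ('a \<Rightarrow> 'b) \<Rightarrow> bool" where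
  "smooth_embedding S S' f \<longleftrightarrow> f ` S \<subseteq> S' \<and>
     (\<forall>q\<in>S. \<exists>g. smooth_extension_at S f q g \<and>
        inj_on (frechet_derivative g (at q)) (tangent_space S q)) \<and>
     (\<exists>h. homeomorphism S (f ` S) f h)"

(* The push-forward of the (1,0)-vector represented by a is of type (1,0) iff the real
   differential Dg satisfies Dg (i a) = i Dg a; it is then represented by Dg a. *)
definition smooth_CR_map ::
    "(complex^'n::finite) set \<Rightarrow> (complex^'k::finite) set \<Rightarrow> (complex^'n \<Rightarrow> complex^'k) \<Rightarrow> bool" where
  "smooth_CR_map S S' f \<longleftrightarrow> f ` S \<subseteq> S' \<and>
     (\<forall>q\<in>S. \<exists>g. smooth_extension_at S f q g \<and>
        (\<forall>a\<in>T10 S q. frechet_derivative g (at q) a \<in> T10 S' (f q) \<and>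
           frechet_derivative g (at q) (\<i> *s a) = \<i> *s frechet_derivative g (at q) a))"

definition CR_diffeomorphism ::
    "(complex^'n::finite) set \<Rightarrow> (complex^'k::finite) set \<Rightarrow> (complex^'n \<Rightarrow> complex^'k) \<Rightarrow> bool" where
  "CR_diffeomorphism S S' f \<longleftrightarrow> bij_betw f S S' \<and> smooth_CR_map S S' f \<and>
     smooth_CR_map S' S (inv_into S f)"

(* For S contained in M', T^{1,0} S is the same inside T^{1,0} M' as inside T^{1,0} C^N. *)
definition CR_submanifold_of :: "(complex^'k::finite) set \<Rightarrow> (complex^'k) set \<Rightarrow> bool" where
  "CR_submanifold_of S M' \<longleftrightarrow> S \<subseteq> M' \<and> (\<exists>d. smooth_submanifold d S) \<and>
     (\<exists>r. \<forall>q\<in>S. vec.dim (T10 S q) = r)"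

definition local_CR_embedding_near ::
    "(complex^'n::finite \<Rightarrow> complex^'k::finite) \<Rightarrow> (complex^'n) set \<Rightarrow> (complex^'k) set \<Rightarrow> complex^'n \<Rightarrow> bool" where
  "local_CR_embedding_near F M M' p \<longleftrightarrow> (\<exists>V. open V \<and> p \<in> V \<and>
     smooth_embedding (M \<inter> V) M' F \<and>
     CR_diffeomorphism (M \<inter> V) (F ` (M \<inter> V)) F \<and>
     CR_submanifold_of (F ` (M \<inter> V)) M')"

end

theory Submission
  imports Defs "HOL-Complex_Analysis.Complex_Analysis"
begin

text \<open>
  Normalise \<open>M\<close> at \<open>p\<close> by a frame in which its Levi form is diagonal with entries \<open>-\<epsilon>\<^sub>j = \<plusminus>1\<close>. Under the
  curved dilations \<open>p + t x' + t\<^sup>2 (x\<^sub>n + S(x',x')) \<nu>\<close> a defining function of \<open>M\<close>, divided by \<open>t\<^sup>2\<close>,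
  converges to \<open>Im x\<^sub>n - \<Sum>\<epsilon>\<^sub>j |x\<^sub>j|\<^sup>2\<close>. Pull the polarised equation of the hyperquadric back by \<open>F\<close>
  and expand it in powers of \<open>t\<close> along the dilations. If all coefficients vanish, \<open>F\<close> maps a neighbourhood of
  \<open>p\<close> into the hyperquadric. Otherwise the first nonzero coefficient is a Hermitian kernel that vanishes
  on the diagonal over the model quadric and has at most \<open>l\<close> positive directions on null combinations of
  points, since the hyperquadric has signature \<open>l\<close>.

  For such a kernel let \<open>\<alpha>\<close> be its normal derivative on the quadric. Differentiating along the tangential
  directions produces \<open>\<alpha>\<close> times the Levi form, and both signs of the Levi form occur with multiplicity at least
  \<open>l\<close>. Whenever \<open>\<alpha>\<close> were zero at one point and the kernel nonzero, one would find an isotropic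
  vector orthogonal to \<open>l\<close> positive directions but not in the radical. Hence the zero set of \<open>\<alpha>\<close> is
  invariant under the null lines of the quadric, so it is everything or empty, and in the first case all
  normal derivatives vanish and the kernel is zero. Therefore \<open>\<alpha> \<noteq> 0\<close>, and homogeneity forces the
  order to be \<open>2\<close>. This says that the equation of the hyperquadric has nonzero derivative along \<open>dF \<nu>\<close>, which
  is transversality; moreover the kernel of order \<open>2\<close> restricts to a nonzero multiple of the Levi form, so
  \<open>dF\<close> is injective at \<open>p\<close> and a holomorphic left inverse of \<open>F\<close> yields the local embedding.
\<close>

section \<open>Holomorphic functions of several variables\<close>

text \<open>\<open>M\<close> is only smooth, so its own equation cannot be polarised; on the
  limiting quadric it can, and a kernel vanishing on the diagonal vanishes at all pairs with
  \<open>qrho x y = 0\<close>. The argument is a count of positive directions without slack. In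
  homogeneous coordinates the equation of the hyperquadric is a Hermitian form with l + 1 positive
  directions, one too many. Null combinations of points have homogenising coordinate 0, and on them
  only l are left; derivatives of the coordinate functions are limits of such combinations.
  Tangential first derivatives have Gram matrix 2\<i>\<alpha> times the Levi form. If \<alpha> is
  nonzero they contain l positive directions, whatever the sign of 2\<i>\<alpha>, and an isotropic
  vector orthogonal to these lies in the radical. If \<alpha> vanishes at a point they are all
  isotropic there, at least 2 l \<ge> l + 1 of them, and a nonzero higher normal derivative would
  pair them into l + 1 hyperbolic planes. The order 2 comes from the weight 2 of the normal
  coordinate: only the coefficient of that weight has a normal derivative at the origin.\<close>

definition holo :: "(complex^'n::finite) set \<Rightarrow> (complex^'n \<Rightarrow> complex) \<Rightarrow> bool" where
  "holo U f \<longleftrightarrow> (\<forall>z\<in>U. \<exists>D. (f has_derivative D) (at z) \<and> (\<forall>c v. D (c *s v) = c * D v))"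

text \<open>The direction is the first argument, so that \<open>dird u\<close> is an operator on
  functions and can be iterated.\<close>

definition dird :: "'a::real_normed_vector \<Rightarrow> ('a \<Rightarrow> 'b::real_normed_vector) \<Rightarrow> 'a \<Rightarrow> 'b" where
  "dird u f x = frechet_derivative f (at x) u"

lemma dird_eq: "(f has_derivative D) (at x) \<Longrightarrow> dird u f x = D u"
  unfolding dird_def using frechet_derivative_at by metis

lemma holo_deriv: "holo U f \<Longrightarrow> x \<in> U \<Longrightarrow> (f has_derivative (\<lambda>u. dird u f x)) (at x)"
proof -
  assume "holo U f" "x \<in> U"
  then obtain D where D: "(f has_derivative D) (at x)" unfolding holo_def by blast
  have "(\<lambda>u. dird u f x) = D" using dird_eq[OF D] by (rule ext)
  with D show ?thesis by simp
qed

lemma holo_dird_scale: "holo U f \<Longrightarrow> x \<in> U \<Longrightarrow> dird (c *s u) f x = c * dird u f x"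
  unfolding holo_def by (metis dird_eq)

lemma holo_dird_add: "holo U f \<Longrightarrow> x \<in> U \<Longrightarrow> dird (u + v) f x = dird u f x + dird v f x"
  using holo_deriv[THEN has_derivative_linear, THEN linear_add] .

lemma holo_dird_scaleR: "holo U f \<Longrightarrow> x \<in> U \<Longrightarrow> dird (c *\<^sub>R u) f x = of_real c * dird u f x"
  using holo_deriv[THEN has_derivative_linear, THEN linear_scale] by (simp add: scaleR_conv_of_real)

lemma holoI: "(\<And>z. z \<in> U \<Longrightarrow> (f has_derivative D z) (at z)) \<Longrightarrow>
    (\<And>z c v. z \<in> U \<Longrightarrow> D z (c *s v) = c * D z v) \<Longrightarrow> holo U f"
  unfolding holo_def by blast

lemma holo_continuous_on: "holo U f \<Longrightarrow> continuous_on U f"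
  by (meson continuous_at_imp_continuous_on has_derivative_continuous holo_deriv)

lemma bounded_linear_vscale: "bounded_linear (\<lambda>t::complex. t *s (v::complex^'n::finite))"
proof -
  have "linear (\<lambda>t::complex. t *s v)"
    by (rule linearI) (simp_all add: vec_eq_iff algebra_simps)
  then show ?thesis by (simp add: linear_conv_bounded_linear)
qed

lemma vscale_has_derivative:
  "((\<lambda>t::complex. x + t *s (v::complex^'n::finite)) has_derivative (\<lambda>h. h *s v)) (at t)"
  using has_derivative_add[OF has_derivative_const bounded_linear.has_derivative[OF bounded_linear_vscale has_derivative_ident]]
  by fastforce

lemma continuous_on_vscale [continuous_intros]:
  "continuous_on S f \<Longrightarrow> continuous_on S (\<lambda>x. f x *s (v::complex^'n::finite))" for f :: "_ \<Rightarrow> complex"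
  by (rule bounded_linear.continuous_on[OF bounded_linear_vscale])

lemma holo_line:
  assumes "holo U f" "x + t *s v \<in> U"
  shows "((\<lambda>t. f (x + t *s v)) has_field_derivative dird v f (x + t *s v)) (at t)"
proof -
  have "((\<lambda>t. f (x + t *s v)) has_derivative (\<lambda>h. dird (h *s v) f (x + t *s v))) (at t)"
    using diff_chain_at[OF vscale_has_derivative holo_deriv[OF assms]] by (simp add: o_def)
  moreover have "(\<lambda>h. dird (h *s v) f (x + t *s v)) = (*) (dird v f (x + t *s v))"
    by (rule ext) (simp add: holo_dird_scale[OF assms])
  ultimately show ?thesis unfolding has_field_derivative_def by metis
qed

section \<open>Cauchy's formula and holomorphy of directional derivatives\<close>

text \<open>Cauchy's formula for the derivative at the centre of the unit disc in the complex line
  through x in direction v. Written over [0,1], x enters only as a parameter, so its regularity can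
  be studied under the integral sign.\<close>

lemma dird_integral:
  fixes f :: "complex^'n::finite \<Rightarrow> complex"
  assumes f: "holo U f" and x: "\<And>\<zeta>. cmod \<zeta> \<le> 1 \<Longrightarrow> x + \<zeta> *s v \<in> U"
  shows "dird v f x = integral {0..1} (\<lambda>\<theta>. f (x + exp (2 * of_real pi * \<i> * of_real \<theta>) *s v) / exp (2 * of_real pi * \<i> * of_real \<theta>))"
proof -
  let ?g = "\<lambda>\<zeta>. f (x + \<zeta> *s v)"
  have d: "(?g has_field_derivative dird v f (x + \<zeta> *s v)) (at \<zeta>)" if "cmod \<zeta> \<le> 1" for \<zeta>
    by (rule holo_line[OF f x[OF that]])
  have c: "continuous_on (cball 0 1) ?g"
    using d by (auto intro!: continuous_at_imp_continuous_on DERIV_isCont)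
  have h: "?g holomorphic_on ball 0 1"
  proof (rule holomorphic_onI)
    fix z :: complex assume "z \<in> ball 0 1"
    then have "cmod z \<le> 1" by simp
    from d[OF this] show "?g field_differentiable at z within ball 0 1"
      using field_differentiable_at_within field_differentiable_def by blast
  qed
  have c0: "(?g has_field_derivative (1 / (2 * of_real pi * \<i>) * contour_integral(circlepath 0 1) (\<lambda>u. ?g u / (u-0)^2))) (at 0)"
    by (rule Cauchy_derivative_integral_circlepath(2)[OF c h]) simp
  have "dird v f x = 1 / (2 * of_real pi * \<i>) * contour_integral(circlepath 0 1) (\<lambda>u. ?g u / u^2)"
  proof -
    have "(?g has_field_derivative dird v f x) (at 0)" using d[of 0] by simp
    from DERIV_unique[OF this c0] show ?thesis by simp
  qed
  also have "contour_integral(circlepath 0 1) (\<lambda>u. ?g u / u^2) =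
     integral {0..1} (\<lambda>\<theta>. (2 * of_real pi * \<i>) * (?g (exp (2 * of_real pi * \<i> * of_real \<theta>)) / exp (2 * of_real pi * \<i> * of_real \<theta>)))"
    unfolding contour_integral_integral vector_derivative_circlepath
    by (rule integral_cong) (simp add: circlepath power2_eq_square field_simps)
  also have "\<dots> = (2 * of_real pi * \<i>) * integral {0..1} (\<lambda>\<theta>. ?g (exp (2 * of_real pi * \<i> * of_real \<theta>)) / exp (2 * of_real pi * \<i> * of_real \<theta>))"
    by (rule integral_mult_right)
  finally show ?thesis by simp
qed

lemma norm_vscale: "norm (c *s (v::complex^'n::finite)) = cmod c * norm v"
  by (simp add: norm_vec_def L2_set_def norm_mult power_mult_distrib sum_distrib_left[symmetric] real_sqrt_mult)

lemma dird_integral_local: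
  fixes f :: "complex^'n::finite \<Rightarrow> complex"
  assumes "open U" and f: "holo U f" and "x0 \<in> U"
  obtains r c where "r > 0" "c > 0" "ball x0 r \<subseteq> U"
    "\<And>x \<zeta>. x \<in> ball x0 r \<Longrightarrow> cmod \<zeta> \<le> 1 \<Longrightarrow> x + \<zeta> *s (c *\<^sub>R v) \<in> U"
    "\<And>x. x \<in> ball x0 r \<Longrightarrow> dird v f x = (1 / of_real c) * integral {0..1}
        (\<lambda>\<theta>. f (x + exp (2 * of_real pi * \<i> * of_real \<theta>) *s (c *\<^sub>R v)) / exp (2 * of_real pi * \<i> * of_real \<theta>))"
proof -
  obtain d where d: "d > 0" "ball x0 d \<subseteq> U" using assms(1,3) open_contains_ball by blast
  \<comment> \<open>The \<open>+ 1\<close> covers v = 0. With this c the discs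
    \<open>x + \<zeta> *s (c *\<^sub>R v)\<close> around all x within d/2 of x0 stay in the ball of
    radius d.\<close>
  define c where "c = d / (2 * (norm v + 1))"
  have c: "c > 0" using d by (simp add: c_def add_nonneg_pos)
  have "c * norm v \<le> c * (norm v + 1)" using c by simp
  also have "\<dots> = d/2" 
  proof -
    have "norm v + 1 \<noteq> 0" using norm_ge_zero[of v] by linarith
    then show ?thesis unfolding c_def by (simp add: field_simps)
  qed
  finally have cv: "c * norm v \<le> d/2" .
  have sub: "ball x0 (d/2) \<subseteq> U" using d(1) order.trans[OF subset_ball d(2), of "d/2"] by simp
  have m: "x + \<zeta> *s (c *\<^sub>R v) \<in> U" if x: "x \<in> ball x0 (d/2)" and z: "cmod \<zeta> \<le> 1" for x \<zeta>
  proof -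
    have "cmod \<zeta> * (c * norm v) \<le> 1 * (d/2)"
      by (rule mult_mono[OF z cv]) (use c in auto)
    then have "norm (\<zeta> *s (c *\<^sub>R v)) \<le> d/2" using c by (simp add: norm_vscale)
    then have "dist x (x + \<zeta> *s (c *\<^sub>R v)) \<le> d/2" by (simp add: dist_norm)
    then have "dist x0 (x + \<zeta> *s (c *\<^sub>R v)) < d"
      using x dist_triangle[of x0 "x + \<zeta> *s (c *\<^sub>R v)" x] by simp
    then show ?thesis using d(2) by auto
  qed
  show ?thesis
  proof (rule that[of "d/2" c])
    fix x assume x: "x \<in> ball x0 (d/2)"
    have "dird (c *\<^sub>R v) f x = of_real c * dird v f x"
      by (rule holo_dird_scaleR[OF f]) (use x sub in auto)
    then show "dird v f x = (1 / of_real c) * integral {0..1}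
        (\<lambda>\<theta>. f (x + exp (2 * of_real pi * \<i> * of_real \<theta>) *s (c *\<^sub>R v)) / exp (2 * of_real pi * \<i> * of_real \<theta>))"
      using dird_integral[OF f m[OF x]] c by simp
  qed (use d c m sub in auto)
qed

lemma holo_dird_continuous:
  fixes f :: "complex^'n::finite \<Rightarrow> complex"
  assumes "open U" and f: "holo U f"
  shows "continuous_on U (dird v f)"
proof (rule continuous_at_imp_continuous_on, rule ballI)
  fix x0 assume x0: "x0 \<in> U"
  obtain r c where rc: "r > 0" "c > 0" "ball x0 r \<subseteq> U"
    "\<And>x \<zeta>. x \<in> ball x0 r \<Longrightarrow> cmod \<zeta> \<le> 1 \<Longrightarrow> x + \<zeta> *s (c *\<^sub>R v) \<in> U"
    "\<And>x. x \<in> ball x0 r \<Longrightarrow> dird v f x = (1 / of_real c) * integral {0..1}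
        (\<lambda>\<theta>. f (x + exp (2 * of_real pi * \<i> * of_real \<theta>) *s (c *\<^sub>R v)) / exp (2 * of_real pi * \<i> * of_real \<theta>))"
      by (rule dird_integral_local[OF assms x0, of v]) (rule that)
  let ?h = "\<lambda>x \<theta>. f (x + exp (2 * of_real pi * \<i> * of_real \<theta>) *s (c *\<^sub>R v)) / exp (2 * of_real pi * \<i> * of_real \<theta>)"
  have "continuous_on (ball x0 r \<times> cbox 0 1) (\<lambda>(x,\<theta>). ?h x \<theta>)"
    unfolding split_beta
  proof (rule continuous_on_divide)
    show "continuous_on (ball x0 r \<times> cbox 0 1) (\<lambda>q. exp (2 * of_real pi * \<i> * of_real (snd q)) :: complex)"
      by (intro continuous_intros)
    have 1: "continuous_on (ball x0 r \<times> cbox 0 1) (\<lambda>q. fst q + exp (2 * of_real pi * \<i> * of_real (snd q)) *s (c *\<^sub>R v))"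
      by (intro continuous_intros)
    show "continuous_on (ball x0 r \<times> cbox 0 1) (\<lambda>q. f (fst q + exp (2 * of_real pi * \<i> * of_real (snd q)) *s (c *\<^sub>R v)))"
      by (rule continuous_on_compose2[OF holo_continuous_on[OF f] 1])
        (auto intro!: rc(4) simp: norm_exp_eq_Re simp del: exp_of_real)
  qed auto
  then have "continuous_on (ball x0 r) (\<lambda>x. integral (cbox 0 1) (?h x))"
    by (rule integral_continuous_on_param)
  then have "continuous_on (ball x0 r) (\<lambda>x. (1 / of_real c) * integral {0..1} (?h x))"
    by (intro continuous_intros) simp
  then have "continuous_on (ball x0 r) (dird v f)"
    by (rule continuous_on_eq) (simp add: rc(5))
  then show "isCont (dird v f) x0" using rc(1)
    by (simp add: continuous_on_eq_continuous_at)
qed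

text \<open>Differentiation under the integral of \<open>dird_integral_local\<close>. The definition
  of \<open>holo\<close> asks for no continuity of the derivative, but the Leibniz rule does;
  \<open>holo_dird_continuous\<close> supplies it.\<close>

lemma holo_dird:
  fixes f :: "complex^'n::finite \<Rightarrow> complex"
  assumes "open U" and f: "holo U f"
  shows "holo U (dird v f)"
proof -
  have "\<exists>D. (dird v f has_derivative D) (at x0) \<and> (\<forall>c u. D (c *s u) = c * D u)" if x0: "x0 \<in> U" for x0
  proof -
    obtain r c where rc: "r > 0" "c > 0" "ball x0 r \<subseteq> U"
      "\<And>x \<zeta>. x \<in> ball x0 r \<Longrightarrow> cmod \<zeta> \<le> 1 \<Longrightarrow> x + \<zeta> *s (c *\<^sub>R v) \<in> U"
      "\<And>x. x \<in> ball x0 r \<Longrightarrow> dird v f x = (1 / of_real c) * integral {0..1}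
          (\<lambda>\<theta>. f (x + exp (2 * of_real pi * \<i> * of_real \<theta>) *s (c *\<^sub>R v)) / exp (2 * of_real pi * \<i> * of_real \<theta>))"
      by (rule dird_integral_local[OF assms x0, of v]) (rule that)
    define e where "e \<theta> = exp (2 * of_real pi * \<i> * of_real \<theta>)" for \<theta> :: real
    define p where "p x \<theta> = x + e \<theta> *s (c *\<^sub>R v)" for x and \<theta> :: real
    have e1: "cmod (e \<theta>) \<le> 1" "e \<theta> \<noteq> 0" for \<theta> by (simp_all add: e_def norm_exp_eq_Re)
    have pU: "p x \<theta> \<in> U" if "x \<in> ball x0 r" for x \<theta> using rc(4)[OF that e1(1)] by (simp add: p_def)
    define D where "D y = Blinfun (\<lambda>u. dird u f y)" for y
    have D: "blinfun_apply (D y) u = dird u f y" if "y \<in> U" for y u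
      unfolding D_def by (subst bounded_linear_Blinfun_apply[OF has_derivative_bounded_linear[OF holo_deriv[OF f that]]]) simp
    have Dc: "continuous_on U D"
      by (rule continuous_on_blinfun_componentwise)
         (simp add: D holo_dird_continuous[OF assms] cong: continuous_on_cong)
    define DD where "DD x \<theta> = blinfun_mult_right (1 / e \<theta>) o\<^sub>L D (p x \<theta>)" for x \<theta>
    have DD: "blinfun_apply (DD x \<theta>) u = dird u f (p x \<theta>) / e \<theta>" if "x \<in> ball x0 r" for x \<theta> u
      unfolding DD_def using D[OF pU[OF that]] by simp
    have ec: "continuous_on S (\<lambda>x. e (h x))" if "continuous_on S h" for S :: "'b::topological_space set" and h
      unfolding e_def by (intro continuous_intros that)
    have DDc: "continuous_on (ball x0 r \<times> cbox 0 1) (\<lambda>(x,\<theta>). DD x \<theta>)"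
    proof -
      have 1: "continuous_on (ball x0 r \<times> cbox 0 1) (\<lambda>q. e (snd q))"
        by (rule ec) (intro continuous_intros)
      then have 2: "continuous_on (ball x0 r \<times> cbox 0 1) (\<lambda>q. p (fst q) (snd q))"
        unfolding p_def by (intro continuous_intros)
      have 3: "continuous_on (ball x0 r \<times> cbox 0 1) (\<lambda>q. D (p (fst q) (snd q)))"
        by (rule continuous_on_compose2[OF Dc 2]) (auto intro: pU)
      have "continuous_on (ball x0 r \<times> cbox 0 1) (\<lambda>q. 1 / e (snd q))"
        by (rule continuous_on_divide[OF continuous_on_const 1]) (simp add: e1)
      then have 4: "continuous_on (ball x0 r \<times> cbox 0 1) (\<lambda>q. blinfun_mult_right (1 / e (snd q)))"
        by (rule bounded_linear.continuous_on[OF bounded_linear_blinfun_mult_right])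
      show ?thesis unfolding split_beta DD_def
        by (rule bounded_bilinear.continuous_on[OF bounded_bilinear_blinfun_compose 4 3])
    qed
    have der: "((\<lambda>x. f (p x \<theta>) / e \<theta>) has_derivative blinfun_apply (DD x \<theta>)) (at x within ball x0 r)"
      if x: "x \<in> ball x0 r" for x \<theta>
    proof -
      have 1: "((\<lambda>x. p x \<theta>) has_derivative (\<lambda>u. u)) (at x)" unfolding p_def
        by (auto intro!: derivative_eq_intros)
      have "((\<lambda>x. f (p x \<theta>)) has_derivative (\<lambda>u. dird u f (p x \<theta>))) (at x)"
        using diff_chain_at[OF 1 holo_deriv[OF f pU[OF x]]] by (simp add: o_def)
      then have "((\<lambda>x. f (p x \<theta>) * (1 / e \<theta>)) has_derivative (\<lambda>u. dird u f (p x \<theta>) * (1 / e \<theta>))) (at x)"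
        by (rule has_derivative_mult_left)
      moreover have "(\<lambda>u. dird u f (p x \<theta>) * (1 / e \<theta>)) = blinfun_apply (DD x \<theta>)"
        by (rule ext) (simp add: DD[OF x])
      ultimately have "((\<lambda>x. f (p x \<theta>) / e \<theta>) has_derivative blinfun_apply (DD x \<theta>)) (at x)"
        by simp
      then show ?thesis by (rule has_derivative_at_withinI)
    qed
    have int: "(\<lambda>\<theta>. f (p x \<theta>) / e \<theta>) integrable_on cbox 0 1" if x: "x \<in> ball x0 r" for x
    proof (rule integrable_continuous)
      have 1: "continuous_on (cbox 0 1) e"
        by (rule ec) (intro continuous_intros)
      then have 2: "continuous_on (cbox 0 1) (p x)"
        unfolding p_def by (intro continuous_intros)
      show "continuous_on (cbox 0 1) (\<lambda>\<theta>. f (p x \<theta>) / e \<theta>)"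
        by (rule continuous_on_divide[OF continuous_on_compose2[OF holo_continuous_on[OF f] 2] 1])
          (use pU[OF x] e1 in auto)
    qed
    have L: "((\<lambda>x. integral (cbox 0 1) (\<lambda>\<theta>. f (p x \<theta>) / e \<theta>)) has_derivative integral (cbox 0 1) (DD x0)) (at x0 within ball x0 r)"
      by (rule leibniz_rule[OF der int DDc]) (use rc in auto)
    have L: "((\<lambda>x. integral (cbox 0 1) (\<lambda>\<theta>. f (p x \<theta>) / e \<theta>)) has_derivative integral (cbox 0 1) (DD x0)) (at x0)"
      using L rc(1) by (simp add: at_within_open[of _ "ball x0 r"])
    then have L2: "((\<lambda>x. (1 / of_real c) * integral (cbox 0 1) (\<lambda>\<theta>. f (p x \<theta>) / e \<theta>)) has_derivative (\<lambda>u. (1 / of_real c) * integral (cbox 0 1) (DD x0) u)) (at x0)"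
      by (rule has_derivative_mult_right)
    have L3: "(dird v f has_derivative (\<lambda>u. (1 / of_real c) * integral (cbox 0 1) (DD x0) u)) (at x0)"
      by (rule has_derivative_transform_within_open[OF L2 open_ball[of x0 r]])
         (use rc in \<open>auto simp: p_def e_def\<close>)
    have DDint: "DD x0 integrable_on cbox 0 1"
    proof (rule integrable_continuous)
      have "continuous_on (cbox 0 1) (\<lambda>\<theta>. (\<lambda>(x,\<theta>). DD x \<theta>) (x0, \<theta>))"
        by (rule continuous_on_compose2[OF DDc]) (use rc in \<open>auto intro!: continuous_intros\<close>)
      then show "continuous_on (cbox 0 1) (DD x0)" by simp
    qed
    have ev: "blinfun_apply (integral (cbox 0 1) (DD x0)) u = integral (cbox 0 1) (\<lambda>\<theta>. dird u f (p x0 \<theta>) / e \<theta>)" for u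
      using blinfun_apply_integral[OF DDint, of u] DD rc(1) by simp
    \<comment> \<open>Complex linearity of the derivative is inherited from the integrand.\<close>
    have "blinfun_apply (integral (cbox 0 1) (DD x0)) (a *s u) = a * blinfun_apply (integral (cbox 0 1) (DD x0)) u" for a u
    proof -
      have eq: "(\<lambda>\<theta>. dird (a *s u) f (p x0 \<theta>) / e \<theta>) = (\<lambda>\<theta>. a * (dird u f (p x0 \<theta>) / e \<theta>))"
        using holo_dird_scale[OF f pU] rc(1) by simp
      show ?thesis unfolding ev eq by (rule integral_mult_right)
    qed
    then have "(1 / of_real c) * integral (cbox 0 1) (DD x0) (a *s u) = a * ((1 / of_real c) * integral (cbox 0 1) (DD x0) u)" for a u
      by (simp only: mult.left_commute)
    with L3 show ?thesis by blast
  qed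
  then show ?thesis unfolding holo_def by blast
qed

section \<open>Smooth functions and holomorphic maps\<close>

lemma C_k_on_Suc_dird: "C_k_on (Suc k) S f \<longleftrightarrow> (\<forall>x\<in>S. f differentiable (at x)) \<and> (\<forall>v. C_k_on k S (dird v f))"
  by (simp add: dird_def[abs_def])

declare C_k_on.simps(2) [simp del]

lemma differentiable_dird: "f differentiable (at x) \<Longrightarrow> (f has_derivative (\<lambda>v. dird v f x)) (at x)"
  unfolding dird_def by (simp add: frechet_derivative_works[symmetric])

lemma dird_cong_open:
  assumes "open S" "x \<in> S" "\<And>y. y \<in> S \<Longrightarrow> f y = g y" "f differentiable (at x)"
  shows "g differentiable (at x)" "dird v g x = dird v f x"
proof -
  have "(g has_derivative (\<lambda>v. dird v f x)) (at x)"
    by (rule has_derivative_transform_within_open[OF differentiable_dird[OF assms(4)] assms(1,2)]) (rule assms(3))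
  then show "g differentiable (at x)" "dird v g x = dird v f x"
    by (auto simp: differentiable_def dest: dird_eq)
qed

text \<open>In the inductions below a formula for the derivative is known only on S; this allows it
  to replace \<open>dird v f\<close> there.\<close>

lemma C_k_on_cong:
  assumes "open S"
  shows "(\<And>x. x \<in> S \<Longrightarrow> f x = g x) \<Longrightarrow> C_k_on k S f \<Longrightarrow> C_k_on k S g"
proof (induction k arbitrary: f g)
  case 0
  then show ?case using continuous_on_eq[of S f g] by simp
next
  case (Suc k)
  have d: "\<And>x. x \<in> S \<Longrightarrow> f differentiable (at x)" and c: "\<And>v. C_k_on k S (dird v f)"
    using Suc.prems(2) by (auto simp: C_k_on_Suc_dird)
  have "\<And>x. x \<in> S \<Longrightarrow> g differentiable (at x)"
    using dird_cong_open(1)[OF assms _ Suc.prems(1) d] by blast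
  moreover have "C_k_on k S (dird v g)" for v
    by (rule Suc.IH[OF _ c[of v]]) (simp add: dird_cong_open(2)[OF assms _ Suc.prems(1) d])
  ultimately show ?case by (simp add: C_k_on_Suc_dird)
qed

lemma C_k_on_subset: "C_k_on k S f \<Longrightarrow> T \<subseteq> S \<Longrightarrow> C_k_on k T f"
  by (induction k arbitrary: f) (auto simp: C_k_on_Suc_dird intro: continuous_on_subset)

lemma C_k_on_pred: "C_k_on (Suc k) S f \<Longrightarrow> C_k_on k S f"
proof (induction k arbitrary: f)
  case 0
  then show ?case
    by (auto simp: C_k_on_Suc_dird intro!: continuous_at_imp_continuous_on differentiable_imp_continuous_within)
next
  case (Suc k)
  have d: "\<forall>x\<in>S. f differentiable (at x)" and c: "C_k_on (Suc k) S (dird v f)" for v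
    using Suc.prems unfolding C_k_on_Suc_dird[of "Suc k"] by blast+
  show ?case unfolding C_k_on_Suc_dird[of k] using d Suc.IH[OF c] by blast
qed

lemma C_k_on_const: "C_k_on k S (\<lambda>x. c)"
proof (induction k arbitrary: c)
  case (Suc k)
  have "dird v (\<lambda>x. c) = (\<lambda>x. 0)" for v :: 'a
    by (rule ext) (rule dird_eq[OF has_derivative_const])
  with Suc show ?case by (simp add: C_k_on_Suc_dird)
qed simp

lemma C_k_on_bounded_linear:
  assumes "bounded_linear L" "open S"
  shows "C_k_on k S f \<Longrightarrow> C_k_on k S (\<lambda>x. L (f x))"
proof (induction k arbitrary: f)
  case 0
  then show ?case using bounded_linear.continuous_on[OF assms(1)] by simp
next
  case (Suc k)
  have d: "((\<lambda>x. L (f x)) has_derivative (\<lambda>v. L (dird v f x))) (at x)" if "x \<in> S" for x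
    by (rule bounded_linear.has_derivative[OF assms(1) differentiable_dird])
      (use Suc.prems that in \<open>simp add: C_k_on_Suc_dird\<close>)
  have "C_k_on k S (dird v (\<lambda>x. L (f x)))" for v
    by (rule C_k_on_cong[OF assms(2) _ Suc.IH[of "dird v f"]])
      (use Suc.prems dird_eq[OF d] in \<open>auto simp: C_k_on_Suc_dird\<close>)
  then show ?case using d by (auto simp: C_k_on_Suc_dird differentiable_def)
qed

lemma C_k_on_add:
  assumes "open S"
  shows "C_k_on k S f \<Longrightarrow> C_k_on k S g \<Longrightarrow> C_k_on k S (\<lambda>x. f x + g x)"
proof (induction k arbitrary: f g)
  case 0
  then show ?case by (simp add: continuous_on_add)
next
  case (Suc k)
  have d: "((\<lambda>x. f x + g x) has_derivative (\<lambda>v. dird v f x + dird v g x)) (at x)" if "x \<in> S" for x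
    using Suc.prems that by (auto simp: C_k_on_Suc_dird intro!: has_derivative_add differentiable_dird)
  have "C_k_on k S (dird v (\<lambda>x. f x + g x))" for v
    by (rule C_k_on_cong[OF assms _ Suc.IH[of "dird v f" "dird v g"]])
      (use Suc.prems dird_eq[OF d] in \<open>auto simp: C_k_on_Suc_dird\<close>)
  then show ?case using d by (auto simp: C_k_on_Suc_dird differentiable_def)
qed

lemma C_k_on_sum:
  assumes "open S" "\<And>i. i \<in> I \<Longrightarrow> C_k_on k S (f i)"
  shows "C_k_on k S (\<lambda>x. \<Sum>i\<in>I. f i x)"
  using assms(2) by (induction I rule: infinite_finite_induct) (simp_all add: C_k_on_const C_k_on_add[OF assms(1)])

lemma C_k_on_scaleR:
  fixes a :: "'a::euclidean_space \<Rightarrow> real"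
  assumes "open S"
  shows "C_k_on k S a \<Longrightarrow> C_k_on k S f \<Longrightarrow> C_k_on k S (\<lambda>x. a x *\<^sub>R f x)"
proof (induction k arbitrary: a f)
  case 0
  then show ?case by (simp add: continuous_on_scaleR)
next
  case (Suc k)
  have d: "((\<lambda>x. a x *\<^sub>R f x) has_derivative (\<lambda>v. a x *\<^sub>R dird v f x + dird v a x *\<^sub>R f x)) (at x)" if "x \<in> S" for x
    using Suc.prems that by (auto simp: C_k_on_Suc_dird intro!: has_derivative_scaleR differentiable_dird)
  have "C_k_on k S (dird v (\<lambda>x. a x *\<^sub>R f x))" for v
  proof (rule C_k_on_cong[OF assms])
    show "C_k_on k S (\<lambda>x. a x *\<^sub>R dird v f x + dird v a x *\<^sub>R f x)"
      using Suc.prems by (intro C_k_on_add[OF assms] Suc.IH) (auto intro: C_k_on_pred simp: C_k_on_Suc_dird)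
  qed (simp add: dird_eq[OF d])
  then show ?case using d by (auto simp: C_k_on_Suc_dird differentiable_def)
qed

text \<open>The chain rule produces a direction that varies with x. Expanding it in
  \<open>Basis\<close> leaves scalar C^k coefficients times compositions with the fixed derivatives
  \<open>dird b f\<close>, to which the induction hypothesis applies.\<close>

lemma C_k_on_compose:
  fixes g :: "'a::euclidean_space \<Rightarrow> 'b::euclidean_space"
  assumes "open S" "open V" "\<And>x. x \<in> S \<Longrightarrow> g x \<in> V"
  shows "C_k_on k S g \<Longrightarrow> C_k_on k V f \<Longrightarrow> C_k_on k S (\<lambda>x. f (g x))"
proof (induction k arbitrary: f)
  case 0
  then show ?case using assms(3) by (auto intro: continuous_on_compose2)
next
  case (Suc k)
  have g: "\<And>x. x \<in> S \<Longrightarrow> g differentiable (at x)" "\<And>v. C_k_on k S (dird v g)"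
    and f: "\<And>x. x \<in> V \<Longrightarrow> f differentiable (at x)" "\<And>v. C_k_on k V (dird v f)"
    using Suc.prems by (auto simp: C_k_on_Suc_dird)
  have d: "((\<lambda>x. f (g x)) has_derivative (\<lambda>v. \<Sum>b\<in>Basis. (dird v g x \<bullet> b) *\<^sub>R dird b f (g x))) (at x)" if "x \<in> S" for x
  proof -
    have 1: "((\<lambda>x. f (g x)) has_derivative (\<lambda>v. dird (dird v g x) f (g x))) (at x)"
      using diff_chain_at[OF differentiable_dird[OF g(1)[OF that]] differentiable_dird[OF f(1)[OF assms(3)[OF that]]]]
      by (simp add: o_def)
    have lin: "linear (\<lambda>w. dird w f (g x))"
      using differentiable_dird[OF f(1)[OF assms(3)[OF that]]] by (rule has_derivative_linear)
    have rep: "dird w f (g x) = (\<Sum>b\<in>Basis. (w \<bullet> b) *\<^sub>R dird b f (g x))" for w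
    proof -
      have "dird w f (g x) = dird (\<Sum>b\<in>Basis. (w \<bullet> b) *\<^sub>R b) f (g x)" by (simp add: euclidean_representation)
      also have "\<dots> = (\<Sum>b\<in>Basis. (w \<bullet> b) *\<^sub>R dird b f (g x))"
        by (simp add: linear_sum[OF lin, of "\<lambda>b. (w \<bullet> b) *\<^sub>R b" Basis] linear_scale[OF lin])
      finally show ?thesis .
    qed
    show ?thesis by (rule has_derivative_eq_rhs[OF 1]) (rule ext, rule rep)
  qed
  have "C_k_on k S (dird v (\<lambda>x. f (g x)))" for v
  proof (rule C_k_on_cong[OF assms(1)])
    show "C_k_on k S (\<lambda>x. \<Sum>b\<in>Basis. (dird v g x \<bullet> b) *\<^sub>R dird b f (g x))"
    proof (intro C_k_on_sum[OF assms(1)] C_k_on_scaleR[OF assms(1)])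
      fix b :: 'b
      show "C_k_on k S (\<lambda>x. dird v g x \<bullet> b)"
        using C_k_on_bounded_linear[OF bounded_linear_inner_left[of b] assms(1) g(2)[of v]] .
      show "C_k_on k S (\<lambda>x. dird b f (g x))"
        using Suc.IH[OF C_k_on_pred[OF Suc.prems(1)] f(2)[of b]] .
    qed
  qed (simp add: dird_eq[OF d])
  then show ?case using d by (auto simp: C_k_on_Suc_dird differentiable_def)
qed

lemma smooth_on_subset: "smooth_on S f \<Longrightarrow> T \<subseteq> S \<Longrightarrow> smooth_on T f"
  unfolding smooth_on_def using C_k_on_subset by blast

lemma smooth_on_compose:
  fixes g :: "'a::euclidean_space \<Rightarrow> 'b::euclidean_space"
  shows "open S \<Longrightarrow> open V \<Longrightarrow> (\<And>x. x \<in> S \<Longrightarrow> g x \<in> V) \<Longrightarrow> smooth_on S g \<Longrightarrow> smooth_on V f \<Longrightarrow>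
    smooth_on S (\<lambda>x. f (g x))"
  unfolding smooth_on_def using C_k_on_compose by blast

lemma smooth_on_bounded_linear:
  "bounded_linear L \<Longrightarrow> open S \<Longrightarrow> smooth_on S f \<Longrightarrow> smooth_on S (\<lambda>x. L (f x))"
  unfolding smooth_on_def using C_k_on_bounded_linear by blast

lemma smooth_on_differentiable: "smooth_on S f \<Longrightarrow> x \<in> S \<Longrightarrow> f differentiable (at x)"
  unfolding smooth_on_def using C_k_on_Suc_dird by blast

lemma holo_C_k_on: "open U \<Longrightarrow> holo U f \<Longrightarrow> C_k_on k U f"
proof (induction k arbitrary: f)
  case 0
  then show ?case by (simp add: holo_continuous_on)
next
  case (Suc k)
  then show ?case using holo_dird[OF Suc.prems] holo_deriv[OF Suc.prems(2)]
    by (auto simp: C_k_on_Suc_dird differentiable_def)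
qed

section \<open>Holomorphic maps through their coordinates\<close>

lemma norm_axis: "norm (axis i x :: 'a::real_normed_vector ^ 'n::finite) = norm x"
proof -
  have "norm (axis i x :: 'a ^ 'n) = L2_set (\<lambda>j. if j = i then norm x else 0) UNIV"
    unfolding norm_vec_def by (rule L2_set_cong) (auto simp: axis_def)
  also have "\<dots> = sqrt (\<Sum>j\<in>UNIV. if j = i then (norm x)\<^sup>2 else 0)"
    unfolding L2_set_def by (intro arg_cong[where f=sqrt] sum.cong) auto
  also have "\<dots> = norm x" by simp
  finally show ?thesis .
qed

lemma bounded_linear_axis: "bounded_linear (axis i :: 'a::real_normed_vector \<Rightarrow> 'a ^ 'n::finite)"
  by (rule bounded_linear_intro[where K=1]) (auto simp: axis_def vec_eq_iff norm_axis[unfolded axis_def])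

lemma vec_eq_sum_axis: "(x :: 'a::comm_monoid_add ^ 'n::finite) = (\<Sum>i\<in>UNIV. axis i (x $ i))"
  by (simp add: vec_eq_iff axis_def if_distrib cong: if_cong)

lemma holomorphic_map_comp: "holomorphic_map_on U F \<Longrightarrow> holo U (\<lambda>x. F x $ i)"
  unfolding holomorphic_map_on_def holo_def
proof
  fix z assume *: "\<forall>z\<in>U. \<exists>D. (F has_derivative D) (at z) \<and> (\<forall>c v. D (c *s v) = c *s D v)" and "z \<in> U"
  then obtain D where D: "(F has_derivative D) (at z)" "\<forall>c v. D (c *s v) = c *s D v" by blast
  show "\<exists>D. ((\<lambda>x. F x $ i) has_derivative D) (at z) \<and> (\<forall>c v. D (c *s v) = c * D v)"
    using bounded_linear.has_derivative[OF bounded_linear_vec_nth D(1)] D(2)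
    by (intro exI[of _ "\<lambda>v. D v $ i"]) simp
qed

lemma holomorphic_mapI: 
  fixes F :: "complex^'n::finite \<Rightarrow> complex^'k::finite"
  assumes "\<And>i. holo U (\<lambda>x. F x $ i)"
  shows "holomorphic_map_on U F"
  unfolding holomorphic_map_on_def
proof
  fix z assume z: "z \<in> U"
  let ?D = "\<lambda>v. \<Sum>i\<in>UNIV. axis i (dird v (\<lambda>x. F x $ i) z)"
  have "((\<lambda>x. \<Sum>i\<in>UNIV. axis i (F x $ i)) has_derivative ?D) (at z)"
    by (intro has_derivative_sum bounded_linear.has_derivative[OF bounded_linear_axis] holo_deriv[OF assms z])
  then have "(F has_derivative ?D) (at z)" by (simp add: vec_eq_sum_axis[symmetric])
  moreover have "?D (c *s v) = c *s ?D v" for c v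
    by (simp add: holo_dird_scale[OF assms z] vec_eq_iff sum_distrib_left axis_def if_distrib cong: if_cong)
  ultimately show "\<exists>D. (F has_derivative D) (at z) \<and> (\<forall>c v. D (c *s v) = c *s D v)" by blast
qed

lemma holomorphic_map_deriv:
  assumes "holomorphic_map_on U F" "z \<in> U"
  shows "(F has_derivative (\<lambda>v. dird v F z)) (at z)" "dird (c *s v) F z = c *s dird v F z"
proof -
  obtain D where D: "(F has_derivative D) (at z)" "\<And>c v. D (c *s v) = c *s D v"
    using assms unfolding holomorphic_map_on_def by blast
  show "dird (c *s v) F z = c *s dird v F z" using dird_eq[OF D(1)] D(2) by simp
  show "(F has_derivative (\<lambda>v. dird v F z)) (at z)"
    using D(1) by (intro differentiable_dird) (auto simp: differentiable_def)
qed

lemma holomorphic_map_dird_nth: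
  assumes "holomorphic_map_on U F" "z \<in> U"
  shows "dird v (\<lambda>x. F x $ i) z = dird v F z $ i"
  by (rule dird_eq) (rule bounded_linear.has_derivative[OF bounded_linear_vec_nth holomorphic_map_deriv(1)[OF assms]])

lemma holomorphic_map_smooth_on:
  assumes "open U" "holomorphic_map_on U F"
  shows "smooth_on U F"
  unfolding smooth_on_def
proof
  fix k
  have "C_k_on k U (\<lambda>x. \<Sum>i\<in>UNIV. axis i (F x $ i))"
    by (intro C_k_on_sum[OF assms(1)] C_k_on_bounded_linear[OF bounded_linear_axis assms(1)]
        holo_C_k_on[OF assms(1)] holomorphic_map_comp[OF assms(2)])
  then show "C_k_on k U F" by (simp add: vec_eq_sum_axis[symmetric])
qed

lemma holomorphic_map_subset: "holomorphic_map_on U F \<Longrightarrow> V \<subseteq> U \<Longrightarrow> holomorphic_map_on V F"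
  unfolding holomorphic_map_on_def by blast

lemma holo_compose:
  assumes "holomorphic_map_on U G" "holo V f" "\<And>x. x \<in> U \<Longrightarrow> G x \<in> V"
  shows "holo U (\<lambda>x. f (G x))" and "x \<in> U \<Longrightarrow> dird v (\<lambda>x. f (G x)) x = dird (dird v G x) f (G x)"
proof -
  have d: "((\<lambda>x. f (G x)) has_derivative (\<lambda>v. dird (dird v G x) f (G x))) (at x)" if "x \<in> U" for x
    using diff_chain_at[OF holomorphic_map_deriv(1)[OF assms(1) that] holo_deriv[OF assms(2) assms(3)[OF that]]]
    by (simp add: o_def)
  show "holo U (\<lambda>x. f (G x))"
    by (rule holoI[OF d]) (simp_all add: holomorphic_map_deriv(2)[OF assms(1)] holo_dird_scale[OF assms(2) assms(3)])
  show "dird v (\<lambda>x. f (G x)) x = dird (dird v G x) f (G x)" if "x \<in> U"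
    by (rule dird_eq[OF d[OF that]])
qed

lemma holomorphic_map_compose:
  assumes "holomorphic_map_on U G" "holomorphic_map_on V F" "\<And>x. x \<in> U \<Longrightarrow> G x \<in> V"
  shows "holomorphic_map_on U (\<lambda>x. F (G x))"
  by (rule holomorphic_mapI) (rule holo_compose(1)[OF assms(1) holomorphic_map_comp[OF assms(2)] assms(3)])

lemma holo_const: "holo U (\<lambda>x. c)"
  unfolding holo_def by (intro ballI exI[of _ "\<lambda>v. 0"]) simp

lemma holo_add:
  assumes "holo U f" "holo U g"
  shows "holo U (\<lambda>x. f x + g x)"
proof (rule holoI)
  fix z assume z: "z \<in> U"
  show "((\<lambda>x. f x + g x) has_derivative (\<lambda>v. dird v f z + dird v g z)) (at z)"
    by (intro has_derivative_add holo_deriv[OF assms(1) z] holo_deriv[OF assms(2) z])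
qed (simp add: holo_dird_scale[OF assms(1)] holo_dird_scale[OF assms(2)] distrib_left)

lemma holo_mult:
  assumes "holo U f" "holo U g"
  shows "holo U (\<lambda>x. f x * g x)"
proof (rule holoI)
  fix z assume z: "z \<in> U"
  show "((\<lambda>x. f x * g x) has_derivative (\<lambda>v. f z * dird v g z + dird v f z * g z)) (at z)"
    by (intro has_derivative_mult holo_deriv[OF assms(1) z] holo_deriv[OF assms(2) z])
qed (simp add: holo_dird_scale[OF assms(1)] holo_dird_scale[OF assms(2)] algebra_simps)

lemma holo_sum: "(\<And>i. i \<in> I \<Longrightarrow> holo U (f i)) \<Longrightarrow> holo U (\<lambda>x. \<Sum>i\<in>I. f i x)"
  by (induction I rule: infinite_finite_induct) (auto intro: holo_const holo_add)

lemma holo_nth: "holo U (\<lambda>x. x $ i)"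
proof (rule holoI)
  show "((\<lambda>x. x $ i) has_derivative (\<lambda>x. x $ i)) (at z)" for z :: "complex ^ 'a"
    by (rule bounded_linear.has_derivative[OF bounded_linear_vec_nth has_derivative_ident])
qed simp

section \<open>Hermitian forms with few positive directions\<close>

definition herm_form :: "nat \<Rightarrow> (nat \<Rightarrow> nat \<Rightarrow> complex) \<Rightarrow> (nat \<Rightarrow> complex) \<Rightarrow> (nat \<Rightarrow> complex) \<Rightarrow> complex" where
  "herm_form m h \<omega> \<omega>' = (\<Sum>a<m. \<Sum>b<m. h a b * \<omega> a * cnj (\<omega>' b))"

definition eval_comb :: "(complex \<times> 'a) list \<Rightarrow> ('a \<Rightarrow> complex) \<Rightarrow> complex" where
  "eval_comb xs f = (\<Sum>(c, x)\<leftarrow>xs. c * f x)"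

text \<open>The weights sum to 0, so these are the linear combinations of differences of values of
  e; a constant coordinate contributes nothing to them.\<close>

definition null_combs :: "(nat \<Rightarrow> 'a \<Rightarrow> complex) \<Rightarrow> (nat \<Rightarrow> complex) set" where
  "null_combs e = {\<lambda>a. eval_comb xs (e a) | xs. eval_comb xs (\<lambda>_. 1) = 0}"

text \<open>The indices 0 to l make l + 1 vectors, one more than the number of positive directions
  that is to be allowed.\<close>

definition near_orthonormal :: "nat \<Rightarrow> (nat \<Rightarrow> nat \<Rightarrow> complex) \<Rightarrow> nat \<Rightarrow> real \<Rightarrow> (nat \<Rightarrow> nat \<Rightarrow> complex) \<Rightarrow> bool" where
  "near_orthonormal m h l \<delta> \<Omega> \<longleftrightarrow>
     (\<forall>i\<le>l. \<forall>j\<le>l. cmod (herm_form m h (\<Omega> i) (\<Omega> j) - (if i = j then 1 else 0)) \<le> \<delta>)"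

text \<open>Positivity is tested on nearly orthonormal systems with a uniform tolerance, so that it survives
  limits of forms and extends to \<open>comb_closure\<close>.\<close>

definition few_positive :: "nat \<Rightarrow> (nat \<Rightarrow> nat \<Rightarrow> complex) \<Rightarrow> nat \<Rightarrow> (nat \<Rightarrow> 'a \<Rightarrow> complex) \<Rightarrow> bool" where
  "few_positive m h l e \<longleftrightarrow> (\<exists>\<delta>>0. \<forall>\<Omega>. (\<forall>i\<le>l. \<Omega> i \<in> null_combs e) \<longrightarrow> \<not> near_orthonormal m h l \<delta> \<Omega>)"

text \<open>Only the coordinates below m are approximated, since \<open>herm_form m\<close> sees no
  others.\<close>

definition comb_closure :: "nat \<Rightarrow> (nat \<Rightarrow> 'a \<Rightarrow> complex) \<Rightarrow> (nat \<Rightarrow> complex) set" where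
  "comb_closure m e = {\<omega>. \<forall>\<eta>>0. \<exists>\<omega>'\<in>null_combs e. \<forall>a<m. cmod (\<omega> a - \<omega>' a) < \<eta>}"

lemma eval_comb_append: "eval_comb (xs @ ys) f = eval_comb xs f + eval_comb ys f"
  by (simp add: eval_comb_def)

lemma eval_comb_scale: "eval_comb (map (\<lambda>(c, x). (k * c, x)) xs) f = k * eval_comb xs f"
  by (induction xs) (auto simp: eval_comb_def algebra_simps)

lemma null_combs_lin:
  assumes "\<omega> \<in> null_combs e" "\<omega>' \<in> null_combs e"
  shows "(\<lambda>a. c * \<omega> a + \<omega>' a) \<in> null_combs e"
proof -
  obtain xs ys where xs: "\<omega> = (\<lambda>a. eval_comb xs (e a))" "eval_comb xs (\<lambda>_. 1) = 0"
    and ys: "\<omega>' = (\<lambda>a. eval_comb ys (e a))" "eval_comb ys (\<lambda>_. 1) = 0"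
    using assms unfolding null_combs_def by blast
  show ?thesis unfolding null_combs_def mem_Collect_eq
    by (rule exI[of _ "map (\<lambda>(c', x). (c * c', x)) xs @ ys"])
       (simp add: eval_comb_append eval_comb_scale xs ys)
qed

lemma null_combs_diff: "(\<lambda>a. e a x - e a y) \<in> null_combs e"
  unfolding null_combs_def mem_Collect_eq
  by (rule exI[of _ "[(1, x), (-1, y)]"]) (simp add: eval_comb_def)

lemma comb_closure_lin:
  assumes "\<omega> \<in> comb_closure m e" "\<omega>' \<in> comb_closure m e"
  shows "(\<lambda>a. c * \<omega> a + \<omega>' a) \<in> comb_closure m e"
  unfolding comb_closure_def mem_Collect_eq
proof (intro allI impI)
  fix \<eta> :: real assume \<eta>: "\<eta> > 0"
  define \<eta>1 where "\<eta>1 = \<eta> / (2 * (cmod c + 1))"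
  have cp: "cmod c + 1 > 0" using norm_ge_zero[of c] by linarith
  then have \<eta>1: "\<eta>1 > 0" using \<eta> by (simp add: \<eta>1_def)
  have c\<eta>: "cmod c * \<eta>1 \<le> \<eta>/2"
  proof -
    have "cmod c * \<eta>1 \<le> (cmod c + 1) * \<eta>1" using \<eta>1 by simp
    also have "\<dots> = \<eta>/2" using less_imp_neq[OF cp] unfolding \<eta>1_def by (simp add: divide_simps)
    finally show ?thesis .
  qed
  obtain \<phi> where \<phi>: "\<phi> \<in> null_combs e" "\<And>a. a < m \<Longrightarrow> cmod (\<omega> a - \<phi> a) < \<eta>1"
    using assms(1) \<eta>1 unfolding comb_closure_def by blast
  obtain \<psi> where \<psi>: "\<psi> \<in> null_combs e" "\<And>a. a < m \<Longrightarrow> cmod (\<omega>' a - \<psi> a) < \<eta>/2"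
    using assms(2) half_gt_zero[OF \<eta>] unfolding comb_closure_def by blast
  show "\<exists>\<omega>''\<in>null_combs e. \<forall>a<m. cmod (c * \<omega> a + \<omega>' a - \<omega>'' a) < \<eta>"
  proof (intro bexI allI impI)
    fix a assume a: "a < m"
    have "c * \<omega> a + \<omega>' a - (c * \<phi> a + \<psi> a) = c * (\<omega> a - \<phi> a) + (\<omega>' a - \<psi> a)" by (simp add: algebra_simps)
    then have "cmod (c * \<omega> a + \<omega>' a - (c * \<phi> a + \<psi> a)) \<le> cmod c * cmod (\<omega> a - \<phi> a) + cmod (\<omega>' a - \<psi> a)"
      by (metis norm_mult norm_triangle_ineq)
    also have "\<dots> < \<eta>"
      using mult_left_mono[OF less_imp_le[OF \<phi>(2)[OF a]] norm_ge_zero[of c]] \<psi>(2)[OF a] c\<eta> by linarith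
    finally show "cmod (c * \<omega> a + \<omega>' a - (c * \<phi> a + \<psi> a)) < \<eta>" .
  qed (rule null_combs_lin[OF \<phi>(1) \<psi>(1)])
qed

lemma null_combs_subset_closure: "\<omega> \<in> null_combs e \<Longrightarrow> \<omega> \<in> comb_closure m e"
  unfolding comb_closure_def mem_Collect_eq by (intro allI impI bexI[of _ \<omega>]) simp_all

lemma zero_comb_closure: "(\<lambda>a. 0) \<in> comb_closure m e"
  using null_combs_subset_closure[OF null_combs_diff[of e x x]] by simp

lemma comb_closure_scale: "\<omega> \<in> comb_closure m e \<Longrightarrow> (\<lambda>a. c * \<omega> a) \<in> comb_closure m e"
  using comb_closure_lin[OF _ zero_comb_closure] by fastforce

lemma comb_closure_diff:
  "\<omega> \<in> comb_closure m e \<Longrightarrow> \<omega>' \<in> comb_closure m e \<Longrightarrow> (\<lambda>a. \<omega> a - \<omega>' a) \<in> comb_closure m e"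
  using comb_closure_lin[of \<omega>' m e \<omega> "-1"] by simp

lemma comb_closure_sum:
  "(\<And>i. i \<in> I \<Longrightarrow> \<Omega> i \<in> comb_closure m e) \<Longrightarrow> (\<lambda>a. \<Sum>i\<in>I. c i * \<Omega> i a) \<in> comb_closure m e"
proof (induction I rule: infinite_finite_induct)
  case (insert i I)
  have "(\<lambda>a. c i * \<Omega> i a + (\<Sum>i\<in>I. c i * \<Omega> i a)) \<in> comb_closure m e"
    by (rule comb_closure_lin) (use insert in auto)
  then show ?case using insert.hyps by simp
qed (simp_all add: zero_comb_closure)

lemma comb_closure_lim:
  assumes "\<And>k. \<omega> k \<in> comb_closure m e" "\<And>a. a < m \<Longrightarrow> (\<lambda>k. \<omega> k a) \<longlonglongrightarrow> \<phi> a"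
  shows "\<phi> \<in> comb_closure m e"
  unfolding comb_closure_def mem_Collect_eq
proof (intro allI impI)
  fix \<eta> :: real assume \<eta>: "\<eta> > 0"
  have "\<forall>\<^sub>F k in sequentially. \<forall>a\<in>{..<m}. dist (\<omega> k a) (\<phi> a) < \<eta>/2"
    by (intro eventually_ball_finite ballI tendstoD[OF assms(2) half_gt_zero[OF \<eta>]]) auto
  from eventually_happens'[OF sequentially_bot this]
  obtain k where k: "\<And>a. a < m \<Longrightarrow> dist (\<omega> k a) (\<phi> a) < \<eta>/2" by auto
  obtain \<psi> where \<psi>: "\<psi> \<in> null_combs e" "\<And>a. a < m \<Longrightarrow> cmod (\<omega> k a - \<psi> a) < \<eta>/2"
    using assms(1)[of k] half_gt_zero[OF \<eta>] unfolding comb_closure_def by blast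
  show "\<exists>\<omega>'\<in>null_combs e. \<forall>a<m. cmod (\<phi> a - \<omega>' a) < \<eta>"
  proof (intro bexI allI impI)
    fix a assume a: "a < m"
    have "dist (\<phi> a) (\<psi> a) \<le> dist (\<phi> a) (\<omega> k a) + dist (\<omega> k a) (\<psi> a)" by (rule dist_triangle)
    then show "cmod (\<phi> a - \<psi> a) < \<eta>" using k[OF a] \<psi>(2)[OF a] by (simp add: dist_norm norm_minus_commute)
  qed (rule \<psi>(1))
qed

text \<open>Difference quotients along the complex line in direction u are multiples of differences,
  and the derivative is their limit.\<close>

lemma comb_closure_dird:
  assumes hol: "\<And>a. holo UNIV (\<omega> a)" and W: "\<And>x y. (\<lambda>a. \<omega> a x - \<omega> a y) \<in> comb_closure m e"
  shows "(\<lambda>a. dird u (\<omega> a) x) \<in> comb_closure m e"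
proof (rule comb_closure_lim)
  define t :: "nat \<Rightarrow> complex" where "t k = of_real (inverse (of_nat (Suc k)))" for k
  show "(\<lambda>a. inverse (t k) * (\<omega> a (x + t k *s u) - \<omega> a x)) \<in> comb_closure m e" for k
    by (rule comb_closure_scale[OF W])
  fix a assume "a < m"
  have "((\<lambda>z. \<omega> a (x + z *s u)) has_field_derivative dird u (\<omega> a) (x + 0 *s u)) (at 0)"
    by (rule holo_line[OF hol]) simp
  then have d: "((\<lambda>z. (\<omega> a (x + z *s u) - \<omega> a x) / z) \<longlongrightarrow> dird u (\<omega> a) x) (at 0)"
    by (simp add: has_field_derivative_iff)
  have "t \<longlonglongrightarrow> of_real 0" unfolding t_def by (intro tendsto_of_real LIMSEQ_inverse_real_of_nat)
  then have "filterlim t (at 0) sequentially"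
    by (intro filterlim_atI always_eventually) (auto simp: t_def simp del: of_nat_Suc)
  from filterlim_compose[OF d this]
  show "(\<lambda>k. inverse (t k) * (\<omega> a (x + t k *s u) - \<omega> a x)) \<longlonglongrightarrow> dird u (\<omega> a) x"
    by (simp add: divide_inverse mult.commute)
qed

lemma herm_form_lin_left: "herm_form m h (\<lambda>a. c * \<omega> a + \<phi> a) \<psi> = c * herm_form m h \<omega> \<psi> + herm_form m h \<phi> \<psi>"
  by (simp add: herm_form_def algebra_simps sum.distrib sum_distrib_left)

lemma herm_form_lin_right: "herm_form m h \<psi> (\<lambda>a. c * \<omega> a + \<phi> a) = cnj c * herm_form m h \<psi> \<omega> + herm_form m h \<psi> \<phi>"
  by (simp add: herm_form_def algebra_simps sum.distrib sum_distrib_left)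

lemma herm_form_scale_left: "herm_form m h (\<lambda>a. c * \<omega> a) \<psi> = c * herm_form m h \<omega> \<psi>"
  using herm_form_lin_left[of m h c \<omega> "\<lambda>a. 0" \<psi>] by (simp add: herm_form_def)

lemma herm_form_scale_right: "herm_form m h \<psi> (\<lambda>a. c * \<omega> a) = cnj c * herm_form m h \<psi> \<omega>"
  using herm_form_lin_right[of m h \<psi> c \<omega> "\<lambda>a. 0"] by (simp add: herm_form_def)

lemma herm_form_diff_left: "herm_form m h (\<lambda>a. \<omega> a - \<phi> a) \<psi> = herm_form m h \<omega> \<psi> - herm_form m h \<phi> \<psi>"
  using herm_form_lin_left[of m h "-1" \<phi> \<omega> \<psi>] by simp

lemma herm_form_diff_right: "herm_form m h \<psi> (\<lambda>a. \<omega> a - \<phi> a) = herm_form m h \<psi> \<omega> - herm_form m h \<psi> \<phi>"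
  using herm_form_lin_right[of m h \<psi> "-1" \<phi> \<omega>] by simp

lemma herm_form_sum_left: "herm_form m h (\<lambda>a. \<Sum>i\<in>I. c i * \<Omega> i a) \<psi> = (\<Sum>i\<in>I. c i * herm_form m h (\<Omega> i) \<psi>)"
proof (induction I rule: infinite_finite_induct)
  case (insert i I)
  then show ?case using herm_form_lin_left[of m h "c i" "\<Omega> i" "\<lambda>a. \<Sum>i\<in>I. c i * \<Omega> i a" \<psi>] by simp
qed (simp_all add: herm_form_def)

lemma herm_form_sum_right: "herm_form m h \<psi> (\<lambda>a. \<Sum>i\<in>I. c i * \<Omega> i a) = (\<Sum>i\<in>I. cnj (c i) * herm_form m h \<psi> (\<Omega> i))"
proof (induction I rule: infinite_finite_induct)
  case (insert i I)
  then show ?case using herm_form_lin_right[of m h \<psi> "c i" "\<Omega> i" "\<lambda>a. \<Sum>i\<in>I. c i * \<Omega> i a"] by simp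
qed (simp_all add: herm_form_def)

lemma herm_form_cnj:
  assumes "\<And>a b. h b a = cnj (h a b)"
  shows "cnj (herm_form m h \<omega> \<phi>) = herm_form m h \<phi> \<omega>"
proof -
  have "cnj (herm_form m h \<omega> \<phi>) = (\<Sum>a<m. \<Sum>b<m. h b a * \<phi> b * cnj (\<omega> a))"
    unfolding herm_form_def by (simp add: assms[symmetric] mult_ac)
  also have "\<dots> = herm_form m h \<phi> \<omega>" unfolding herm_form_def by (rule sum.swap)
  finally show ?thesis .
qed

text \<open>Null combinations close to the \<open>\<Omega> i\<close> have a Gram matrix close to
  theirs; half of the tolerance is spent on this approximation.\<close>

lemma few_positive_closure:
  assumes "few_positive m h l e"
  obtains \<delta> where "\<delta> > 0" "\<And>\<Omega>. (\<And>i. i \<le> l \<Longrightarrow> \<Omega> i \<in> comb_closure m e) \<Longrightarrow> \<not> near_orthonormal m h l \<delta> \<Omega>"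
proof -
  obtain \<delta> where \<delta>: "\<delta> > 0" "\<And>\<Omega>. (\<And>i. i \<le> l \<Longrightarrow> \<Omega> i \<in> null_combs e) \<Longrightarrow> \<not> near_orthonormal m h l \<delta> \<Omega>"
    using assms unfolding few_positive_def by blast
  have "\<not> near_orthonormal m h l (\<delta>/2) \<Omega>" if \<Omega>: "\<And>i. i \<le> l \<Longrightarrow> \<Omega> i \<in> comb_closure m e" for \<Omega>
  proof
    assume no: "near_orthonormal m h l (\<delta>/2) \<Omega>"
    have "\<exists>\<omega>'. \<omega>' \<in> null_combs e \<and> (\<forall>a<m. cmod (\<Omega> i a - \<omega>' a) < inverse (of_nat (Suc k)))" if "i \<le> l" for i k
    proof -
      have "inverse (of_nat (Suc k) :: real) > 0" by simp
      then show ?thesis using \<Omega>[OF that] unfolding comb_closure_def by blast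
    qed
    then obtain X where X: "\<And>i k. i \<le> l \<Longrightarrow> X i k \<in> null_combs e"
      "\<And>i k a. i \<le> l \<Longrightarrow> a < m \<Longrightarrow> cmod (\<Omega> i a - X i k a) < inverse (of_nat (Suc k))"
      by metis
    have lim: "(\<lambda>k. X i k a) \<longlonglongrightarrow> \<Omega> i a" if "i \<le> l" "a < m" for i a
    proof -
      have "(\<lambda>k. X i k a - \<Omega> i a) \<longlonglongrightarrow> 0"
        by (rule Lim_null_comparison[OF always_eventually LIMSEQ_inverse_real_of_nat])
           (use X(2)[OF that] in \<open>auto simp: norm_minus_commute less_imp_le simp del: of_nat_Suc\<close>)
      then show ?thesis by (simp add: LIM_zero_iff)
    qed
    have "(\<lambda>k. herm_form m h (X i k) (X j k)) \<longlonglongrightarrow> herm_form m h (\<Omega> i) (\<Omega> j)" if "i \<le> l" "j \<le> l" for i j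
      unfolding herm_form_def by (intro tendsto_intros lim that) auto
    then have "\<forall>\<^sub>F k in sequentially. dist (herm_form m h (X i k) (X j k)) (herm_form m h (\<Omega> i) (\<Omega> j)) < \<delta>/2"
      if "i \<le> l" "j \<le> l" for i j
      using that \<delta>(1) by (intro tendstoD) auto
    then have "\<forall>\<^sub>F k in sequentially. \<forall>i\<in>{..l}. \<forall>j\<in>{..l}. dist (herm_form m h (X i k) (X j k)) (herm_form m h (\<Omega> i) (\<Omega> j)) < \<delta>/2"
      by (intro eventually_ball_finite ballI) auto
    from eventually_happens'[OF sequentially_bot this]
    obtain k where k: "\<And>i j. i \<le> l \<Longrightarrow> j \<le> l \<Longrightarrow> dist (herm_form m h (X i k) (X j k)) (herm_form m h (\<Omega> i) (\<Omega> j)) < \<delta>/2"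
      by auto
    have "near_orthonormal m h l \<delta> (\<lambda>i. X i k)"
      unfolding near_orthonormal_def
    proof (intro allI impI)
      fix i j assume ij: "i \<le> l" "j \<le> l"
      have "cmod (herm_form m h (\<Omega> i) (\<Omega> j) - (if i = j then 1 else 0)) \<le> \<delta>/2"
        using no ij unfolding near_orthonormal_def by blast
      then show "cmod (herm_form m h (X i k) (X j k) - (if i = j then 1 else 0)) \<le> \<delta>"
        using k[OF ij] dist_triangle[of "herm_form m h (X i k) (X j k)" "if i = j then 1 else 0" "herm_form m h (\<Omega> i) (\<Omega> j)"]
        unfolding dist_norm by linarith
    qed
    with \<delta>(2)[of "\<lambda>i. X i k"] X(1) show False by blast
  qed
  with \<delta>(1) show ?thesis by (intro that[of "\<delta>/2"]) auto
qed

text \<open>If \<phi> paired nontrivially with \<psi>, adding a multiple of \<phi> to the part of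
  \<psi> orthogonal to the \<open>\<Omega> i\<close> would produce one more unit vector orthogonal
  to these l ones.\<close>

lemma few_positive_radical:
  assumes few: "few_positive m h l e" and herm: "\<And>a b. h b a = cnj (h a b)"
    and \<Omega>: "\<And>i. i < l \<Longrightarrow> \<Omega> i \<in> comb_closure m e"
    and on: "\<And>i j. i < l \<Longrightarrow> j < l \<Longrightarrow> herm_form m h (\<Omega> i) (\<Omega> j) = (if i = j then 1 else 0)"
    and \<phi>: "\<phi> \<in> comb_closure m e" "herm_form m h \<phi> \<phi> = 0" "\<And>i. i < l \<Longrightarrow> herm_form m h \<phi> (\<Omega> i) = 0"
    and \<psi>: "\<psi> \<in> comb_closure m e"
  shows "herm_form m h \<phi> \<psi> = 0"
proof (rule ccontr)
  assume \<beta>: "herm_form m h \<phi> \<psi> \<noteq> 0"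
  obtain \<delta> where \<delta>: "\<delta> > 0" "\<And>\<Omega>. (\<And>i. i \<le> l \<Longrightarrow> \<Omega> i \<in> comb_closure m e) \<Longrightarrow> \<not> near_orthonormal m h l \<delta> \<Omega>"
    using few_positive_closure[OF few] by blast
  have cn: "cnj (herm_form m h x y) = herm_form m h y x" for x y
    by (rule herm_form_cnj) (rule herm)
  define \<psi>' where "\<psi>' = (\<lambda>a. \<psi> a - (\<Sum>i<l. herm_form m h \<psi> (\<Omega> i) * \<Omega> i a))"
  have \<psi>'W: "\<psi>' \<in> comb_closure m e" unfolding \<psi>'_def
    by (rule comb_closure_diff[OF \<psi> comb_closure_sum]) (simp add: \<Omega>)
  have o1: "herm_form m h \<psi>' (\<Omega> j) = 0" if "j < l" for j
  proof -
    have "(\<Sum>i<l. herm_form m h \<psi> (\<Omega> i) * herm_form m h (\<Omega> i) (\<Omega> j)) = (\<Sum>i<l. if i = j then herm_form m h \<psi> (\<Omega> i) else 0)"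
      by (rule sum.cong) (use that on in auto)
    then show ?thesis using that by (simp add: \<psi>'_def herm_form_diff_left herm_form_sum_left)
  qed
  have o2: "herm_form m h \<phi> \<psi>' = herm_form m h \<phi> \<psi>"
    by (simp add: \<psi>'_def herm_form_diff_right herm_form_sum_right \<phi>(3))
  define \<rho> where "\<rho> = Re (herm_form m h \<psi>' \<psi>')"
  have \<rho>: "herm_form m h \<psi>' \<psi>' = of_real \<rho>"
    using cn[of \<psi>' \<psi>'] by (simp add: \<rho>_def complex_eq_iff)
  \<comment> \<open>As \<phi> is isotropic, the square of \<xi> is \<rho> plus twice the real part
    of c times the pairing of \<phi> with \<psi>; this c makes it 1.\<close>
  define c where "c = of_real ((1 - \<rho>)/2) / herm_form m h \<phi> \<psi>"
  define \<xi> where "\<xi> = (\<lambda>a. c * \<phi> a + \<psi>' a)"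
  have \<xi>W: "\<xi> \<in> comb_closure m e" unfolding \<xi>_def by (rule comb_closure_lin[OF \<phi>(1) \<psi>'W])
  have "herm_form m h \<psi>' \<phi> = cnj (herm_form m h \<phi> \<psi>)" using cn[of \<phi> \<psi>'] o2 by simp
  then have "herm_form m h \<xi> \<xi> = c * herm_form m h \<phi> \<psi> + cnj c * cnj (herm_form m h \<phi> \<psi>) + of_real \<rho>"
    unfolding \<xi>_def herm_form_lin_left herm_form_lin_right \<phi>(2) o2 \<rho> by (simp add: algebra_simps)
  also have "c * herm_form m h \<phi> \<psi> = of_real ((1 - \<rho>)/2)" using \<beta> by (simp add: c_def)
  also have "cnj c * cnj (herm_form m h \<phi> \<psi>) = of_real ((1 - \<rho>)/2)"
    using \<beta> by (simp add: c_def)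
  finally have c1: "herm_form m h \<xi> \<xi> = 1" by (simp add: field_simps)
  have c2: "herm_form m h \<xi> (\<Omega> j) = 0" if "j < l" for j
    using that by (simp add: \<xi>_def herm_form_lin_left o1 \<phi>(3))
  have c3: "herm_form m h (\<Omega> j) \<xi> = 0" if "j < l" for j
    using cn[of \<xi> "\<Omega> j"] c2[OF that] by simp
  define \<Omega>' where "\<Omega>' i = (if i < l then \<Omega> i else \<xi>)" for i
  have "near_orthonormal m h l \<delta> \<Omega>'"
    unfolding near_orthonormal_def \<Omega>'_def using \<delta>(1) c1 c2 c3 on by auto
  moreover have "\<Omega>' i \<in> comb_closure m e" for i using \<Omega> \<xi>W by (simp add: \<Omega>'_def)
  ultimately show False using \<delta>(2) by blast
qed

text \<open>The two families span hyperbolic planes: the vectors C \<Omega> + \<Psi> / (2 C) have as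
  Gram matrix the identity plus 1 / (4 C^2) times that of \<Psi>, which is within any tolerance once
  C is large.\<close>

lemma few_positive_isotropic:
  assumes few: "few_positive m h l e" and herm: "\<And>a b. h b a = cnj (h a b)"
    and \<Omega>: "\<And>i. i \<le> l \<Longrightarrow> \<Omega> i \<in> comb_closure m e" and \<Psi>: "\<And>i. i \<le> l \<Longrightarrow> \<Psi> i \<in> comb_closure m e"
    and iso: "\<And>i j. i \<le> l \<Longrightarrow> j \<le> l \<Longrightarrow> herm_form m h (\<Omega> i) (\<Omega> j) = 0"
    and pair: "\<And>i j. i \<le> l \<Longrightarrow> j \<le> l \<Longrightarrow> herm_form m h (\<Omega> i) (\<Psi> j) = (if i = j then 1 else 0)"
  shows False
proof -
  obtain \<delta> where \<delta>: "\<delta> > 0" "\<And>\<Omega>. (\<And>i. i \<le> l \<Longrightarrow> \<Omega> i \<in> comb_closure m e) \<Longrightarrow> \<not> near_orthonormal m h l \<delta> \<Omega>"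
    using few_positive_closure[OF few] by blast
  have cn: "cnj (herm_form m h x y) = herm_form m h y x" for x y
    by (rule herm_form_cnj) (rule herm)
  define N where "N = (\<Sum>i\<le>l. \<Sum>j\<le>l. cmod (herm_form m h (\<Psi> i) (\<Psi> j)))"
  have N: "cmod (herm_form m h (\<Psi> i) (\<Psi> j)) \<le> N" if "i \<le> l" "j \<le> l" for i j
  proof -
    have "cmod (herm_form m h (\<Psi> i) (\<Psi> j)) \<le> (\<Sum>j\<le>l. cmod (herm_form m h (\<Psi> i) (\<Psi> j)))"
      by (rule member_le_sum) (use that in auto)
    also have "\<dots> \<le> N" unfolding N_def
      by (rule member_le_sum[of i "{..l}" "\<lambda>i. \<Sum>j\<le>l. cmod (herm_form m h (\<Psi> i) (\<Psi> j))"])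
         (use that in \<open>auto intro: sum_nonneg\<close>)
    finally show ?thesis .
  qed
  have N0: "N \<ge> 0" unfolding N_def by (intro sum_nonneg) auto
  \<comment> \<open>N bounds the entries of the Gram matrix of \<Psi>, so the error N / (4 C^2) is
    at most \<delta>; the \<open>+ 1\<close> keeps C positive when N = 0.\<close>
  define C where "C = sqrt (N / \<delta> + 1)"
  have C0: "C > 0" unfolding C_def using \<delta>(1) N0 by (intro real_sqrt_gt_zero add_nonneg_pos) auto
  have C2: "C\<^sup>2 = N / \<delta> + 1" unfolding C_def using \<delta>(1) N0 by simp
  define X where "X i = (\<lambda>a. of_real C * \<Omega> i a + of_real (1 / (2 * C)) * \<Psi> i a)" for i
  have XW: "X i \<in> comb_closure m e" if "i \<le> l" for i
    unfolding X_def by (rule comb_closure_lin[OF \<Omega>[OF that] comb_closure_scale[OF \<Psi>[OF that]]])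
  have "near_orthonormal m h l \<delta> X"
    unfolding near_orthonormal_def
  proof (intro allI impI)
    fix i j assume ij: "i \<le> l" "j \<le> l"
    have p2: "herm_form m h (\<Psi> i) (\<Omega> j) = (if i = j then 1 else 0)"
      using cn[of "\<Omega> j" "\<Psi> i"] pair[OF ij(2,1)] by (auto split: if_splits)
    have "herm_form m h (X i) (X j) = of_real (C * (1 / (2 * C))) * (herm_form m h (\<Omega> i) (\<Psi> j) + herm_form m h (\<Psi> i) (\<Omega> j))
        + of_real ((1 / (2 * C))\<^sup>2) * herm_form m h (\<Psi> i) (\<Psi> j)"
      unfolding X_def herm_form_lin_left herm_form_lin_right herm_form_scale_left herm_form_scale_right iso[OF ij]
      by (simp add: algebra_simps power2_eq_square)
    also have "C * (1 / (2 * C)) = 1/2" using C0 by simp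
    finally have "herm_form m h (X i) (X j) - (if i = j then 1 else 0) = of_real ((1 / (2 * C))\<^sup>2) * herm_form m h (\<Psi> i) (\<Psi> j)"
      using pair[OF ij] p2 by simp
    then have "cmod (herm_form m h (X i) (X j) - (if i = j then 1 else 0)) = (1 / (2 * C))\<^sup>2 * cmod (herm_form m h (\<Psi> i) (\<Psi> j))"
      by (simp only: norm_mult norm_of_real) simp
    also have "\<dots> \<le> (1 / (2 * C))\<^sup>2 * N" by (rule mult_left_mono[OF N[OF ij]]) simp
    also have "\<dots> = N / (4 * C\<^sup>2)" by (simp add: power2_eq_square)
    also have "\<dots> \<le> \<delta>"
    proof -
      have "N \<le> \<delta> * C\<^sup>2" using \<delta>(1) by (simp add: C2 field_simps)
      moreover have "\<delta> * C\<^sup>2 \<ge> 0" using \<delta>(1) by simp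
      ultimately have "N \<le> \<delta> * (4 * C\<^sup>2)" by linarith
      then show ?thesis using C0 by (simp add: pos_divide_le_eq)
    qed
    finally show "cmod (herm_form m h (X i) (X j) - (if i = j then 1 else 0)) \<le> \<delta>" .
  qed
  with \<delta>(2)[of X] XW show False by blast
qed

section \<open>Kernels on the model quadric\<close>

definition lev :: "('n::finite \<Rightarrow> real) \<Rightarrow> 'n \<Rightarrow> complex^'n \<Rightarrow> complex^'n \<Rightarrow> complex" where
  "lev \<epsilon> n0 x y = (\<Sum>j\<in>UNIV - {n0}. of_real (\<epsilon> j) * x $ j * cnj (y $ j))"

text \<open>The polarised equation of the model quadric, holomorphic in x and antiholomorphic in y.
  For fixed x its zero set in y is the Segre variety of x.\<close>

definition qrho :: "('n::finite \<Rightarrow> real) \<Rightarrow> 'n \<Rightarrow> complex^'n \<Rightarrow> complex^'n \<Rightarrow> complex" where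
  "qrho \<epsilon> n0 x y = (x $ n0 - cnj (y $ n0)) / (2 * \<i>) - lev \<epsilon> n0 x y"

text \<open>Translation by q in the Heisenberg group, extended to an affine map of the ambient
  space.\<close>

definition heis :: "('n::finite \<Rightarrow> real) \<Rightarrow> 'n \<Rightarrow> complex^'n \<Rightarrow> complex^'n \<Rightarrow> complex^'n" where
  "heis \<epsilon> n0 q x = q + x + (2 * \<i> * lev \<epsilon> n0 x q) *s axis n0 1"

lemma lev_add_left: "lev \<epsilon> n0 (x + y) z = lev \<epsilon> n0 x z + lev \<epsilon> n0 y z"
  by (simp add: lev_def algebra_simps sum.distrib)

lemma lev_add_right: "lev \<epsilon> n0 z (x + y) = lev \<epsilon> n0 z x + lev \<epsilon> n0 z y"
  by (simp add: lev_def algebra_simps sum.distrib)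

lemma lev_scale_left: "lev \<epsilon> n0 (c *s x) z = c * lev \<epsilon> n0 x z"
  by (simp add: lev_def algebra_simps sum_distrib_left)

lemma lev_scale_right: "lev \<epsilon> n0 z (c *s x) = cnj c * lev \<epsilon> n0 z x"
  by (simp add: lev_def algebra_simps sum_distrib_left)

lemma lev_cnj: "cnj (lev \<epsilon> n0 x y) = lev \<epsilon> n0 y x"
  by (simp add: lev_def mult_ac)

lemma lev_axis_left: "lev \<epsilon> n0 (axis i c) y = (if i = n0 then 0 else of_real (\<epsilon> i) * c * cnj (y $ i))"
proof -
  have "lev \<epsilon> n0 (axis i c) y = (\<Sum>j\<in>UNIV - {n0}. if j = i then of_real (\<epsilon> i) * c * cnj (y $ i) else 0)"
    unfolding lev_def by (rule sum.cong) (auto simp: axis_def)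
  then show ?thesis by simp
qed

lemma lev_axis_right: "lev \<epsilon> n0 y (axis i c) = (if i = n0 then 0 else of_real (\<epsilon> i) * cnj c * y $ i)"
proof -
  have "lev \<epsilon> n0 y (axis i c) = cnj (lev \<epsilon> n0 (axis i c) y)" by (simp add: lev_cnj)
  then show ?thesis unfolding lev_axis_left by simp
qed

lemma lev_0 [simp]: "lev \<epsilon> n0 0 y = 0" "lev \<epsilon> n0 y 0 = 0"
  by (simp_all add: lev_def)

lemma lev_cong: "(\<And>j. j \<noteq> n0 \<Longrightarrow> x $ j = x' $ j) \<Longrightarrow> (\<And>j. j \<noteq> n0 \<Longrightarrow> y $ j = y' $ j) \<Longrightarrow> lev \<epsilon> n0 x y = lev \<epsilon> n0 x' y'"
  unfolding lev_def by (rule sum.cong) auto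

lemma lev_real: "lev \<epsilon> n0 x x = of_real (Re (lev \<epsilon> n0 x x))"
  using lev_cnj[of \<epsilon> n0 x x] by (simp add: complex_eq_iff)

text \<open>Invariance of the polarised equation lets everything proved at the origin be moved to
  any point q of the quadric.\<close>

lemma qrho_heis:
  assumes "qrho \<epsilon> n0 q q = 0"
  shows "qrho \<epsilon> n0 (heis \<epsilon> n0 q x) (heis \<epsilon> n0 q y) = qrho \<epsilon> n0 x y"
proof -
  have "qrho \<epsilon> n0 (heis \<epsilon> n0 q x) (heis \<epsilon> n0 q y) = qrho \<epsilon> n0 q q + qrho \<epsilon> n0 x y + (lev \<epsilon> n0 x q + cnj (lev \<epsilon> n0 y q)) - lev \<epsilon> n0 x q - lev \<epsilon> n0 q y"
    by (simp add: qrho_def heis_def lev_add_left lev_add_right lev_scale_left lev_scale_right lev_axis_left lev_axis_right field_simps)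
  then show ?thesis using assms by (simp add: lev_cnj)
qed

text \<open>Reflection turns the antiholomorphic dependence on the second slot of a kernel into a
  holomorphic one.\<close>

lemma holo_cnj: "holo UNIV f \<Longrightarrow> holo UNIV (\<lambda>y. cnj (f (\<chi> j. cnj (y $ j))))"
proof (rule holoI)
  fix z :: "complex^'a" and c v
  assume f: "holo UNIV f"
  let ?C = "\<lambda>y :: complex^'a. \<chi> j. cnj (y $ j)"
  have "linear ?C" by (rule linearI) (simp_all add: vec_eq_iff)
  then have C: "bounded_linear ?C" by (simp add: linear_conv_bounded_linear)
  have "((\<lambda>y. f (?C y)) has_derivative (\<lambda>v. dird (?C v) f (?C z))) (at z)"
    using diff_chain_at[OF bounded_linear.has_derivative[OF C has_derivative_ident] holo_deriv[OF f, of "?C z"]]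
    by (simp add: o_def)
  then show "((\<lambda>y. cnj (f (?C y))) has_derivative (\<lambda>v. cnj (dird (?C v) f (?C z)))) (at z)"
    by (rule bounded_linear.has_derivative[OF bounded_linear_cnj])
  have "?C (c *s v) = cnj c *s ?C v" by (simp add: vec_eq_iff)
  then show "cnj (dird (?C (c *s v)) f (?C z)) = c * cnj (dird (?C v) f (?C z))"
    by (simp add: holo_dird_scale[OF f])
qed

lemma holo_curve:
  fixes c :: "complex \<Rightarrow> complex^'n::finite"
  assumes f: "holo UNIV f" and c: "\<And>j. (\<lambda>t. c t $ j) holomorphic_on UNIV"
  shows "(\<lambda>t. f (c t)) holomorphic_on UNIV"
proof (rule holomorphic_onI)
  fix t :: complex
  have cj: "((\<lambda>t. c t $ j) has_field_derivative deriv (\<lambda>t. c t $ j) t) (at t)" for j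
    using holomorphic_derivI[OF c open_UNIV] by blast
  let ?d = "\<chi> j. deriv (\<lambda>t. c t $ j) t"
  have "((\<lambda>t. \<Sum>j\<in>UNIV. axis j (c t $ j)) has_derivative (\<lambda>h. \<Sum>j\<in>UNIV. axis j (deriv (\<lambda>t. c t $ j) t * h))) (at t)"
    by (intro has_derivative_sum bounded_linear.has_derivative[OF bounded_linear_axis] cj[unfolded has_field_derivative_def])
  moreover have "(\<lambda>h. \<Sum>j\<in>UNIV. axis j (deriv (\<lambda>t. c t $ j) t * h)) = (\<lambda>h. h *s ?d)"
  proof
    fix h :: complex
    show "(\<Sum>j\<in>UNIV. axis j (deriv (\<lambda>t. c t $ j) t * h)) = h *s ?d"
      by (subst vec_eq_sum_axis[of "h *s ?d"]) (simp add: mult.commute)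
  qed
  ultimately have 1: "(c has_derivative (\<lambda>h. h *s ?d)) (at t)" by (simp add: vec_eq_sum_axis[symmetric])
  have 2: "(f has_derivative (\<lambda>u. dird u f (c t))) (at (c t))" by (rule holo_deriv[OF f UNIV_I])
  have "((\<lambda>t. f (c t)) has_derivative (\<lambda>h. dird (h *s ?d) f (c t))) (at t)"
    using diff_chain_at[OF 1 2] by (simp add: o_def)
  moreover have "(\<lambda>h. dird (h *s ?d) f (c t)) = (*) (dird ?d f (c t))"
    by (rule ext) (simp add: holo_dird_scale[OF f])
  ultimately have "((\<lambda>t. f (c t)) has_field_derivative dird ?d f (c t)) (at t)"
    unfolding has_field_derivative_def by simp
  then show "(\<lambda>t. f (c t)) field_differentiable at t within UNIV"
    unfolding field_differentiable_def by blast
qed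

lemma herm_form_curve:
  fixes c d :: "complex \<Rightarrow> complex^'n::finite"
  assumes f: "\<And>a. holo UNIV (\<omega> a)" and g: "\<And>a. holo UNIV (\<omega>' a)"
    and c: "\<And>j. (\<lambda>t. c t $ j) holomorphic_on UNIV" and d: "\<And>j. (\<lambda>t. cnj (d t $ j)) holomorphic_on UNIV"
  shows "(\<lambda>t. herm_form m h (\<lambda>a. \<omega> a (c t)) (\<lambda>a. \<omega>' a (d t))) holomorphic_on UNIV"
proof -
  have "(\<lambda>t. cnj (\<omega>' b (d t))) holomorphic_on UNIV" for b
    using holo_curve[OF holo_cnj[OF g[of b]], of "\<lambda>t. \<chi> j. cnj (d t $ j)"] d by simp
  then show ?thesis unfolding herm_form_def
    by (intro holomorphic_intros holo_curve[OF f c]) auto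
qed

lemma entire_zero_on_reals:
  assumes f: "f holomorphic_on UNIV" and z: "\<And>x::real. f (of_real x) = 0"
  shows "f w = 0"
proof (rule analytic_continuation[OF f open_UNIV connected_UNIV, of "range of_real" 0])
  show "(0::complex) islimpt range of_real"
  proof (rule islimptI)
    fix T :: "complex set" assume "0 \<in> T" "open T"
    then obtain r where r: "r > 0" "ball 0 r \<subseteq> T" using open_contains_ball by blast
    then have "complex_of_real (r/2) \<in> T" by (intro subsetD[OF r(2)]) (simp add: norm_of_real)
    then show "\<exists>y\<in>range of_real. y \<in> T \<and> y \<noteq> (0::complex)" using r(1) by (intro bexI[OF _ rangeI[of _ "r/2"]]) auto
  qed
qed (use z in auto)

text \<open>Polarisation: two points with \<open>qrho x y = 0\<close> lie on a complex curve through the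
  quadric; the three real parameters of its points on the quadric are complexified one by one.\<close>

lemma herm_form_polarize:
  assumes f: "\<And>a. holo UNIV (\<omega> a)" and g: "\<And>a. holo UNIV (\<omega>' a)"
    and v: "\<And>x. qrho \<epsilon> n0 x x = 0 \<Longrightarrow> herm_form m h (\<lambda>a. \<omega> a x) (\<lambda>a. \<omega>' a x) = 0"
    and xy: "qrho \<epsilon> n0 x y = 0"
  shows "herm_form m h (\<lambda>a. \<omega> a x) (\<lambda>a. \<omega>' a y) = 0"
proof -
  \<comment> \<open>Tangential coordinates on the complex line from y at s = 0 to x at s = 1. Below,
    \<open>\<Lambda> s \<tau>\<close> is the Levi form between its points, with \<tau> standing for
    \<open>cnj\<close> of the second parameter.\<close>
  define z where "z s = (\<chi> j. if j = n0 then 0 else y $ j + s * (x $ j - y $ j))" for s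
  define \<Lambda> where "\<Lambda> s \<tau> = (\<Sum>j\<in>UNIV-{n0}. of_real (\<epsilon> j) * (y $ j + s * (x $ j - y $ j)) * (cnj (y $ j) + \<tau> * cnj (x $ j - y $ j)))" for s \<tau>
  have \<Lambda>: "\<Lambda> s (cnj \<sigma>) = lev \<epsilon> n0 (z s) (z \<sigma>)" for s \<sigma>
    unfolding \<Lambda>_def lev_def z_def by (rule sum.cong) auto
  \<comment> \<open>For real a, b, w the points \<open>X a b w\<close> and \<open>Y a b w\<close>
    coincide and lie on the quadric, w being the real part of the normal coordinate.
    \<open>G\<close> is holomorphic in each of the three parameters.\<close>
  define X where "X a b w = z (a + \<i> * b) + axis n0 (w + \<i> * \<Lambda> (a + \<i> * b) (a - \<i> * b))" for a b w
  define Y where "Y a b w = z (cnj (a - \<i> * b)) + axis n0 (cnj (w - \<i> * \<Lambda> (a + \<i> * b) (a - \<i> * b)))" for a b w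
  define G where "G a b w = herm_form m h (\<lambda>i. \<omega> i (X a b w)) (\<lambda>i. \<omega>' i (Y a b w))" for a b w
  have Xc: "X a b w $ j = (if j = n0 then w + \<i> * \<Lambda> (a + \<i> * b) (a - \<i> * b) else y $ j + (a + \<i> * b) * (x $ j - y $ j))" for a b w j
    by (simp add: X_def z_def axis_def)
  have Yc: "cnj (Y a b w $ j) = (if j = n0 then w - \<i> * \<Lambda> (a + \<i> * b) (a - \<i> * b) else cnj (y $ j) + (a - \<i> * b) * cnj (x $ j - y $ j))" for a b w j
    by (simp add: Y_def z_def axis_def)
  have \<Lambda>h: "(\<lambda>t. \<Lambda> (f t) (g t)) holomorphic_on UNIV" if "f holomorphic_on UNIV" "g holomorphic_on UNIV" for f g
    unfolding \<Lambda>_def by (intro holomorphic_intros that)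
  have Gh: "(\<lambda>t. G (a t) (b t) (w t)) holomorphic_on UNIV"
    if "a holomorphic_on UNIV" "b holomorphic_on UNIV" "w holomorphic_on UNIV" for a b w
    unfolding G_def
  proof (rule herm_form_curve[OF f g])
    show "(\<lambda>t. X (a t) (b t) (w t) $ j) holomorphic_on UNIV" for j
      unfolding Xc by (cases "j = n0") (auto intro!: holomorphic_intros \<Lambda>h that)
    show "(\<lambda>t. cnj (Y (a t) (b t) (w t) $ j)) holomorphic_on UNIV" for j
      unfolding Yc by (cases "j = n0") (auto intro!: holomorphic_intros \<Lambda>h that simp del: complex_cnj_diff)
  qed
  have 0: "G (of_real a) (of_real b) (of_real w) = 0" for a b w :: real
  proof -
    define s where "s = of_real a + \<i> * of_real b"
    have cs: "of_real a - \<i> * of_real b = cnj s" by (simp add: s_def)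
    have L: "\<Lambda> s (cnj s) = of_real (Re (lev \<epsilon> n0 (z s) (z s)))" unfolding \<Lambda> by (rule lev_real)
    have XY: "Y (of_real a) (of_real b) (of_real w) = X (of_real a) (of_real b) (of_real w)"
      unfolding X_def Y_def cs s_def[symmetric] L by simp
    have "qrho \<epsilon> n0 (X (of_real a) (of_real b) (of_real w)) (X (of_real a) (of_real b) (of_real w)) = 0"
    proof -
      have "lev \<epsilon> n0 (X (of_real a) (of_real b) (of_real w)) (X (of_real a) (of_real b) (of_real w)) = lev \<epsilon> n0 (z s) (z s)"
        by (rule lev_cong) (simp_all add: X_def s_def axis_def)
      moreover have "X (of_real a) (of_real b) (of_real w) $ n0 = of_real w + \<i> * of_real (Re (lev \<epsilon> n0 (z s) (z s)))"
        unfolding X_def cs s_def[symmetric] L by (simp add: z_def axis_def)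
      ultimately show ?thesis unfolding qrho_def
        using lev_real[of \<epsilon> n0 "z s"] lev_cnj[of \<epsilon> n0 "z s" "z s"] by (simp add: field_simps)
    qed
    from v[OF this] show ?thesis unfolding G_def XY .
  qed
  have 1: "G (of_real a) (of_real b) w = 0" for a b :: real and w
    by (rule entire_zero_on_reals[where f="\<lambda>w. G (of_real a) (of_real b) w"]) (intro Gh holomorphic_intros, rule 0)
  have 2: "G a (of_real b) w = 0" for a w and b :: real
    by (rule entire_zero_on_reals[where f="\<lambda>a. G a (of_real b) w"]) (intro Gh holomorphic_intros, rule 1)
  have 3: "G a b w = 0" for a b w
    by (rule entire_zero_on_reals[where f="\<lambda>b. G a b w"]) (intro Gh holomorphic_intros, rule 2)
  define w where "w = x $ n0 - \<i> * lev \<epsilon> n0 x y"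
  \<comment> \<open>At these complex values the parameters a + \<i> b and a - \<i> b, conjugate for
    real a and b, become 1 and 0: X lies over x and Y over y. That one w serves both normal
    coordinates is the condition \<open>qrho x y = 0\<close>.\<close>
  have s1: "1/2 + \<i> * (- \<i> / 2) = 1" "1/2 - \<i> * (- \<i> / 2) = 0" by (simp_all add: field_simps)
  have L1: "\<Lambda> 1 0 = lev \<epsilon> n0 x y" unfolding \<Lambda>_def lev_def by simp
  have "X (1/2) (- \<i> / 2) w = x"
    unfolding X_def s1 L1 w_def by (simp add: vec_eq_iff z_def axis_def)
  moreover have "Y (1/2) (- \<i> / 2) w = y"
  proof -
    have "cnj (w - \<i> * lev \<epsilon> n0 x y) = y $ n0"
    proof -
      have "x $ n0 - cnj (y $ n0) = 2 * \<i> * lev \<epsilon> n0 x y" using xy by (simp add: qrho_def field_simps)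
      then have "w - \<i> * lev \<epsilon> n0 x y = cnj (y $ n0)" by (simp add: w_def algebra_simps)
      then show ?thesis by simp
    qed
    then show ?thesis unfolding Y_def s1 L1 by (simp add: vec_eq_iff z_def axis_def)
  qed
  ultimately show ?thesis using 3[of "1/2" "-\<i>/2" w] unfolding G_def by simp
qed

section \<open>Derivatives of kernels along lines and under translations\<close>

lemma herm_form_deriv_left:
  assumes "\<And>a. holo UNIV (\<omega> a)"
  shows "((\<lambda>t. herm_form m h (\<lambda>a. \<omega> a (x + t *s u)) \<psi>) has_field_derivative
     herm_form m h (\<lambda>a. dird u (\<omega> a) (x + t *s u)) \<psi>) (at t)"
proof -
  have "((\<lambda>t. h a b * \<omega> a (x + t *s u) * cnj (\<psi> b)) has_field_derivative h a b * dird u (\<omega> a) (x + t *s u) * cnj (\<psi> b)) (at t)" for a b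
    by (intro DERIV_cmult DERIV_cmult_right holo_line[OF assms]) simp
  then show ?thesis unfolding herm_form_def by (intro DERIV_sum)
qed

text \<open>The second slot is antilinear; running through the line with \<open>cnj s\<close> gives
  a function that is holomorphic in s.\<close>

lemma herm_form_deriv_right:
  assumes "\<And>a. holo UNIV (\<omega> a)"
  shows "((\<lambda>s. herm_form m h \<psi> (\<lambda>a. \<omega> a (x + cnj s *s u))) has_field_derivative
     herm_form m h \<psi> (\<lambda>a. dird u (\<omega> a) (x + cnj s *s u))) (at s)"
proof -
  have "((\<lambda>s. cnj (\<omega> b (x + cnj s *s u))) has_field_derivative cnj (dird u (\<omega> b) (x + cnj s *s u))) (at s)" for b
  proof -
    have "((\<lambda>t. \<omega> b (x + t *s u)) has_field_derivative dird u (\<omega> b) (x + cnj s *s u)) (at (cnj s))"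
      by (rule holo_line[OF assms]) simp
    from has_field_derivative_cnj_cnj[OF this] show ?thesis by (simp add: o_def)
  qed
  then have "((\<lambda>s. h a b * \<psi> a * cnj (\<omega> b (x + cnj s *s u))) has_field_derivative h a b * \<psi> a * cnj (dird u (\<omega> b) (x + cnj s *s u))) (at s)" for a b
    by (intro DERIV_cmult)
  then show ?thesis unfolding herm_form_def by (intro DERIV_sum)
qed

lemma lev_scaleR_left: "lev \<epsilon> n0 (c *\<^sub>R x) z = of_real c * lev \<epsilon> n0 x z"
proof -
  have "c *\<^sub>R x = of_real c *s x" by (simp add: vec_eq_iff scaleR_conv_of_real[where 'a=complex])
  then show ?thesis by (simp add: lev_scale_left)
qed

lemma axis_nth_if: "axis i c $ j = (if j = i then c else 0)"
  by (simp add: axis_def)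

lemma axis_nth_other: "i \<noteq> j \<Longrightarrow> axis i c $ j = 0" and axis_nth_same: "axis i c $ i = c"
  by (simp_all add: axis_def)

lemma dird_zero: "holo UNIV f \<Longrightarrow> dird 0 f x = 0"
  using holo_dird_scale[of UNIV f x 0 0] by simp

lemma herm_form_zero_right: "herm_form m h \<psi> (\<lambda>a. 0) = 0"
  by (simp add: herm_form_def)

lemma heis_has_derivative: "(heis \<epsilon> n0 q has_derivative (\<lambda>v. v + (2 * \<i> * lev \<epsilon> n0 v q) *s axis n0 1)) (at x)"
proof -
  have "linear (\<lambda>v. v + (2 * \<i> * lev \<epsilon> n0 v q) *s axis n0 1)"
    by (rule linearI) (simp_all add: lev_add_left lev_scaleR_left vec_eq_iff algebra_simps scaleR_conv_of_real[where 'a=complex])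
  then have b: "bounded_linear (\<lambda>v. v + (2 * \<i> * lev \<epsilon> n0 v q) *s axis n0 1)" by (simp add: linear_conv_bounded_linear)
  have eq: "heis \<epsilon> n0 q = (\<lambda>x. q + (x + (2 * \<i> * lev \<epsilon> n0 x q) *s axis n0 1))"
    by (simp add: heis_def fun_eq_iff algebra_simps)
  show ?thesis unfolding eq
    using has_derivative_add[OF has_derivative_const[of q] bounded_linear.has_derivative[OF b has_derivative_ident]] by simp
qed

lemma heis_holomorphic: "holomorphic_map_on UNIV (heis \<epsilon> n0 q)"
  unfolding holomorphic_map_on_def
  by (intro ballI exI conjI, rule heis_has_derivative)
    (simp add: lev_scale_left vec_eq_iff algebra_simps)

lemma dird_heis: 
  assumes "holo UNIV f"
  shows "dird v (\<lambda>x. f (heis \<epsilon> n0 q x)) x = dird (v + (2 * \<i> * lev \<epsilon> n0 v q) *s axis n0 1) f (heis \<epsilon> n0 q x)"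
  using holo_compose(2)[OF heis_holomorphic assms, of \<epsilon> n0 q x v] dird_eq[OF heis_has_derivative, of v \<epsilon> n0 q x]
  by simp

section \<open>Kernels with few positive directions, studied at the origin\<close>

locale few_positive_kernel =
  fixes n0 :: "'n::finite" and \<epsilon> :: "'n \<Rightarrow> real" and l m :: nat
    and h :: "nat \<Rightarrow> nat \<Rightarrow> complex" and e :: "nat \<Rightarrow> complex^'n \<Rightarrow> complex"
  assumes eps: "\<And>j. j \<noteq> n0 \<Longrightarrow> \<epsilon> j = 1 \<or> \<epsilon> j = -1"
    and lpos: "0 < l"
    and card_pos: "l \<le> card {j. j \<noteq> n0 \<and> \<epsilon> j = 1}" and card_neg: "l \<le> card {j. j \<noteq> n0 \<and> \<epsilon> j = -1}"
    and hol: "\<And>a. holo UNIV (e a)"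
    and herm: "\<And>a b. h b a = cnj (h a b)"
    and vanish: "\<And>x. qrho \<epsilon> n0 x x = 0 \<Longrightarrow> herm_form m h (\<lambda>a. e a x) (\<lambda>a. e a x) = 0"
    and few: "few_positive m h l e"
begin

abbreviation "B \<equiv> herm_form m h"
abbreviation "L \<equiv> lev \<epsilon> n0"
abbreviation "nn \<equiv> axis n0 (1::complex)"
abbreviation "W \<equiv> comb_closure m e"
abbreviation "D u \<omega> x \<equiv> (\<lambda>a::nat. dird u (\<omega> a) x)"

definition nd :: "nat \<Rightarrow> nat \<Rightarrow> complex^'n \<Rightarrow> complex" where
  "nd j a = (dird nn ^^ j) (e a)"

lemma nd_0 [simp]: "nd 0 = e" by (simp add: nd_def fun_eq_iff)

lemma nd_Suc: "nd (Suc j) a = dird nn (nd j a)" by (simp add: nd_def)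

lemma nd_holo: "holo UNIV (nd j a)"
  by (induction j) (simp_all add: hol nd_Suc holo_dird)

lemma e_W: "(\<lambda>a. e a x - e a y) \<in> W"
  by (rule null_combs_subset_closure[OF null_combs_diff])

lemma nd_W: "(\<lambda>a. nd j a x - nd j a y) \<in> W"
proof (induction j arbitrary: x y)
  case (Suc j)
  show ?case unfolding nd_Suc
    by (intro comb_closure_diff comb_closure_dird nd_holo Suc)
qed (simp add: e_W)

lemma dird_nd_W: "D u (nd j) x \<in> W"
  by (rule comb_closure_dird[OF nd_holo nd_W])

lemma D_W: "D u e x \<in> W"
  using dird_nd_W[of u 0] by simp

lemma B_cnj: "cnj (B x y) = B y x"
  by (rule herm_form_cnj) (rule herm)

text \<open>The sign s is left open because it will have to match that of 2\<i> times the normal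
  derivative, so that the first derivatives in these directions have positive square.\<close>

lemma sign_family:
  assumes "s = 1 \<or> s = -1"
  shows "\<exists>f. inj_on f {..<l} \<and> (\<forall>i<l. f i \<noteq> n0 \<and> \<epsilon> (f i) = s)"
proof -
  have "l \<le> card {j. j \<noteq> n0 \<and> \<epsilon> j = s}" using assms card_pos card_neg by auto
  then obtain T where T: "T \<subseteq> {j. j \<noteq> n0 \<and> \<epsilon> j = s}" "card T = l"
    by (rule obtain_subset_with_card_n)
  obtain f where "bij_betw f {0..<card T} T" using ex_bij_betw_nat_finite[OF finite] by blast
  then have "inj_on f {..<l}" "f ` {..<l} = T" by (auto simp: bij_betw_def T atLeast0LessThan)
  with T(1) show ?thesis by (intro exI[of _ f]) auto
qed

text \<open>For tangential v the Segre variety of v passes through 0 and contains there the complex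
  line in direction u, after a normal correction. The conjugations undo the antilinearity of the
  second slot.\<close>

lemma tangent_normal_curve:
  assumes "v $ n0 = 0" "u $ n0 = 0"
  shows "qrho \<epsilon> n0 v (0 + cnj s *s (u + cnj (- 2 * \<i> * L v u) *s nn)) = 0"
  using assms by (simp add: qrho_def lev_scale_right lev_add_right lev_axis_right field_simps)

lemma dird_tangent_normal: "holo UNIV f \<Longrightarrow> dird (u + c *s nn) f x = dird u f x + c * dird nn f x"
  by (simp add: holo_dird_add holo_dird_scale)

text \<open>The kernel vanishes on the line of \<open>tangent_normal_curve\<close>. In its
  derivative at 0 the tangential and normal parts cancel, and the normal correction of that line
  brings in the Levi form.\<close>

lemma tangential_deriv:
  assumes \<omega>: "\<And>a. holo UNIV (\<omega> a)" and \<omega>': "\<And>a. holo UNIV (\<omega>' a)"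
    and z: "\<And>x y. qrho \<epsilon> n0 x y = 0 \<Longrightarrow> B (\<lambda>a. \<omega> a x) (\<lambda>a. \<omega>' a y) = 0"
    and vu: "v $ n0 = 0" "u $ n0 = 0"
  shows "B (\<lambda>a. \<omega> a v) (D u \<omega>' 0) = 2 * \<i> * L v u * B (\<lambda>a. \<omega> a v) (D nn \<omega>' 0)"
proof -
  let ?w = "u + cnj (- 2 * \<i> * L v u) *s nn"
  have "((\<lambda>s. B (\<lambda>a. \<omega> a v) (\<lambda>a. \<omega>' a (0 + cnj s *s ?w))) has_field_derivative
      B (\<lambda>a. \<omega> a v) (D ?w \<omega>' (0 + cnj 0 *s ?w))) (at 0)"
    by (rule herm_form_deriv_right[OF \<omega>'])
  moreover have "(\<lambda>s. B (\<lambda>a. \<omega> a v) (\<lambda>a. \<omega>' a (0 + cnj s *s ?w))) = (\<lambda>s. 0)"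
    by (rule ext) (rule z[OF tangent_normal_curve[OF vu]])
  ultimately have "B (\<lambda>a. \<omega> a v) (D ?w \<omega>' 0) = 0"
    using DERIV_unique[OF _ DERIV_const] by fastforce
  moreover have "D ?w \<omega>' 0 = (\<lambda>a. cnj (- 2 * \<i> * L v u) * dird nn (\<omega>' a) 0 + dird u (\<omega>' a) 0)"
    by (rule ext) (simp only: dird_tangent_normal[OF \<omega>'] add.commute)
  ultimately show ?thesis by (simp add: herm_form_lin_right)
qed

text \<open>\<open>tangential_deriv\<close> at t v, differentiated at t = 0: the Levi form supplies
  a factor t, so only the value of the normal term at 0 remains. For \<omega> = \<omega>' = e this
  is the Gram matrix of the tangential first derivatives.\<close>

lemma mixed_deriv:
  assumes \<omega>: "\<And>a. holo UNIV (\<omega> a)" and \<omega>': "\<And>a. holo UNIV (\<omega>' a)"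
    and z: "\<And>x y. qrho \<epsilon> n0 x y = 0 \<Longrightarrow> B (\<lambda>a. \<omega> a x) (\<lambda>a. \<omega>' a y) = 0"
    and vu: "v $ n0 = 0" "u $ n0 = 0"
  shows "B (D v \<omega> 0) (D u \<omega>' 0) = 2 * \<i> * L v u * B (\<lambda>a. \<omega> a 0) (D nn \<omega>' 0)"
proof -
  let ?f = "\<lambda>t. B (\<lambda>a. \<omega> a (0 + t *s v)) (D u \<omega>' 0)" and ?g = "\<lambda>t. B (\<lambda>a. \<omega> a (0 + t *s v)) (D nn \<omega>' 0)"
  have fg: "?f = (\<lambda>t. 2 * \<i> * t * L v u * ?g t)"
  proof
    fix t show "?f t = 2 * \<i> * t * L v u * ?g t"
      using tangential_deriv[OF \<omega> \<omega>' z, of "t *s v" u] vu by (simp add: lev_scale_left mult.assoc)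
  qed
  have "(?f has_field_derivative B (D v \<omega> (0 + 0 *s v)) (D u \<omega>' 0)) (at 0)"
    by (rule herm_form_deriv_left[OF \<omega>])
  moreover have "(?g has_field_derivative B (D v \<omega> (0 + 0 *s v)) (D nn \<omega>' 0)) (at 0)"
    by (rule herm_form_deriv_left[OF \<omega>])
  then have "((\<lambda>t. 2 * \<i> * t * L v u * ?g t) has_field_derivative 2 * \<i> * L v u * ?g 0) (at 0)"
    by (auto intro!: derivative_eq_intros)
  ultimately show ?thesis unfolding fg[symmetric] using DERIV_unique by fastforce
qed

lemma polar: "qrho \<epsilon> n0 x y = 0 \<Longrightarrow> B (\<lambda>a. e a x) (\<lambda>a. e a y) = 0"
  by (rule herm_form_polarize[OF hol hol vanish])

text \<open>2\<i> times the normal derivative is the square of a first derivative in a direction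
  with Levi form 1, hence real.\<close>

lemma normal_imaginary: "cnj (B (\<lambda>a. e a 0) (D nn e 0)) = - B (\<lambda>a. e a 0) (D nn e 0)"
proof -
  obtain f where f': "inj_on f {..<l}" "\<And>i. i < l \<Longrightarrow> f i \<noteq> n0 \<and> \<epsilon> (f i) = 1"
    using sign_family[of 1] by blast
  then have f: "f 0 \<noteq> n0" "\<epsilon> (f 0) = 1" using lpos by auto
  let ?u = "axis (f 0) 1 :: complex^'n"
  have eq: "B (D ?u e 0) (D ?u e 0) = 2 * \<i> * B (\<lambda>a. e a 0) (D nn e 0)"
    using mixed_deriv[OF hol hol polar, of ?u ?u] f by (simp add: lev_axis_left axis_nth_other axis_nth_same)
  have aux: "cnj K = - K" if "cnj (2 * \<i> * K) = 2 * \<i> * K" for K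
    using that by (auto simp: complex_eq_iff)
  show ?thesis by (rule aux) (unfold eq[symmetric], rule B_cnj)
qed

text \<open>Otherwise a difference quotient along the null vector \<open>v\<close>, corrected by a multiple of the first
  derivative, is isotropic and orthogonal to too many positive directions without being in the radical.\<close>

lemma second_deriv_null:
  assumes v: "v $ n0 = 0" "L v v = 0" and k1: "B (\<lambda>a. e a 0) (D nn e 0) \<noteq> 0"
  shows "B (D v e 0) (D nn e 0) = 0"
proof (rule ccontr)
  assume "B (D v e 0) (D nn e 0) \<noteq> 0"
  define k where "k = B (\<lambda>a. e a 0) (D nn e 0)"
  define \<kappa> where "\<kappa> = B (D v e 0) (D nn e 0)"
  have k0: "k \<noteq> 0" using k1 by (simp add: k_def)
  have \<kappa>0: "\<kappa> \<noteq> 0" using \<open>B (D v e 0) (D nn e 0) \<noteq> 0\<close> by (simp add: \<kappa>_def)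
  have "v \<noteq> 0" using \<kappa>0 dird_zero[OF hol] by (auto simp: \<kappa>_def herm_form_def)
  then obtain i where i: "v $ i \<noteq> 0" by (auto simp: vec_eq_iff)
  then have in0: "i \<noteq> n0" using v(1) by auto
  define u where "u = (axis i 1 :: complex^'n)"
  have u0: "u $ n0 = 0" using in0 by (simp add: u_def axis_nth_other)
  have Lvu: "L v u \<noteq> 0" using in0 i eps[OF in0] by (auto simp: u_def lev_axis_right)
  \<comment> \<open>The identity reached at the end reads - 2\<i> t L(v,u) k + 2\<i> \<alpha> L(v,u)
    (k - t \<kappa>) = 0. This t removes the second term and leaves a nonzero first one.\<close>
  define t where "t = k / \<kappa>"
  have t0: "t \<noteq> 0" using k0 \<kappa>0 by (simp add: t_def)
  \<comment> \<open>The coefficient for which \<phi> becomes orthogonal to all tangential first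
    derivatives at 0.\<close>
  define \<alpha> where "\<alpha> = t * B (\<lambda>a. e a (t *s v)) (D nn e 0) / k"
  define \<phi> where "\<phi> = (\<lambda>a. (- \<alpha>) * dird v (e a) 0 + (e a (t *s v) - e a 0))"
  have \<phi>W: "\<phi> \<in> W" unfolding \<phi>_def by (rule comb_closure_lin[OF D_W e_W])
  have \<phi>B: "B \<phi> x = B (\<lambda>a. e a (t *s v)) x - B (\<lambda>a. e a 0) x - \<alpha> * B (D v e 0) x" for x
    unfolding \<phi>_def herm_form_lin_left herm_form_diff_left by simp
  have B\<phi>: "B x \<phi> = B x (\<lambda>a. e a (t *s v)) - B x (\<lambda>a. e a 0) - cnj \<alpha> * B x (D v e 0)" for x
    unfolding \<phi>_def herm_form_lin_right herm_form_diff_right by simp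
  have line: "B (\<lambda>a. e a (s *s v)) (\<lambda>a. e a (s' *s v)) = 0" for s s'
    by (rule polar) (use v in \<open>simp add: qrho_def lev_scale_left lev_scale_right\<close>)
  have line1: "B (\<lambda>a. e a (s *s v)) (D v e 0) = 0" for s
    using tangential_deriv[OF hol hol polar, of "s *s v" v] v by (simp add: lev_scale_left)
  have line2: "B (D v e 0) (\<lambda>a. e a (s *s v)) = 0" for s
    using B_cnj[of "\<lambda>a. e a (s *s v)" "D v e 0"] line1[of s] by simp
  have line3: "B (D v e 0) (D v e 0) = 0"
    using mixed_deriv[OF hol hol polar, of v v] v by simp
  have zz: "0 = 0 *s v" by simp
  have \<phi>\<phi>: "B \<phi> \<phi> = 0"
    unfolding \<phi>B B\<phi> line3 line1 line2 line using line1[of 0] line2[of 0] line[of 0] line[of _ 0] line[of 0 0] by simp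
  have \<phi>D: "B \<phi> (D w e 0) = 0" if w: "w $ n0 = 0" for w
  proof -
    have "B (\<lambda>a. e a (t *s v)) (D w e 0) = 2 * \<i> * (t * L v w) * B (\<lambda>a. e a (t *s v)) (D nn e 0)"
      using tangential_deriv[OF hol hol polar, of "t *s v" w] v w by (simp add: lev_scale_left)
    moreover have "B (\<lambda>a. e a 0) (D w e 0) = 0"
      using tangential_deriv[OF hol hol polar, of 0 w] w by simp
    moreover have "B (D v e 0) (D w e 0) = 2 * \<i> * L v w * k"
      using mixed_deriv[OF hol hol polar, of v w] v w by (simp add: k_def)
    ultimately show ?thesis unfolding \<phi>B \<alpha>_def using k0 by (simp add: field_simps)
  qed
  have rad: "B \<phi> \<psi> = 0" if \<psi>: "\<psi> \<in> W" for \<psi>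
  proof -
    \<comment> \<open>2\<i> k is real. Directions whose Levi sign is \<open>sgn c\<close> have first
      derivatives of positive square \<open>\<bar>c\<bar>\<close>, and there are l of them for
      either sign.\<close>
    define c where "c = Re (2 * \<i> * k)"
    have c: "2 * \<i> * k = of_real c" using normal_imaginary by (simp add: c_def k_def complex_eq_iff)
    have c0: "c \<noteq> 0" using c k0 by auto
    obtain f where f: "inj_on f {..<l}" "\<And>i. i < l \<Longrightarrow> f i \<noteq> n0 \<and> \<epsilon> (f i) = sgn c"
    proof -
      have "sgn c = 1 \<or> sgn c = -1" using c0 by (simp add: sgn_if)
      from sign_family[OF this] show ?thesis using that by blast
    qed
    define \<Omega> where "\<Omega> i = (\<lambda>a. of_real (1 / sqrt \<bar>c\<bar>) * dird (axis (f i) 1) (e a) 0)" for i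
    show ?thesis
    proof (rule few_positive_radical[OF few herm _ _ \<phi>W \<phi>\<phi> _ \<psi>])
      show "\<Omega> i \<in> W" for i unfolding \<Omega>_def by (rule comb_closure_scale[OF D_W])
      show "B \<phi> (\<Omega> i) = 0" if "i < l" for i
        unfolding \<Omega>_def herm_form_scale_right using \<phi>D[of "axis (f i) 1"] f(2)[OF that] by (simp add: axis_nth_other)
      show "B (\<Omega> i) (\<Omega> j) = (if i = j then 1 else 0)" if ij: "i < l" "j < l" for i j
      proof -
        have "B (D (axis (f i) 1) e 0) (D (axis (f j) 1) e 0) = 2 * \<i> * L (axis (f i) 1) (axis (f j) 1) * k"
          unfolding k_def by (rule mixed_deriv[OF hol hol polar]) (use f(2) ij in \<open>auto simp: axis_nth_other\<close>)
        also have "L (axis (f i) 1) (axis (f j) 1) = (if i = j then of_real (sgn c) else 0)"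
          using f(2)[OF ij(1)] inj_onD[OF f(1), of i j] ij
          by (auto simp: lev_axis_left axis_nth_if)
        also have "2 * \<i> * (if i = j then of_real (sgn c) else 0) * k = (if i = j then of_real (sgn c) * (2 * \<i> * k) else 0)"
          by simp
        finally have 1: "B (D (axis (f i) 1) e 0) (D (axis (f j) 1) e 0) = (if i = j then of_real (sgn c * c) else 0)"
          unfolding c of_real_mult .
        have "B (\<Omega> i) (\<Omega> j) = of_real ((1 / sqrt \<bar>c\<bar>) * (1 / sqrt \<bar>c\<bar>)) * B (D (axis (f i) 1) e 0) (D (axis (f j) 1) e 0)"
          by (simp only: \<Omega>_def herm_form_scale_left herm_form_scale_right of_real_mult complex_cnj_complex_of_real mult.assoc)
        also have "(1 / sqrt \<bar>c\<bar>) * (1 / sqrt \<bar>c\<bar>) = 1 / \<bar>c\<bar>" by simp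
        also have "B (D (axis (f i) 1) e 0) (D (axis (f j) 1) e 0) = (if i = j then of_real \<bar>c\<bar> else 0)"
          unfolding 1 by (simp add: abs_sgn mult.commute)
        finally show ?thesis using c0 by simp
      qed
    qed
  qed
  \<comment> \<open>The points \<open>cnj s *s w\<close> form a line in the Segre variety of
    \<open>t *s v\<close>, so the value of e at \<open>t *s v\<close> drops out when \<phi> is
    paired with differences along it.\<close>
  define w where "w = u + cnj (- 2 * \<i> * L (t *s v) u) *s nn"
  have eq: "B (\<lambda>a. e a 0) (\<lambda>a. e a (0 + cnj s *s w)) + \<alpha> * B (D v e 0) (\<lambda>a. e a (0 + cnj s *s w)) = 0" for s
  proof -
    let ?\<zeta> = "0 + cnj s *s w"
    have "B \<phi> (\<lambda>a. e a ?\<zeta> - e a 0) = 0" by (rule rad[OF e_W])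
    moreover have "B (\<lambda>a. e a (t *s v)) (\<lambda>a. e a ?\<zeta>) = 0"
      unfolding w_def by (rule polar[OF tangent_normal_curve]) (use v u0 in auto)
    moreover have "B \<phi> (\<lambda>a. e a 0) = 0"
      unfolding \<phi>B using line[of _ 0] line[of 0 0] line2[of 0] by simp
    ultimately have "- (B (\<lambda>a. e a 0) (\<lambda>a. e a ?\<zeta>) + \<alpha> * B (D v e 0) (\<lambda>a. e a ?\<zeta>)) = 0"
      using \<phi>B[of "\<lambda>a. e a ?\<zeta>"] unfolding herm_form_diff_right by (simp only: minus_add_distrib) algebra
    then show ?thesis by (simp only: neg_equal_0_iff_equal)
  qed
  have "((\<lambda>s. B (\<lambda>a. e a 0) (\<lambda>a. e a (0 + cnj s *s w)) + \<alpha> * B (D v e 0) (\<lambda>a. e a (0 + cnj s *s w))) has_field_derivative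
     B (\<lambda>a. e a 0) (D w e (0 + cnj 0 *s w)) + \<alpha> * B (D v e 0) (D w e (0 + cnj 0 *s w))) (at 0)"
    by (intro DERIV_add DERIV_cmult herm_form_deriv_right hol)
  then have "B (\<lambda>a. e a 0) (D w e 0) + \<alpha> * B (D v e 0) (D w e 0) = 0"
    unfolding eq using DERIV_unique[OF _ DERIV_const] by fastforce
  moreover have Dw: "D w e 0 = (\<lambda>a. cnj (- 2 * \<i> * L (t *s v) u) * dird nn (e a) 0 + dird u (e a) 0)"
    unfolding w_def by (rule ext) (simp only: dird_tangent_normal[OF hol] add.commute)
  have "B x (D w e 0) = (- 2 * \<i> * t * L v u) * B x (D nn e 0) + B x (D u e 0)" for x
    unfolding Dw herm_form_lin_right by (simp add: lev_scale_left)
  moreover have "B (\<lambda>a. e a 0) (D u e 0) = 0"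
    using tangential_deriv[OF hol hol polar, of 0 u] u0 by simp
  moreover have "B (D v e 0) (D u e 0) = 2 * \<i> * L v u * k"
    using mixed_deriv[OF hol hol polar, of v u] v u0 by (simp add: k_def)
  ultimately have "(- 2 * \<i> * t * L v u) * k + \<alpha> * (2 * \<i> * L v u * (k - t * \<kappa>)) = 0"
    by (simp add: k_def \<kappa>_def algebra_simps)
  moreover have "t * \<kappa> = k" using \<kappa>0 by (simp add: t_def)
  ultimately show False using t0 Lvu k0 by simp
qed

text \<open>When the first normal derivative vanishes, \<open>mixed_deriv\<close> makes the
  tangential first derivatives of e isotropic, while their pairing with those of \<open>nd j\<close>
  is the Levi form times 2\<i> k. A nonzero k would provide l + 1 isotropic vectors with a dual
  family.\<close>

lemma normal_deriv_step:
  assumes j: "0 < j" and z: "\<And>x. qrho \<epsilon> n0 x x = 0 \<Longrightarrow> B (\<lambda>a. e a x) (\<lambda>a. nd j a x) = 0"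
    and k1: "B (\<lambda>a. e a 0) (D nn e 0) = 0"
  shows "B (\<lambda>a. e a 0) (\<lambda>a. nd (Suc j) a 0) = 0"
proof (rule ccontr)
  define k where "k = B (\<lambda>a. e a 0) (\<lambda>a. nd (Suc j) a 0)"
  assume "B (\<lambda>a. e a 0) (\<lambda>a. nd (Suc j) a 0) \<noteq> 0"
  then have k0: "k \<noteq> 0" by (simp add: k_def)
  have zp: "B (\<lambda>a. e a x) (\<lambda>a. nd j a y) = 0" if "qrho \<epsilon> n0 x y = 0" for x y
    by (rule herm_form_polarize[OF hol nd_holo z that])
  obtain f where f: "inj_on f {..<l}" "\<And>i. i < l \<Longrightarrow> f i \<noteq> n0 \<and> \<epsilon> (f i) = 1"
    using sign_family[of 1] by blast
  obtain g where g': "inj_on g {..<l}" "\<And>i. i < l \<Longrightarrow> g i \<noteq> n0 \<and> \<epsilon> (g i) = -1"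
    using sign_family[of "-1"] by blast
  then have g: "g 0 \<noteq> n0" "\<epsilon> (g 0) = -1" using lpos by auto
  \<comment> \<open>l coordinates of positive sign and one of negative sign: l + 1 distinct
    tangential directions.\<close>
  define F where "F i = (if i < l then f i else g 0)" for i
  have F: "F i \<noteq> n0" for i using f(2) g(1) by (simp add: F_def)
  have Finj: "F i = F i' \<longleftrightarrow> i = i'" if "i \<le> l" "i' \<le> l" for i i'
  proof (cases "i < l \<longleftrightarrow> i' < l")
    case True
    then have "i < l \<and> i' < l \<or> i = l \<and> i' = l" using that by linarith
    then show ?thesis using inj_onD[OF f(1), of i i'] by (auto simp: F_def)
  next
    case False
    then have "\<epsilon> (F i) \<noteq> \<epsilon> (F i')" using f(2) g(2) by (auto simp: F_def)
    with False show ?thesis by auto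
  qed
  define \<Omega> where "\<Omega> i = (\<lambda>a. (of_real (\<epsilon> (F i)) / (2 * \<i> * k)) * dird (axis (F i) 1) (e a) 0)" for i
  define \<Psi> where "\<Psi> i = D (axis (F i) 1) (nd j) 0" for i
  have LF: "L (axis (F i) 1) (axis (F i') 1) = (if i = i' then of_real (\<epsilon> (F i)) else 0)" if "i \<le> l" "i' \<le> l" for i i'
    using F Finj[OF that] by (simp add: lev_axis_left axis_nth_if)
  have F0: "axis (F i) 1 $ n0 = (0::complex)" for i using F by (simp add: axis_nth_other)
  show False
  proof (rule few_positive_isotropic[OF few herm])
    show "\<Omega> i \<in> W" for i unfolding \<Omega>_def by (rule comb_closure_scale[OF D_W])
    show "\<Psi> i \<in> W" for i unfolding \<Psi>_def by (rule dird_nd_W)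
    show "B (\<Omega> i) (\<Omega> i') = 0" for i i'
      using mixed_deriv[OF hol hol polar F0[of i] F0[of i']] k1
      unfolding \<Omega>_def herm_form_scale_left herm_form_scale_right by simp
    show "B (\<Omega> i) (\<Psi> i') = (if i = i' then 1 else 0)" if ii: "i \<le> l" "i' \<le> l" for i i'
    proof -
      have "B (\<Omega> i) (\<Psi> i') = (of_real (\<epsilon> (F i)) / (2 * \<i> * k)) * (2 * \<i> * L (axis (F i) 1) (axis (F i') 1) * k)"
        using mixed_deriv[OF hol nd_holo zp F0[of i] F0[of i']]
        unfolding \<Omega>_def \<Psi>_def herm_form_scale_left k_def nd_Suc by (simp only:)
      also have "\<dots> = of_real (\<epsilon> (F i)) * L (axis (F i) 1) (axis (F i') 1)" using k0 by simp
      also have "\<dots> = (if i = i' then of_real (\<epsilon> (F i) * \<epsilon> (F i)) else 0)" using LF[OF ii] by simp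
      also have "\<epsilon> (F i) * \<epsilon> (F i) = 1" using eps[OF F, of i] by auto
      finally show ?thesis by simp
    qed
  qed
qed

end

section \<open>Change of base point on the quadric\<close>

lemma few_positive_compose:
  assumes "few_positive m h l e"
  shows "few_positive m h l (\<lambda>a x. e a (\<tau> x))"
proof -
  have "null_combs (\<lambda>a x. e a (\<tau> x)) \<subseteq> null_combs e"
  proof
    fix \<omega> assume "\<omega> \<in> null_combs (\<lambda>a x. e a (\<tau> x))"
    then obtain xs where xs: "\<omega> = (\<lambda>a. eval_comb xs (\<lambda>x. e a (\<tau> x)))" "eval_comb xs (\<lambda>_. 1) = 0"
      unfolding null_combs_def by blast
    have "eval_comb (map (\<lambda>(c, x). (c, \<tau> x)) xs) f = eval_comb xs (\<lambda>x. f (\<tau> x))" for f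
      by (simp add: eval_comb_def split_def o_def)
    then show "\<omega> \<in> null_combs e" unfolding null_combs_def mem_Collect_eq
      by (intro exI[of _ "map (\<lambda>(c, x). (c, \<tau> x)) xs"]) (simp add: xs)
  qed
  then show ?thesis using assms unfolding few_positive_def by blast
qed

context few_positive_kernel
begin

text \<open>Translations preserve the quadric and merely rename the points in null combinations, so
  the pulled-back kernel is of the same kind.\<close>

lemma translate:
  assumes "qrho \<epsilon> n0 q q = 0"
  shows "few_positive_kernel n0 \<epsilon> l m h (\<lambda>a x. e a (heis \<epsilon> n0 q x))"
proof
  show "holo UNIV (\<lambda>x. e a (heis \<epsilon> n0 q x))" for a
    by (rule holo_compose(1)[OF heis_holomorphic hol]) simp
  show "B (\<lambda>a. e a (heis \<epsilon> n0 q x)) (\<lambda>a. e a (heis \<epsilon> n0 q x)) = 0" if "qrho \<epsilon> n0 x x = 0" for x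
    by (rule vanish) (simp add: qrho_heis[OF assms] that)
qed (fact lpos card_pos card_neg | rule eps herm few_positive_compose[OF few], assumption?)+

end

lemma holo_line_vector:
  assumes "holo UNIV f"
  shows "((\<lambda>t. f (x + of_real t *s v)) has_vector_derivative dird v f (x + of_real t *s v)) (at t)"
  using has_vector_derivative_real_field[OF holo_line[OF assms, of x "of_real t" v], of UNIV] by simp

lemma herm_form_line_vector:
  assumes f: "\<And>a. holo UNIV (\<omega> a)" and g: "\<And>a. holo UNIV (\<omega>' a)"
  shows "((\<lambda>t. herm_form m h (\<lambda>a. \<omega> a (x + of_real t *s v)) (\<lambda>a. \<omega>' a (x + of_real t *s v))) has_vector_derivative
    herm_form m h (\<lambda>a. dird v (\<omega> a) (x + of_real t *s v)) (\<lambda>a. \<omega>' a (x + of_real t *s v)) +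
    herm_form m h (\<lambda>a. \<omega> a (x + of_real t *s v)) (\<lambda>a. dird v (\<omega>' a) (x + of_real t *s v))) (at t)"
proof -
  let ?p = "x + of_real t *s v"
  have "((\<lambda>t. h a b * (\<omega> a (x + of_real t *s v) * cnj (\<omega>' b (x + of_real t *s v)))) has_vector_derivative
      h a b * (\<omega> a ?p * cnj (dird v (\<omega>' b) ?p) + dird v (\<omega> a) ?p * cnj (\<omega>' b ?p))) (at t)" for a b
    by (rule has_vector_derivative_mult_right[OF has_vector_derivative_mult[OF holo_line_vector[OF f]
        has_vector_derivative_cnj[OF holo_line_vector[OF g]]]])
  then have "((\<lambda>t. \<Sum>a<m. \<Sum>b<m. h a b * (\<omega> a (x + of_real t *s v) * cnj (\<omega>' b (x + of_real t *s v)))) has_vector_derivative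
      (\<Sum>a<m. \<Sum>b<m. h a b * (\<omega> a ?p * cnj (dird v (\<omega>' b) ?p) + dird v (\<omega> a) ?p * cnj (\<omega>' b ?p)))) (at t)"
    by (intro has_vector_derivative_sum)
  then show ?thesis
    by (simp add: herm_form_def distrib_left sum.distrib mult.assoc add.commute)
qed

section \<open>The normal derivative along null lines\<close>

context few_positive_kernel
begin

definition "\<alpha> q = B (\<lambda>a. e a q) (D nn e q)"

text \<open>For \<open>v $ n0 = 0\<close> and q on the quadric, the (1,0)-tangent vector at q with
  tangential coordinates v.\<close>

definition "lift q v = v + (2 * \<i> * L v q) *s nn"

lemma hol1: "holo UNIV (dird nn (e a))"
  by (rule holo_dird[OF open_UNIV hol])

lemma heis_eq_lift: "heis \<epsilon> n0 q v = q + lift q v"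
  by (simp add: heis_def lift_def)

lemma lift_scale: "lift q (c *s v) = c *s lift q v"
  by (simp add: lift_def lev_scale_left vec_eq_iff algebra_simps)

lemma heis_0: "heis \<epsilon> n0 q 0 = q"
  by (simp add: heis_def)

lemma dird_normal_heis: "holo UNIV f \<Longrightarrow> dird nn (\<lambda>x. f (heis \<epsilon> n0 q x)) x = dird nn f (heis \<epsilon> n0 q x)"
  by (simp add: dird_heis lev_axis_left)

lemma normal_imaginary_at:
  assumes "qrho \<epsilon> n0 q q = 0"
  shows "cnj (\<alpha> q) = - \<alpha> q"
proof -
  interpret T: few_positive_kernel n0 \<epsilon> l m h "\<lambda>a x. e a (heis \<epsilon> n0 q x)" by (rule translate[OF assms])
  show ?thesis using T.normal_imaginary by (simp add: \<alpha>_def dird_normal_heis[OF hol] heis_0)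
qed

lemma second_deriv_null_at:
  assumes "qrho \<epsilon> n0 q q = 0" "v $ n0 = 0" "L v v = 0" "\<alpha> q \<noteq> 0"
  shows "B (D (lift q v) e q) (D nn e q) = 0"
proof -
  interpret T: few_positive_kernel n0 \<epsilon> l m h "\<lambda>a x. e a (heis \<epsilon> n0 q x)" by (rule translate[OF assms(1)])
  have N: "D nn (\<lambda>a x. e a (heis \<epsilon> n0 q x)) 0 = D nn e q"
    by (rule ext) (simp add: dird_normal_heis[OF hol] heis_0)
  have V: "D v (\<lambda>a x. e a (heis \<epsilon> n0 q x)) 0 = D (lift q v) e q"
    by (rule ext) (simp add: dird_heis[OF hol] heis_0 lift_def)
  show ?thesis using T.second_deriv_null[OF assms(2,3)] assms(4)
    unfolding N V heis_0 \<alpha>_def by blast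
qed

text \<open>For isotropic v the whole complex line through q in direction \<open>lift q v\<close>
  lies in the quadric, and the lift of v is constant along it; what holds at q therefore holds at
  each of its points with the same direction.\<close>

lemma null_curve:
  assumes "qrho \<epsilon> n0 q q = 0" "v $ n0 = 0" "L v v = 0"
  shows "qrho \<epsilon> n0 (q + c *s lift q v) (q + c *s lift q v) = 0"
    and "lift (q + c *s lift q v) v = lift q v"
proof -
  have "qrho \<epsilon> n0 (heis \<epsilon> n0 q (c *s v)) (heis \<epsilon> n0 q (c *s v)) = 0"
    unfolding qrho_heis[OF assms(1)] using assms(2,3) by (simp add: qrho_def lev_scale_left lev_scale_right)
  then show "qrho \<epsilon> n0 (q + c *s lift q v) (q + c *s lift q v) = 0"
    by (simp add: heis_eq_lift lift_scale)
  have "L v (lift q v) = 0" using assms(3) by (simp add: lift_def lev_add_right lev_scale_right lev_axis_right)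
  then show "lift (q + c *s lift q v) v = lift q v"
    by (simp add: lift_def[of "q + _"] lev_add_right lev_scale_right) (simp add: lift_def)
qed

lemma \<alpha>_deriv:
  "((\<lambda>t. \<alpha> (q + of_real t *s v)) has_vector_derivative
     B (D v e (q + of_real t *s v)) (D nn e (q + of_real t *s v)) +
     B (\<lambda>a. e a (q + of_real t *s v)) (D v (\<lambda>a. dird nn (e a)) (q + of_real t *s v))) (at t)"
  unfolding \<alpha>_def by (rule herm_form_line_vector[where \<omega>=e and \<omega>'="\<lambda>a. dird nn (e a)", OF hol hol1])

text \<open>By \<open>second_deriv_null_at\<close> the other half of the derivative of \<alpha>
  along the null line is 0. As \<alpha> is imaginary on the quadric, the half considered here is
  imaginary. It is antilinear in v, and \<open>\<i> *s v\<close> is isotropic too, so it is also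
  real.\<close>

lemma \<alpha>_deriv_null:
  assumes q: "qrho \<epsilon> n0 q q = 0" and v: "v $ n0 = 0" "L v v = 0" and \<alpha>0: "\<alpha> q \<noteq> 0"
  shows "B (\<lambda>a. e a q) (D (lift q v) (\<lambda>a. dird nn (e a)) q) = 0"
proof -
  define C where "C w = B (\<lambda>a. e a q) (D (lift q w) (\<lambda>a. dird nn (e a)) q)" for w
  have *: "cnj (C w) = - C w" if w: "w $ n0 = 0" "L w w = 0" for w
  proof -
    have "((\<lambda>t. \<alpha> (q + of_real t *s lift q w)) has_vector_derivative C w) (at 0)"
      using \<alpha>_deriv[of q "lift q w" 0] second_deriv_null_at[OF q w \<alpha>0] by (simp add: C_def)
    then have a: "((\<lambda>t. cnj (\<alpha> (q + of_real t *s lift q w))) has_vector_derivative cnj (C w)) (at 0)"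
      and b: "((\<lambda>t. - \<alpha> (q + of_real t *s lift q w)) has_vector_derivative - C w) (at 0)"
      by (rule has_vector_derivative_cnj, rule has_vector_derivative_minus)
    have eq: "(\<lambda>t. cnj (\<alpha> (q + of_real t *s lift q w))) = (\<lambda>t. - \<alpha> (q + of_real t *s lift q w))"
      by (rule ext) (rule normal_imaginary_at[OF null_curve(1)[OF q w]])
    show ?thesis by (rule vector_derivative_unique_at[OF a[unfolded eq] b])
  qed
  have "C (\<i> *s v) = - \<i> * C v"
    unfolding C_def lift_scale holo_dird_scale[OF hol1 UNIV_I] herm_form_scale_right by simp
  moreover have "cnj (C (\<i> *s v)) = - C (\<i> *s v)"
    by (rule *) (use v in \<open>simp_all add: lev_scale_left lev_scale_right\<close>)
  ultimately have "cnj (C v) = C v" by simp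
  with *[OF v] show ?thesis unfolding C_def by simp
qed

text \<open>Wherever \<alpha> is nonzero its derivative along the null line is 0. Hence f f' = 0
  everywhere and f^2 is constant, with no need to look at the boundary of the zero set.\<close>

lemma \<alpha>_null_line:
  assumes q: "qrho \<epsilon> n0 q q = 0" and v: "v $ n0 = 0" "L v v = 0"
  shows "\<alpha> (heis \<epsilon> n0 q v) = 0 \<longleftrightarrow> \<alpha> q = 0"
proof -
  define f where "f t = \<alpha> (q + of_real t *s lift q v)" for t :: real
  define f' where "f' t = B (D (lift q v) e (q + of_real t *s lift q v)) (D nn e (q + of_real t *s lift q v)) +
     B (\<lambda>a. e a (q + of_real t *s lift q v)) (D (lift q v) (\<lambda>a. dird nn (e a)) (q + of_real t *s lift q v))" for t :: real
  have d: "(f has_vector_derivative f' t) (at t)" for t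
    using \<alpha>_deriv[of q "lift q v" t] unfolding f_def[abs_def] f'_def .
  have z: "f t * f' t = 0" for t
  proof (cases "f t = 0")
    case False
    note q' = null_curve[OF q v, of "of_real t"]
    have "f' t = 0" unfolding f'_def
      using second_deriv_null_at[OF q'(1) v] \<alpha>_deriv_null[OF q'(1) v] False unfolding q'(2) f_def by simp
    then show ?thesis by simp
  qed simp
  have "((\<lambda>t. f t * f t) has_vector_derivative 0) (at t)" for t
  proof -
    have "f t * f' t + f' t * f t = 0" using z[of t] by auto
    with has_vector_derivative_mult[OF d[of t] d[of t]] show ?thesis by simp
  qed
  then have d0: "\<And>t. t \<in> UNIV \<Longrightarrow> ((\<lambda>t. f t * f t) has_derivative (\<lambda>h. 0)) (at t within UNIV)"
    by (simp add: has_vector_derivative_def)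
  obtain c where c: "\<forall>t\<in>UNIV. f t * f t = c"
    using has_derivative_zero_constant[OF convex_UNIV d0] by blast
  then have "f 1 * f 1 = f 0 * f 0" by simp
  then show ?thesis by (auto simp: f_def heis_eq_lift)
qed

section \<open>Null lines connect the points of the quadric\<close>

lemma opposite_sign: "j \<noteq> n0 \<Longrightarrow> \<exists>k. k \<noteq> n0 \<and> \<epsilon> k = - \<epsilon> j"
proof -
  assume "j \<noteq> n0"
  then have "- \<epsilon> j = 1 \<or> - \<epsilon> j = -1" using eps[of j] by auto
  from sign_family[OF this] obtain f where "\<forall>i<l. f i \<noteq> n0 \<and> \<epsilon> (f i) = - \<epsilon> j" by blast
  then show ?thesis using lpos by blast
qed

lemma heis_on_quadric: "qrho \<epsilon> n0 q q = 0 \<Longrightarrow> v $ n0 = 0 \<Longrightarrow> L v v = 0 \<Longrightarrow> qrho \<epsilon> n0 (heis \<epsilon> n0 q v) (heis \<epsilon> n0 q v) = 0"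
  by (simp only: qrho_heis) (simp add: qrho_def)

lemma heis_nth: "i \<noteq> n0 \<Longrightarrow> heis \<epsilon> n0 q v $ i = q $ i + v $ i"
  by (simp add: heis_def axis_nth_if)

text \<open>These isotropic vectors exist because both signs of the Levi form occur.\<close>

lemma pair_null:
  assumes "j \<noteq> n0" "k \<noteq> n0" "\<epsilon> k = - \<epsilon> j"
  shows "(c *s (axis j 1 + axis k 1)) $ n0 = 0" "L (c *s (axis j 1 + axis k 1)) (c *s (axis j 1 + axis k 1)) = 0"
    "(c *s (axis j 1 - axis k 1)) $ n0 = 0" "L (c *s (axis j 1 - axis k 1)) (c *s (axis j 1 - axis k 1)) = 0"
proof -
  have jk: "j \<noteq> k" using assms eps[OF assms(1)] by auto
  have m: "axis j 1 - axis k 1 = axis j 1 + (-1) *s axis k (1::complex)" by (simp add: vec_eq_iff)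
  show "(c *s (axis j 1 + axis k 1)) $ n0 = 0" "(c *s (axis j 1 - axis k 1)) $ n0 = 0"
    using assms by (auto simp: axis_nth_if)
  show "L (c *s (axis j 1 + axis k 1)) (c *s (axis j 1 + axis k 1)) = 0"
    "L (c *s (axis j 1 - axis k 1)) (c *s (axis j 1 - axis k 1)) = 0"
    unfolding m lev_scale_left lev_scale_right lev_add_left lev_add_right lev_axis_left
    using assms jk by (auto simp: axis_nth_if)
qed

text \<open>A step of length c along coordinate j is the sum of two isotropic steps c/2 (e_j + e_k)
  and c/2 (e_j - e_k), where k has the opposite sign. The normal coordinate follows as the
  translations dictate.\<close>

lemma move_coordinate:
  assumes q: "qrho \<epsilon> n0 q q = 0" and j: "j \<noteq> n0"
  shows "\<exists>q'. qrho \<epsilon> n0 q' q' = 0 \<and> (\<alpha> q' = 0 \<longleftrightarrow> \<alpha> q = 0) \<and> (\<forall>i. i \<noteq> n0 \<longrightarrow> q' $ i = q $ i + (if i = j then c else 0))"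
proof -
  obtain k where k: "k \<noteq> n0" "\<epsilon> k = - \<epsilon> j" using opposite_sign[OF j] by blast
  let ?v = "(c/2) *s (axis j 1 + axis k 1)" and ?w = "(c/2) *s (axis j 1 - axis k (1::complex))"
  note n = pair_null[OF j k, of "c/2"]
  define q1 where "q1 = heis \<epsilon> n0 q ?v"
  define q2 where "q2 = heis \<epsilon> n0 q1 ?w"
  have 1: "qrho \<epsilon> n0 q1 q1 = 0" unfolding q1_def by (rule heis_on_quadric[OF q n(1,2)])
  have 2: "qrho \<epsilon> n0 q2 q2 = 0" unfolding q2_def by (rule heis_on_quadric[OF 1 n(3,4)])
  have "\<alpha> q2 = 0 \<longleftrightarrow> \<alpha> q = 0"
    unfolding q2_def \<alpha>_null_line[OF 1 n(3,4)] unfolding q1_def \<alpha>_null_line[OF q n(1,2)] ..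
  moreover have "q2 $ i = q $ i + (if i = j then c else 0)" if "i \<noteq> n0" for i
    using that by (simp add: q2_def q1_def heis_nth axis_nth_if)
  ultimately show ?thesis using 2 by blast
qed

text \<open>The tangential coordinates are cleared one by one; a point of the quadric without
  tangential part has real normal coordinate.\<close>

lemma move_to_axis:
  assumes q: "qrho \<epsilon> n0 q q = 0"
  shows "\<exists>u. \<alpha> (axis n0 (of_real u)) = 0 \<longleftrightarrow> \<alpha> q = 0"
proof -
  have "\<exists>q'. qrho \<epsilon> n0 q' q' = 0 \<and> (\<alpha> q' = 0 \<longleftrightarrow> \<alpha> q = 0) \<and> (\<forall>i\<in>J. q' $ i = 0)" if "finite J" "n0 \<notin> J" for J
    using that
  proof (induction J rule: finite_induct)
    case empty
    then show ?case using q by blast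
  next
    case (insert j J)
    then obtain q' where q': "qrho \<epsilon> n0 q' q' = 0" "\<alpha> q' = 0 \<longleftrightarrow> \<alpha> q = 0" "\<forall>i\<in>J. q' $ i = 0" by auto
    have j: "j \<noteq> n0" using insert.prems by auto
    obtain q'' where q'': "qrho \<epsilon> n0 q'' q'' = 0" "\<alpha> q'' = 0 \<longleftrightarrow> \<alpha> q' = 0" "\<forall>i. i \<noteq> n0 \<longrightarrow> q'' $ i = q' $ i + (if i = j then - q' $ j else 0)"
      using move_coordinate[OF q'(1) j] by blast
    have "\<forall>i\<in>insert j J. q'' $ i = 0"
    proof
      fix i assume i: "i \<in> insert j J"
      then have "i \<noteq> n0" using insert.prems by auto
      then show "q'' $ i = 0" using q''(3) q'(3) i by auto
    qed
    then show ?case using q''(1,2) q'(2) by blast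
  qed
  from this[of "UNIV - {n0}"] obtain q' where q': "qrho \<epsilon> n0 q' q' = 0" "\<alpha> q' = 0 \<longleftrightarrow> \<alpha> q = 0" "\<And>i. i \<noteq> n0 \<Longrightarrow> q' $ i = 0"
    by auto
  have "L q' q' = 0" unfolding lev_def by (rule sum.neutral) (use q'(3) in auto)
  then have "cnj (q' $ n0) = q' $ n0" using q'(1) by (simp add: qrho_def)
  then have "q' $ n0 = of_real (Re (q' $ n0))" by (simp add: complex_eq_iff)
  then have "axis n0 (of_real (Re (q' $ n0))) = q'" using q'(3) by (auto simp: vec_eq_iff axis_nth_if)
  then show ?thesis using q'(2) by (intro exI[of _ "Re (q' $ n0)"]) simp
qed

text \<open>Heisenberg translations do not commute: the commutator of two isotropic ones whose
  mutual Levi product is not real is a shift along the real normal axis.\<close>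

lemma \<alpha>_axis:
  assumes "\<alpha> 0 = 0"
  shows "\<alpha> (axis n0 (of_real u)) = 0"
proof -
  have "{j. j \<noteq> n0 \<and> \<epsilon> j = 1} \<noteq> {}"
  proof
    assume "{j. j \<noteq> n0 \<and> \<epsilon> j = 1} = {}"
    then have "card {j. j \<noteq> n0 \<and> \<epsilon> j = 1} = 0" by (simp only: card.empty)
    then show False using card_pos lpos by linarith
  qed
  then obtain j where j: "j \<noteq> n0" "\<epsilon> j = 1" by blast
  obtain k where k: "k \<noteq> n0" "\<epsilon> k = - \<epsilon> j" using opposite_sign[OF j(1)] by blast
  have jk: "j \<noteq> k" using j k by auto
  \<comment> \<open>The commutator of v and v' shifts the normal coordinate by 4\<i> (c - cnj c) = -
    8 Im c, which is to be u.\<close>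
  define c where "c = - \<i> * of_real u / 8"
  define v where "v = axis j 1 + axis k (1::complex)"
  define v' where "v' = c *s (axis j 1 - axis k (1::complex))"
  have v: "v $ n0 = 0" "L v v = 0" using pair_null(1,2)[OF j(1) k, of 1] by (simp_all add: v_def)
  have v': "v' $ n0 = 0" "L v' v' = 0" using pair_null(3,4)[OF j(1) k, of c] by (simp_all add: v'_def)
  have mv: "(- v) $ n0 = 0" "L (- v) (- v) = 0" "(- v') $ n0 = 0" "L (- v') (- v') = 0"
    unfolding vector_sneg_minus1[of v] vector_sneg_minus1[of v'] lev_scale_left lev_scale_right
    using v v' by simp_all
  have vv: "L v' v = 2 * c" "L v v' = 2 * cnj c"
  proof -
    have m: "axis j 1 - axis k 1 = axis j 1 + (-1) *s axis k (1::complex)" by (simp add: vec_eq_iff)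
    show 1: "L v' v = 2 * c" unfolding v'_def v_def m lev_scale_left lev_scale_right lev_add_left lev_add_right lev_axis_left
      using j k jk by (auto simp: axis_nth_if)
    show "L v v' = 2 * cnj c" using lev_cnj[of \<epsilon> n0 v' v] 1 by simp
  qed
  define q1 where "q1 = heis \<epsilon> n0 0 v"
  define q2 where "q2 = heis \<epsilon> n0 q1 v'"
  define q3 where "q3 = heis \<epsilon> n0 q2 (- v)"
  define q4 where "q4 = heis \<epsilon> n0 q3 (- v')"
  have 0: "qrho \<epsilon> n0 0 0 = 0" by (simp add: qrho_def)
  have 1: "qrho \<epsilon> n0 q1 q1 = 0" unfolding q1_def by (rule heis_on_quadric[OF 0 v])
  have 2: "qrho \<epsilon> n0 q2 q2 = 0" unfolding q2_def by (rule heis_on_quadric[OF 1 v'])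
  have 3: "qrho \<epsilon> n0 q3 q3 = 0" unfolding q3_def by (rule heis_on_quadric[OF 2 mv(1,2)])
  have "\<alpha> q4 = 0"
    unfolding q4_def \<alpha>_null_line[OF 3 mv(3,4)] unfolding q3_def \<alpha>_null_line[OF 2 mv(1,2)]
    unfolding q2_def \<alpha>_null_line[OF 1 v'] unfolding q1_def \<alpha>_null_line[OF 0 v] by (rule assms)
  moreover have "q4 = axis n0 (of_real u)"
  proof -
    have q1: "q1 = v" by (simp add: q1_def heis_def)
    have q2: "q2 = v + v' + (2 * \<i> * (2 * c)) *s nn" by (simp add: q2_def heis_def q1 vv)
    have "L (- v) q2 = - (2 * cnj c)"
      using lev_scale_left[of \<epsilon> n0 "-1" v q2] unfolding q2
      by (simp add: vector_sneg_minus1[symmetric] lev_add_right lev_scale_right lev_axis_right v vv)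
    then have q3: "q3 = v' + (2 * \<i> * (2 * c) - 2 * \<i> * (2 * cnj c)) *s nn"
      by (simp add: q3_def heis_def q2 vec_eq_iff algebra_simps)
    have "L (- v') q3 = 0"
      unfolding vector_sneg_minus1[of v'] lev_scale_left q3 lev_add_right lev_scale_right lev_axis_right
      by (simp add: v')
    then have "q4 = (2 * \<i> * (2 * c) - 2 * \<i> * (2 * cnj c)) *s nn"
      by (simp add: q4_def heis_def q3)
    moreover have "2 * \<i> * (2 * c) - 2 * \<i> * (2 * cnj c) = of_real u"
      by (simp add: c_def complex_eq_iff)
    ultimately show ?thesis by (simp add: vec_eq_iff axis_nth_if)
  qed
  ultimately show ?thesis by simp
qed

lemma \<alpha>_zero: "\<alpha> 0 = 0 \<Longrightarrow> qrho \<epsilon> n0 q q = 0 \<Longrightarrow> \<alpha> q = 0"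
  using move_to_axis[of q] \<alpha>_axis by blast

text \<open>The induction runs over all points of the quadric at once, because
  \<open>normal_deriv_step\<close> requires the preceding order on the whole quadric and not just at
  its base point.\<close>

lemma normal_derivs_zero:
  assumes \<alpha>0: "\<alpha> 0 = 0" and "qrho \<epsilon> n0 q q = 0"
  shows "B (\<lambda>a. e a q) (\<lambda>a. nd j a q) = 0"
  using assms(2)
proof (induction j arbitrary: q)
  case 0
  then show ?case by (simp add: vanish)
next
  case (Suc j)
  show ?case
  proof (cases "j = 0")
    case True
    then show ?thesis using \<alpha>_zero[OF \<alpha>0 Suc.prems] by (simp add: \<alpha>_def nd_Suc)
  next
    case False
    interpret T: few_positive_kernel n0 \<epsilon> l m h "\<lambda>a x. e a (heis \<epsilon> n0 q x)" by (rule translate[OF Suc.prems])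
    have nd: "T.nd i a = (\<lambda>x. nd i a (heis \<epsilon> n0 q x))" for i a
    proof (induction i)
      case (Suc i)
      show ?case unfolding T.nd_Suc Suc by (rule ext) (simp add: dird_normal_heis[OF nd_holo] nd_Suc)
    qed simp
    have "B (\<lambda>a. e a (heis \<epsilon> n0 q 0)) (\<lambda>a. T.nd (Suc j) a 0) = 0"
    proof (rule T.normal_deriv_step)
      show "0 < j" using False by simp
      show "B (\<lambda>a. e a (heis \<epsilon> n0 q x)) (\<lambda>a. T.nd j a x) = 0" if "qrho \<epsilon> n0 x x = 0" for x
        unfolding nd by (rule Suc.IH) (simp add: qrho_heis[OF Suc.prems] that)
      show "B (\<lambda>a. e a (heis \<epsilon> n0 q 0)) (D nn (\<lambda>a x. e a (heis \<epsilon> n0 q x)) 0) = 0"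
        using \<alpha>_zero[OF \<alpha>0 Suc.prems] by (simp add: dird_normal_heis[OF hol] heis_0 \<alpha>_def)
    qed
    then show ?thesis unfolding nd heis_0 .
  qed
qed

text \<open>Shifting y along the normal axis gives y0 with \<open>qrho x y0 = 0\<close>. There the
  polarised normal derivatives are all the Taylor coefficients of an entire function, the kernel on
  the normal line through y; they vanish, so it does.\<close>

theorem kernel_zero:
  assumes \<alpha>0: "\<alpha> 0 = 0"
  shows "B (\<lambda>a. e a x) (\<lambda>a. e a y) = 0"
proof -
  define d where "d = cnj (2 * \<i> * qrho \<epsilon> n0 x y)"
  define y0 where "y0 = y + axis n0 d"
  have y0: "qrho \<epsilon> n0 x y0 = 0"
    by (simp add: y0_def d_def qrho_def lev_add_right lev_axis_right axis_nth_same field_simps)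
  have z: "B (\<lambda>a. e a x) (\<lambda>a. nd j a y0) = 0" for j
    by (rule herm_form_polarize[OF hol nd_holo normal_derivs_zero[OF \<alpha>0] y0])
  define g where "g s = B (\<lambda>a. e a x) (\<lambda>a. e a (y0 + cnj s *s nn))" for s
  have dg: "(deriv ^^ j) g = (\<lambda>s. B (\<lambda>a. e a x) (\<lambda>a. nd j a (y0 + cnj s *s nn)))" for j
  proof (induction j)
    case 0
    then show ?case by (simp add: g_def fun_eq_iff)
  next
    case (Suc j)
    have "deriv (\<lambda>s. B (\<lambda>a. e a x) (\<lambda>a. nd j a (y0 + cnj s *s nn))) s = B (\<lambda>a. e a x) (\<lambda>a. nd (Suc j) a (y0 + cnj s *s nn))" for s
      unfolding nd_Suc by (rule DERIV_imp_deriv) (rule herm_form_deriv_right[OF nd_holo])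
    then show ?case by (simp add: Suc fun_eq_iff)
  qed
  have gh: "g holomorphic_on UNIV"
    unfolding g_def by (rule holomorphic_onI, rule field_differentiable_at_within)
      (unfold field_differentiable_def, intro exI, rule herm_form_deriv_right[OF hol])
  have "g (- cnj d) = 0"
    by (rule holomorphic_fun_eq_0_on_connected[OF gh open_UNIV connected_UNIV, of 0]) (simp_all add: dg z)
  moreover have "y0 + cnj (- cnj d) *s nn = y" by (simp add: y0_def vec_eq_iff axis_nth_if)
  ultimately show ?thesis by (simp add: g_def)
qed

end

section \<open>Asymptotic expansions\<close>

text \<open>f t x = \<Sum>i\<le>k. a i x t^i + O(t^(k+1)) as t tends to 0 from the right, uniformly
  in x in S and with bounded coefficients. Peeling off the constant term makes products and
  uniqueness inductions on k; \<open>asymI\<close> and \<open>asym_remainder\<close> relate it to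
  the explicit form.\<close>

primrec asym :: "nat \<Rightarrow> 'p set \<Rightarrow> (real \<Rightarrow> 'p \<Rightarrow> complex) \<Rightarrow> (nat \<Rightarrow> 'p \<Rightarrow> complex) \<Rightarrow> bool" where
  "asym 0 S f a \<longleftrightarrow> (\<exists>M. \<forall>x\<in>S. cmod (a 0 x) \<le> M) \<and>
     (\<exists>C. \<forall>\<^sub>F t in at_right 0. \<forall>x\<in>S. cmod (f t x - a 0 x) \<le> C * t)"
| "asym (Suc k) S f a \<longleftrightarrow> (\<exists>M. \<forall>x\<in>S. cmod (a 0 x) \<le> M) \<and>
     asym k S (\<lambda>t x. (f t x - a 0 x) / of_real t) (\<lambda>i. a (Suc i))"

lemma norm_mult_bound:
  fixes a b :: complex
  assumes "cmod a \<le> M" "cmod b \<le> N"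
  shows "cmod (a * b) \<le> \<bar>M\<bar> * \<bar>N\<bar>"
proof -
  have "cmod a \<le> \<bar>M\<bar>" "cmod b \<le> \<bar>N\<bar>" using assms by linarith+
  then show ?thesis unfolding norm_mult by (intro mult_mono) auto
qed

lemma eventually_pos: "\<forall>\<^sub>F t in at_right (0::real). 0 < t"
  by (rule eventually_at_right_less)

lemma asym_cong:
  assumes "\<forall>\<^sub>F t in at_right 0. \<forall>x\<in>S. f t x = g t x"
  shows "asym k S f a \<Longrightarrow> asym k S g a"
  using assms
proof (induction k arbitrary: f g a)
  case 0
  then obtain M C where "\<forall>x\<in>S. cmod (a 0 x) \<le> M" and C: "\<forall>\<^sub>F t in at_right 0. \<forall>x\<in>S. cmod (f t x - a 0 x) \<le> C * t"
    by auto
  moreover from C 0(2) have "\<forall>\<^sub>F t in at_right 0. \<forall>x\<in>S. cmod (g t x - a 0 x) \<le> C * t"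
    by eventually_elim simp
  ultimately show ?case by auto
next
  case (Suc k)
  have "\<forall>\<^sub>F t in at_right 0. \<forall>x\<in>S. (f t x - a 0 x) / of_real t = (g t x - a 0 x) / of_real t"
    using Suc.prems(2) by eventually_elim simp
  with Suc show ?case by auto
qed

lemma asym_pred: "asym (Suc k) S f a \<Longrightarrow> asym k S f a"
proof (induction k arbitrary: f a)
  case 0
  then obtain M M1 C where M: "\<forall>x\<in>S. cmod (a 0 x) \<le> M" and M1: "\<forall>x\<in>S. cmod (a (Suc 0) x) \<le> M1"
    and C: "\<forall>\<^sub>F t in at_right 0. \<forall>x\<in>S. cmod ((f t x - a 0 x) / of_real t - a (Suc 0) x) \<le> C * t"
    by auto
  have "\<forall>\<^sub>F t in at_right 0. (t::real) < 1" by (rule eventually_at_right_real[of 0 1, THEN eventually_mono]) auto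
  with C eventually_pos have "\<forall>\<^sub>F t in at_right 0. \<forall>x\<in>S. cmod (f t x - a 0 x) \<le> (\<bar>C\<bar> + M1) * t"
  proof eventually_elim
    case (elim t)
    show ?case
    proof
      fix x assume x: "x \<in> S"
      have "cmod ((f t x - a 0 x) / of_real t) \<le> cmod ((f t x - a 0 x) / of_real t - a (Suc 0) x) + cmod (a (Suc 0) x)"
        by (rule norm_triangle_sub[of "(f t x - a 0 x) / of_real t" "a (Suc 0) x", unfolded add.commute[of "cmod (a _ _)"]])
      also have "\<dots> \<le> C * t + M1" using elim(1) M1 x by (intro add_mono) auto
      also have "\<dots> \<le> \<bar>C\<bar> + M1"
      proof -
        have "C * t \<le> \<bar>C\<bar> * t" using elim(2) by (intro mult_right_mono) auto
        also have "\<dots> \<le> \<bar>C\<bar> * 1" using elim(3) by (intro mult_left_mono) auto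
        finally show ?thesis by simp
      qed
      finally have "cmod (f t x - a 0 x) / t \<le> \<bar>C\<bar> + M1" using elim(2) by (simp add: norm_divide)
      then show "cmod (f t x - a 0 x) \<le> (\<bar>C\<bar> + M1) * t" using elim(2) by (simp add: pos_divide_le_eq)
    qed
  qed
  with M show ?case by auto
next
  case (Suc k)
  then show ?case by auto
qed

lemma asym_const: "(\<exists>M. \<forall>x\<in>S. cmod (c x) \<le> M) \<Longrightarrow> asym k S (\<lambda>t x. c x) (\<lambda>i x. if i = 0 then c x else 0)"
proof (induction k arbitrary: c)
  case 0
  then show ?case by (auto intro!: exI[of _ 0])
next
  case (Suc k)
  have "asym k S (\<lambda>t x. 0) (\<lambda>i x. if i = 0 then 0 else (0::complex))" by (rule Suc.IH) auto
  then show ?case using Suc.prems by simp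
qed

lemma asym_zero: "asym k S (\<lambda>t x. 0) (\<lambda>i x. 0)"
proof -
  have "asym k S (\<lambda>t x. 0) (\<lambda>i x. if i = 0 then 0 else (0::complex))" by (rule asym_const) auto
  then show ?thesis by simp
qed

lemma asym_add:
  "asym k S f a \<Longrightarrow> asym k S g b \<Longrightarrow> asym k S (\<lambda>t x. f t x + g t x) (\<lambda>i x. a i x + b i x)"
proof (induction k arbitrary: f g a b)
  case 0
  then obtain M N C D where M: "\<forall>x\<in>S. cmod (a 0 x) \<le> M" and N: "\<forall>x\<in>S. cmod (b 0 x) \<le> N"
    and C: "\<forall>\<^sub>F t in at_right 0. \<forall>x\<in>S. cmod (f t x - a 0 x) \<le> C * t"
    and D: "\<forall>\<^sub>F t in at_right 0. \<forall>x\<in>S. cmod (g t x - b 0 x) \<le> D * t" by auto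
  have "\<forall>x\<in>S. cmod (a 0 x + b 0 x) \<le> M + N" using M N by (auto intro!: norm_triangle_le add_mono)
  moreover from C D have "\<forall>\<^sub>F t in at_right 0. \<forall>x\<in>S. cmod (f t x + g t x - (a 0 x + b 0 x)) \<le> (C + D) * t"
  proof eventually_elim
    case (elim t)
    show ?case
    proof
      fix x assume "x \<in> S"
      with elim have "cmod (f t x - a 0 x) + cmod (g t x - b 0 x) \<le> (C + D) * t" by (auto simp: distrib_right intro: add_mono)
      then show "cmod (f t x + g t x - (a 0 x + b 0 x)) \<le> (C + D) * t"
        unfolding add_diff_add by (rule norm_triangle_le)
    qed
  qed
  ultimately show ?case by auto
next
  case (Suc k)
  obtain M N where "\<forall>x\<in>S. cmod (a 0 x) \<le> M" "\<forall>x\<in>S. cmod (b 0 x) \<le> N" using Suc.prems by auto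
  then have "\<forall>x\<in>S. cmod (a 0 x + b 0 x) \<le> M + N" by (auto intro!: norm_triangle_le add_mono)
  moreover have "asym k S (\<lambda>t x. (f t x - a 0 x) / of_real t + (g t x - b 0 x) / of_real t) (\<lambda>i x. a (Suc i) x + b (Suc i) x)"
    by (rule Suc.IH) (use Suc.prems in auto)
  ultimately show ?case by (auto simp: add_divide_distrib[symmetric] add_diff_add)
qed

lemma asym_cmult:
  assumes c: "\<exists>M. \<forall>x\<in>S. cmod (c x) \<le> M"
  shows "asym k S f a \<Longrightarrow> asym k S (\<lambda>t x. c x * f t x) (\<lambda>i x. c x * a i x)"
proof (induction k arbitrary: f a)
  case 0
  then obtain M C where M: "\<forall>x\<in>S. cmod (a 0 x) \<le> M"
    and C: "\<forall>\<^sub>F t in at_right 0. \<forall>x\<in>S. cmod (f t x - a 0 x) \<le> C * t" by auto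
  obtain N where N: "\<forall>x\<in>S. cmod (c x) \<le> N" using c by blast
  have "\<forall>x\<in>S. cmod (c x * a 0 x) \<le> \<bar>N\<bar> * \<bar>M\<bar>" using M N by (blast intro: norm_mult_bound)
  moreover from C eventually_pos have "\<forall>\<^sub>F t in at_right 0. \<forall>x\<in>S. cmod (c x * f t x - c x * a 0 x) \<le> (\<bar>N\<bar> * \<bar>C\<bar>) * t"
  proof eventually_elim
    case (elim t)
    show ?case
    proof
      fix x assume x: "x \<in> S"
      have "cmod (f t x - a 0 x) \<le> \<bar>C\<bar> * t"
      proof -
        have "cmod (f t x - a 0 x) \<le> C * t" using elim(1) x by blast
        also have "\<dots> \<le> \<bar>C\<bar> * t" using elim(2) by (intro mult_right_mono) auto
        finally show ?thesis .
      qed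
      moreover have "cmod (c x) \<le> \<bar>N\<bar>" using N x by (auto intro: order_trans)
      ultimately have "cmod (c x) * cmod (f t x - a 0 x) \<le> \<bar>N\<bar> * (\<bar>C\<bar> * t)"
        by (intro mult_mono) auto
      then show "cmod (c x * f t x - c x * a 0 x) \<le> (\<bar>N\<bar> * \<bar>C\<bar>) * t"
        by (simp add: right_diff_distrib[symmetric] norm_mult mult.assoc)
    qed
  qed
  ultimately show ?case by auto
next
  case (Suc k)
  obtain M where M: "\<forall>x\<in>S. cmod (a 0 x) \<le> M" using Suc.prems by auto
  obtain N where N: "\<forall>x\<in>S. cmod (c x) \<le> N" using c by blast
  have "\<forall>x\<in>S. cmod (c x * a 0 x) \<le> \<bar>N\<bar> * \<bar>M\<bar>" using M N by (blast intro: norm_mult_bound)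
  moreover have "asym k S (\<lambda>t x. c x * ((f t x - a 0 x) / of_real t)) (\<lambda>i x. c x * a (Suc i) x)"
    by (rule Suc.IH) (use Suc.prems in auto)
  ultimately show ?case by (auto simp: right_diff_distrib)
qed

text \<open>f g - a0 b0 = (f - a0) g + a0 (g - b0). After division by t the induction hypothesis
  covers the first product, with g known to one order less by \<open>asym_pred\<close>, and the
  second has a coefficient independent of t.\<close>

lemma asym_mult:
  "asym k S f a \<Longrightarrow> asym k S g b \<Longrightarrow> asym k S (\<lambda>t x. f t x * g t x) (\<lambda>j x. \<Sum>i\<le>j. a i x * b (j - i) x)"
proof (induction k arbitrary: f g a b)
  case 0
  then obtain M N C D where M: "\<forall>x\<in>S. cmod (a 0 x) \<le> M" and N: "\<forall>x\<in>S. cmod (b 0 x) \<le> N"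
    and C: "\<forall>\<^sub>F t in at_right 0. \<forall>x\<in>S. cmod (f t x - a 0 x) \<le> C * t"
    and D: "\<forall>\<^sub>F t in at_right 0. \<forall>x\<in>S. cmod (g t x - b 0 x) \<le> D * t" by auto
  have "\<forall>x\<in>S. cmod (a 0 x * b 0 x) \<le> \<bar>M\<bar> * \<bar>N\<bar>" using M N by (blast intro: norm_mult_bound)
  moreover have lt1: "\<forall>\<^sub>F t in at_right 0. (t::real) < 1" by (rule eventually_at_right_real[of 0 1, THEN eventually_mono]) auto
  from C D eventually_pos lt1 have "\<forall>\<^sub>F t in at_right 0. \<forall>x\<in>S. cmod (f t x * g t x - a 0 x * b 0 x) \<le> (\<bar>C\<bar> * (\<bar>D\<bar> + \<bar>N\<bar>) + \<bar>M\<bar> * \<bar>D\<bar>) * t"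
  proof eventually_elim
    case (elim t)
    show ?case
    proof
      fix x assume x: "x \<in> S"
      have Ct: "C * t \<le> \<bar>C\<bar> * t" "D * t \<le> \<bar>D\<bar> * t" using elim(3) by (auto intro: mult_right_mono)
      have f: "cmod (f t x - a 0 x) \<le> \<bar>C\<bar> * t" using elim(1) x Ct(1) by (auto intro: order_trans)
      have g: "cmod (g t x - b 0 x) \<le> \<bar>D\<bar> * t" using elim(2) x Ct(2) by (auto intro: order_trans)
      have Dt: "\<bar>D\<bar> * t \<le> \<bar>D\<bar>" using elim(3,4) by (simp add: mult_left_le)
      have "cmod (g t x) \<le> cmod (g t x - b 0 x) + cmod (b 0 x)" using norm_triangle_sub[of "g t x" "b 0 x"] by simp
      also have "\<dots> \<le> \<bar>D\<bar> + \<bar>N\<bar>" using g Dt N x by (intro add_mono) (auto intro: order_trans)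
      finally have g1: "cmod (g t x) \<le> \<bar>D\<bar> + \<bar>N\<bar>" .
      have a: "cmod (a 0 x) \<le> \<bar>M\<bar>" using M x by (auto intro: order_trans)
      have "f t x * g t x - a 0 x * b 0 x = (f t x - a 0 x) * g t x + a 0 x * (g t x - b 0 x)" by (simp add: algebra_simps)
      then have "cmod (f t x * g t x - a 0 x * b 0 x) \<le> cmod (f t x - a 0 x) * cmod (g t x) + cmod (a 0 x) * cmod (g t x - b 0 x)"
        using norm_triangle_ineq[of "(f t x - a 0 x) * g t x" "a 0 x * (g t x - b 0 x)"] by (simp only: norm_mult)
      also have "\<dots> \<le> (\<bar>C\<bar> * t) * (\<bar>D\<bar> + \<bar>N\<bar>) + \<bar>M\<bar> * (\<bar>D\<bar> * t)"
        using f g g1 a elim(3) by (intro add_mono mult_mono) auto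
      finally show "cmod (f t x * g t x - a 0 x * b 0 x) \<le> (\<bar>C\<bar> * (\<bar>D\<bar> + \<bar>N\<bar>) + \<bar>M\<bar> * \<bar>D\<bar>) * t" by (simp add: algebra_simps)
    qed
  qed
  ultimately show ?case by auto
next
  case (Suc k)
  obtain M N where M: "\<forall>x\<in>S. cmod (a 0 x) \<le> M" and N: "\<forall>x\<in>S. cmod (b 0 x) \<le> N" using Suc.prems by auto
  then have bd: "\<forall>x\<in>S. cmod (a 0 x * b 0 x) \<le> \<bar>M\<bar> * \<bar>N\<bar>" by (blast intro: norm_mult_bound)
  have 1: "asym k S (\<lambda>t x. (f t x - a 0 x) / of_real t * g t x) (\<lambda>j x. \<Sum>i\<le>j. a (Suc i) x * b (j - i) x)"
  proof (rule Suc.IH)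
    show "asym k S (\<lambda>t x. (f t x - a 0 x) / of_real t) (\<lambda>i. a (Suc i))" using Suc.prems(1) by simp
  qed (rule asym_pred[OF Suc.prems(2)])
  have 2: "asym k S (\<lambda>t x. a 0 x * ((g t x - b 0 x) / of_real t)) (\<lambda>j x. a 0 x * b (Suc j) x)"
    by (rule asym_cmult) (use M Suc.prems in auto)
  have 3: "asym k S (\<lambda>t x. (f t x * g t x - a 0 x * b 0 x) / of_real t) (\<lambda>j x. (\<Sum>i\<le>j. a (Suc i) x * b (j - i) x) + a 0 x * b (Suc j) x)"
  proof (rule asym_cong[OF _ asym_add[OF 1 2]])
    show "\<forall>\<^sub>F t in at_right 0. \<forall>x\<in>S. (f t x - a 0 x) / of_real t * g t x + a 0 x * ((g t x - b 0 x) / of_real t)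
       = (f t x * g t x - a 0 x * b 0 x) / of_real t"
      using eventually_pos by eventually_elim (simp add: field_simps)
  qed
  have 4: "(\<lambda>j x. (\<Sum>i\<le>j. a (Suc i) x * b (j - i) x) + a 0 x * b (Suc j) x) = (\<lambda>j x. \<Sum>i\<le>Suc j. a i x * b (Suc j - i) x)"
    by (simp only: sum.atMost_Suc_shift) (simp add: add.commute)
  show ?case using 3 bd unfolding 4 by auto
qed

lemma asym_cnj: "asym k S f a \<Longrightarrow> asym k S (\<lambda>t x. cnj (f t x)) (\<lambda>i x. cnj (a i x))"
proof (induction k arbitrary: f a)
  case 0
  then show ?case by (simp flip: complex_cnj_diff)
next
  case (Suc k)
  have "asym k S (\<lambda>t x. cnj ((f t x - a 0 x) / of_real t)) (\<lambda>i x. cnj (a (Suc i) x))"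
    by (rule Suc.IH) (use Suc.prems in auto)
  then show ?case using Suc.prems by simp
qed

lemma asym_sum:
  "(\<And>i. i \<in> I \<Longrightarrow> asym k S (f i) (a i)) \<Longrightarrow> asym k S (\<lambda>t x. \<Sum>i\<in>I. f i t x) (\<lambda>j x. \<Sum>i\<in>I. a i j x)"
proof (induction I rule: infinite_finite_induct)
  case (insert i I)
  then show ?case using asym_add[of k S "f i" "a i" "\<lambda>t x. \<Sum>i\<in>I. f i t x" "\<lambda>j x. \<Sum>i\<in>I. a i j x"] by simp
qed (simp_all add: asym_zero)

lemma asym_map:
  assumes "\<And>y. y \<in> S' \<Longrightarrow> \<pi> y \<in> S"
  shows "asym k S f a \<Longrightarrow> asym k S' (\<lambda>t y. f t (\<pi> y)) (\<lambda>i y. a i (\<pi> y))"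
proof (induction k arbitrary: f a)
  case 0
  then obtain M C where M: "\<forall>x\<in>S. cmod (a 0 x) \<le> M"
    and C: "\<forall>\<^sub>F t in at_right 0. \<forall>x\<in>S. cmod (f t x - a 0 x) \<le> C * t" by auto
  from C have "\<forall>\<^sub>F t in at_right 0. \<forall>y\<in>S'. cmod (f t (\<pi> y) - a 0 (\<pi> y)) \<le> C * t"
    by eventually_elim (use assms in auto)
  with M assms show ?case by auto
next
  case (Suc k)
  have "asym k S' (\<lambda>t y. (\<lambda>t x. (f t x - a 0 x) / of_real t) t (\<pi> y)) (\<lambda>i y. (\<lambda>i. a (Suc i)) i (\<pi> y))"
    by (rule Suc.IH) (use Suc.prems in simp)
  then show ?case using Suc.prems assms by auto
qed

lemma asym_remainder:
  "asym k S f a \<Longrightarrow> \<exists>C. \<forall>\<^sub>F t in at_right 0. \<forall>x\<in>S. cmod (f t x - (\<Sum>i\<le>k. a i x * of_real t ^ i)) \<le> C * t ^ Suc k"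
proof (induction k arbitrary: f a)
  case (Suc k)
  have "asym k S (\<lambda>t x. (f t x - a 0 x) / of_real t) (\<lambda>i. a (Suc i))" using Suc.prems by simp
  from Suc.IH[OF this] obtain C where C: "\<forall>\<^sub>F t in at_right 0. \<forall>x\<in>S. cmod ((f t x - a 0 x) / of_real t - (\<Sum>i\<le>k. a (Suc i) x * of_real t ^ i)) \<le> C * t ^ Suc k"
    by blast
  from C eventually_pos have "\<forall>\<^sub>F t in at_right 0. \<forall>x\<in>S. cmod (f t x - (\<Sum>i\<le>Suc k. a i x * of_real t ^ i)) \<le> C * t ^ Suc (Suc k)"
  proof eventually_elim
    case (elim t)
    show ?case
    proof
      fix x assume x: "x \<in> S"
      have "f t x - (\<Sum>i\<le>Suc k. a i x * of_real t ^ i) = of_real t * ((f t x - a 0 x) / of_real t - (\<Sum>i\<le>k. a (Suc i) x * of_real t ^ i))"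
        proof -
        have "of_real t * ((f t x - a 0 x) / of_real t) = f t x - a 0 x" using elim(2) by simp
        then show ?thesis unfolding right_diff_distrib sum.atMost_Suc_shift by (simp add: sum_distrib_left mult_ac)
      qed
      then have "cmod (f t x - (\<Sum>i\<le>Suc k. a i x * of_real t ^ i)) = t * cmod ((f t x - a 0 x) / of_real t - (\<Sum>i\<le>k. a (Suc i) x * of_real t ^ i))"
        using elim(2) by (simp only: norm_mult) simp
      also have "\<dots> \<le> t * (C * t ^ Suc k)" using elim x by (intro mult_left_mono) auto
      finally show "cmod (f t x - (\<Sum>i\<le>Suc k. a i x * of_real t ^ i)) \<le> C * t ^ Suc (Suc k)" by (simp add: mult_ac)
    qed
  qed
  then show ?case by blast
qed simp

lemma asymI:
  assumes "\<And>i. i \<le> k \<Longrightarrow> \<exists>M. \<forall>x\<in>S. cmod (a i x) \<le> M"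
    "\<forall>\<^sub>F t in at_right 0. \<forall>x\<in>S. cmod (f t x - (\<Sum>i\<le>k. a i x * of_real t ^ i)) \<le> C * t ^ Suc k"
  shows "asym k S f a"
  using assms
proof (induction k arbitrary: f a)
  case 0
  then show ?case by (auto intro!: exI[of _ C])
next
  case (Suc k)
  have "asym k S (\<lambda>t x. (f t x - a 0 x) / of_real t) (\<lambda>i. a (Suc i))"
  proof (rule Suc.IH)
    show "\<exists>M. \<forall>x\<in>S. cmod (a (Suc i) x) \<le> M" if "i \<le> k" for i using Suc.prems(1)[of "Suc i"] that by simp
    from Suc.prems(2) eventually_pos
    show "\<forall>\<^sub>F t in at_right 0. \<forall>x\<in>S. cmod ((f t x - a 0 x) / of_real t - (\<Sum>i\<le>k. a (Suc i) x * of_real t ^ i)) \<le> C * t ^ Suc k"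
    proof eventually_elim
      case (elim t)
      show ?case
      proof
        fix x assume x: "x \<in> S"
        have "f t x - (\<Sum>i\<le>Suc k. a i x * of_real t ^ i) = of_real t * ((f t x - a 0 x) / of_real t - (\<Sum>i\<le>k. a (Suc i) x * of_real t ^ i))"
          proof -
        have "of_real t * ((f t x - a 0 x) / of_real t) = f t x - a 0 x" using elim(2) by simp
        then show ?thesis unfolding right_diff_distrib sum.atMost_Suc_shift by (simp add: sum_distrib_left mult_ac)
      qed
        then have "cmod (f t x - (\<Sum>i\<le>Suc k. a i x * of_real t ^ i)) = t * cmod ((f t x - a 0 x) / of_real t - (\<Sum>i\<le>k. a (Suc i) x * of_real t ^ i))"
          using elim(2) by (simp only: norm_mult) simp
        moreover have "cmod (f t x - (\<Sum>i\<le>Suc k. a i x * of_real t ^ i)) \<le> C * t ^ Suc (Suc k)"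
          using elim(1) x by blast
        ultimately have "t * cmod ((f t x - a 0 x) / of_real t - (\<Sum>i\<le>k. a (Suc i) x * of_real t ^ i)) \<le> t * (C * t ^ Suc k)"
          by (simp add: mult_ac)
        then show "cmod ((f t x - a 0 x) / of_real t - (\<Sum>i\<le>k. a (Suc i) x * of_real t ^ i)) \<le> C * t ^ Suc k"
          by (rule mult_left_le_imp_le[OF _ elim(2)])
      qed
    qed
  qed
  then show ?case using Suc.prems(1)[of 0] by simp
qed

lemma asym_unique:
  "asym k S f a \<Longrightarrow> asym k S f b \<Longrightarrow> i \<le> k \<Longrightarrow> x \<in> S \<Longrightarrow> a i x = b i x"
proof (induction k arbitrary: f a b i x)
  case 0
  then obtain C D where C: "\<forall>\<^sub>F t in at_right 0. \<forall>x\<in>S. cmod (f t x - a 0 x) \<le> C * t"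
    and D: "\<forall>\<^sub>F t in at_right 0. \<forall>x\<in>S. cmod (f t x - b 0 x) \<le> D * t" by auto
  from C D have "\<forall>\<^sub>F t in at_right 0. cmod (a 0 x - b 0 x) \<le> (C + D) * t"
  proof eventually_elim
    case (elim t)
    then have "cmod (f t x - a 0 x) \<le> C * t" "cmod (f t x - b 0 x) \<le> D * t" using \<open>x \<in> S\<close> by auto
    moreover have "cmod (a 0 x - b 0 x) \<le> cmod (f t x - b 0 x) + cmod (f t x - a 0 x)"
      using norm_triangle_ineq4[of "f t x - b 0 x" "f t x - a 0 x"] by simp
    ultimately show ?case by (simp add: distrib_right)
  qed
  moreover have "((\<lambda>t. (C + D) * t) \<longlongrightarrow> (C + D) * 0) (at_right 0)" by (intro tendsto_intros)
  ultimately have "cmod (a 0 x - b 0 x) \<le> (C + D) * 0"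
    by (intro tendsto_lowerbound[of "\<lambda>t. (C + D) * t" _ "at_right 0"]) auto
  then show ?case using 0 by simp
next
  case (Suc k)
  have 0: "a 0 x = b 0 x" if "x \<in> S" for x
    by (rule Suc.IH[OF asym_pred[OF Suc.prems(1)] asym_pred[OF Suc.prems(2)] _ that]) simp
  have 1: "asym k S (\<lambda>t x. (f t x - a 0 x) / of_real t) (\<lambda>i. a (Suc i))" using Suc.prems by simp
  have "asym k S (\<lambda>t x. (f t x - b 0 x) / of_real t) (\<lambda>i. b (Suc i))" using Suc.prems by simp
  then have 2: "asym k S (\<lambda>t x. (f t x - a 0 x) / of_real t) (\<lambda>i. b (Suc i))"
    by (rule asym_cong[rotated]) (simp add: 0)
  show ?case
  proof (cases i)
    case 0
    then show ?thesis using \<open>\<And>x. x \<in> S \<Longrightarrow> a 0 x = b 0 x\<close> Suc.prems by simp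
  next
    case (Suc j)
    then show ?thesis using Suc.IH[OF 1 2, of j] Suc.prems by simp
  qed
qed

lemma asym_leading:
  assumes "asym k S f a" "\<And>i x. i < k \<Longrightarrow> x \<in> S \<Longrightarrow> a i x = 0"
  shows "\<exists>C. \<forall>\<^sub>F t in at_right 0. \<forall>x\<in>S. cmod (f t x / of_real t ^ k - a k x) \<le> C * t"
proof -
  obtain C where C: "\<forall>\<^sub>F t in at_right 0. \<forall>x\<in>S. cmod (f t x - (\<Sum>i\<le>k. a i x * of_real t ^ i)) \<le> C * t ^ Suc k"
    using asym_remainder[OF assms(1)] by blast
  have "\<forall>\<^sub>F t in at_right 0. \<forall>x\<in>S. cmod (f t x / of_real t ^ k - a k x) \<le> C * t"
    using C eventually_pos
  proof eventually_elim
    case (elim t)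
    show ?case
    proof
      fix x assume x: "x \<in> S"
      have "(\<Sum>i\<le>k. a i x * of_real t ^ i) = a k x * of_real t ^ k"
        using assms(2)[OF _ x] by (simp add: lessThan_Suc_atMost[symmetric])
      then have "cmod (f t x - a k x * of_real t ^ k) \<le> C * t ^ Suc k" using elim(1) x by auto
      moreover have "f t x - a k x * of_real t ^ k = of_real t ^ k * (f t x / of_real t ^ k - a k x)"
        using elim(2) by (simp add: field_simps)
      ultimately have "t ^ k * cmod (f t x / of_real t ^ k - a k x) \<le> t ^ k * (C * t)"
        using elim(2) by (simp add: norm_mult norm_power mult_ac)
      then show "cmod (f t x / of_real t ^ k - a k x) \<le> C * t" using elim(2) by simp
    qed
  qed
  then show ?thesis by blast
qed

section \<open>Curved dilations\<close>

text \<open>The quadratic term with matrix \<open>S\<close> is there to absorb the \<open>(2,0)\<close>-part of the Taylor polynomial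
  of a defining function.\<close>

definition par_dil :: "'n::finite \<Rightarrow> complex^'n \<Rightarrow> ('n \<Rightarrow> complex^'n) \<Rightarrow> ('n \<Rightarrow> 'n \<Rightarrow> complex) \<Rightarrow> complex^'n
    \<Rightarrow> complex \<Rightarrow> complex^'n \<Rightarrow> complex^'n" where
  "par_dil n0 p u S \<nu> t x = p + t *s (\<Sum>j\<in>UNIV-{n0}. x $ j *s u j)
     + (t * t * (x $ n0 + (\<Sum>j\<in>UNIV-{n0}. \<Sum>k\<in>UNIV-{n0}. S j k * x $ j * x $ k))) *s \<nu>"

text \<open>t becomes the coordinate \<open>None\<close>, so that joint holomorphy in (t, x) is an
  instance of \<open>holo\<close> and differentiation in t is a directional derivative.\<close>

definition adjoin :: "complex \<Rightarrow> complex^'n::finite \<Rightarrow> complex^('n option)" where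
  "adjoin t x = (\<chi> i. case i of None \<Rightarrow> t | Some j \<Rightarrow> x $ j)"

lemma adjoin_nth [simp]: "adjoin t x $ None = t" "adjoin t x $ Some j = x $ j"
  by (simp_all add: adjoin_def)

lemma adjoin_line: "adjoin s x = adjoin 0 x + s *s axis None 1"
  by (auto simp: vec_eq_iff adjoin_def axis_def split: option.split)

lemma adjoin_holomorphic: "holomorphic_map_on UNIV (adjoin 0)"
proof (rule holomorphic_mapI)
  fix i :: "'a option"
  show "holo UNIV (\<lambda>x. adjoin 0 x $ i)"
    by (cases i) (simp_all add: holo_const holo_nth)
qed

locale dilation =
  fixes n0 :: "'n::finite" and p \<nu> :: "complex^'n" and u :: "'n \<Rightarrow> complex^'n" and S :: "'n \<Rightarrow> 'n \<Rightarrow> complex"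
    and U :: "(complex^'n) set" and F :: "complex^'n \<Rightarrow> complex^'k::finite"
  assumes open_U: "open U" and p_U: "p \<in> U" and F_hol: "holomorphic_map_on U F"
begin

abbreviation "\<Phi> \<equiv> par_dil n0 p u S \<nu>"

definition "\<Theta> y = \<Phi> (y $ None) (\<chi> i. y $ Some i)"

lemma \<Theta>_adjoin: "\<Theta> (adjoin t x) = \<Phi> t x"
  by (simp add: \<Theta>_def)

lemma \<Phi>_0: "\<Phi> 0 x = p"
  by (simp add: par_dil_def)

lemma \<Theta>_hol: "holomorphic_map_on UNIV \<Theta>"
proof (rule holomorphic_mapI)
  fix i
  show "holo UNIV (\<lambda>y. \<Theta> y $ i)"
    unfolding \<Theta>_def par_dil_def
    by (simp add: sum_distrib_left) (intro holo_add holo_mult holo_sum holo_const holo_nth)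
qed

definition "\<Omega> = {y. \<Theta> y \<in> U}"

lemma open_\<Omega>: "open \<Omega>"
proof -
  have "continuous_on UNIV \<Theta>"
    by (intro continuous_at_imp_continuous_on ballI has_derivative_continuous[OF holomorphic_map_deriv(1)[OF \<Theta>_hol]]) auto
  then have "open (\<Theta> -` U)" using open_U by (simp add: continuous_on_open_vimage)
  then show ?thesis unfolding \<Omega>_def vimage_def .
qed

text \<open>At t = 0 the dilation collapses to p, so the whole slice t = 0 lies in the domain. Hence
  the Taylor coefficients in t are entire in x although F is only locally defined.\<close>

lemma adjoin_0_\<Omega>: "adjoin 0 x \<in> \<Omega>"
  by (simp add: \<Omega>_def \<Theta>_adjoin \<Phi>_0 p_U)

definition "tder c i = (dird (axis None 1) ^^ i) (\<lambda>y. F (\<Theta> y) $ c)"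

definition "tcoef c i x = tder c i (adjoin 0 x) / fact i"

lemma tder_hol: "holo \<Omega> (tder c i)"
proof (induction i)
  case 0
  show ?case unfolding tder_def
    by (simp, rule holo_compose(1)[OF holomorphic_map_subset[OF \<Theta>_hol subset_UNIV] holomorphic_map_comp[OF F_hol]])
      (simp add: \<Omega>_def)
next
  case (Suc i)
  then show ?case using holo_dird[OF open_\<Omega>] by (simp add: tder_def)
qed

lemma tcoef_hol: "holo UNIV (tcoef c i)"
proof -
  have "holo UNIV (\<lambda>x. tder c i (adjoin 0 x))"
    by (rule holo_compose(1)[OF adjoin_holomorphic tder_hol adjoin_0_\<Omega>])
  then have "holo UNIV (\<lambda>x. tder c i (adjoin 0 x) * (1 / fact i))" by (rule holo_mult[OF _ holo_const])
  then show ?thesis by (simp add: tcoef_def[abs_def])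
qed

lemma dist_adjoin: "dist (adjoin 0 x) (adjoin t x) = cmod t"
proof -
  have "adjoin 0 x - adjoin t x = axis None (- t)"
    by (auto simp: vec_eq_iff adjoin_def axis_def split: option.split)
  then show ?thesis by (simp add: dist_norm norm_axis)
qed

lemma uniform_domain:
  obtains \<epsilon> where "\<epsilon> > 0" "\<And>t x. cmod t \<le> \<epsilon> \<Longrightarrow> norm x \<le> R \<Longrightarrow> adjoin t x \<in> \<Omega>"
proof -
  have "continuous_on (cball 0 R) (adjoin 0 :: complex^'n \<Rightarrow> _)"
    by (intro continuous_at_imp_continuous_on ballI has_derivative_continuous[OF holomorphic_map_deriv(1)[OF adjoin_holomorphic]]) auto
  then have "compact (adjoin 0 ` cball (0::complex^'n) R)" by (rule compact_continuous_image) simp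
  moreover have "adjoin 0 ` cball (0::complex^'n) R \<subseteq> \<Omega>" using adjoin_0_\<Omega> by auto
  ultimately obtain d where d: "d > 0" "(\<Union>y\<in>adjoin 0 ` cball (0::complex^'n) R. ball y d) \<subseteq> \<Omega>"
    by (rule compact_subset_open_imp_ball_epsilon_subset[OF _ open_\<Omega>])
  show ?thesis
  proof (rule that[of "d/2"])
    fix t :: complex and x :: "complex^'n" assume "cmod t \<le> d/2" "norm x \<le> R"
    then have "adjoin t x \<in> ball (adjoin 0 x) d" using d(1) by (simp add: dist_adjoin)
    moreover have "adjoin 0 x \<in> adjoin 0 ` cball 0 R" using \<open>norm x \<le> R\<close> by (intro imageI) simp
    ultimately show "adjoin t x \<in> \<Omega>" using d(2) by blast
  qed (use d in simp)
qed

lemma continuous_on_adjoin: "continuous_on A (\<lambda>p. adjoin (fst p) (snd p :: complex^'n))"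
proof -
  have 0: "continuous_on UNIV (adjoin 0 :: complex^'n \<Rightarrow> _)"
    by (intro continuous_at_imp_continuous_on ballI has_derivative_continuous[OF holomorphic_map_deriv(1)[OF adjoin_holomorphic]]) auto
  have 1: "continuous_on A (\<lambda>p. adjoin 0 (snd p :: complex^'n))"
    by (rule continuous_on_compose2[OF 0 continuous_on_snd[OF continuous_on_id]]) auto
  have 2: "continuous_on A (\<lambda>p :: complex \<times> (complex^'n). fst p *s axis None 1 :: complex^('n option))"
    by (rule continuous_on_vscale[OF continuous_on_fst[OF continuous_on_id]])
  show ?thesis using continuous_on_add[OF 1 2] by (simp only: adjoin_line[symmetric])
qed

lemma eventually_in_U: "\<forall>\<^sub>F t in at_right 0. \<forall>x\<in>cball 0 R. \<Phi> (of_real t) x \<in> U"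
proof -
  obtain \<epsilon> where e: "\<epsilon> > 0" "\<And>t x. cmod t \<le> \<epsilon> \<Longrightarrow> norm x \<le> R \<Longrightarrow> adjoin t x \<in> \<Omega>" using uniform_domain[of R] by blast
  have "\<forall>\<^sub>F t in at_right 0. t \<in> {0<..<\<epsilon>}" by (rule eventually_at_right_real[OF e(1)])
  then show ?thesis
  proof eventually_elim
    case (elim t)
    show ?case
    proof
      fix x :: "complex^'n" assume "x \<in> cball 0 R"
      then have "adjoin (of_real t) x \<in> \<Omega>" using elim by (intro e(2)) auto
      then show "\<Phi> (of_real t) x \<in> U" by (simp add: \<Omega>_def \<Theta>_adjoin)
    qed
  qed
qed

lemma tder_line:
  assumes "adjoin t x \<in> \<Omega>"
  shows "((\<lambda>t. tder c i (adjoin t x)) has_field_derivative tder c (Suc i) (adjoin t x)) (at t)"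
  using holo_line[OF tder_hol, of "adjoin 0 x" t "axis None 1" c i] assms
  by (simp add: adjoin_line[symmetric] tder_def)

text \<open>The remainder is uniform in x because the derivative of order k + 1 in t is bounded on a
  compact set of pairs (t, x).\<close>

lemma taylor: "asym k (cball 0 R) (\<lambda>t x. F (\<Phi> (of_real t) x) $ c) (tcoef c)"
proof -
  obtain \<epsilon> where e: "\<epsilon> > 0" "\<And>t x. cmod t \<le> \<epsilon> \<Longrightarrow> norm x \<le> R \<Longrightarrow> adjoin t x \<in> \<Omega>" using uniform_domain[of R] by blast
  let ?K = "(\<lambda>p. adjoin (fst p) (snd p)) ` (cball (0::complex) \<epsilon> \<times> cball (0::complex^'n) R)"
  have "compact ?K"
    by (intro compact_continuous_image continuous_on_adjoin compact_Times compact_cball)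
  moreover have "continuous_on ?K (tder c (Suc k))"
    by (rule continuous_on_subset[OF holo_continuous_on[OF tder_hol]]) (use e(2) in auto)
  ultimately have "bounded (tder c (Suc k) ` ?K)" using compact_continuous_image compact_imp_bounded by blast
  then obtain B where B: "\<And>y. y \<in> ?K \<Longrightarrow> cmod (tder c (Suc k) y) \<le> B" unfolding bounded_iff by blast
  have "\<forall>\<^sub>F t in at_right 0. t \<in> {0<..<\<epsilon>}" by (rule eventually_at_right_real[OF e(1)])
  then have *: "\<forall>\<^sub>F t in at_right 0. \<forall>x\<in>cball 0 R. cmod (F (\<Phi> (of_real t) x) $ c - (\<Sum>i\<le>k. tcoef c i x * of_real t ^ i)) \<le> (B / fact k) * t ^ Suc k"
  proof eventually_elim
    case (elim t)
    show ?case
    proof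
      fix x :: "complex^'n" assume x: "x \<in> cball 0 R"
      have "cmod (tder c 0 (adjoin (of_real t) x) - (\<Sum>i\<le>k. tder c i (adjoin 0 x) * (of_real t - 0) ^ i / fact i)) \<le> B * cmod (of_real t - 0) ^ Suc k / fact k"
      proof (rule complex_Taylor[where S="cball 0 \<epsilon>" and f="\<lambda>i t. tder c i (adjoin t x)"])
        show "((\<lambda>t. tder c i (adjoin t x)) has_field_derivative tder c (Suc i) (adjoin s x)) (at s within cball 0 \<epsilon>)"
          if "s \<in> cball 0 \<epsilon>" for i s
          by (rule has_field_derivative_at_within[OF tder_line]) (use that x e(2) in auto)
        show "cmod (tder c (Suc k) (adjoin s x)) \<le> B" if "s \<in> cball 0 \<epsilon>" for s
          by (rule B) (use that x in force)
      qed (use elim e(1) in auto)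
      then show "cmod (F (\<Phi> (of_real t) x) $ c - (\<Sum>i\<le>k. tcoef c i x * of_real t ^ i)) \<le> (B / fact k) * t ^ Suc k"
        using elim by (simp add: tder_def \<Theta>_adjoin tcoef_def)
    qed
  qed
  show ?thesis
  proof (rule asymI[OF _ *])
    fix i
    have "continuous_on (cball 0 R) (tcoef c i)"
      by (rule continuous_on_subset[OF holo_continuous_on[OF tcoef_hol]]) simp
    then have "bounded (tcoef c i ` cball 0 R)" using compact_continuous_image compact_imp_bounded compact_cball by blast
    then show "\<exists>M. \<forall>x\<in>cball 0 R. cmod (tcoef c i x) \<le> M" unfolding bounded_iff by blast
  qed
qed

lemma tcoef_0: "tcoef c 0 x = F p $ c"
  by (simp add: tcoef_def tder_def \<Theta>_adjoin \<Phi>_0)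

lemma dird_\<Theta>: "dird (axis None 1) \<Theta> (adjoin 0 x) = (\<Sum>j\<in>UNIV-{n0}. x $ j *s u j)"
proof -
  let ?a = "\<Sum>j\<in>UNIV-{n0}. x $ j *s u j" and ?b = "x $ n0 + (\<Sum>j\<in>UNIV-{n0}. \<Sum>k\<in>UNIV-{n0}. S j k * x $ j * x $ k)"
  have "dird (axis None 1) (\<lambda>y. \<Theta> y $ i) (adjoin 0 x) = ?a $ i" for i
  proof -
    have "((\<lambda>t. \<Theta> (adjoin 0 x + t *s axis None 1) $ i) has_field_derivative dird (axis None 1) (\<lambda>y. \<Theta> y $ i) (adjoin 0 x + 0 *s axis None 1)) (at 0)"
      by (rule holo_line[OF holomorphic_map_comp[OF \<Theta>_hol]]) simp
    then have "((\<lambda>t. p $ i + t * ?a $ i + t * t * ?b * \<nu> $ i) has_field_derivative dird (axis None 1) (\<lambda>y. \<Theta> y $ i) (adjoin 0 x)) (at 0)"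
      by (simp add: adjoin_line[symmetric] \<Theta>_adjoin par_dil_def)
    moreover have "((\<lambda>t. p $ i + t * ?a $ i + t * t * ?b * \<nu> $ i) has_field_derivative ?a $ i) (at 0)"
      by (auto intro!: derivative_eq_intros)
    ultimately show ?thesis by (rule DERIV_unique)
  qed
  then show ?thesis
    unfolding vec_eq_iff holomorphic_map_dird_nth[OF \<Theta>_hol UNIV_I, symmetric] by simp
qed

lemma tcoef_1: "tcoef c 1 x = dird (\<Sum>j\<in>UNIV-{n0}. x $ j *s u j) F p $ c"
proof -
  have "dird (axis None 1) (\<lambda>y. F (\<Theta> y) $ c) (adjoin 0 x) = dird (dird (axis None 1) \<Theta> (adjoin 0 x)) (\<lambda>z. F z $ c) (\<Theta> (adjoin 0 x))"
    by (rule holo_compose(2)[OF holomorphic_map_subset[OF \<Theta>_hol subset_UNIV, of \<Omega>] holomorphic_map_comp[OF F_hol] _ adjoin_0_\<Omega>])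
      (simp add: \<Omega>_def)
  then show ?thesis
    by (simp add: tcoef_def tder_def dird_\<Theta> \<Theta>_adjoin \<Phi>_0 holomorphic_map_dird_nth[OF F_hol p_U])
qed

text \<open>Tangential coordinates have weight 1 and the normal coordinate weight 2; the correction
  by \<open>S\<close>, being quadratic in tangential coordinates, respects the weights.\<close>

lemma \<Phi>_scale: "\<Phi> (t * s) x = \<Phi> t (\<chi> j. (if j = n0 then s * s else s) * x $ j)"
proof -
  have 1: "(\<Sum>j\<in>UNIV-{n0}. (\<chi> j. (if j = n0 then s * s else s) * x $ j) $ j *s u j) = s *s (\<Sum>j\<in>UNIV-{n0}. x $ j *s u j)"
    unfolding vec.scale_sum_right by (rule sum.cong) auto
  have 2: "(\<Sum>j\<in>UNIV-{n0}. \<Sum>k\<in>UNIV-{n0}. S j k * (\<chi> j. (if j = n0 then s * s else s) * x $ j) $ j * (\<chi> j. (if j = n0 then s * s else s) * x $ j) $ k)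
     = s * s * (\<Sum>j\<in>UNIV-{n0}. \<Sum>k\<in>UNIV-{n0}. S j k * x $ j * x $ k)"
    unfolding sum_distrib_left by (intro sum.cong) auto
  show ?thesis unfolding par_dil_def 1 2 by (simp add: vec_eq_iff algebra_simps)
qed

end

section \<open>The polarised hyperquadric\<close>

text \<open>The polarised equation of the hyperquadric, homogenised by a coordinate of index 0. The
  form has l + 1 positive directions: the coordinates 1 to l, and one from the hyperbolic plane of
  the coordinates 0 and N.\<close>

definition quad_matrix :: "nat \<Rightarrow> nat \<Rightarrow> nat \<Rightarrow> nat \<Rightarrow> complex" where
  "quad_matrix N l c d = (if c = 0 \<and> d = N then - 1 / (2 * \<i>) else if c = N \<and> d = 0 then 1 / (2 * \<i>)
     else if c = d \<and> 1 \<le> c \<and> c \<le> l then 1 else if c = d \<and> l < c \<and> c < N then -1 else 0)"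

lemma quad_matrix_cnj: "0 < N \<Longrightarrow> quad_matrix N l d c = cnj (quad_matrix N l c d)"
  by (auto simp: quad_matrix_def)

lemma herm_form_quad:
  assumes "l < N"
  shows "herm_form (Suc N) (quad_matrix N l) X Y = (X N * cnj (Y 0) - X 0 * cnj (Y N)) / (2 * \<i>)
     + (\<Sum>c=1..l. X c * cnj (Y c)) - (\<Sum>c=l+1..N-1. X c * cnj (Y c))"
proof -
  define J where "J c = (\<Sum>d<Suc N. quad_matrix N l c d * X c * cnj (Y d))" for c
  have J0: "J 0 = - (X 0 * cnj (Y N) / (2 * \<i>))"
  proof -
    have "J 0 = (\<Sum>d<Suc N. if d = N then - (X 0 * cnj (Y N) / (2 * \<i>)) else 0)"
      unfolding J_def by (rule sum.cong) (use assms in \<open>auto simp: quad_matrix_def\<close>)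
    then show ?thesis by simp
  qed
  have JN: "J N = X N * cnj (Y 0) / (2 * \<i>)"
  proof -
    have "J N = (\<Sum>d<Suc N. if d = 0 then X N * cnj (Y 0) / (2 * \<i>) else 0)"
      unfolding J_def by (rule sum.cong) (use assms in \<open>auto simp: quad_matrix_def\<close>)
    then show ?thesis by simp
  qed
  have J1: "J c = X c * cnj (Y c)" if "c \<in> {1..l}" for c
  proof -
    have "J c = (\<Sum>d<Suc N. if d = c then X c * cnj (Y c) else 0)"
      unfolding J_def by (rule sum.cong) (use assms that in \<open>auto simp: quad_matrix_def\<close>)
    then show ?thesis using that assms by simp
  qed
  have J2: "J c = - (X c * cnj (Y c))" if "c \<in> {l+1..N-1}" for c
  proof -
    have "c < N" using that assms by auto
    have "J c = (\<Sum>d<Suc N. if d = c then - (X c * cnj (Y c)) else 0)"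
      unfolding J_def by (rule sum.cong) (use assms that in \<open>auto simp: quad_matrix_def\<close>)
    then show ?thesis using \<open>c < N\<close> by simp
  qed
  have "herm_form (Suc N) (quad_matrix N l) X Y = sum J {..<Suc N}" unfolding herm_form_def J_def ..
  also have "{..<Suc N} = insert 0 (insert N ({1..l} \<union> {l+1..N-1}))" using assms by auto
  also have "sum J \<dots> = J 0 + (J N + (sum J {1..l} + sum J {l+1..N-1}))"
    using assms by (simp add: sum.union_disjoint)
  also have "sum J {1..l} = (\<Sum>c=1..l. X c * cnj (Y c))" by (rule sum.cong[OF refl J1])
  also have "sum J {l+1..N-1} = - (\<Sum>c=l+1..N-1. X c * cnj (Y c))"
    unfolding sum_negf[symmetric] by (rule sum.cong[OF refl J2])
  finally show ?thesis unfolding J0 JN diff_divide_distrib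
  proof -
    have gen: "- a + (b + (c + - d)) = b - a + c - d" for a b c d :: complex by simp
    show "herm_form (Suc N) (quad_matrix N l) X Y = X N * cnj (Y 0) / (2 * \<i>) - X 0 * cnj (Y N) / (2 * \<i>) + (\<Sum>c=1..l. X c * cnj (Y c)) - (\<Sum>c=l+1..N-1. X c * cnj (Y c))"
      if "herm_form (Suc N) (quad_matrix N l) X Y = - (X 0 * cnj (Y N) / (2 * \<i>)) + (X N * cnj (Y 0) / (2 * \<i>) + ((\<Sum>c=1..l. X c * cnj (Y c)) + - (\<Sum>c=l+1..N-1. X c * cnj (Y c))))"
      using that unfolding gen .
  qed
qed

lemma sum_div_mod:
  fixes f :: "nat \<Rightarrow> nat \<Rightarrow> 'a::comm_monoid_add"
  assumes "0 < M"
  shows "(\<Sum>a<K * M. f (a div M) (a mod M)) = (\<Sum>i<K. \<Sum>c<M. f i c)"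
proof -
  have "(\<Sum>a<K * M. f (a div M) (a mod M)) = (\<Sum>i<K. \<Sum>a\<in>{i*M..<i*M+M}. f (a div M) (a mod M))"
    by (rule sum.nat_group[symmetric])
  also have "\<dots> = (\<Sum>i<K. \<Sum>c<M. f i c)"
  proof (rule sum.cong[OF refl])
    fix i
    have "(\<Sum>a\<in>{i*M..<i*M+M}. f (a div M) (a mod M)) = (\<Sum>c\<in>{0..<M}. f ((i*M+c) div M) ((i*M+c) mod M))"
      by (simp add: sum.atLeastLessThan_shift_0[of _ "i*M"])
    also have "\<dots> = (\<Sum>c<M. f i c)" by (rule sum.cong) (use assms in auto)
    finally show "(\<Sum>a\<in>{i*M..<i*M+M}. f (a div M) (a mod M)) = (\<Sum>c<M. f i c)" .
  qed
  finally show ?thesis .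
qed

text \<open>The coefficient of weight \<open>k\<close> of a form of power series is a single Hermitian form in the
  coefficients; the index \<open>a = i * M + c\<close> stands for coordinate \<open>c\<close> of the coefficient of order \<open>i\<close>.\<close>

definition graded_matrix :: "nat \<Rightarrow> nat \<Rightarrow> (nat \<Rightarrow> nat \<Rightarrow> complex) \<Rightarrow> nat \<Rightarrow> nat \<Rightarrow> complex" where
  "graded_matrix k M h a b = (if a div M + b div M = k then h (a mod M) (b mod M) else 0)"

text \<open>The size \<open>Suc k * M\<close> accommodates the orders 0 to k with M coordinates
  each; only pairs of orders adding up to k contribute.\<close>

lemma herm_form_graded:
  assumes "0 < M"
  shows "herm_form (Suc k * M) (graded_matrix k M h) (\<lambda>a. \<omega> (a div M) (a mod M)) (\<lambda>a. \<omega>' (a div M) (a mod M))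
    = (\<Sum>i\<le>k. herm_form M h (\<omega> i) (\<omega>' (k - i)))"
proof -
  have "herm_form (Suc k * M) (graded_matrix k M h) (\<lambda>a. \<omega> (a div M) (a mod M)) (\<lambda>a. \<omega>' (a div M) (a mod M))
    = (\<Sum>a<Suc k * M. \<Sum>b<Suc k * M. (\<lambda>i c. (if a div M + i = k then h (a mod M) c else 0) * \<omega> (a div M) (a mod M) * cnj (\<omega>' i c)) (b div M) (b mod M))"
    by (simp add: herm_form_def graded_matrix_def)
  also have "\<dots> = (\<Sum>a<Suc k * M. (\<lambda>i c. \<Sum>j<Suc k. \<Sum>d<M. (if i + j = k then h c d else 0) * \<omega> i c * cnj (\<omega>' j d)) (a div M) (a mod M))"
  proof (rule sum.cong[OF refl])
    fix a
    show "(\<Sum>b<Suc k * M. (\<lambda>i c. (if a div M + i = k then h (a mod M) c else 0) * \<omega> (a div M) (a mod M) * cnj (\<omega>' i c)) (b div M) (b mod M))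
      = (\<lambda>i c. \<Sum>j<Suc k. \<Sum>d<M. (if i + j = k then h c d else 0) * \<omega> i c * cnj (\<omega>' j d)) (a div M) (a mod M)"
      using sum_div_mod[OF assms, of "\<lambda>i c. (if a div M + i = k then h (a mod M) c else 0) * \<omega> (a div M) (a mod M) * cnj (\<omega>' i c)" "Suc k"]
      by (simp only:)
  qed
  also have "\<dots> = (\<Sum>i<Suc k. \<Sum>c<M. \<Sum>j<Suc k. \<Sum>d<M. (if i + j = k then h c d else 0) * \<omega> i c * cnj (\<omega>' j d))"
    by (rule sum_div_mod[OF assms])
  also have "\<dots> = (\<Sum>i<Suc k. herm_form M h (\<omega> i) (\<omega>' (k - i)))"
  proof (rule sum.cong[OF refl])
    fix i assume i: "i \<in> {..<Suc k}"
    have "(\<Sum>j<Suc k. \<Sum>d<M. (if i + j = k then h c d else 0) * \<omega> i c * cnj (\<omega>' j d)) = (\<Sum>d<M. h c d * \<omega> i c * cnj (\<omega>' (k - i) d))" for c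
    proof -
      have "(\<Sum>j<Suc k. \<Sum>d<M. (if i + j = k then h c d else 0) * \<omega> i c * cnj (\<omega>' j d))
         = (\<Sum>j<Suc k. if j = k - i then (\<Sum>d<M. h c d * \<omega> i c * cnj (\<omega>' (k - i) d)) else 0)"
        by (rule sum.cong) (use i in \<open>auto intro!: sum.neutral\<close>)
      then show ?thesis by simp
    qed
    then show "(\<Sum>c<M. \<Sum>j<Suc k. \<Sum>d<M. (if i + j = k then h c d else 0) * \<omega> i c * cnj (\<omega>' j d)) = herm_form M h (\<omega> i) (\<omega>' (k - i))"
      by (simp add: herm_form_def)
  qed
  finally show ?thesis by (simp add: lessThan_Suc_atMost)
qed

lemma graded_matrix_cnj:
  assumes "\<And>c d. h d c = cnj (h c d)"
  shows "graded_matrix k M h b a = cnj (graded_matrix k M h a b)"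
proof -
  have "h (b mod M) (a mod M) = cnj (h (a mod M) (b mod M))" by (rule assms)
  then show ?thesis unfolding graded_matrix_def by (auto simp only: add.commute complex_cnj_zero split: if_split)
qed

text \<open>l + 1 vectors with l coordinates are linearly dependent; the last coordinate is
  eliminated with a pivot vector.\<close>

lemma nontrivial_combination:
  fixes A :: "nat \<Rightarrow> nat \<Rightarrow> complex"
  shows "\<exists>z. (\<exists>i\<le>l. z i \<noteq> 0) \<and> (\<forall>c\<in>{1..l}. (\<Sum>i\<le>l. z i * A i c) = 0)"
proof (induction l arbitrary: A)
  case 0
  show ?case by (intro exI[of _ "\<lambda>_. 1"]) auto
next
  case (Suc l)
  show ?case
  proof (cases "A (Suc l) (Suc l) = 0 \<and> (\<forall>i\<le>l. A i (Suc l) = 0)")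
    case True
    obtain z where z': "(\<exists>i\<le>l. z i \<noteq> 0) \<and> (\<forall>c\<in>{1..l}. (\<Sum>i\<le>l. z i * A i c) = 0)"
      using Suc.IH[of A] by (rule exE)
    note z = conjunct1[OF z'] conjunct2[OF z']
    define z' where "z' i = (if i \<le> l then z i else 0)" for i
    have s: "(\<Sum>i\<le>Suc l. z' i * A i c) = (\<Sum>i\<le>l. z i * A i c)" for c
    proof -
      have "(\<Sum>i\<le>l. z' i * A i c) = (\<Sum>i\<le>l. z i * A i c)" by (rule sum.cong) (auto simp: z'_def)
      then show ?thesis by (simp add: z'_def)
    qed
    have "(\<Sum>i\<le>l. z i * A i (Suc l)) = 0" by (rule sum.neutral) (use True in auto)
    then have "\<forall>c\<in>{1..Suc l}. (\<Sum>i\<le>Suc l. z' i * A i c) = 0" unfolding s using z(2) by (auto simp: le_Suc_eq)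
    moreover have "\<exists>i\<le>Suc l. z' i \<noteq> 0" using z(1) by (auto simp: z'_def intro: le_SucI)
    ultimately show ?thesis by blast
  next
    case False
    then have "\<exists>r\<le>Suc l. A r (Suc l) \<noteq> 0" by (auto intro: le_SucI)
    then obtain r where r: "r \<le> Suc l" "A r (Suc l) \<noteq> 0" by blast
    \<comment> \<open>An enumeration of the l + 1 indices other than the pivot r.\<close>
    define s where "s i = (if i < r then i else Suc i)" for i :: nat
    have s_inj: "inj_on s {..l}" by (rule inj_onI) (auto simp: s_def split: if_splits)
    have s_im: "s ` {..l} = {..Suc l} - {r}"
    proof
      show "s ` {..l} \<subseteq> {..Suc l} - {r}" by (auto simp: s_def)
      show "{..Suc l} - {r} \<subseteq> s ` {..l}"
      proof
        fix i assume i: "i \<in> {..Suc l} - {r}"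
        show "i \<in> s ` {..l}"
        proof (cases "i < r")
          case True
          then show ?thesis using r i by (intro image_eqI[of _ _ i]) (auto simp: s_def)
        next
          case False
          then show ?thesis using i by (intro image_eqI[of _ _ "i - 1"]) (auto simp: s_def)
        qed
      qed
    qed
    obtain z where zz: "(\<exists>i\<le>l. z i \<noteq> 0) \<and> (\<forall>c\<in>{1..l}. (\<Sum>i\<le>l. z i * (A (s i) c - A (s i) (Suc l) / A r (Suc l) * A r c)) = 0)"
      using Suc.IH[of "\<lambda>i c. A (s i) c - A (s i) (Suc l) / A r (Suc l) * A r c"] by (rule exE)
    note z = conjunct1[OF zz] conjunct2[OF zz]
    define w where "w = - (\<Sum>i\<le>l. z i * (A (s i) (Suc l) / A r (Suc l)))"
    define z' where "z' j = (if j = r then w else z (inv_into {..l} s j))" for j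
    have z's: "z' (s i) = z i" if "i \<le> l" for i
      using that inv_into_f_f[OF s_inj, of i] by (auto simp: z'_def s_def)
    have sum: "(\<Sum>j\<le>Suc l. z' j * A j c) = w * A r c + (\<Sum>i\<le>l. z i * A (s i) c)" for c
    proof -
      have "(\<Sum>j\<le>Suc l. z' j * A j c) = z' r * A r c + (\<Sum>j\<in>{..Suc l} - {r}. z' j * A j c)"
        by (rule sum.remove) (use r in auto)
      also have "(\<Sum>j\<in>{..Suc l} - {r}. z' j * A j c) = (\<Sum>i\<le>l. z' (s i) * A (s i) c)"
        unfolding s_im[symmetric] by (rule sum.reindex_cong[OF s_inj refl]) simp
      also have "\<dots> = (\<Sum>i\<le>l. z i * A (s i) c)" by (rule sum.cong) (auto simp: z's)
      finally show ?thesis by (simp add: z'_def)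
    qed
    have w: "w * A r c + (\<Sum>i\<le>l. z i * A (s i) c) = (\<Sum>i\<le>l. z i * (A (s i) c - A (s i) (Suc l) / A r (Suc l) * A r c))" for c
      by (simp add: w_def sum_distrib_right sum_subtractf right_diff_distrib mult.assoc)
    have "\<forall>c\<in>{1..Suc l}. (\<Sum>j\<le>Suc l. z' j * A j c) = 0"
    proof
      fix c assume c: "c \<in> {1..Suc l}"
      show "(\<Sum>j\<le>Suc l. z' j * A j c) = 0"
      proof (cases "c = Suc l")
        case True
        show ?thesis unfolding sum w unfolding True using r(2) by simp
      next
        case False
        then show ?thesis unfolding sum w using z(2) c by auto
      qed
    qed
    moreover obtain i where i: "i \<le> l" "z i \<noteq> 0" using z(1) by blast
    then have "z' (s i) \<noteq> 0" "s i \<le> Suc l" using z's by (auto simp: s_def)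
    ultimately show ?thesis by blast
  qed
qed

text \<open>By Cauchy-Schwarz the perturbation is at most (\<Sum>|z i|)^2 / (2 (l + 1)) \<le>
  \<Sum>|z i|^2 / 2, half of the main term; this dictates the tolerance.\<close>

lemma near_identity_positive:
  fixes z :: "nat \<Rightarrow> complex"
  assumes "\<And>i j. i \<le> l \<Longrightarrow> j \<le> l \<Longrightarrow> cmod (A i j - (if i = j then 1 else 0)) \<le> 1 / (2 * (real l + 1))"
    and "\<exists>i\<le>l. z i \<noteq> 0"
  shows "0 < Re (\<Sum>i\<le>l. \<Sum>j\<le>l. z i * cnj (z j) * A i j)"
proof -
  define s where "s = (\<Sum>i\<le>l. (cmod (z i))\<^sup>2)"
  have s: "s > 0"
  proof -
    obtain i where "i \<le> l" "z i \<noteq> 0" using assms(2) by blast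
    then show ?thesis unfolding s_def by (intro sum_pos2[of _ i]) auto
  qed
  have split: "(\<Sum>i\<le>l. \<Sum>j\<le>l. z i * cnj (z j) * A i j) = of_real s + (\<Sum>i\<le>l. \<Sum>j\<le>l. z i * cnj (z j) * (A i j - (if i = j then 1 else 0)))"
  proof -
    have "(\<Sum>j\<le>l. z i * cnj (z j) * (if i = j then 1 else 0)) = of_real ((cmod (z i))\<^sup>2)" if "i \<le> l" for i
    proof -
      have "(\<Sum>j\<le>l. z i * cnj (z j) * (if i = j then 1 else 0)) = (\<Sum>j\<le>l. if j = i then z i * cnj (z i) else 0)"
        by (rule sum.cong) auto
      also have "\<dots> = of_real ((cmod (z i))\<^sup>2)" using that complex_norm_square[of "z i"] by simp
      finally show ?thesis .
    qed
    then have "(\<Sum>i\<le>l. \<Sum>j\<le>l. z i * cnj (z j) * (if i = j then 1 else 0)) = of_real s" by (simp add: s_def)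
    then show ?thesis by (simp add: right_diff_distrib sum_subtractf)
  qed
  have "cmod (\<Sum>i\<le>l. \<Sum>j\<le>l. z i * cnj (z j) * (A i j - (if i = j then 1 else 0))) \<le> s / 2"
  proof -
    have "cmod (\<Sum>i\<le>l. \<Sum>j\<le>l. z i * cnj (z j) * (A i j - (if i = j then 1 else 0)))
       \<le> (\<Sum>i\<le>l. \<Sum>j\<le>l. cmod (z i) * cmod (z j) * (1 / (2 * (real l + 1))))"
    proof (intro order_trans[OF norm_sum] sum_mono)
      fix i j assume "i \<in> {..l}" "j \<in> {..l}"
      then show "cmod (z i * cnj (z j) * (A i j - (if i = j then 1 else 0))) \<le> cmod (z i) * cmod (z j) * (1 / (2 * (real l + 1)))"
        unfolding norm_mult complex_mod_cnj by (intro mult_left_mono assms(1)) auto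
    qed
    also have "\<dots> = (\<Sum>i\<le>l. cmod (z i))\<^sup>2 / (2 * (real l + 1))"
      by (simp add: power2_eq_square sum_product sum_divide_distrib)
    also have "\<dots> \<le> (s * (real l + 1)) / (2 * (real l + 1))"
    proof (intro divide_right_mono)
      show "(\<Sum>i\<le>l. cmod (z i))\<^sup>2 \<le> s * (real l + 1)"
        using Cauchy_Schwarz_ineq_sum[of "\<lambda>i. cmod (z i)" "\<lambda>_. 1" "{..l}"] by (simp add: s_def add.commute)
    qed simp
    also have "\<dots> = s / 2" by (simp add: field_simps)
    finally show ?thesis .
  qed
  then have "\<bar>Re (\<Sum>i\<le>l. \<Sum>j\<le>l. z i * cnj (z j) * (A i j - (if i = j then 1 else 0)))\<bar> \<le> s / 2"
    by (rule order_trans[OF abs_Re_le_cmod])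
  then show ?thesis unfolding split using s by simp
qed

section \<open>Lowest-order kernels of a map into the hyperquadric\<close>

locale quadric_map = dilation n0 p \<nu> u S U F
  for n0 :: "'n::finite" and p \<nu> :: "complex^'n" and u :: "'n \<Rightarrow> complex^'n" and S :: "'n \<Rightarrow> 'n \<Rightarrow> complex"
    and U :: "(complex^'n) set" and F :: "complex^'n \<Rightarrow> complex^'k::finite" +
  fixes e :: "nat \<Rightarrow> 'k" and l N :: nat and \<epsilon> :: "'n \<Rightarrow> real"
  assumes l_less: "l < N" and lpos: "0 < l"
    and eps: "\<And>j. j \<noteq> n0 \<Longrightarrow> \<epsilon> j = 1 \<or> \<epsilon> j = -1"
    and card_pos: "l \<le> card {j. j \<noteq> n0 \<and> \<epsilon> j = 1}" and card_neg: "l \<le> card {j. j \<noteq> n0 \<and> \<epsilon> j = -1}"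
begin

abbreviation "hq \<equiv> quad_matrix N l"
abbreviation "Rq \<equiv> herm_form (Suc N) hq"
abbreviation "nn \<equiv> axis n0 (1::complex)"

definition "homog y c = (if c = 0 then 1 else y $ e c)"

text \<open>The coefficient of order i in t of coordinate c of
  \<open>homog (F (\<Phi> t x))\<close>; coordinate 0 is constantly 1.\<close>

definition "ft i c x = (if c = 0 then (if i = 0 then 1 else 0) else tcoef (e c) i x)"

text \<open>The coefficient of order j in real t of the polarised equation pulled back by F along
  the dilations.\<close>

definition "Kern j x y = (\<Sum>i\<le>j. Rq (\<lambda>c. ft i c x) (\<lambda>c. ft (j - i) c y))"

lemma ft_holo: "holo UNIV (ft i c)"
  by (cases "c = 0") (auto simp: ft_def[abs_def] holo_const tcoef_hol)

lemma homog_asym: "asym k (cball 0 R) (\<lambda>t x. homog (F (\<Phi> (of_real t) x)) c) (\<lambda>i. ft i c)"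
proof (cases "c = 0")
  case True
  have "asym k (cball (0::complex^'n) R) (\<lambda>t x. 1) (\<lambda>i x. if i = 0 then 1 else (0::complex))"
    by (rule asym_const) (auto intro: exI[of _ 1])
  then show ?thesis using True by (simp add: homog_def ft_def[abs_def])
next
  case False
  then show ?thesis using taylor[of k R "e c"] by (simp add: homog_def ft_def[abs_def])
qed

lemma kern_asym:
  "asym k (cball 0 R \<times> cball 0 R) (\<lambda>t z. Rq (homog (F (\<Phi> (of_real t) (fst z)))) (homog (F (\<Phi> (of_real t) (snd z)))))
     (\<lambda>j z. Kern j (fst z) (snd z))"
proof -
  let ?D = "cball 0 R \<times> cball (0::complex^'n) R"
  have "asym k ?D (\<lambda>t z. \<Sum>c<Suc N. \<Sum>d<Suc N. hq c d * (homog (F (\<Phi> (of_real t) (fst z))) c * cnj (homog (F (\<Phi> (of_real t) (snd z))) d)))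
    (\<lambda>j z. \<Sum>c<Suc N. \<Sum>d<Suc N. hq c d * (\<Sum>i\<le>j. ft i c (fst z) * cnj (ft (j - i) d (snd z))))"
  proof (intro asym_sum asym_cmult)
    fix c d
    show "\<exists>M. \<forall>x\<in>?D. cmod (hq c d) \<le> M" by blast
    have 1: "asym k ?D (\<lambda>t z. homog (F (\<Phi> (of_real t) (fst z))) c) (\<lambda>i z. ft i c (fst z))"
      by (rule asym_map[OF _ homog_asym]) auto
    have "asym k ?D (\<lambda>t z. homog (F (\<Phi> (of_real t) (snd z))) d) (\<lambda>i z. ft i d (snd z))"
      by (rule asym_map[OF _ homog_asym]) auto
    from asym_mult[OF 1 asym_cnj[OF this]]
    show "asym k ?D (\<lambda>t z. homog (F (\<Phi> (of_real t) (fst z))) c * cnj (homog (F (\<Phi> (of_real t) (snd z))) d))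
      (\<lambda>j z. \<Sum>i\<le>j. ft i c (fst z) * cnj (ft (j - i) d (snd z)))" .
  qed
  moreover have "(\<lambda>j z. \<Sum>c<Suc N. \<Sum>d<Suc N. hq c d * (\<Sum>i\<le>j. ft i c (fst z) * cnj (ft (j - i) d (snd z)))) = (\<lambda>j z. Kern j (fst z) (snd z))"
  proof (intro ext)
    fix j and z :: "(complex^'n) \<times> (complex^'n)"
    have "Kern j (fst z) (snd z) = (\<Sum>i\<le>j. \<Sum>c<Suc N. \<Sum>d<Suc N. hq c d * (ft i c (fst z) * cnj (ft (j - i) d (snd z))))"
      by (simp only: Kern_def herm_form_def mult.assoc)
    also have "\<dots> = (\<Sum>c<Suc N. \<Sum>i\<le>j. \<Sum>d<Suc N. hq c d * (ft i c (fst z) * cnj (ft (j - i) d (snd z))))"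
      by (rule sum.swap)
    also have "\<dots> = (\<Sum>c<Suc N. \<Sum>d<Suc N. \<Sum>i\<le>j. hq c d * (ft i c (fst z) * cnj (ft (j - i) d (snd z))))"
      by (rule sum.cong[OF refl], rule sum.swap)
    finally show "(\<Sum>c<Suc N. \<Sum>d<Suc N. hq c d * (\<Sum>i\<le>j. ft i c (fst z) * cnj (ft (j - i) d (snd z)))) = Kern j (fst z) (snd z)"
      by (simp only: sum_distrib_left)
  qed
  ultimately show ?thesis by (simp only: herm_form_def mult.assoc)
qed

text \<open>Every dilation sends x = 0 to p, so the expansion there is that of a constant.\<close>

lemma ft_at_0: "ft i c 0 = (if i = 0 then homog (F p) c else 0)"
proof -
  have \<Phi>0: "\<Phi> t 0 = p" for t by (simp add: par_dil_def)
  have "asym i (cball 0 0) (\<lambda>t x. homog (F (\<Phi> (of_real t) x)) c) (\<lambda>i x. if i = 0 then homog (F p) c else 0)"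
  proof (rule asym_cong[OF _ asym_const])
    show "\<forall>\<^sub>F t in at_right 0. \<forall>x\<in>cball (0::complex^'n) 0. homog (F p) c = homog (F (\<Phi> (of_real t) x)) c"
      by (rule always_eventually) (auto simp: \<Phi>0)
  qed blast
  from asym_unique[OF homog_asym[of i 0 c] this, of i 0] show ?thesis by simp
qed

definition "fe k a x = ft (a div Suc N) (a mod Suc N) x"

abbreviation "m k \<equiv> Suc k * Suc N"
abbreviation "hk k \<equiv> graded_matrix k (Suc N) hq"

lemma Kern_herm: "herm_form (m k) (hk k) (\<lambda>a. fe k a x) (\<lambda>a. fe k a y) = Kern k x y"
  unfolding fe_def Kern_def by (rule herm_form_graded[where \<omega>="\<lambda>i c. ft i c x" and \<omega>'="\<lambda>i c. ft i c y"]) simp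

lemma Kern_tendsto:
  assumes lower: "\<And>j x y. j < k \<Longrightarrow> Kern j x y = 0"
  shows "((\<lambda>t. Rq (homog (F (\<Phi> (of_real t) x))) (homog (F (\<Phi> (of_real t) y))) / of_real t ^ k) \<longlongrightarrow> Kern k x y) (at_right 0)"
proof -
  define R where "R = max (norm x) (norm y)"
  obtain C where C: "\<forall>\<^sub>F t in at_right 0. \<forall>z\<in>cball 0 R \<times> cball 0 R.
     cmod (Rq (homog (F (\<Phi> (of_real t) (fst z)))) (homog (F (\<Phi> (of_real t) (snd z)))) / of_real t ^ k - Kern k (fst z) (snd z)) \<le> C * t"
    using asym_leading[OF kern_asym[of k R]] lower by blast
  have "(x, y) \<in> cball 0 R \<times> cball 0 R" by (simp add: R_def)
  with C have ev: "\<forall>\<^sub>F t in at_right 0. cmod (Rq (homog (F (\<Phi> (of_real t) x))) (homog (F (\<Phi> (of_real t) y))) / of_real t ^ k - Kern k x y) \<le> C * t"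
    by (auto elim!: eventually_mono)
  have "((\<lambda>t. C * t) \<longlongrightarrow> C * 0) (at_right 0)" by (intro tendsto_intros)
  then have "((\<lambda>t. C * t) \<longlongrightarrow> 0) (at_right 0)" by simp
  from Lim_null_comparison[OF ev this] show ?thesis by (simp add: LIM_zero_iff)
qed

lemma herm_form_eval_comb:
  "herm_form M h (\<lambda>a. eval_comb xs (g a)) (\<lambda>a. eval_comb ys (g' a)) =
    (\<Sum>(c, x)\<leftarrow>xs. \<Sum>(d, y)\<leftarrow>ys. c * cnj d * herm_form M h (\<lambda>a. g a x) (\<lambda>a. g' a y))"
proof (induction xs)
  case Nil
  then show ?case by (simp add: eval_comb_def herm_form_def)
next
  case (Cons z xs)
  obtain c x where z: "z = (c, x)" by (cases z)
  have 1: "herm_form M h \<psi> (\<lambda>a. eval_comb ys (g' a)) = (\<Sum>(d, y)\<leftarrow>ys. cnj d * herm_form M h \<psi> (\<lambda>a. g' a y))" for \<psi>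
  proof (induction ys)
    case Nil
    then show ?case by (simp add: eval_comb_def herm_form_def)
  next
    case (Cons w ys)
    obtain d y where w: "w = (d, y)" by (cases w)
    have "(\<lambda>a. eval_comb (w # ys) (g' a)) = (\<lambda>a. d * g' a y + eval_comb ys (g' a))"
      by (simp add: eval_comb_def w)
    then show ?case using Cons by (simp add: herm_form_lin_right w)
  qed
  have "(\<lambda>a. eval_comb (z # xs) (g a)) = (\<lambda>a. c * g a x + eval_comb xs (g a))"
    by (simp add: eval_comb_def z)
  then have "herm_form M h (\<lambda>a. eval_comb (z # xs) (g a)) (\<lambda>a. eval_comb ys (g' a)) =
     c * (\<Sum>(d, y)\<leftarrow>ys. cnj d * herm_form M h (\<lambda>a. g a x) (\<lambda>a. g' a y)) + herm_form M h (\<lambda>a. eval_comb xs (g a)) (\<lambda>a. eval_comb ys (g' a))"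
    by (simp add: herm_form_lin_left 1)
  also have "c * (\<Sum>(d, y)\<leftarrow>ys. cnj d * herm_form M h (\<lambda>a. g a x) (\<lambda>a. g' a y)) = (\<Sum>(d, y)\<leftarrow>ys. c * cnj d * herm_form M h (\<lambda>a. g a x) (\<lambda>a. g' a y))"
    by (induction ys) (auto simp: algebra_simps)
  finally show ?case using Cons z by simp
qed

lemma tendsto_sum_list:
  fixes f :: "real \<Rightarrow> 'b \<Rightarrow> complex"
  assumes "\<And>x. (((\<lambda>t. f t x)) \<longlongrightarrow> g x) G"
  shows "((\<lambda>t. \<Sum>x\<leftarrow>xs. f t x) \<longlongrightarrow> (\<Sum>x\<leftarrow>xs. g x)) G"
  by (induction xs) (auto intro!: tendsto_add assms)

text \<open>A null combination of points is blind to the constant coordinate \<open>1\<close> of \<open>homog\<close>, which carries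
  the only positive direction of \<open>Rq\<close> beyond the \<open>l\<close> obvious ones.\<close>

lemma Kern_few_positive:
  assumes lower: "\<And>j x y. j < k \<Longrightarrow> Kern j x y = 0"
  shows "few_positive (m k) (hk k) l (fe k)"
  unfolding few_positive_def
\<comment> \<open>Half of the tolerance of \<open>near_identity_positive\<close>; the other half is
  left for the distance between the rescaled Gram matrix at a small t and its limit.\<close>
proof (intro exI[of _ "1 / (4 * (real l + 1))"] conjI allI impI notI)
  show "0 < 1 / (4 * (real l + 1))" by simp
next
  fix \<Omega> assume \<Omega>: "\<forall>i\<le>l. \<Omega> i \<in> null_combs (fe k)" and no: "near_orthonormal (m k) (hk k) l (1 / (4 * (real l + 1))) \<Omega>"
  have "\<forall>i. \<exists>xs. i \<le> l \<longrightarrow> \<Omega> i = (\<lambda>a. eval_comb xs (fe k a)) \<and> eval_comb xs (\<lambda>_. 1) = 0"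
    using \<Omega> unfolding null_combs_def by blast
  from choice[OF this] obtain xs where xs: "\<And>i. i \<le> l \<Longrightarrow> \<Omega> i = (\<lambda>a. eval_comb (xs i) (fe k a))" "\<And>i. i \<le> l \<Longrightarrow> eval_comb (xs i) (\<lambda>_. 1) = 0"
    by blast
  \<comment> \<open>The same null combinations of points, with the coefficients of the expansion
    replaced by actual values of F at some positive t.\<close>
  define V where "V t i = (\<lambda>c. eval_comb (xs i) (\<lambda>x. homog (F (\<Phi> (of_real t) x)) c))" for t :: real and i
  define A where "A t i j = Rq (V t i) (V t j) / of_real t ^ k" for t i j
  have lim: "((\<lambda>t. A t i j) \<longlongrightarrow> herm_form (m k) (hk k) (\<Omega> i) (\<Omega> j)) (at_right 0)" if "i \<le> l" "j \<le> l" for i j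
  proof -
    have "A t i j = (\<Sum>(c, x)\<leftarrow>xs i. \<Sum>(d, y)\<leftarrow>xs j. c * cnj d * (Rq (homog (F (\<Phi> (of_real t) x))) (homog (F (\<Phi> (of_real t) y))) / of_real t ^ k))" for t
      unfolding A_def V_def herm_form_eval_comb divide_inverse
      by (simp add: sum_list_mult_const[symmetric] split_def mult.assoc)
    moreover have "herm_form (m k) (hk k) (\<Omega> i) (\<Omega> j) = (\<Sum>(c, x)\<leftarrow>xs i. \<Sum>(d, y)\<leftarrow>xs j. c * cnj d * Kern k x y)"
      unfolding xs(1)[OF that(1)] xs(1)[OF that(2)] herm_form_eval_comb Kern_herm ..
    ultimately show ?thesis
      unfolding split_def by (simp only:) (intro tendsto_sum_list tendsto_mult tendsto_const Kern_tendsto[OF lower])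
  qed
  have "\<forall>\<^sub>F t in at_right 0. cmod (A t i j - (if i = j then 1 else 0)) \<le> 1 / (2 * (real l + 1))" if "i \<le> l" "j \<le> l" for i j
  proof -
    have "\<forall>\<^sub>F t in at_right 0. dist (A t i j) (herm_form (m k) (hk k) (\<Omega> i) (\<Omega> j)) < 1 / (4 * (real l + 1))"
      by (rule tendstoD[OF lim[OF that]]) simp
    then show ?thesis
    proof eventually_elim
      case (elim t)
      have "cmod (herm_form (m k) (hk k) (\<Omega> i) (\<Omega> j) - (if i = j then 1 else 0)) \<le> 1 / (4 * (real l + 1))"
        using no that unfolding near_orthonormal_def by blast
      moreover have "cmod (A t i j - (if i = j then 1 else 0)) \<le> dist (A t i j) (herm_form (m k) (hk k) (\<Omega> i) (\<Omega> j))
          + cmod (herm_form (m k) (hk k) (\<Omega> i) (\<Omega> j) - (if i = j then 1 else 0))"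
        using dist_triangle[of "A t i j" "if i = j then 1 else 0" "herm_form (m k) (hk k) (\<Omega> i) (\<Omega> j)"] by (simp only: dist_norm)
      moreover have "1 / (2 * (real l + 1)) = 1 / (4 * (real l + 1)) + 1 / (4 * (real l + 1))" by (simp add: field_simps)
      moreover have "b \<le> r + r" if "a \<le> r" "b \<le> d + a" "d < r" for a b d r :: real using that by linarith
      ultimately show ?case using elim by metis
    qed
  qed
  then have "\<forall>\<^sub>F t in at_right 0. \<forall>i\<in>{..l}. \<forall>j\<in>{..l}. cmod (A t i j - (if i = j then 1 else 0)) \<le> 1 / (2 * (real l + 1))"
    by (intro eventually_ball_finite ballI) auto
  then have "\<forall>\<^sub>F t in at_right 0. 0 < t \<and> (\<forall>i\<in>{..l}. \<forall>j\<in>{..l}. cmod (A t i j - (if i = j then 1 else 0)) \<le> 1 / (2 * (real l + 1)))"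
    using eventually_pos by eventually_elim simp
  from eventually_happens'[OF trivial_limit_at_right_real this]
  obtain t where t: "0 < t" "\<And>i j. i \<le> l \<Longrightarrow> j \<le> l \<Longrightarrow> cmod (A t i j - (if i = j then 1 else 0)) \<le> 1 / (2 * (real l + 1))"
    by auto
  \<comment> \<open>l + 1 vectors combine so that the coordinates 1 to l cancel. Coordinate 0 is
    absent already, which removes the hyperbolic part of \<open>Rq\<close> as well; what remains of
    \<open>Rq\<close> is nonpositive.\<close>
  obtain z where z': "(\<exists>i\<le>l. z i \<noteq> 0) \<and> (\<forall>c\<in>{1..l}. (\<Sum>i\<le>l. z i * V t i c) = 0)"
    using nontrivial_combination[of l "V t"] by (rule exE)
  note z = conjunct1[OF z'] conjunct2[OF z']
  define w where "w c = (\<Sum>i\<le>l. z i * V t i c)" for c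
  have w0: "w 0 = 0"
    unfolding w_def by (rule sum.neutral) (auto simp: V_def homog_def xs(2))
  have w1: "w c = 0" if "c \<in> {1..l}" for c using z(2) that by (simp add: w_def)
  have "Rq w w = (\<Sum>i\<le>l. \<Sum>j\<le>l. z i * cnj (z j) * Rq (V t i) (V t j))"
    unfolding w_def herm_form_sum_left herm_form_sum_right by (simp add: sum_distrib_left mult.assoc)
  also have "\<dots> = of_real (t ^ k) * (\<Sum>i\<le>l. \<Sum>j\<le>l. z i * cnj (z j) * A t i j)"
    using t(1) by (simp add: A_def sum_distrib_left)
  finally have "Re (Rq w w) = t ^ k * Re (\<Sum>i\<le>l. \<Sum>j\<le>l. z i * cnj (z j) * A t i j)" by simp
  also have "\<dots> > 0" using near_identity_positive[OF t(2) z(1)] t(1) by simp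
  finally have "Re (Rq w w) > 0" .
  moreover have "Re (Rq w w) \<le> 0"
  proof -
    have "(\<Sum>c=1..l. w c * cnj (w c)) = 0" by (rule sum.neutral) (use w1 in auto)
    then have "Re (Rq w w) = - (\<Sum>c=l+1..N-1. Re (w c * cnj (w c)))"
      unfolding herm_form_quad[OF l_less] using w0 by (simp add: Re_sum)
    also have "\<dots> \<le> 0" by (simp add: sum_nonneg)
    finally show ?thesis .
  qed
  ultimately show False by simp
qed

text \<open>The dilated point \<open>\<Phi> t x\<close> itself need not be mapped into the
  hyperquadric. Since the expansion is uniform near x and its coefficient continuous, points y
  within any given distance of x suffice.\<close>

lemma Kern_vanish:
  assumes lower: "\<And>j x y. j < k \<Longrightarrow> Kern j x y = 0"
    and z: "\<And>\<delta>. 0 < \<delta> \<Longrightarrow> \<forall>\<^sub>F t in at_right 0. \<exists>y. dist y x < \<delta> \<and> Rq (homog (F (\<Phi> (of_real t) y))) (homog (F (\<Phi> (of_real t) y))) = 0"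
  shows "Kern k x x = 0"
proof -
  define R where "R = norm x + 1"
  obtain C where C: "\<forall>\<^sub>F t in at_right 0. \<forall>z\<in>cball 0 R \<times> cball 0 R.
     cmod (Rq (homog (F (\<Phi> (of_real t) (fst z)))) (homog (F (\<Phi> (of_real t) (snd z)))) / of_real t ^ k - Kern k (fst z) (snd z)) \<le> C * t"
    using asym_leading[OF kern_asym[of k R]] lower by blast
  have cont: "isCont (ft i c) x" for i c
    using holo_continuous_on[OF ft_holo[of i c]] by (simp add: continuous_on_eq_continuous_at)
  have "isCont (\<lambda>y. Kern k y y) x"
    unfolding Kern_def herm_form_def by (intro continuous_intros cont)
  have "cmod (Kern k x x) \<le> r" if r: "r > 0" for r
  proof -
    obtain d where d: "d > 0" "\<And>y. dist y x < d \<Longrightarrow> dist (Kern k y y) (Kern k x x) < r"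
      using \<open>isCont (\<lambda>y. Kern k y y) x\<close> r unfolding continuous_at_eps_delta by (auto simp: dist_norm)
    have "0 < min d 1" using d(1) by simp
    from C z[OF this] have "\<forall>\<^sub>F t in at_right 0. cmod (Kern k x x) \<le> r + C * t"
    proof eventually_elim
      case (elim t)
      then obtain y where y: "dist y x < min d 1" "Rq (homog (F (\<Phi> (of_real t) y))) (homog (F (\<Phi> (of_real t) y))) = 0" by blast
      have "norm y \<le> R" using y(1) norm_triangle_sub[of y x] by (simp add: R_def dist_norm)
      then have "(y, y) \<in> cball 0 R \<times> cball 0 R" by simp
      from bspec[OF elim(1) this] y(2) have "cmod (Kern k y y) \<le> C * t" by simp
      moreover have "dist (Kern k y y) (Kern k x x) < r" by (rule d(2)) (use y(1) in simp)
      ultimately show ?case using norm_triangle_sub[of "Kern k x x" "Kern k y y"]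
        by (simp add: dist_norm norm_minus_commute)
    qed
    moreover have "((\<lambda>t. r + C * t) \<longlongrightarrow> r + C * 0) (at_right 0)" by (intro tendsto_intros)
    ultimately have "cmod (Kern k x x) \<le> r + C * 0"
      by (intro tendsto_lowerbound[of "\<lambda>t. r + C * t" _ "at_right 0"]) auto
    then show ?thesis by simp
  qed
  then have "cmod (Kern k x x) \<le> 0" by (rule field_le_epsilon[of _ 0, simplified])
  then show ?thesis by simp
qed

section \<open>Weighted homogeneity and normal derivatives of the coefficients\<close>

lemma \<Phi>_normal: "\<Phi> t nn = p + (t * t) *s \<nu>"
proof -
  have 1: "(\<Sum>j\<in>UNIV-{n0}. nn $ j *s u j) = 0"
    by (rule sum.neutral) (auto simp: axis_nth_if)
  have 2: "(\<Sum>j\<in>UNIV-{n0}. \<Sum>k\<in>UNIV-{n0}. S j k * nn $ j * nn $ k) = 0"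
    by (intro sum.neutral ballI) (auto simp: axis_nth_if)
  show ?thesis unfolding par_dil_def 1 2 by (simp add: axis_nth_if)
qed

text \<open>By \<open>\<Phi>_scale\<close>, dilating x by s amounts to replacing t by t s, and
  expansions are unique. s is real and positive because t runs through positive reals.\<close>

lemma tcoef_scale:
  assumes s: "(0::real) < s"
  shows "tcoef c i (\<chi> j. (if j = n0 then of_real s * of_real s else of_real s) * x $ j) = of_real s ^ i * tcoef c i x"
proof -
  let ?y = "\<chi> j. (if j = n0 then of_real s * of_real s else of_real s) * x $ j"
  have 1: "asym i {()} (\<lambda>t _. F (\<Phi> (of_real t) ?y) $ c) (\<lambda>j _. tcoef c j ?y)"
    by (rule asym_map[OF _ taylor[of i "norm ?y" c], where \<pi>="\<lambda>_. ?y"]) simp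
  have t: "asym i {()} (\<lambda>t _. F (\<Phi> (of_real t) x) $ c) (\<lambda>j _. tcoef c j x)"
    by (rule asym_map[OF _ taylor[of i "norm x" c], where \<pi>="\<lambda>_. x"]) simp
  obtain C where C: "\<forall>\<^sub>F t in at_right 0. \<forall>_\<in>{()}. cmod (F (\<Phi> (of_real t) x) $ c - (\<Sum>j\<le>i. tcoef c j x * of_real t ^ j)) \<le> C * t ^ Suc i"
    using asym_remainder[OF t] by blast
  have "filterlim (\<lambda>t. t * s) (at_right 0) (at_right 0)"
  proof (rule filterlim_at_withinI)
    have "((\<lambda>t. t * s) \<longlongrightarrow> 0 * s) (at_right 0)" by (intro tendsto_intros)
    then show "((\<lambda>t. t * s) \<longlongrightarrow> 0) (at_right 0)" by simp
    show "\<forall>\<^sub>F t in at_right 0. t * s \<in> {0<..} - {0}"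
      using eventually_pos by eventually_elim (use s in simp)
  qed
  from eventually_compose_filterlim[OF C this]
  have "\<forall>\<^sub>F t in at_right 0. cmod (F (\<Phi> (of_real (t * s)) x) $ c - (\<Sum>j\<le>i. tcoef c j x * of_real (t * s) ^ j)) \<le> C * (t * s) ^ Suc i"
    by simp
  then have ev: "\<forall>\<^sub>F t in at_right 0. \<forall>_\<in>{()}. cmod (F (\<Phi> (of_real t) ?y) $ c - (\<Sum>j\<le>i. of_real s ^ j * tcoef c j x * of_real t ^ j)) \<le> (C * s ^ Suc i) * t ^ Suc i"
  proof eventually_elim
    case (elim t)
    have "\<Phi> (of_real (t * s)) x = \<Phi> (of_real t) ?y" unfolding of_real_mult by (rule \<Phi>_scale)
    then show ?case using elim by (simp only: of_real_mult power_mult_distrib mult_ac ball_simps simp_thms)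
  qed
  have "asym i {()} (\<lambda>t _. F (\<Phi> (of_real t) ?y) $ c) (\<lambda>j _. of_real s ^ j * tcoef c j x)"
    by (rule asymI[OF _ ev]) auto
  from asym_unique[OF 1 this, of i "()"] show ?thesis by simp
qed

text \<open>On the normal axis the dilation is p + t^2 \<nu>, so a first derivative of F along \<nu>
  appears at order 2 in t.\<close>

lemma tcoef_2_normal: "tcoef c 2 nn = dird \<nu> F p $ c"
proof -
  define G where "G t = dird \<nu> (\<lambda>z. F z $ c) (p + (t * t) *s \<nu>)" for t
  obtain \<epsilon>' where \<epsilon>': "\<epsilon>' > 0" "\<And>t x. cmod t \<le> \<epsilon>' \<Longrightarrow> norm x \<le> norm nn \<Longrightarrow> adjoin t x \<in> \<Omega>"
    using uniform_domain[of "norm nn"] by blast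
  have U: "p + (t * t) *s \<nu> \<in> U" if "cmod t \<le> \<epsilon>'" for t
    using \<epsilon>'(2)[OF that, of nn] by (simp add: \<Omega>_def \<Theta>_adjoin \<Phi>_normal)
  have 0: "tder c 0 (adjoin t nn) = F (p + (t * t) *s \<nu>) $ c" for t
    by (simp add: tder_def \<Theta>_adjoin \<Phi>_normal)
  have 1: "tder c (Suc 0) (adjoin t nn) = 2 * t * G t" if t: "cmod t \<le> \<epsilon>'" for t
  proof -
    have a: "((\<lambda>t. F (p + (t * t) *s \<nu>) $ c) has_field_derivative tder c (Suc 0) (adjoin t nn)) (at t)"
      using tder_line[of t nn c 0] \<epsilon>'(2)[OF t, of nn] by (simp add: 0)
    have "((\<lambda>t. t * t) has_field_derivative 2 * t) (at t)" by (auto intro!: derivative_eq_intros)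
    from DERIV_chain2[OF holo_line[OF holomorphic_map_comp[OF F_hol] U[OF t]] this]
    have "((\<lambda>t. F (p + (t * t) *s \<nu>) $ c) has_field_derivative G t * (2 * t)) (at t)" by (simp add: G_def)
    from DERIV_unique[OF a this] show ?thesis by simp
  qed
  have "((\<lambda>t. tder c (Suc 0) (adjoin t nn)) has_field_derivative tder c (Suc (Suc 0)) (adjoin 0 nn)) (at 0)"
    by (rule tder_line[OF adjoin_0_\<Omega>])
  then have a: "((\<lambda>t. 2 * t * G t) has_field_derivative tder c (Suc (Suc 0)) (adjoin 0 nn)) (at 0)"
    by (rule has_field_derivative_transform_within_open[of _ _ _ "ball 0 \<epsilon>'"]) (use \<epsilon>'(1) 1 in auto)
  have "((\<lambda>t. t * t) has_field_derivative 0) (at (0::complex))" by (auto intro!: derivative_eq_intros)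
  moreover have "((\<lambda>t. dird \<nu> (\<lambda>z. F z $ c) (p + t *s \<nu>)) has_field_derivative dird \<nu> (dird \<nu> (\<lambda>z. F z $ c)) (p + (0*0) *s \<nu>)) (at (0 * 0))"
    by (rule holo_line[OF holo_dird[OF open_U holomorphic_map_comp[OF F_hol]]]) (use p_U in simp)
  ultimately have "(G has_field_derivative 0) (at 0)"
    unfolding G_def[abs_def] using DERIV_chain2[where f="\<lambda>t. dird \<nu> (\<lambda>z. F z $ c) (p + t *s \<nu>)" and g="\<lambda>t. t * t" and x=0] by fastforce
  then have b: "((\<lambda>t. 2 * t * G t) has_field_derivative 2 * G 0) (at 0)"
    by (auto intro!: derivative_eq_intros)
  have "tder c 2 (adjoin 0 nn) = 2 * G 0" using DERIV_unique[OF a b] by (simp add: numeral_2_eq_2)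
  then have "tcoef c 2 nn = G 0" by (simp add: tcoef_def)
  also have "G 0 = dird \<nu> F p $ c" by (simp add: G_def holomorphic_map_dird_nth[OF F_hol p_U])
  finally show ?thesis .
qed

text \<open>On the normal axis the coefficient satisfies \<phi>(s^2 t) = s^k \<phi>(t). With s = 2
  this gives 4 \<phi>'(0) = 2^k \<phi>'(0), so \<phi>'(0) = 0 unless k = 2; for k = 2, \<phi> is
  linear on the positive reals and \<phi>'(0) = \<phi>(1).\<close>

lemma dird_normal_tcoef: "dird nn (tcoef c k) 0 = (if k = 2 then dird \<nu> F p $ c else 0)"
proof -
  define \<phi> where "\<phi> t = tcoef c k (t *s nn)" for t
  have d: "(\<phi> has_field_derivative dird nn (tcoef c k) 0) (at 0)"
    using holo_line[OF tcoef_hol, of 0 0 nn c k] by (simp add: \<phi>_def[abs_def])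
  have sc: "\<phi> (of_real (s * s) * t) = of_real s ^ k * \<phi> t" if "(0::real) < s" for s t
  proof -
    have "(of_real (s * s) * t) *s nn = (\<chi> j. (if j = n0 then of_real s * of_real s else of_real s) * (t *s nn) $ j)"
      by (simp add: vec_eq_iff axis_nth_if)
    then show ?thesis unfolding \<phi>_def using tcoef_scale[OF that, of c k "t *s nn"] by (simp only:)
  qed
  show ?thesis
  proof (cases "k = 2")
    case False
    have "((\<lambda>t. \<phi> (4 * t)) has_field_derivative dird nn (tcoef c k) 0 * 4) (at 0)"
      by (rule DERIV_chain2[of \<phi>]) (use d in \<open>auto intro!: derivative_eq_intros\<close>)
    moreover have "(\<lambda>t. \<phi> (4 * t)) = (\<lambda>t. 2 ^ k * \<phi> t)" using sc[of 2] by auto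
    moreover have "((\<lambda>t. 2 ^ k * \<phi> t) has_field_derivative 2 ^ k * dird nn (tcoef c k) 0) (at 0)"
      by (rule DERIV_cmult[OF d])
    ultimately have "dird nn (tcoef c k) 0 * 4 = 2 ^ k * dird nn (tcoef c k) 0" using DERIV_unique by metis
    moreover have "(2::complex) ^ k \<noteq> 4"
    proof
      assume "(2::complex) ^ k = 4"
      then have "of_nat (2 ^ k) = (of_nat (2 ^ 2) :: complex)" by simp
      then have "(2::nat) ^ k = 2 ^ 2" by (simp only: of_nat_eq_iff)
      then show False using False by (simp only: power_inject_exp)
    qed
    ultimately show ?thesis using False by (simp add: mult.commute)
  next
    case True
    define h :: "nat \<Rightarrow> real" where "h n = inverse (of_nat (Suc n))" for n
    have h: "h n > 0" for n by (simp add: h_def)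
    have \<phi>h: "\<phi> (of_real (h n)) = of_real (h n) * \<phi> 1" for n
    proof -
      have "sqrt (h n) * sqrt (h n) = h n" using h[of n] by simp
      then show ?thesis using sc[of "sqrt (h n)" 1] h[of n] True by (simp add: power2_eq_square flip: of_real_mult)
    qed
    have \<phi>0: "\<phi> 0 = 0" using ft_at_0 True sc[of 2 0] by simp
    have "((\<lambda>z. (\<phi> (0 + z) - \<phi> 0) / z) \<longlongrightarrow> dird nn (tcoef c k) 0) (at 0)"
      using d by (simp add: DERIV_def)
    moreover have "filterlim (\<lambda>n. complex_of_real (h n)) (at 0) sequentially"
    proof (rule filterlim_atI)
      have "(\<lambda>n. complex_of_real (h n)) \<longlonglongrightarrow> of_real 0" unfolding h_def by (intro tendsto_of_real LIMSEQ_inverse_real_of_nat)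
      then show "(\<lambda>n. complex_of_real (h n)) \<longlonglongrightarrow> 0" by simp
      show "\<forall>\<^sub>F n in sequentially. complex_of_real (h n) \<noteq> 0"
        by (rule always_eventually) (use h in \<open>simp add: less_imp_neq[symmetric]\<close>)
    qed
    ultimately have "(\<lambda>n. (\<phi> (0 + of_real (h n)) - \<phi> 0) / of_real (h n)) \<longlonglongrightarrow> dird nn (tcoef c k) 0"
      by (rule filterlim_compose)
    moreover have "(\<phi> (0 + of_real (h n)) - \<phi> 0) / of_real (h n) = \<phi> 1" for n
      using h[of n] by (simp add: \<phi>h \<phi>0)
    ultimately have "dird nn (tcoef c k) 0 = \<phi> 1" using LIMSEQ_unique[OF _ tendsto_const] by simp
    also have "\<phi> 1 = dird \<nu> F p $ c" using tcoef_2_normal[of c] True by (simp add: \<phi>_def)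
    finally show ?thesis using True by simp
  qed
qed

text \<open>The derivative of the polarised equation in its second slot along dF \<nu>; a tangent
  vector has homogenising coordinate 0.\<close>

definition "normal_deriv = Rq (homog (F p)) (\<lambda>c. if c = 0 then 0 else dird \<nu> F p $ e c)"

text \<open>At the origin only order 0 survives in the first slot, which leaves order k for the
  second, and its normal derivative is nonzero at most for k = 2. This is what pins down the order
  of a kernel with nonzero \<alpha>.\<close>

lemma Kern_normal: "herm_form (m k) (hk k) (\<lambda>a. fe k a 0) (\<lambda>a. dird nn (fe k a) 0) = (if k = 2 then normal_deriv else 0)"
proof -
  have d: "dird nn (ft i c) 0 = (if c = 0 then 0 else if i = 2 then dird \<nu> F p $ e c else 0)" for i c
  proof (cases "c = 0")
    case True
    have "dird nn (\<lambda>x::complex^'n. if i = 0 then 1 else (0::complex)) 0 = 0" by (rule dird_eq[OF has_derivative_const])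
    then show ?thesis using True by (simp add: ft_def[abs_def])
  next
    case False
    then show ?thesis using dird_normal_tcoef[of "e c" i] by (simp add: ft_def[abs_def])
  qed
  have "herm_form (m k) (hk k) (\<lambda>a. fe k a 0) (\<lambda>a. dird nn (fe k a) 0)
      = (\<Sum>i\<le>k. Rq (\<lambda>c. ft i c 0) (\<lambda>c. dird nn (ft (k - i) c) 0))"
    unfolding fe_def[abs_def] by (rule herm_form_graded[where \<omega>="\<lambda>i c. ft i c 0" and \<omega>'="\<lambda>i c. dird nn (ft i c) 0"]) simp
  also have "\<dots> = (\<Sum>i\<le>k. if i = 0 then Rq (homog (F p)) (\<lambda>c. dird nn (ft k c) 0) else 0)"
    by (rule sum.cong[OF refl]) (simp add: ft_at_0 herm_form_def)
  also have "\<dots> = Rq (homog (F p)) (\<lambda>c. dird nn (ft k c) 0)" by simp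
  also have "\<dots> = (if k = 2 then normal_deriv else 0)"
    unfolding d normal_deriv_def by (cases "k = 2") (simp_all add: herm_form_def cong: if_cong)
  finally show ?thesis .
qed

theorem Kern_dichotomy:
  assumes approach: "\<And>x \<delta>. qrho \<epsilon> n0 x x = 0 \<Longrightarrow> 0 < \<delta> \<Longrightarrow>
     \<forall>\<^sub>F t in at_right 0. \<exists>y. dist y x < \<delta> \<and> Rq (homog (F (\<Phi> (of_real t) y))) (homog (F (\<Phi> (of_real t) y))) = 0"
  shows "(\<forall>k x y. Kern k x y = 0) \<or>
    (normal_deriv \<noteq> 0 \<and> (\<forall>k x y. k < 2 \<longrightarrow> Kern k x y = 0) \<and> (\<forall>x. qrho \<epsilon> n0 x x = 0 \<longrightarrow> Kern 2 x x = 0))"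
proof (cases "\<forall>k x y. Kern k x y = 0")
  case False
  then have ex: "\<exists>k. \<exists>x y. Kern k x y \<noteq> 0" by blast
  define k where "k = (LEAST k. \<exists>x y. Kern k x y \<noteq> 0)"
  have k: "\<exists>x y. Kern k x y \<noteq> 0" unfolding k_def by (rule LeastI_ex[OF ex])
  have lower: "Kern j x y = 0" if "j < k" for j x y
    using not_less_Least[of j "\<lambda>k. \<exists>x y. Kern k x y \<noteq> 0"] that unfolding k_def by blast
  have vanish: "Kern k x x = 0" if x: "qrho \<epsilon> n0 x x = 0" for x
    by (rule Kern_vanish[of k x, OF lower approach[OF x]])
  interpret T: few_positive_kernel n0 \<epsilon> l "m k" "hk k" "fe k"
  proof
    show "holo UNIV (fe k a)" for a unfolding fe_def[abs_def] by (rule ft_holo)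
    show "hk k b a = cnj (hk k a b)" for a b
      by (rule graded_matrix_cnj, rule quad_matrix_cnj) (use l_less in simp)
    show "herm_form (m k) (hk k) (\<lambda>a. fe k a x) (\<lambda>a. fe k a x) = 0" if "qrho \<epsilon> n0 x x = 0" for x
      unfolding Kern_herm by (rule vanish[OF that])
    show "few_positive (m k) (hk k) l (fe k)" by (rule Kern_few_positive[OF lower])
  qed (fact lpos card_pos card_neg | rule eps, assumption)+
  have "T.\<alpha> 0 \<noteq> 0" using T.kernel_zero k unfolding Kern_herm by blast
  then have "k = 2" "normal_deriv \<noteq> 0" unfolding T.\<alpha>_def Kern_normal by (auto split: if_splits)
  then show ?thesis using lower vanish by blast
qed simp

end

section \<open>Second-order calculus at a point\<close>

lemma dird_mvt:
  fixes f :: "'a::euclidean_space \<Rightarrow> real"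
  assumes d: "\<And>s. 0 \<le> s \<Longrightarrow> s \<le> t \<Longrightarrow> f differentiable (at (x + s *\<^sub>R u))" and t: "0 < t"
  obtains s where "0 < s" "s < t" "f (x + t *\<^sub>R u) - f x = t * dird u f (x + s *\<^sub>R u)"
proof -
  have der: "((\<lambda>s. f (x + s *\<^sub>R u)) has_real_derivative dird u f (x + s *\<^sub>R u)) (at s)" if "0 \<le> s" "s \<le> t" for s
  proof -
    have 1: "((\<lambda>s. x + s *\<^sub>R u) has_derivative (\<lambda>h. h *\<^sub>R u)) (at s)" by (auto intro!: derivative_eq_intros)
    have 2: "(f has_derivative (\<lambda>v. dird v f (x + s *\<^sub>R u))) (at (x + s *\<^sub>R u))"
      by (rule differentiable_dird[OF d[OF that]])
    have "((\<lambda>s. f (x + s *\<^sub>R u)) has_derivative (\<lambda>h. dird (h *\<^sub>R u) f (x + s *\<^sub>R u))) (at s)"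
      using diff_chain_at[OF 1 2] by (simp add: o_def)
    moreover have "(\<lambda>h. dird (h *\<^sub>R u) f (x + s *\<^sub>R u)) = (*) (dird u f (x + s *\<^sub>R u))"
      using linear_scale[OF has_derivative_linear[OF 2]] by (auto simp: mult.commute)
    ultimately show ?thesis by (simp add: has_field_derivative_def)
  qed
  from MVT2[OF t der] obtain s where "0 < s" "s < t" "f (x + t *\<^sub>R u) - f (x + 0 *\<^sub>R u) = (t - 0) * dird u f (x + s *\<^sub>R u)"
    by auto
  then show ?thesis by (intro that[of s]) auto
qed

lemma second_difference:
  fixes f :: "'a::euclidean_space \<Rightarrow> real"
  assumes V: "\<And>y. norm (y - x) \<le> t * (norm u + norm v) \<Longrightarrow> f differentiable (at y)"
    "\<And>y. norm (y - x) \<le> t * (norm u + norm v) \<Longrightarrow> dird u f differentiable (at y)" and t: "0 < t"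
  obtains y where "norm (y - x) \<le> t * (norm u + norm v)"
    "f (x + t *\<^sub>R u + t *\<^sub>R v) - f (x + t *\<^sub>R u) - f (x + t *\<^sub>R v) + f x = t * (t * dird v (dird u f) y)"
proof -
  have b: "norm (x + s *\<^sub>R u + r *\<^sub>R v - x) \<le> t * (norm u + norm v)" if "0 \<le> s" "s \<le> t" "0 \<le> r" "r \<le> t" for s r
  proof -
    have "norm (s *\<^sub>R u + r *\<^sub>R v) \<le> s * norm u + r * norm v" using that by (intro norm_triangle_le) simp
    also have "\<dots> \<le> t * norm u + t * norm v" using that by (intro add_mono mult_right_mono) auto
    finally show ?thesis by (simp add: algebra_simps)
  qed
  define g where "g y = f (y + t *\<^sub>R v) - f y" for y
  have dg: "(g has_derivative (\<lambda>w. dird w f (x + s *\<^sub>R u + t *\<^sub>R v) - dird w f (x + s *\<^sub>R u))) (at (x + s *\<^sub>R u))" if s: "0 \<le> s" "s \<le> t" for s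
  proof -
    have 1: "((\<lambda>y. y + t *\<^sub>R v) has_derivative (\<lambda>w. w)) (at (x + s *\<^sub>R u))" by (auto intro!: derivative_eq_intros)
    have "(f has_derivative (\<lambda>w. dird w f (x + s *\<^sub>R u + t *\<^sub>R v))) (at (x + s *\<^sub>R u + t *\<^sub>R v))"
      by (intro differentiable_dird V(1) b) (use s t in auto)
    from diff_chain_at[OF 1 this] have 2: "((\<lambda>y. f (y + t *\<^sub>R v)) has_derivative (\<lambda>w. dird w f (x + s *\<^sub>R u + t *\<^sub>R v))) (at (x + s *\<^sub>R u))"
      by (simp add: o_def)
    have 3: "(f has_derivative (\<lambda>w. dird w f (x + s *\<^sub>R u))) (at (x + s *\<^sub>R u))"
      by (intro differentiable_dird V(1)) (use b[of s 0] s t in auto)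
    show ?thesis unfolding g_def[abs_def] by (rule has_derivative_diff[OF 2 3])
  qed
  obtain s where s: "0 < s" "s < t" "g (x + t *\<^sub>R u) - g x = t * dird u g (x + s *\<^sub>R u)"
    by (rule dird_mvt[of t g x u]) (use dg t in \<open>auto simp: differentiable_def\<close>)
  have "dird u g (x + s *\<^sub>R u) = dird u f (x + s *\<^sub>R u + t *\<^sub>R v) - dird u f (x + s *\<^sub>R u)"
    by (rule dird_eq[OF dg]) (use s in auto)
  moreover obtain r where r: "0 < r" "r < t" "dird u f (x + s *\<^sub>R u + t *\<^sub>R v) - dird u f (x + s *\<^sub>R u) = t * dird v (dird u f) (x + s *\<^sub>R u + r *\<^sub>R v)"
  proof (rule dird_mvt[of t "dird u f" "x + s *\<^sub>R u" v])
    show "dird u f differentiable (at (x + s *\<^sub>R u + r *\<^sub>R v))" if "0 \<le> r" "r \<le> t" for r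
      by (intro V(2) b) (use s that in auto)
  qed (use t in auto)
  ultimately have "g (x + t *\<^sub>R u) - g x = t * (t * dird v (dird u f) (x + s *\<^sub>R u + r *\<^sub>R v))" using s(3) by simp
  then show ?thesis
    by (intro that[OF b[of s r]]) (use s r in \<open>auto simp: g_def algebra_simps\<close>)
qed

text \<open>Both iterated derivatives are limits of one second difference quotient, which is
  symmetric in u and v.\<close>

lemma dird_symmetric:
  fixes f :: "'a::euclidean_space \<Rightarrow> real"
  assumes V: "open V" "x \<in> V" and f: "smooth_on V f"
  shows "dird u (dird v f) x = dird v (dird u f) x"
proof -
  have sm: "smooth_on V (dird w f)" for w
    using f unfolding smooth_on_def using C_k_on_Suc_dird by blast
  have sm2: "continuous_on V (dird w' (dird w f))" for w w'
    using sm[of w] unfolding smooth_on_def using C_k_on_Suc_dird[of 0] by (metis C_k_on.simps(1))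
  obtain d where d: "d > 0" "ball x d \<subseteq> V" using V open_contains_ball by blast
  have "dist (dird u (dird v f) x) (dird v (dird u f) x) \<le> r" if r: "r > 0" for r
  proof -
    have c1: "isCont (dird u (dird v f)) x" and c2: "isCont (dird v (dird u f)) x"
      using continuous_on_eq_continuous_at[OF V(1)] sm2 V(2) by blast+
    have "\<exists>d1>0. \<forall>y. norm (y - x) < d1 \<longrightarrow> norm (dird u (dird v f) y - dird u (dird v f) x) < r/2"
      using iffD1[OF continuous_at_eps_delta c1, THEN spec, THEN mp, OF half_gt_zero[OF r]] unfolding dist_norm .
    moreover have "\<exists>d2>0. \<forall>y. norm (y - x) < d2 \<longrightarrow> norm (dird v (dird u f) y - dird v (dird u f) x) < r/2"
      using iffD1[OF continuous_at_eps_delta c2, THEN spec, THEN mp, OF half_gt_zero[OF r]] unfolding dist_norm .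
    ultimately obtain d1 d2 where d1: "d1 > 0" "\<And>y. norm (y - x) < d1 \<Longrightarrow> norm (dird u (dird v f) y - dird u (dird v f) x) < r/2"
      and d2: "d2 > 0" "\<And>y. norm (y - x) < d2 \<Longrightarrow> norm (dird v (dird u f) y - dird v (dird u f) x) < r/2"
      by blast
    define \<delta> where "\<delta> = min d (min d1 d2)"
    define t where "t = \<delta> / (2 * (norm u + norm v + 1))"
    have \<delta>: "\<delta> > 0" using d(1) d1(1) d2(1) by (simp add: \<delta>_def)
    have nn: "norm u + norm v + 1 > 0" by (simp add: add_nonneg_pos)
    have t: "t > 0" using \<delta> nn by (simp add: t_def)
    have tn: "t * (norm u + norm v) < \<delta>"
    proof -
      have "t * (norm u + norm v) \<le> t * (norm u + norm v + 1)" using t by simp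
      also have "\<dots> = \<delta> / 2" using nn unfolding t_def by (simp add: field_simps)
      finally show ?thesis using \<delta> by simp
    qed
    have in_V: "y \<in> V" if "norm (y - x) \<le> t * (norm u + norm v)" for y
    proof -
      have "norm (y - x) < \<delta>" using that tn by linarith
      then have "norm (x - y) < d" by (simp add: \<delta>_def norm_minus_commute)
      then show ?thesis using d(2) by (auto simp: dist_norm)
    qed
    have in_V': "y \<in> V" if "norm (y - x) \<le> t * (norm v + norm u)" for y
      by (rule in_V) (use that in \<open>simp add: add.commute\<close>)
    obtain y where y: "norm (y - x) \<le> t * (norm u + norm v)"
      "f (x + t *\<^sub>R u + t *\<^sub>R v) - f (x + t *\<^sub>R u) - f (x + t *\<^sub>R v) + f x = t * (t * dird v (dird u f) y)"
      using second_difference[of x t u v f, OF smooth_on_differentiable[OF f in_V] smooth_on_differentiable[OF sm in_V] t] by blast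
    obtain y' where y': "norm (y' - x) \<le> t * (norm v + norm u)"
      "f (x + t *\<^sub>R v + t *\<^sub>R u) - f (x + t *\<^sub>R v) - f (x + t *\<^sub>R u) + f x = t * (t * dird u (dird v f) y')"
      using second_difference[of x t v u f, OF smooth_on_differentiable[OF f in_V'] smooth_on_differentiable[OF sm in_V'] t] by blast
    have "t * (t * dird v (dird u f) y) = t * (t * dird u (dird v f) y')"
      unfolding y(2)[symmetric] y'(2)[symmetric] by (simp add: add.commute add.left_commute)
    then have "dird v (dird u f) y = dird u (dird v f) y'" using t by simp
    moreover have "norm (dird v (dird u f) y - dird v (dird u f) x) < r/2"
      by (rule d2(2)) (use y(1) tn in \<open>simp add: \<delta>_def dist_norm\<close>)
    moreover have "norm (dird u (dird v f) y' - dird u (dird v f) x) < r/2"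
      by (rule d1(2)) (use y'(1) tn in \<open>simp add: \<delta>_def dist_norm add.commute\<close>)
    ultimately show ?thesis unfolding dist_real_def real_norm_def by linarith
  qed
  then have "dist (dird u (dird v f) x) (dird v (dird u f) x) \<le> 0" by (rule field_le_epsilon[of _ 0, simplified])
  then show ?thesis by simp
qed

lemma complex_vec_real_expand:
  "(a :: complex^'n::finite) = (\<Sum>j\<in>UNIV. Re (a $ j) *\<^sub>R axis j 1 + Im (a $ j) *\<^sub>R axis j \<i>)"
proof -
  have "axis j (a $ j) = Re (a $ j) *\<^sub>R axis j 1 + Im (a $ j) *\<^sub>R axis j \<i>" for j
    by (auto simp: vec_eq_iff axis_def complex_eq_iff)
  then show ?thesis using vec_eq_sum_axis[of a] by simp
qed

lemma linear_complex_expand: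
  fixes f :: "complex^'n::finite \<Rightarrow> 'b::real_vector"
  assumes "linear f"
  shows "f a = (\<Sum>j\<in>UNIV. Re (a $ j) *\<^sub>R f (axis j 1) + Im (a $ j) *\<^sub>R f (axis j \<i>))"
  by (subst complex_vec_real_expand)
    (simp add: linear_sum[OF assms, of "\<lambda>j. Re (a $ j) *\<^sub>R axis j 1 + Im (a $ j) *\<^sub>R axis j \<i>" UNIV] linear_add[OF assms] linear_scale[OF assms])

text \<open>In spite of the name this is the (1,0)-part \<partial>f of the differential, applied to
  a: it is complex linear in a and equals \<Sum> a_j \<partial>f/\<partial>z_j by
  \<open>sum_wirtinger\<close>.\<close>

definition dbar :: "(complex^'n::finite \<Rightarrow> real) \<Rightarrow> complex^'n \<Rightarrow> complex^'n \<Rightarrow> complex" where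
  "dbar f q a = (of_real (dird a f q) - \<i> * of_real (dird (\<i> *s a) f q)) / 2"

lemma dird_of_real: "f differentiable (at x) \<Longrightarrow> dird v (\<lambda>z. complex_of_real (f z)) x = of_real (dird v f x)"
  by (rule dird_eq) (rule bounded_linear.has_derivative[OF bounded_linear_of_real differentiable_dird])

lemma sum_wirtinger:
  fixes f :: "complex^'n::finite \<Rightarrow> real"
  assumes "f differentiable (at q)"
  shows "(\<Sum>j\<in>UNIV. a $ j * wirtinger j (\<lambda>z. complex_of_real (f z)) q) = dbar f q a"
proof -
  have lin: "linear (\<lambda>v. dird v f q)" by (rule has_derivative_linear[OF differentiable_dird[OF assms]])
  have w: "wirtinger j (\<lambda>z. complex_of_real (f z)) q = (of_real (dird (axis j 1) f q) - \<i> * of_real (dird (axis j \<i>) f q)) / 2" for j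
    unfolding wirtinger_def dird_def[symmetric] using dird_of_real[OF assms] by simp
  have "dird a f q = (\<Sum>j\<in>UNIV. Re (a $ j) * dird (axis j 1) f q + Im (a $ j) * dird (axis j \<i>) f q)"
    using linear_complex_expand[OF lin, of a] by simp
  moreover have "dird (\<i> *s a) f q = (\<Sum>j\<in>UNIV. - Im (a $ j) * dird (axis j 1) f q + Re (a $ j) * dird (axis j \<i>) f q)"
    using linear_complex_expand[OF lin, of "\<i> *s a"] by simp
  moreover have "(\<Sum>j\<in>UNIV. a $ j * ((complex_of_real (dird (axis j 1) f q) - \<i> * complex_of_real (dird (axis j \<i>) f q)) / 2))
     = (\<Sum>j\<in>UNIV. a $ j * (complex_of_real (dird (axis j 1) f q) - \<i> * complex_of_real (dird (axis j \<i>) f q))) / 2"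
    by (simp add: sum_divide_distrib)
  ultimately show ?thesis unfolding dbar_def w
    by (simp add: complex_eq_iff Re_sum Im_sum sum_subtractf sum.distrib sum_negf)
qed

lemma dbar_linear:
  assumes "f differentiable (at q)"
  shows "dbar f q (a + b) = dbar f q a + dbar f q b" "dbar f q (c *s a) = c * dbar f q a"
  unfolding sum_wirtinger[OF assms, symmetric] by (simp_all add: sum.distrib sum_distrib_left algebra_simps)

lemma Re_dbar: "Re (dbar f q a) = dird a f q / 2"
  by (simp add: dbar_def)

definition hess :: "('a::real_normed_vector \<Rightarrow> real) \<Rightarrow> 'a \<Rightarrow> 'a \<Rightarrow> 'a \<Rightarrow> real" where
  "hess f q u v = dird u (dird v f) q"

text \<open>The (1,1)-part of the real Hessian, which is the Levi form without coordinates;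
  \<open>hess20\<close> is the (2,0)-part, with coefficients \<partial>^2 f / \<partial>z_j
  \<partial>z_k.\<close>

definition hess11 :: "(complex^'n::finite \<Rightarrow> real) \<Rightarrow> complex^'n \<Rightarrow> complex^'n \<Rightarrow> complex^'n \<Rightarrow> complex" where
  "hess11 f q a b = (of_real (hess f q a b + hess f q (\<i> *s a) (\<i> *s b)) + \<i> * of_real (hess f q a (\<i> *s b) - hess f q (\<i> *s a) b)) / 4"

definition hess20 :: "(complex^'n::finite \<Rightarrow> real) \<Rightarrow> complex^'n \<Rightarrow> complex^'n \<Rightarrow> complex^'n \<Rightarrow> complex" where
  "hess20 f q a b = (of_real (hess f q a b - hess f q (\<i> *s a) (\<i> *s b)) - \<i> * of_real (hess f q a (\<i> *s b) + hess f q (\<i> *s a) b)) / 4"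

lemma smooth_on_dird: "smooth_on V f \<Longrightarrow> smooth_on V (dird w f)"
  unfolding smooth_on_def using C_k_on_Suc_dird by blast

lemma i_i_vec: "\<i> *s (\<i> *s a) = - (a :: complex^'n::finite)"
  by (simp add: vec_eq_iff)

lemma vscale_add_right: "c *s (a + b) = c *s a + c *s (b :: complex^'n::finite)"
  by (simp add: vec_eq_iff distrib_left)

lemma vscale_split: "c *s a = Re c *\<^sub>R a + Im c *\<^sub>R (\<i> *s (a :: complex^'n::finite))"
  by (simp add: vec_eq_iff complex_eq_iff)

lemma complex_linearI:
  fixes g :: "complex^'n::finite \<Rightarrow> complex"
  assumes "linear g" "\<And>a. g (\<i> *s a) = \<i> * g a"
  shows "g (c *s a) = c * g a"
proof -
  have "g (c *s a) = Re c *\<^sub>R g a + Im c *\<^sub>R (\<i> * g a)"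
    by (subst vscale_split) (simp add: linear_add[OF assms(1)] linear_scale[OF assms(1)] assms(2))
  also have "\<dots> = c * g a" by (simp add: complex_eq_iff)
  finally show ?thesis .
qed

section \<open>Hessian and Levi form of a smooth real function\<close>

context
  fixes V :: "(complex^'n::finite) set" and f :: "complex^'n \<Rightarrow> real" and q
  assumes V: "open V" "q \<in> V" and f: "smooth_on V f"
begin

lemma hess_linear_left: "linear (\<lambda>u. hess f q u v)"
  unfolding hess_def by (rule has_derivative_linear[OF differentiable_dird[OF smooth_on_differentiable[OF smooth_on_dird[OF f] V(2)]]])

lemma hess_sym: "hess f q u v = hess f q v u"
  unfolding hess_def by (rule dird_symmetric[OF V f])

lemma hess_linear_right: "linear (\<lambda>v. hess f q u v)"
  using hess_linear_left[of u] by (simp add: hess_sym[of u])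

lemmas hess_add = linear_add[OF hess_linear_left] linear_add[OF hess_linear_right]
lemmas hess_scale = linear_scale[OF hess_linear_left] linear_scale[OF hess_linear_right]
lemmas hess_neg = linear_neg[OF hess_linear_left] linear_neg[OF hess_linear_right]

lemma hess11_cnj: "cnj (hess11 f q a b) = hess11 f q b a"
  unfolding hess11_def by (simp add: complex_eq_iff hess_sym[of b a] hess_sym[of "\<i> *s b" "\<i> *s a"] hess_sym[of b "\<i> *s a"] hess_sym[of "\<i> *s b" a])

lemma hess11_add_left: "hess11 f q (a + a') b = hess11 f q a b + hess11 f q a' b"
  unfolding hess11_def vscale_add_right hess_add by (simp add: complex_eq_iff add_divide_distrib diff_divide_distrib)

lemma hess11_scale_left: "hess11 f q (c *s a) b = c * hess11 f q a b"
proof (rule complex_linearI)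
  show "linear (\<lambda>a. hess11 f q a b)"
  proof (rule linearI)
    show "hess11 f q (r *\<^sub>R a) b = r *\<^sub>R hess11 f q a b" for r a
    proof -
      have "\<i> *s (r *\<^sub>R a) = r *\<^sub>R (\<i> *s a)" by (simp add: vec_eq_iff)
      then show ?thesis unfolding hess11_def by (simp add: hess_scale complex_eq_iff algebra_simps)
    qed
  qed (rule hess11_add_left)
  show "hess11 f q (\<i> *s a) b = \<i> * hess11 f q a b" for a
    unfolding hess11_def i_i_vec hess_neg by (simp add: complex_eq_iff algebra_simps)
qed

lemma hess20_sym: "hess20 f q a b = hess20 f q b a"
  unfolding hess20_def by (simp add: complex_eq_iff hess_sym[of b a] hess_sym[of "\<i> *s b" "\<i> *s a"] hess_sym[of b "\<i> *s a"] hess_sym[of "\<i> *s b" a] algebra_simps)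

lemma hess20_add_left: "hess20 f q (a + a') b = hess20 f q a b + hess20 f q a' b"
  unfolding hess20_def vscale_add_right hess_add by (simp add: complex_eq_iff add_divide_distrib diff_divide_distrib)

lemma hess20_scale_left: "hess20 f q (c *s a) b = c * hess20 f q a b"
proof (rule complex_linearI)
  show "linear (\<lambda>a. hess20 f q a b)"
  proof (rule linearI)
    show "hess20 f q (r *\<^sub>R a) b = r *\<^sub>R hess20 f q a b" for r a
    proof -
      have "\<i> *s (r *\<^sub>R a) = r *\<^sub>R (\<i> *s a)" by (simp add: vec_eq_iff)
      then show ?thesis unfolding hess20_def by (simp add: hess_scale complex_eq_iff algebra_simps)
    qed
  qed (rule hess20_add_left)
  show "hess20 f q (\<i> *s a) b = \<i> * hess20 f q a b" for a
    unfolding hess20_def i_i_vec hess_neg by (simp add: complex_eq_iff algebra_simps)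
qed

lemma hess11_add_right: "hess11 f q b (a + a') = hess11 f q b a + hess11 f q b a'"
  using hess11_add_left[of a a' b, THEN arg_cong[where f=cnj]] by (simp add: hess11_cnj)

lemma hess11_scale_right: "hess11 f q b (c *s a) = cnj c * hess11 f q b a"
  using hess11_scale_left[of c a b, THEN arg_cong[where f=cnj]] by (simp add: hess11_cnj)

lemma hess11_0: "hess11 f q 0 b = 0" "hess11 f q b 0 = 0"
  using hess11_scale_left[of 0 0 b] hess11_scale_right[of b 0 0] by simp_all

lemma hess20_0: "hess20 f q 0 b = 0" "hess20 f q b 0 = 0"
  using hess20_scale_left[of 0 0 b] hess20_sym[of b 0] by simp_all

lemma hess11_sum_left: "hess11 f q (\<Sum>i\<in>I. c i *s a i) b = (\<Sum>i\<in>I. c i * hess11 f q (a i) b)"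
  by (induction I rule: infinite_finite_induct) (simp_all add: hess11_0 hess11_add_left hess11_scale_left)

lemma hess11_sum_right: "hess11 f q b (\<Sum>i\<in>I. c i *s a i) = (\<Sum>i\<in>I. cnj (c i) * hess11 f q b (a i))"
  by (induction I rule: infinite_finite_induct) (simp_all add: hess11_0 hess11_add_right hess11_scale_right)

lemma hess20_sum_left: "hess20 f q (\<Sum>i\<in>I. c i *s a i) b = (\<Sum>i\<in>I. c i * hess20 f q (a i) b)"
  by (induction I rule: infinite_finite_induct) (simp_all add: hess20_0 hess20_add_left hess20_scale_left)

lemma hess20_sum_right: "hess20 f q b (\<Sum>i\<in>I. c i *s a i) = (\<Sum>i\<in>I. c i * hess20 f q b (a i))"
  unfolding hess20_sym[of b] by (rule hess20_sum_left)

lemma hess_decompose: "hess f q a a = 2 * Re (hess20 f q a a) + 2 * Re (hess11 f q a a)"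
  by (simp add: hess11_def hess20_def add_divide_distrib diff_divide_distrib)

lemma vec_axis_sum: "(a :: complex^'n) = (\<Sum>j\<in>UNIV. a $ j *s axis j 1)"
  by (simp add: vec_eq_iff axis_def if_distrib cong: if_cong)

lemma wirtinger_wirtinger_bar:
  "wirtinger j (wirtinger_bar k (\<lambda>z. complex_of_real (f z))) q = hess11 f q (axis j 1) (axis k 1)"
proof -
  have ia: "\<i> *s axis j (1::complex) = axis j \<i>" for j :: 'n by (simp add: vec_eq_iff axis_def)
  let ?w = "\<lambda>z. (complex_of_real (dird (axis k 1) f z) + \<i> * complex_of_real (dird (axis k \<i>) f z)) / 2"
  have w: "wirtinger_bar k (\<lambda>z. complex_of_real (f z)) z = ?w z" if "z \<in> V" for z
    unfolding wirtinger_bar_def dird_def[symmetric] using dird_of_real[OF smooth_on_differentiable[OF f that]] by simp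
  have d: "(?w has_derivative (\<lambda>v. (complex_of_real (dird v (dird (axis k 1) f) q) + \<i> * complex_of_real (dird v (dird (axis k \<i>) f) q)) / 2)) (at q)"
  proof -
    have 1: "((\<lambda>z. complex_of_real (dird b f z)) has_derivative (\<lambda>v. complex_of_real (dird v (dird b f) q))) (at q)" for b
      by (rule bounded_linear.has_derivative[OF bounded_linear_of_real differentiable_dird[OF smooth_on_differentiable[OF smooth_on_dird[OF f] V(2)]]])
    have "((\<lambda>z. (1/2) * (complex_of_real (dird (axis k 1) f z) + \<i> * complex_of_real (dird (axis k \<i>) f z))) has_derivative
       (\<lambda>v. (1/2) * (complex_of_real (dird v (dird (axis k 1) f) q) + \<i> * complex_of_real (dird v (dird (axis k \<i>) f) q)))) (at q)"
      by (intro has_derivative_mult_right has_derivative_add 1)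
    then show ?thesis by simp
  qed
  have D: "dird v (wirtinger_bar k (\<lambda>z. complex_of_real (f z))) q = (complex_of_real (dird v (dird (axis k 1) f) q) + \<i> * complex_of_real (dird v (dird (axis k \<i>) f) q)) / 2" for v
  proof -
    have "?w differentiable (at q)" using d unfolding differentiable_def by blast
    from dird_cong_open(2)[OF V w[symmetric] this] show ?thesis using dird_eq[OF d] by simp
  qed
  show ?thesis
    unfolding wirtinger_def dird_def[symmetric] D hess11_def ia hess_def by (simp add: complex_eq_iff add_divide_distrib diff_divide_distrib)
qed

lemma levi_form_eq: "levi_form f q a b = hess11 f q a b"
proof -
  have "hess11 f q a b = hess11 f q (\<Sum>j\<in>UNIV. a $ j *s axis j 1) (\<Sum>j\<in>UNIV. b $ j *s axis j 1)"
    by (simp only: vec_axis_sum[symmetric])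
  also have "\<dots> = (\<Sum>j\<in>UNIV. \<Sum>k\<in>UNIV. hess11 f q (axis j 1) (axis k 1) * a $ j * cnj (b $ k))"
    unfolding hess11_sum_left hess11_sum_right sum_distrib_left by (simp only: mult_ac, rule sum.swap)
  finally show ?thesis unfolding levi_form_def wirtinger_wirtinger_bar by simp
qed

text \<open>By L'Hopital's rule. The derivative of f along the curve, divided by 2 t, splits into
  half a difference quotient of \<open>dird a f\<close>, which vanishes at q, and a value of
  \<open>dird b f\<close>.\<close>

lemma second_order_limit:
  assumes f0: "f q = 0" and a: "dird a f q = 0"
  shows "((\<lambda>t. f (q + t *\<^sub>R a + (t * t) *\<^sub>R b) / t\<^sup>2) \<longlongrightarrow> hess f q a a / 2 + dird b f q) (at_right 0)"
proof -
  define c where "c t = q + t *\<^sub>R a + (t * t) *\<^sub>R b" for t :: real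
  have c0: "c 0 = q" by (simp add: c_def)
  have dc: "(c has_derivative (\<lambda>h. h *\<^sub>R (a + (2 * t) *\<^sub>R b))) (at t)" for t
    unfolding c_def[abs_def] by (auto intro!: derivative_eq_intros simp: algebra_simps)
  have "isCont c 0" using has_derivative_continuous[OF dc] by simp
  then have "\<forall>\<^sub>F t in at 0. c t \<in> V"
    using topological_tendstoD[of c "c 0" "at 0" V] V by (simp add: isCont_def c0)
  then have evV: "\<forall>\<^sub>F t in at_right 0. c t \<in> V"
    by (rule filter_leD[OF at_le, rotated]) simp
  have chain: "((\<lambda>t. g (c t)) has_real_derivative dird (a + (2 * t) *\<^sub>R b) g (c t)) (at t)" if g: "smooth_on V g" "c t \<in> V" for g t
  proof -
    have 2: "(g has_derivative (\<lambda>v. dird v g (c t))) (at (c t))" by (rule differentiable_dird[OF smooth_on_differentiable[OF g]])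
    have "((\<lambda>t. g (c t)) has_derivative (\<lambda>h. dird (h *\<^sub>R (a + (2 * t) *\<^sub>R b)) g (c t))) (at t)"
      using diff_chain_at[OF dc 2] by (simp add: o_def)
    moreover have "(\<lambda>h. dird (h *\<^sub>R (a + (2 * t) *\<^sub>R b)) g (c t)) = (*) (dird (a + (2 * t) *\<^sub>R b) g (c t))"
      using linear_scale[OF has_derivative_linear[OF 2]] by (auto simp: mult.commute)
    ultimately show ?thesis by (simp add: has_field_derivative_def)
  qed
  have split: "dird (a + (2 * t) *\<^sub>R b) f (c t) = dird a f (c t) + 2 * t * dird b f (c t)" if "c t \<in> V" for t
  proof -
    have lin: "linear (\<lambda>v. dird v f (c t))" by (rule has_derivative_linear[OF differentiable_dird[OF smooth_on_differentiable[OF f that]]])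
    show ?thesis using linear_add[OF lin] linear_scale[OF lin] by simp
  qed
  have lim0: "((\<lambda>t. g (c t)) \<longlongrightarrow> g q) (at_right 0)" if "smooth_on V g" for g :: "complex^'n \<Rightarrow> real"
  proof -
    have "isCont (\<lambda>t. g (c t)) 0" using chain[OF that, of 0] c0 V(2) by (auto intro: DERIV_isCont)
    then show ?thesis unfolding isCont_def c0 by (rule tendsto_within_subset[OF _ subset_UNIV]) 
  qed
  have quot: "((\<lambda>t. dird a f (c t) / t) \<longlongrightarrow> hess f q a a) (at_right 0)"
  proof -
    have "((\<lambda>t. dird a f (c t)) has_real_derivative hess f q a a) (at 0)"
      using chain[OF smooth_on_dird[OF f, of a], of 0] c0 V(2) by (simp add: hess_def)
    then have "((\<lambda>t. (dird a f (c (0 + t)) - dird a f (c 0)) / t) \<longlongrightarrow> hess f q a a) (at 0)"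
      by (simp add: DERIV_def)
    then have "((\<lambda>t. dird a f (c t) / t) \<longlongrightarrow> hess f q a a) (at 0)" by (simp add: c0 a)
    then show ?thesis by (rule tendsto_within_subset[OF _ subset_UNIV])
  qed
  have "((\<lambda>t. (dird a f (c t) / t) / 2 + dird b f (c t)) \<longlongrightarrow> hess f q a a / 2 + dird b f q) (at_right 0)"
    by (intro tendsto_intros quot lim0 smooth_on_dird f) simp
  moreover have "\<forall>\<^sub>F t in at_right 0. (dird a f (c t) / t) / 2 + dird b f (c t) = dird (a + (2 * t) *\<^sub>R b) f (c t) / (2 * t)"
    using evV eventually_at_right_less
  proof eventually_elim
    case (elim t)
    then show ?case unfolding split[OF elim(1)] by (simp add: add_divide_distrib)
  qed
  ultimately have L: "((\<lambda>t. dird (a + (2 * t) *\<^sub>R b) f (c t) / (2 * t)) \<longlongrightarrow> hess f q a a / 2 + dird b f q) (at_right 0)"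
    by (rule Lim_transform_eventually)
  have "((\<lambda>t. f (c t) / t\<^sup>2) \<longlongrightarrow> hess f q a a / 2 + dird b f q) (at_right 0)"
  proof (rule lhopital_right_0[OF _ _ _ _ _ _ L])
    show "((\<lambda>t. f (c t)) \<longlongrightarrow> 0) (at_right 0)" using lim0[OF f] f0 by simp
    have "((\<lambda>t::real. t\<^sup>2) \<longlongrightarrow> 0\<^sup>2) (at_right 0)" by (intro tendsto_intros)
    then show "((\<lambda>t::real. t\<^sup>2) \<longlongrightarrow> 0) (at_right 0)" by simp
    show "\<forall>\<^sub>F t::real in at_right 0. t\<^sup>2 \<noteq> 0" "\<forall>\<^sub>F t::real in at_right 0. 2 * t \<noteq> 0"
      using eventually_at_right_less[of "0::real"] by (auto elim!: eventually_mono)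
    show "\<forall>\<^sub>F t in at_right 0. ((\<lambda>t. f (c t)) has_real_derivative dird (a + (2 * t) *\<^sub>R b) f (c t)) (at t)"
      using evV by eventually_elim (rule chain[OF f])
    show "\<forall>\<^sub>F t::real in at_right 0. ((\<lambda>t. t\<^sup>2) has_real_derivative 2 * t) (at t)"
      by (rule always_eventually) (auto intro!: derivative_eq_intros)
  qed
  then show ?thesis by (simp add: c_def)
qed

end

lemma linear_frame: "linear (\<lambda>z::complex^'n::finite. (\<Sum>j\<in>J. z $ j *s u j) + z $ n0 *s \<nu>)" for u :: "'n \<Rightarrow> complex^'n"
proof -
  have "linear (\<lambda>z::complex^'n. z $ j *s w)" for j and w :: "complex^'n"
    by (rule linearI) (simp_all add: vec_eq_iff distrib_right)
  then show ?thesis by (intro linear_compose_add linear_compose_sum) blast+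
qed

section \<open>Injectivity of the differential, and the flat case\<close>

context quadric_map
begin

lemma dird_F_linear: "linear (\<lambda>v. dird v F p)"
  by (rule has_derivative_linear[OF holomorphic_map_deriv(1)[OF F_hol p_U]])

lemma dird_ft_0: "dird v (ft 0 c) x = 0"
proof (cases "c = 0")
  case True
  then show ?thesis by (simp add: ft_def[abs_def] dird_eq[OF has_derivative_const])
next
  case False
  then show ?thesis by (simp add: ft_def[abs_def] tcoef_0 dird_eq[OF has_derivative_const])
qed

lemma ft_1: "ft 1 c x = (if c = 0 then 0 else dird (\<Sum>j\<in>UNIV-{n0}. x $ j *s u j) F p $ e c)"
  by (simp add: ft_def tcoef_1[unfolded One_nat_def])

lemma dird_ft_1: "dird v (ft 1 c) 0 = ft 1 c v"
proof -
  have "((\<lambda>t. ft 1 c (0 + t *s v)) has_field_derivative dird v (ft 1 c) (0 + 0 *s v)) (at 0)"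
    by (rule holo_line[OF ft_holo]) simp
  moreover have "(\<lambda>t. ft 1 c (0 + t *s v)) = (\<lambda>t. t * ft 1 c v)"
  proof
    fix t
    have "(\<Sum>j\<in>UNIV-{n0}. (t *s v) $ j *s u j) = t *s (\<Sum>j\<in>UNIV-{n0}. v $ j *s u j)"
      unfolding vec.scale_sum_right by (rule sum.cong) auto
    then show "ft 1 c (0 + t *s v) = t * ft 1 c v"
      unfolding ft_1 by (simp add: holomorphic_map_deriv(2)[OF F_hol p_U])
  qed
  moreover have "((\<lambda>t. t * ft 1 c v) has_field_derivative ft 1 c v) (at 0)"
    by (auto intro!: derivative_eq_intros)
  ultimately show ?thesis using DERIV_unique[of "\<lambda>t. t * ft 1 c v" "dird v (ft 1 c) (0 + 0 *s v)" 0 "ft 1 c v"] by simp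
qed

text \<open>As the kernel of order 1 vanishes, tangential vectors contribute nothing to the
  derivative of the polarised equation at F p, so \<open>normal_deriv\<close> detects the normal
  component of z. The tangential components are detected by the mixed derivative of the kernel of
  order 2: it is built from dF, and it equals 2\<i> times the Levi form times
  \<open>normal_deriv\<close>.\<close>

lemma immersion:
  assumes nd: "normal_deriv \<noteq> 0" and lower: "\<And>j x y. j < 2 \<Longrightarrow> Kern j x y = 0"
    and vanish: "\<And>x. qrho \<epsilon> n0 x x = 0 \<Longrightarrow> Kern 2 x x = 0"
    and z: "dird ((\<Sum>j\<in>UNIV-{n0}. z $ j *s u j) + z $ n0 *s \<nu>) F p = 0"
  shows "z = 0"
proof -
  define \<eta> where "\<eta> w = (\<lambda>c. if c = 0 then 0 else dird w F p $ e c)" for w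
  let ?a = "\<Sum>j\<in>UNIV-{n0}. z $ j *s u j"
  have "Kern 1 0 z = Rq (homog (F p)) (\<eta> ?a)"
  proof -
    have "Kern 1 0 z = Rq (\<lambda>c. ft 0 c 0) (\<lambda>c. ft 1 c z) + Rq (\<lambda>c. ft 1 c 0) (\<lambda>c. ft 0 c z)"
      by (simp add: Kern_def)
    also have "Rq (\<lambda>c. ft 1 c 0) (\<lambda>c. ft 0 c z) = 0" by (simp add: ft_at_0 herm_form_def)
    also have "(\<lambda>c. ft 1 c z) = \<eta> ?a" by (rule ext) (simp only: ft_1 \<eta>_def)
    finally show ?thesis by (simp add: ft_at_0)
  qed
  then have 1: "Rq (homog (F p)) (\<eta> ?a) = 0" using lower[of 1] by simp
  have "\<eta> (?a + z $ n0 *s \<nu>) = (\<lambda>c. z $ n0 * \<eta> \<nu> c + \<eta> ?a c)"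
    by (rule ext) (simp add: \<eta>_def linear_add[OF dird_F_linear] holomorphic_map_deriv(2)[OF F_hol p_U])
  moreover have "\<eta> (?a + z $ n0 *s \<nu>) = (\<lambda>c. 0)"
    by (rule ext) (simp only: \<eta>_def z zero_index if_cancel)
  ultimately have "(\<lambda>c. z $ n0 * \<eta> \<nu> c + \<eta> ?a c) = (\<lambda>c. 0)" by simp
  then have "Rq (homog (F p)) (\<lambda>c. z $ n0 * \<eta> \<nu> c + \<eta> ?a c) = 0" by (simp only: herm_form_zero_right)
  then have "cnj (z $ n0) * Rq (homog (F p)) (\<eta> \<nu>) = 0" by (simp add: herm_form_lin_right 1)
  moreover have "Rq (homog (F p)) (\<eta> \<nu>) = normal_deriv" by (simp add: normal_deriv_def \<eta>_def)
  ultimately have zn: "z $ n0 = 0" using nd by simp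
  then have Fa: "dird ?a F p = 0" using z by simp
  define k :: nat where "k = 2"
  have vanish': "Kern k x x = 0" if "qrho \<epsilon> n0 x x = 0" for x unfolding k_def by (rule vanish[OF that])
  have lower': "Kern j x y = 0" if "j < k" for j x y using that unfolding k_def by (rule lower)
  interpret T: few_positive_kernel n0 \<epsilon> l "m k" "hk k" "fe k"
  proof
    show "holo UNIV (fe k a)" for a unfolding fe_def[abs_def] by (rule ft_holo)
    show "hk k b a = cnj (hk k a b)" for a b
      by (rule graded_matrix_cnj, rule quad_matrix_cnj) (use l_less in simp)
    show "herm_form (m k) (hk k) (\<lambda>a. fe k a x) (\<lambda>a. fe k a x) = 0" if "qrho \<epsilon> n0 x x = 0" for x
      unfolding Kern_herm by (rule vanish'[OF that])
    show "few_positive (m k) (hk k) l (fe k)" by (rule Kern_few_positive[OF lower'])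
  qed (fact lpos card_pos card_neg | rule eps, assumption)+
  have "z $ i = 0" for i
  proof (cases "i = n0")
    case False
    let ?w = "axis i 1"
    have 2: "herm_form (m k) (hk k) (\<lambda>a. dird z (fe k a) 0) (\<lambda>a. dird ?w (fe k a) 0)
       = 2 * \<i> * lev \<epsilon> n0 z ?w * herm_form (m k) (hk k) (\<lambda>a. fe k a 0) (\<lambda>a. dird nn (fe k a) 0)"
      by (rule T.mixed_deriv[OF T.hol T.hol T.polar]) (use zn False in \<open>auto simp: axis_nth_if\<close>)
    have 3: "herm_form (m k) (hk k) (\<lambda>a. fe k a 0) (\<lambda>a. dird nn (fe k a) 0) = normal_deriv"
      using Kern_normal[of k] by (simp add: k_def)
    have "herm_form (m k) (hk k) (\<lambda>a. dird z (fe k a) 0) (\<lambda>a. dird ?w (fe k a) 0)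
         = (\<Sum>i\<le>k. Rq (\<lambda>c. dird z (ft i c) 0) (\<lambda>c. dird ?w (ft (k - i) c) 0))"
        unfolding fe_def[abs_def]
        by (rule herm_form_graded[where \<omega>="\<lambda>i c. dird z (ft i c) 0" and \<omega>'="\<lambda>i c. dird ?w (ft i c) 0"]) simp
    also have "\<dots> = (\<Sum>i\<le>Suc (Suc 0). Rq (\<lambda>c. dird z (ft i c) 0) (\<lambda>c. dird ?w (ft (Suc (Suc 0) - i) c) 0))"
      by (simp only: k_def numeral_2_eq_2)
    \<comment> \<open>The orders 0 + 2 and 2 + 0 drop out because the coefficient of order 0 does
      not depend on x.\<close>
    also have "\<dots> = Rq (\<lambda>c. dird z (ft 1 c) 0) (\<lambda>c. dird ?w (ft 1 c) 0)"
      by (simp add: dird_ft_0 herm_form_def)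
    also have "(\<lambda>c. dird z (ft 1 c) 0) = (\<lambda>c. 0)"
      by (rule ext) (simp only: dird_ft_1 ft_1 Fa zero_index if_cancel)
    finally have 4: "herm_form (m k) (hk k) (\<lambda>a. dird z (fe k a) 0) (\<lambda>a. dird ?w (fe k a) 0) = 0"
      by (simp add: herm_form_def)
    have "2 * \<i> * lev \<epsilon> n0 z ?w * normal_deriv = 0" using 2 unfolding 3 4 by (rule sym)
    then have "lev \<epsilon> n0 z ?w = 0" using nd by simp
    then show ?thesis using False eps[OF False] by (auto simp: lev_axis_right)
  qed (use zn in simp)
  then show ?thesis by (simp add: vec_eq_iff)
qed

lemma holomorphic_asym:
  assumes h: "g holomorphic_on ball 0 r" and r: "0 < r"
  shows "asym k {()} (\<lambda>t _. g (of_real t)) (\<lambda>i _. (deriv ^^ i) g 0 / fact i)"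
proof -
  have d: "((deriv ^^ i) g has_field_derivative (deriv ^^ Suc i) g s) (at s)" if "cmod s < r" for i s
    using holomorphic_derivI[OF holomorphic_higher_deriv[OF h open_ball] open_ball, of s i] that by simp
  have "continuous_on (cball 0 (r/2)) ((deriv ^^ Suc k) g)"
    by (rule continuous_on_subset[OF holomorphic_on_imp_continuous_on[OF holomorphic_higher_deriv[OF h open_ball]]])
      (use r in auto)
  then have "bounded ((deriv ^^ Suc k) g ` cball 0 (r/2))"
    by (intro compact_imp_bounded compact_continuous_image compact_cball)
  then obtain B where "\<forall>y\<in>(deriv ^^ Suc k) g ` cball 0 (r/2). cmod y \<le> B" unfolding bounded_iff by (rule exE)
  then have B: "cmod ((deriv ^^ Suc k) g s) \<le> B" if "cmod s \<le> r/2" for s using that by (simp del: funpow.simps)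
  have "\<forall>\<^sub>F t in at_right 0. t \<in> {0<..<r/2}" by (rule eventually_at_right_real) (use r in simp)
  then have "\<forall>\<^sub>F t in at_right 0. \<forall>x\<in>{()}. cmod (g (of_real t) - (\<Sum>i\<le>k. (deriv ^^ i) g 0 / fact i * of_real t ^ i)) \<le> (B / fact k) * t ^ Suc k"
  proof eventually_elim
    case (elim t)
    have "cmod ((deriv ^^ 0) g (of_real t) - (\<Sum>i\<le>k. (deriv ^^ i) g 0 * (of_real t - 0) ^ i / fact i)) \<le> B * cmod (of_real t - 0) ^ Suc k / fact k"
    proof (rule complex_Taylor[where S="cball 0 (r/2)" and f="\<lambda>i. (deriv ^^ i) g"])
      show "((deriv ^^ i) g has_field_derivative (deriv ^^ Suc i) g s) (at s within cball 0 (r/2))" if "s \<in> cball 0 (r/2)" for i s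
        by (rule has_field_derivative_at_within[OF d]) (use that r in auto)
    qed (use elim B in auto)
    then show ?case using elim by simp
  qed
  then show ?thesis by (rule asymI[rotated]) auto
qed

text \<open>An expansion with zero coefficients says nothing about a fixed t. With
  \<open>cnj t\<close> in the second slot, however, the pulled-back equation is holomorphic in t on
  a disc that is the same for all x of norm at most 1, and it vanishes to infinite order at
  0.\<close>

lemma flat_zero:
  assumes "\<And>k x y. Kern k x y = 0"
  obtains t where "0 < t" "\<And>x. norm x \<le> 1 \<Longrightarrow> \<Phi> (of_real t) x \<in> U \<and> Rq (homog (F (\<Phi> (of_real t) x))) (homog (F (\<Phi> (of_real t) x))) = 0"
proof -
  obtain r where r: "r > 0" "\<And>t x. cmod t \<le> r \<Longrightarrow> norm x \<le> 1 \<Longrightarrow> adjoin t x \<in> \<Omega>" using uniform_domain[of 1] by blast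
  have main: "Rq (homog (F (\<Phi> (of_real (r/2)) x))) (homog (F (\<Phi> (of_real (r/2)) x))) = 0" if x: "norm x \<le> 1" for x
  proof -
    define g where "g t = Rq (homog (F (\<Phi> t x))) (homog (F (\<Phi> (cnj t) x)))" for t
    have hom: "((\<lambda>t. homog (F (\<Phi> t x)) c) has_field_derivative (if c = 0 then 0 else tder (e c) (Suc 0) (adjoin t x))) (at t)"
      if "cmod t \<le> r" for t c
    proof (cases "c = 0")
      case False
      have "((\<lambda>t. tder (e c) 0 (adjoin t x)) has_field_derivative tder (e c) (Suc 0) (adjoin t x)) (at t)"
        by (rule tder_line) (rule r(2)[OF that x])
      then show ?thesis using False by (simp add: homog_def tder_def \<Theta>_adjoin)
    qed (simp add: homog_def)
    have homc: "((\<lambda>t. cnj (homog (F (\<Phi> (cnj t) x)) c)) has_field_derivative cnj (if c = 0 then 0 else tder (e c) (Suc 0) (adjoin (cnj t) x))) (at t)"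
      if "cmod t \<le> r" for t c
      using has_field_derivative_cnj_cnj[OF hom, of t c] that by (simp add: o_def)
    have gh: "g holomorphic_on ball 0 r"
    proof (rule holomorphic_onI)
      fix t :: complex assume "t \<in> ball 0 r"
      then have t: "cmod t \<le> r" by simp
      have "(\<lambda>t. homog (F (\<Phi> t x)) c) field_differentiable at t" "(\<lambda>t. cnj (homog (F (\<Phi> (cnj t) x)) c)) field_differentiable at t" for c
        using hom[OF t] homc[OF t] unfolding field_differentiable_def by blast+
      then have "g field_differentiable at t"
        unfolding g_def[abs_def] herm_form_def
        by (intro Derivative.field_differentiable_sum field_differentiable_mult field_differentiable_const) auto
      then show "g field_differentiable at t within ball 0 r" by (rule field_differentiable_at_within)
    qed
    have d0: "(deriv ^^ k) g 0 = 0" for k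
    proof -
      have "asym k {()} (\<lambda>t z. Rq (homog (F (\<Phi> (of_real t) x))) (homog (F (\<Phi> (of_real t) x)))) (\<lambda>j z. Kern j x x)"
        using asym_map[OF _ kern_asym[of k 1], where \<pi>="\<lambda>_. (x, x)" and S'="{()}"] x by simp
      then have 1: "asym k {()} (\<lambda>t z. g (of_real t)) (\<lambda>j z. 0)" by (simp add: g_def assms)
      have "(deriv ^^ k) g 0 / fact k = 0"
        by (rule asym_unique[OF holomorphic_asym[OF gh r(1)] 1, of k "()"]) simp_all
      then show ?thesis by simp
    qed
    have "g (of_real (r/2)) = 0"
      by (rule holomorphic_fun_eq_0_on_connected[OF gh open_ball connected_ball, of 0]) (use r(1) d0 in \<open>auto simp: norm_of_real\<close>)
    then show ?thesis by (simp add: g_def)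
  qed
  show ?thesis
  proof (rule that[of "r/2"])
    fix x :: "complex^'n" assume x: "norm x \<le> 1"
    have "adjoin (of_real (r/2)) x \<in> \<Omega>" by (rule r(2)[OF _ x]) (use r(1) in simp)
    then show "\<Phi> (of_real (r/2)) x \<in> U \<and> Rq (homog (F (\<Phi> (of_real (r/2)) x))) (homog (F (\<Phi> (of_real (r/2)) x))) = 0"
      using main[OF x] by (simp add: \<Omega>_def \<Theta>_adjoin)
  qed (use r in simp)
qed

text \<open>For fixed t > 0 the dilation has a polynomial inverse X with X p = 0, so the image of
  the unit ball contains a neighbourhood of p.\<close>

lemma flat_degenerate:
  assumes flat: "\<And>k x y. Kern k x y = 0"
    and inj: "\<And>z. (\<Sum>j\<in>UNIV-{n0}. z $ j *s u j) + z $ n0 *s \<nu> = 0 \<Longrightarrow> z = 0"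
  shows "\<exists>V. open V \<and> p \<in> V \<and> V \<subseteq> U \<and> (\<forall>y\<in>V. Rq (homog (F y)) (homog (F y)) = 0)"
proof -
  obtain t where t: "0 < t" "\<And>x. norm x \<le> 1 \<Longrightarrow> \<Phi> (of_real t) x \<in> U \<and> Rq (homog (F (\<Phi> (of_real t) x))) (homog (F (\<Phi> (of_real t) x))) = 0"
    using flat_zero[OF flat] by blast
  define A where "A z = (\<Sum>j\<in>UNIV-{n0}. z $ j *s u j) + z $ n0 *s \<nu>" for z
  have lin: "linear A" unfolding A_def[abs_def] by (rule linear_frame)
  have "inj A" unfolding linear_injective_0[OF lin] unfolding A_def by (intro allI impI) (rule inj)
  then have "surj A" by (rule linear_inj_imp_surj[OF lin])
  then have ex: "\<exists>f'. linear f' \<and> A \<circ> f' = id" by (rule linear_surjective_right_inverse[OF lin])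
  obtain A' where "linear A' \<and> A \<circ> A' = id" using ex by (rule exE)
  then have A': "linear A'" "A (A' x) = x" for x by (simp_all add: fun_eq_iff)
  define X where "X y = (\<chi> j. if j = n0 then A' (y - p) $ n0 / (of_real t * of_real t)
      - (\<Sum>j\<in>UNIV-{n0}. \<Sum>k\<in>UNIV-{n0}. S j k * (A' (y - p) $ j / of_real t) * (A' (y - p) $ k / of_real t))
     else A' (y - p) $ j / of_real t)" for y
  have XP: "\<Phi> (of_real t) (X y) = y" for y
  proof -
    have 1: "(\<Sum>j\<in>UNIV-{n0}. X y $ j *s u j) = (1 / of_real t) *s (\<Sum>j\<in>UNIV-{n0}. A' (y - p) $ j *s u j)"
      unfolding vec.scale_sum_right by (rule sum.cong) (auto simp: X_def)
    have 2: "(\<Sum>j\<in>UNIV-{n0}. \<Sum>k\<in>UNIV-{n0}. S j k * X y $ j * X y $ k) = (\<Sum>j\<in>UNIV-{n0}. \<Sum>k\<in>UNIV-{n0}. S j k * (A' (y - p) $ j / of_real t) * (A' (y - p) $ k / of_real t))"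
      by (intro sum.cong) (auto simp: X_def)
    have 3: "of_real t * of_real t * (X y $ n0 + (\<Sum>j\<in>UNIV-{n0}. \<Sum>k\<in>UNIV-{n0}. S j k * X y $ j * X y $ k)) = A' (y - p) $ n0"
      unfolding 2 using t(1) by (simp add: X_def)
    have "\<Phi> (of_real t) (X y) = p + A (A' (y - p))"
      unfolding par_dil_def 1 3 A_def using t(1) by (simp add: add.assoc)
    then show ?thesis by (simp add: A')
  qed
  have A'c: "continuous_on UNIV (\<lambda>y. A' (y - p) $ j)" for j
  proof -
    have "continuous_on UNIV A'" by (rule linear_continuous_on) (simp add: A'(1) linear_conv_bounded_linear[symmetric])
    then have "continuous_on UNIV (\<lambda>y. A' (y - p))" by (rule continuous_on_compose2) (auto intro!: continuous_intros)
    then show ?thesis by (rule continuous_on_component)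
  qed
  have div: "continuous_on UNIV (\<lambda>y. A' (y - p) $ j / of_real t)" for j
    using continuous_on_mult_right[OF A'c, of j "inverse (of_real t)"] by (simp only: divide_inverse)
  have "continuous_on UNIV (\<lambda>y. A' (y - p) $ n0 / (of_real t * of_real t)
      - (\<Sum>j\<in>UNIV-{n0}. \<Sum>k\<in>UNIV-{n0}. S j k * (A' (y - p) $ j / of_real t) * (A' (y - p) $ k / of_real t)))"
  proof (rule continuous_on_diff)
    show "continuous_on UNIV (\<lambda>y. A' (y - p) $ n0 / (of_real t * of_real t))"
      using continuous_on_mult_right[OF A'c, of n0 "inverse (of_real t * of_real t)"] by (simp only: divide_inverse)
  qed (intro continuous_on_sum continuous_on_mult continuous_on_const div)
  then have "continuous_on UNIV (\<lambda>y. if j = n0 then A' (y - p) $ n0 / (of_real t * of_real t)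
      - (\<Sum>j\<in>UNIV-{n0}. \<Sum>k\<in>UNIV-{n0}. S j k * (A' (y - p) $ j / of_real t) * (A' (y - p) $ k / of_real t))
     else A' (y - p) $ j / of_real t)" for j
    using div[of j] by (cases "j = n0") simp_all
  then have "continuous_on UNIV X" unfolding X_def[abs_def] by (rule continuous_on_vec_lambda)
  then have "open {y. norm (X y) < 1}" by (intro open_Collect_less continuous_intros)
  moreover have "A' 0 = 0" by (rule linear_0[OF A'(1)])
  then have "X p = 0" by (simp add: X_def vec_eq_iff)
  then have "p \<in> {y. norm (X y) < 1}" by simp
  moreover have "y \<in> U \<and> Rq (homog (F y)) (homog (F y)) = 0" if "norm (X y) < 1" for y
    using t(2)[of "X y"] that unfolding XP by simp
  ultimately show ?thesis by (intro exI[of _ "{y. norm (X y) < 1}"]) auto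
qed

end

section \<open>Eigenbases of the Levi form\<close>

lemma hermitian_inner_lin:
  "hermitian_inner (a + b) c = hermitian_inner a c + hermitian_inner b c"
  "hermitian_inner (a - b) c = hermitian_inner a c - hermitian_inner b c"
  "hermitian_inner (z *s a) c = z * hermitian_inner a c"
  "hermitian_inner a (z *s c) = cnj z * hermitian_inner a c"
  "hermitian_inner (\<Sum>i\<in>I. f i) c = (\<Sum>i\<in>I. hermitian_inner (f i) c)"
  unfolding hermitian_inner_def
  by (simp_all add: distrib_right left_diff_distrib sum.distrib sum_subtractf sum_distrib_left sum_distrib_right mult.assoc
      mult.left_commute[of _ "cnj _"] sum.swap[of _ I])

lemma hermitian_inner_cnj: "cnj (hermitian_inner a b) = hermitian_inner b a"
  by (simp add: hermitian_inner_def mult_ac)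

lemma hermitian_inner_self: "hermitian_inner a a = of_real ((norm a)\<^sup>2)"
proof -
  have "(norm a)\<^sup>2 = (\<Sum>j\<in>UNIV. (norm (a $ j))\<^sup>2)" by (simp add: norm_vec_def L2_set_def sum_nonneg)
  then show ?thesis by (simp add: hermitian_inner_def complex_norm_square del: of_real_power)
qed

definition orthonormal_family :: "nat \<Rightarrow> (nat \<Rightarrow> complex^'n::finite) \<Rightarrow> bool" where
  "orthonormal_family m b \<longleftrightarrow> (\<forall>i<m. \<forall>j<m. hermitian_inner (b i) (b j) = (if i = j then 1 else 0))"

text \<open>Gram-Schmidt; the dimension provides a vector of E outside the span of those already
  chosen.\<close>

lemma orthonormal_family_exists:
  fixes E :: "(complex^'n::finite) set"
  assumes E: "vec.subspace E"
  shows "m \<le> vec.dim E \<Longrightarrow> \<exists>b. (\<forall>i<m. b i \<in> E) \<and> orthonormal_family m b"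
proof (induction m)
  case (Suc m)
  then have "m \<le> vec.dim E" by simp
  from Suc.IH[OF this] obtain b where b: "(\<forall>i<m. b i \<in> E) \<and> orthonormal_family m b" by (rule exE)
  have on: "hermitian_inner (b i) (b j) = (if i = j then 1 else 0)" if "i < m" "j < m" for i j
    using b that by (simp add: orthonormal_family_def)
  have "\<not> E \<subseteq> vec.span (b ` {..<m})"
  proof
    assume "E \<subseteq> vec.span (b ` {..<m})"
    then have "vec.dim E \<le> card (b ` {..<m})" by (rule vec.dim_le_card) simp
    also have "\<dots> \<le> card {..<m}" by (rule card_image_le) simp
    finally show False using Suc.prems by simp
  qed
  then obtain v where v: "v \<in> E" "v \<notin> vec.span (b ` {..<m})" by blast
  let ?s = "\<Sum>i<m. hermitian_inner v (b i) *s b i"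
  define w where "w = v - ?s"
  have sE: "?s \<in> E" by (rule vec.subspace_sum[OF E], rule vec.subspace_scale[OF E]) (use b in simp)
  have "?s \<in> vec.span (b ` {..<m})" by (intro vec.span_sum vec.span_scale vec.span_base) auto
  then have "w \<noteq> 0" unfolding w_def using v(2) by auto
  have wE: "w \<in> E" unfolding w_def by (rule vec.subspace_diff[OF E v(1) sE])
  have ort: "hermitian_inner w (b j) = 0" if "j < m" for j
  proof -
    have "(\<Sum>i<m. hermitian_inner v (b i) * hermitian_inner (b i) (b j)) = (\<Sum>i<m. if i = j then hermitian_inner v (b i) else 0)"
      by (rule sum.cong) (auto simp: on that)
    then show ?thesis using that by (simp add: w_def hermitian_inner_lin)
  qed
  have ort': "hermitian_inner (b j) w = 0" if "j < m" for j
    using hermitian_inner_cnj[of w "b j"] ort[OF that] by simp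
  define c where "c = complex_of_real (1 / norm w)"
  define b' where "b' = b(m := c *s w)"
  have cc: "c * (cnj c * of_real ((norm w)\<^sup>2)) = 1"
    using \<open>w \<noteq> 0\<close> by (simp add: c_def power2_eq_square flip: of_real_mult)
  then have cc': "cnj c * (c * of_real ((norm w)\<^sup>2)) = 1" by (simp only: mult.left_commute)
  have "\<forall>i<Suc m. b' i \<in> E"
    using b vec.subspace_scale[OF E wE] by (auto simp: b'_def less_Suc_eq)
  moreover have "orthonormal_family (Suc m) b'"
    unfolding orthonormal_family_def b'_def
    by (auto simp: less_Suc_eq on hermitian_inner_lin ort ort' hermitian_inner_self cc cc' simp del: of_real_power)
  ultimately show ?case by blast
qed (auto simp: orthonormal_family_def)

text \<open>The prescribed eigenvalue counts add up to \<open>CARD('n) - 1\<close>, so orthonormal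
  bases of the eigenspaces already supply one vector for each coordinate other than n0; scaling by 1
  / sqrt |\<mu>| normalises the form.\<close>

lemma eigenbasis:
  fixes H :: "complex^'n::finite \<Rightarrow> complex^'n \<Rightarrow> complex" and n0 :: 'n
  assumes T: "vec.subspace T"
    and add: "\<And>a b c. H (a + b) c = H a c + H b c" and scale: "\<And>z a b. H (z *s a) b = z * H a b"
    and herm: "\<And>a b. cnj (H a b) = H b a"
    and neg: "num_neg_eigenvalues H T = l" and pos: "num_pos_eigenvalues H T = CARD('n) - 1 - l"
    and l: "0 < l" "l \<le> CARD('n) - 1 - l"
  shows "\<exists>u \<epsilon>. (\<forall>j. j \<noteq> n0 \<longrightarrow> u j \<in> T \<and> (\<epsilon> j = 1 \<or> \<epsilon> j = (-1::real))) \<and>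
    (\<forall>i j. i \<noteq> n0 \<longrightarrow> j \<noteq> n0 \<longrightarrow> H (u i) (u j) = (if i = j then - of_real (\<epsilon> j) else 0)) \<and>
    l \<le> card {j. j \<noteq> n0 \<and> \<epsilon> j = 1} \<and> l \<le> card {j. j \<noteq> n0 \<and> \<epsilon> j = -1}"
proof -
  define E where "E \<mu> = form_eigenspace H T \<mu>" for \<mu>
  have scale': "H a (z *s b) = cnj z * H a b" for z a b
    using scale[of z b a, THEN arg_cong[where f=cnj]] by (simp add: herm)
  have subE: "vec.subspace (E \<mu>)" for \<mu>
  proof (rule vec.subspaceI)
    have "H 0 w = 0" "hermitian_inner 0 w = 0" for w using scale[of 0 0 w] by (simp_all add: hermitian_inner_def)
    then show "0 \<in> E \<mu>" by (simp add: E_def form_eigenspace_def vec.subspace_0[OF T])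
    show "x + y \<in> E \<mu>" if "x \<in> E \<mu>" "y \<in> E \<mu>" for x y
      using that by (simp add: E_def form_eigenspace_def vec.subspace_add[OF T] add hermitian_inner_lin distrib_left)
    show "c *s x \<in> E \<mu>" if "x \<in> E \<mu>" for x c
      using that by (simp add: E_def form_eigenspace_def vec.subspace_scale[OF T] scale hermitian_inner_lin)
  qed
  have "\<forall>\<mu>. \<exists>b. (\<forall>i<vec.dim (E \<mu>). b i \<in> E \<mu>) \<and> orthonormal_family (vec.dim (E \<mu>)) b"
    by (intro allI orthonormal_family_exists[OF subE order.refl])
  then have "\<exists>b. \<forall>\<mu>. (\<forall>i<vec.dim (E \<mu>). b \<mu> i \<in> E \<mu>) \<and> orthonormal_family (vec.dim (E \<mu>)) (b \<mu>)"
    by (rule choice)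
  then obtain b where "\<forall>\<mu>. (\<forall>i<vec.dim (E \<mu>). b \<mu> i \<in> E \<mu>) \<and> orthonormal_family (vec.dim (E \<mu>)) (b \<mu>)"
    by (rule exE)
  then have bE: "b \<mu> i \<in> E \<mu>" and on: "hermitian_inner (b \<mu> i) (b \<mu> j) = (if i = j then 1 else 0)"
    if "i < vec.dim (E \<mu>)" "j < vec.dim (E \<mu>)" for \<mu> i j
    using that by (simp_all add: orthonormal_family_def)
  define Neg where "Neg = {\<mu>. \<mu> < 0 \<and> (\<exists>v\<in>E \<mu>. v \<noteq> 0)}"
  define Pos where "Pos = {\<mu>. \<mu> > 0 \<and> (\<exists>v\<in>E \<mu>. v \<noteq> 0)}"
  have sN: "(\<Sum>\<mu>\<in>Neg. vec.dim (E \<mu>)) = l" using neg unfolding num_neg_eigenvalues_def Neg_def E_def .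
  have sP: "(\<Sum>\<mu>\<in>Pos. vec.dim (E \<mu>)) = CARD('n) - 1 - l" using pos unfolding num_pos_eigenvalues_def Pos_def E_def .
  \<comment> \<open>A sum over an infinite set is 0 by convention, whereas both counts are
    positive.\<close>
  have fin: "finite Neg" "finite Pos"
    using sN sP l sum.infinite[of Neg "\<lambda>\<mu>. vec.dim (E \<mu>)"] sum.infinite[of Pos "\<lambda>\<mu>. vec.dim (E \<mu>)"]
    by linarith+
  define IN where "IN = (SIGMA \<mu>:Neg. {..<vec.dim (E \<mu>)})"
  define IP where "IP = (SIGMA \<mu>:Pos. {..<vec.dim (E \<mu>)})"
  have finI: "finite IN" "finite IP" using fin by (auto simp: IN_def IP_def)
  have cI: "card IN = l" "card IP = CARD('n) - 1 - l"
    using fin sN sP by (simp_all add: IN_def IP_def)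
  have disj: "IN \<inter> IP = {}" by (auto simp: IN_def IP_def Neg_def Pos_def)
  have "card (UNIV - {n0}) = card (IN \<union> IP)"
    using cI l by (simp add: card_Un_disjoint[OF finI disj] card_Diff_singleton)
  then obtain \<beta> where \<beta>: "bij_betw \<beta> (UNIV - {n0}) (IN \<union> IP)"
    using finite_same_card_bij[of "UNIV - {n0}" "IN \<union> IP"] finI by auto
  have \<beta>I: "\<beta> j \<in> IN \<union> IP" if "j \<noteq> n0" for j using bij_betwE[OF \<beta>] that by simp
  have \<beta>inj: "i = j" if "\<beta> i = \<beta> j" "i \<noteq> n0" "j \<noteq> n0" for i j
    using bij_betw_imp_inj_on[OF \<beta>] that by (auto dest: inj_onD)
  define u where "u j = complex_of_real (1 / sqrt \<bar>fst (\<beta> j)\<bar>) *s b (fst (\<beta> j)) (snd (\<beta> j))" for j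
  \<comment> \<open>The sign is reversed because the model equation subtracts the form with entries
    \<epsilon>: negative eigenvalues correspond to \<epsilon> = 1.\<close>
  define \<epsilon> where "\<epsilon> j = - sgn (fst (\<beta> j))" for j
  have \<mu>0: "fst (\<beta> j) \<noteq> 0" and ind: "snd (\<beta> j) < vec.dim (E (fst (\<beta> j)))" if "j \<noteq> n0" for j
    using \<beta>I[OF that] by (auto simp: IN_def IP_def Neg_def Pos_def)
  have uE: "u j \<in> E (fst (\<beta> j))" if "j \<noteq> n0" for j
    unfolding u_def by (rule vec.subspace_scale[OF subE]) (rule bE[OF ind ind, OF that that])
  have uT: "u j \<in> T" if "j \<noteq> n0" for j using uE[OF that] by (simp add: E_def form_eigenspace_def)
  have eig: "H v w = of_real \<mu> * hermitian_inner v w" if "v \<in> E \<mu>" "w \<in> T" for v w \<mu>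
    using that by (simp add: E_def form_eigenspace_def)
  have main: "H (u i) (u j) = (if i = j then - of_real (\<epsilon> j) else 0)" if ij: "i \<noteq> n0" "j \<noteq> n0" for i j
  proof (cases "fst (\<beta> i) = fst (\<beta> j)")
    case False
    have 1: "H (u i) (u j) = of_real (fst (\<beta> i)) * hermitian_inner (u i) (u j)" by (rule eig[OF uE[OF ij(1)] uT[OF ij(2)]])
    have "H (u j) (u i) = of_real (fst (\<beta> j)) * hermitian_inner (u j) (u i)" by (rule eig[OF uE[OF ij(2)] uT[OF ij(1)]])
    from arg_cong[OF this, of cnj] have 2: "H (u i) (u j) = of_real (fst (\<beta> j)) * hermitian_inner (u i) (u j)"
      by (simp add: herm hermitian_inner_cnj)
    have "of_real (fst (\<beta> i) - fst (\<beta> j)) * hermitian_inner (u i) (u j) = 0" by (simp only: of_real_diff left_diff_distrib 1[symmetric] 2[symmetric] diff_self)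
    moreover have "complex_of_real (fst (\<beta> i) - fst (\<beta> j)) \<noteq> 0" using False by simp
    ultimately have "hermitian_inner (u i) (u j) = 0" by (simp only: mult_eq_0_iff simp_thms)
    then show ?thesis using 1 False by auto
  next
    case True
    let ?\<mu> = "fst (\<beta> j)"
    have s: "1 / sqrt \<bar>?\<mu>\<bar> * (1 / sqrt \<bar>?\<mu>\<bar>) * ?\<mu> = sgn ?\<mu>"
    proof -
      have "1 / sqrt \<bar>?\<mu>\<bar> * (1 / sqrt \<bar>?\<mu>\<bar>) = 1 / \<bar>?\<mu>\<bar>" by (simp add: real_sqrt_mult_self)
      then show ?thesis by (simp add: sgn_div_norm divide_inverse mult.commute)
    qed
    have "H (u i) (u j) = of_real ?\<mu> * hermitian_inner (u i) (u j)" using eig[OF uE[OF ij(1)] uT[OF ij(2)]] True by simp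
    also have "\<dots> = of_real (1 / sqrt \<bar>?\<mu>\<bar> * (1 / sqrt \<bar>?\<mu>\<bar>) * ?\<mu>) * hermitian_inner (b ?\<mu> (snd (\<beta> i))) (b ?\<mu> (snd (\<beta> j)))"
    proof -
      have "complex_of_real (sqrt \<bar>?\<mu>\<bar>) * complex_of_real (sqrt \<bar>?\<mu>\<bar>) = of_real \<bar>?\<mu>\<bar>" by (simp flip: of_real_mult)
      then show ?thesis using True by (simp add: u_def hermitian_inner_lin)
    qed
    also have "hermitian_inner (b ?\<mu> (snd (\<beta> i))) (b ?\<mu> (snd (\<beta> j))) = (if snd (\<beta> i) = snd (\<beta> j) then 1 else 0)"
      by (rule on) (use ind[OF ij(1)] ind[OF ij(2)] True in auto)
    also have "snd (\<beta> i) = snd (\<beta> j) \<longleftrightarrow> i = j" using True \<beta>inj[OF _ ij] by (auto simp: prod_eq_iff)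
    finally show ?thesis unfolding s by (simp add: \<epsilon>_def)
  qed
  have \<epsilon>N: "\<epsilon> j = 1 \<longleftrightarrow> fst (\<beta> j) < 0" and \<epsilon>P: "\<epsilon> j = -1 \<longleftrightarrow> 0 < fst (\<beta> j)" for j
    by (simp_all add: \<epsilon>_def sgn_if)
  have \<epsilon>1: "\<epsilon> j = 1 \<or> \<epsilon> j = -1" if "j \<noteq> n0" for j
    using \<mu>0[OF that] unfolding \<epsilon>N \<epsilon>P by linarith
  have IN: "fst x < 0" if "x \<in> IN" for x using that by (auto simp: IN_def Neg_def)
  have IP: "0 < fst x" if "x \<in> IP" for x using that by (auto simp: IP_def Pos_def)
  have "\<beta> ` {j. j \<noteq> n0 \<and> \<epsilon> j = 1} = IN" "\<beta> ` {j. j \<noteq> n0 \<and> \<epsilon> j = -1} = IP"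
  proof -
    have im: "\<beta> ` (UNIV - {n0}) = IN \<union> IP" by (rule bij_betw_imp_surj_on[OF \<beta>])
    show "\<beta> ` {j. j \<noteq> n0 \<and> \<epsilon> j = 1} = IN"
    proof (intro equalityI subsetI)
      fix x assume "x \<in> \<beta> ` {j. j \<noteq> n0 \<and> \<epsilon> j = 1}"
      then obtain j where j: "x = \<beta> j" "j \<noteq> n0" "fst (\<beta> j) < 0" unfolding \<epsilon>N by blast
      then show "x \<in> IN" using \<beta>I[OF j(2)] IP[of x] by auto
    next
      fix x assume x: "x \<in> IN"
      then obtain j where j: "j \<noteq> n0" "x = \<beta> j" using im by blast
      then show "x \<in> \<beta> ` {j. j \<noteq> n0 \<and> \<epsilon> j = 1}" unfolding \<epsilon>N using IN[OF x] by blast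
    qed
    show "\<beta> ` {j. j \<noteq> n0 \<and> \<epsilon> j = -1} = IP"
    proof (intro equalityI subsetI)
      fix x assume "x \<in> \<beta> ` {j. j \<noteq> n0 \<and> \<epsilon> j = -1}"
      then obtain j where j: "x = \<beta> j" "j \<noteq> n0" "0 < fst (\<beta> j)" unfolding \<epsilon>P by blast
      then show "x \<in> IP" using \<beta>I[OF j(2)] IN[of x] by auto
    next
      fix x assume x: "x \<in> IP"
      then obtain j where j: "j \<noteq> n0" "x = \<beta> j" using im by blast
      then show "x \<in> \<beta> ` {j. j \<noteq> n0 \<and> \<epsilon> j = -1}" unfolding \<epsilon>P using IP[OF x] by blast
    qed
  qed
  then have "l \<le> card {j. j \<noteq> n0 \<and> \<epsilon> j = 1}" "l \<le> card {j. j \<noteq> n0 \<and> \<epsilon> j = -1}"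
    using cI l card_image_le[of "{j. j \<noteq> n0 \<and> \<epsilon> j = 1}" \<beta>] card_image_le[of "{j. j \<noteq> n0 \<and> \<epsilon> j = -1}" \<beta>] by simp_all
  then show ?thesis by (intro exI[of _ u] exI[of _ \<epsilon>] conjI allI impI uT \<epsilon>1 main)
qed

section \<open>Adapted frames\<close>

text \<open>The value - \<i> / 2 is chosen so that the real derivative of \<sigma> along
  \<open>c *s \<nu>\<close> is Im c, as for the model equation.\<close>

locale defining_frame =
  fixes n0 :: "'n::finite" and p \<nu> :: "complex^'n" and u :: "'n \<Rightarrow> complex^'n" and \<epsilon> :: "'n \<Rightarrow> real"
    and \<sigma> :: "complex^'n \<Rightarrow> real" and V :: "(complex^'n) set"
  assumes open_V: "open V" and p_V: "p \<in> V" and \<sigma>_smooth: "smooth_on V \<sigma>" and \<sigma>_p: "\<sigma> p = 0"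
    and dbar_\<nu>: "dbar \<sigma> p \<nu> = - \<i> / 2" and dbar_u: "\<And>j. j \<noteq> n0 \<Longrightarrow> dbar \<sigma> p (u j) = 0"
    and hess_u: "\<And>i j. i \<noteq> n0 \<Longrightarrow> j \<noteq> n0 \<Longrightarrow> hess11 \<sigma> p (u i) (u j) = (if i = j then - of_real (\<epsilon> j) else 0)"
    and eps': "\<And>j. j \<noteq> n0 \<Longrightarrow> \<epsilon> j = 1 \<or> \<epsilon> j = -1"
begin

text \<open>With this choice only the Levi form survives in the quadratic part of \<open>\<sigma>\<close> along the dilations.\<close>

definition "S j k = - \<i> * hess20 \<sigma> p (u j) (u k)"

lemma \<sigma>_diff: "\<sigma> differentiable (at p)"
  by (rule smooth_on_differentiable[OF \<sigma>_smooth p_V])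

lemma dbar_sum: "dbar \<sigma> p (\<Sum>j\<in>UNIV-{n0}. x $ j *s u j) = 0"
proof -
  have "dbar \<sigma> p (\<Sum>j\<in>J. x $ j *s u j) = (\<Sum>j\<in>J. x $ j * dbar \<sigma> p (u j))" for J
  proof (induction J rule: infinite_finite_induct)
    have "dbar \<sigma> p 0 = 0" using dbar_linear(2)[OF \<sigma>_diff, of 0 0] by simp
    then show "dbar \<sigma> p (\<Sum>j\<in>{}. x $ j *s u j) = (\<Sum>j\<in>{}. x $ j * dbar \<sigma> p (u j))"
      "infinite A \<Longrightarrow> dbar \<sigma> p (\<Sum>j\<in>A. x $ j *s u j) = (\<Sum>j\<in>A. x $ j * dbar \<sigma> p (u j))" for A by simp_all
  qed (simp add: dbar_linear[OF \<sigma>_diff])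
  then show ?thesis by (simp add: dbar_u)
qed

lemma hess11_frame: "hess11 \<sigma> p (\<Sum>j\<in>UNIV-{n0}. x $ j *s u j) (\<Sum>j\<in>UNIV-{n0}. y $ j *s u j) = - lev \<epsilon> n0 x y"
proof -
  have "hess11 \<sigma> p (\<Sum>j\<in>UNIV-{n0}. x $ j *s u j) (\<Sum>j\<in>UNIV-{n0}. y $ j *s u j)
     = (\<Sum>j\<in>UNIV-{n0}. x $ j * (\<Sum>i\<in>UNIV-{n0}. cnj (y $ i) * hess11 \<sigma> p (u j) (u i)))"
    unfolding hess11_sum_left[OF open_V p_V \<sigma>_smooth]
    by (intro sum.cong refl arg_cong[where f="(*) _"] hess11_sum_right[OF open_V p_V \<sigma>_smooth])
  also have "\<dots> = (\<Sum>j\<in>UNIV-{n0}. x $ j * (\<Sum>i\<in>UNIV-{n0}. if j = i then - cnj (y $ i) * of_real (\<epsilon> i) else 0))"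
    by (intro sum.cong refl arg_cong[where f="(*) _"]) (simp add: hess_u)
  also have "\<dots> = (\<Sum>j\<in>UNIV-{n0}. x $ j * (- cnj (y $ j) * of_real (\<epsilon> j)))"
    by (intro sum.cong refl arg_cong[where f="(*) _"]) (simp add: sum.delta)
  also have "\<dots> = - lev \<epsilon> n0 x y"
    unfolding lev_def sum_negf[symmetric] by (rule sum.cong) simp_all
  finally show ?thesis .
qed

lemma hess20_frame: "- \<i> * hess20 \<sigma> p (\<Sum>j\<in>UNIV-{n0}. x $ j *s u j) (\<Sum>j\<in>UNIV-{n0}. x $ j *s u j)
   = (\<Sum>j\<in>UNIV-{n0}. \<Sum>k\<in>UNIV-{n0}. S j k * x $ j * x $ k)"
  unfolding hess20_sum_left[OF open_V p_V \<sigma>_smooth] hess20_sum_right[OF open_V p_V \<sigma>_smooth] S_def sum_distrib_left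
  by (intro sum.cong refl) (auto simp: mult_ac intro: hess20_sym[OF open_V p_V \<sigma>_smooth])

text \<open>The (1,0)-differential of \<sigma> detects the component along \<nu>, and the
  nondegenerate form \<open>hess11\<close> the others.\<close>

lemma frame_injective:
  assumes z: "(\<Sum>j\<in>UNIV-{n0}. z $ j *s u j) + z $ n0 *s \<nu> = 0"
  shows "z = 0"
proof -
  let ?a = "\<Sum>j\<in>UNIV-{n0}. z $ j *s u j"
  have "dbar \<sigma> p (?a + z $ n0 *s \<nu>) = z $ n0 * (- \<i> / 2)"
    unfolding dbar_linear[OF \<sigma>_diff] dbar_sum dbar_\<nu> by simp
  moreover have "dbar \<sigma> p 0 = 0" using dbar_linear(2)[OF \<sigma>_diff, of 0 0] by simp
  ultimately have zn: "z $ n0 = 0" unfolding z by simp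
  then have a: "?a = 0" using z by simp
  have "z $ i = 0" if i: "i \<noteq> n0" for i
  proof -
    have "lev \<epsilon> n0 z (axis i 1) = - hess11 \<sigma> p 0 (\<Sum>j\<in>UNIV-{n0}. axis i 1 $ j *s u j)"
      using hess11_frame[of z "axis i 1"] unfolding a by simp
    also have "\<dots> = 0" by (simp add: hess11_0[OF open_V p_V \<sigma>_smooth])
    finally show ?thesis using i eps'[OF i] by (auto simp: lev_axis_right)
  qed
  then have "z $ i = 0" for i using zn by (cases "i = n0") simp_all
  then show ?thesis by (simp add: vec_eq_iff)
qed

lemma dilation_limit:
  "((\<lambda>t. \<sigma> (par_dil n0 p u S \<nu> (of_real t) y) / t\<^sup>2) \<longlongrightarrow> Re (qrho \<epsilon> n0 y y)) (at_right 0)"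
proof -
  define a where "a = (\<Sum>j\<in>UNIV-{n0}. y $ j *s u j)"
  define c where "c = y $ n0 + (\<Sum>j\<in>UNIV-{n0}. \<Sum>k\<in>UNIV-{n0}. S j k * y $ j * y $ k)"
  have a0: "dbar \<sigma> p a = 0" unfolding a_def by (rule dbar_sum)
  have "dird a \<sigma> p = 0" using Re_dbar[of \<sigma> p a] a0 by simp
  from second_order_limit[OF open_V p_V \<sigma>_smooth \<sigma>_p this, of "c *s \<nu>"]
  have lim: "((\<lambda>t. \<sigma> (p + t *\<^sub>R a + (t * t) *\<^sub>R (c *s \<nu>)) / t\<^sup>2) \<longlongrightarrow> hess \<sigma> p a a / 2 + dird (c *s \<nu>) \<sigma> p) (at_right 0)" .
  have "p + t *\<^sub>R a + (t * t) *\<^sub>R (c *s \<nu>) = par_dil n0 p u S \<nu> (of_real t) y" for t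
    unfolding par_dil_def a_def[symmetric] c_def[symmetric] by (simp add: vec_eq_iff mult.assoc scaleR_conv_of_real[where 'a=complex])
  moreover have "hess \<sigma> p a a / 2 + dird (c *s \<nu>) \<sigma> p = Re (qrho \<epsilon> n0 y y)"
  proof -
    have c: "c = y $ n0 - \<i> * hess20 \<sigma> p a a" unfolding c_def a_def hess20_frame[symmetric] by simp
    have "dird (c *s \<nu>) \<sigma> p = 2 * Re (dbar \<sigma> p (c *s \<nu>))" by (simp add: Re_dbar)
    also have "\<dots> = Im c" unfolding dbar_linear(2)[OF \<sigma>_diff] dbar_\<nu> by simp
    also have "\<dots> = Im (y $ n0) - Re (hess20 \<sigma> p a a)" unfolding c by simp
    finally have 1: "dird (c *s \<nu>) \<sigma> p = Im (y $ n0) - Re (hess20 \<sigma> p a a)" .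
    have 2: "Re (hess11 \<sigma> p a a) = - Re (lev \<epsilon> n0 y y)" unfolding a_def hess11_frame by simp
    have "Re (qrho \<epsilon> n0 y y) = Im (y $ n0) - Re (lev \<epsilon> n0 y y)"
      by (simp add: qrho_def complex_diff_cnj)
    then show ?thesis using hess_decompose[OF open_V p_V \<sigma>_smooth, of a] 1 2 by linarith
  qed
  ultimately show ?thesis using lim by simp
qed

text \<open>At the points x + \<i> s e_n0 the real part of \<open>qrho\<close> is s, so by
  \<open>dilation_limit\<close> \<sigma> changes sign between the images of s = - \<delta>/2 and s =
  \<delta>/2 for small t; the intermediate value theorem gives a zero.\<close>

lemma approach:
  assumes x: "qrho \<epsilon> n0 x x = 0" and \<delta>: "0 < \<delta>" and W: "open W" "p \<in> W" "W \<subseteq> V"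
  shows "\<forall>\<^sub>F t in at_right 0. \<exists>y. dist y x < \<delta> \<and> par_dil n0 p u S \<nu> (of_real t) y \<in> W \<and> \<sigma> (par_dil n0 p u S \<nu> (of_real t) y) = 0"
proof -
  define Y where "Y \<eta> = x + of_real \<eta> *s axis n0 \<i>" for \<eta> :: real
  define \<eta> where "\<eta> = \<delta> / 2"
  have \<eta>: "0 < \<eta>" using \<delta> by (simp add: \<eta>_def)
  have dY: "dist (Y s) x = \<bar>s\<bar>" for s by (simp add: Y_def dist_norm norm_vscale norm_axis)
  have qY: "Re (qrho \<epsilon> n0 (Y s) (Y s)) = s" for s
  proof -
    have "lev \<epsilon> n0 (Y s) (Y s) = lev \<epsilon> n0 x x"
      unfolding lev_def by (rule sum.cong) (auto simp: Y_def axis_nth_if)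
    then have "qrho \<epsilon> n0 (Y s) (Y s) = qrho \<epsilon> n0 x x + of_real s"
      by (simp add: qrho_def Y_def axis_nth_if field_simps)
    then show ?thesis using x by simp
  qed
  let ?\<Phi> = "\<lambda>t. par_dil n0 p u S \<nu> (complex_of_real t)"
  have \<Phi>Y: "?\<Phi> t (Y s) = ?\<Phi> t x + of_real (t * t * s) *s (\<i> *s \<nu>)" for t s
  proof -
    have 1: "(\<Sum>j\<in>UNIV-{n0}. Y s $ j *s u j) = (\<Sum>j\<in>UNIV-{n0}. x $ j *s u j)"
      by (rule sum.cong) (auto simp: Y_def axis_nth_if)
    have 2: "(\<Sum>j\<in>UNIV-{n0}. \<Sum>k\<in>UNIV-{n0}. S j k * Y s $ j * Y s $ k) = (\<Sum>j\<in>UNIV-{n0}. \<Sum>k\<in>UNIV-{n0}. S j k * x $ j * x $ k)"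
      by (intro sum.cong) (auto simp: Y_def axis_nth_if)
    show ?thesis unfolding par_dil_def 1 2 by (simp add: vec_eq_iff Y_def axis_nth_if algebra_simps)
  qed
  \<comment> \<open>Only the statement about domains, \<open>eventually_in_U\<close>, is wanted, so
    the identity serves as the map.\<close>
  interpret D: dilation n0 p \<nu> u S W "\<lambda>z. z"
    by unfold_locales (use W in \<open>auto simp: holomorphic_map_on_def intro!: exI[of _ "\<lambda>x. x"]\<close>)
  have ev1: "\<forall>\<^sub>F t in at_right 0. \<forall>y\<in>cball 0 (norm x + \<eta>). ?\<Phi> t y \<in> W" by (rule D.eventually_in_U)
  have ev2: "\<forall>\<^sub>F t in at_right 0. 0 < \<sigma> (?\<Phi> t (Y \<eta>)) / t\<^sup>2"
    by (rule order_tendstoD(1)[OF dilation_limit]) (use \<eta> qY in simp)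
  have ev3: "\<forall>\<^sub>F t in at_right 0. \<sigma> (?\<Phi> t (Y (- \<eta>))) / t\<^sup>2 < 0"
    by (rule order_tendstoD(2)[OF dilation_limit]) (use \<eta> qY in simp)
  show ?thesis
    using ev1 ev2 ev3
  proof eventually_elim
    case (elim t)
    have inW: "?\<Phi> t (Y s) \<in> W" if "- \<eta> \<le> s" "s \<le> \<eta>" for s
    proof -
      have "norm (Y s) \<le> norm x + \<eta>" using norm_triangle_sub[of "Y s" x] dY[of s] that by (simp add: dist_norm)
      then show ?thesis using elim(1) by simp
    qed
    have t0: "0 < t\<^sup>2" using elim(2) by (cases "t = 0") simp_all
    have "0 < \<sigma> (?\<Phi> t (Y \<eta>))" "\<sigma> (?\<Phi> t (Y (- \<eta>))) < 0"
      using elim(2,3) t0 by (simp_all add: zero_less_divide_iff divide_less_0_iff)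
    then have sg: "\<sigma> (?\<Phi> t (Y (- \<eta>))) \<le> 0" "0 \<le> \<sigma> (?\<Phi> t (Y \<eta>))" by simp_all
    have cY: "continuous_on {-\<eta>..\<eta>} (\<lambda>s. ?\<Phi> t (Y s))"
      unfolding \<Phi>Y by (intro continuous_intros)
    have "continuous_on V \<sigma>" using \<sigma>_smooth unfolding smooth_on_def by (metis C_k_on.simps(1))
    then have "continuous_on {-\<eta>..\<eta>} (\<lambda>s. \<sigma> (?\<Phi> t (Y s)))"
      by (rule continuous_on_compose2[OF _ cY]) (use inW W(3) in auto)
    from IVT'[of "\<lambda>s. \<sigma> (?\<Phi> t (Y s))", OF sg _ this] \<eta>
    obtain s where s: "- \<eta> \<le> s" "s \<le> \<eta>" "\<sigma> (?\<Phi> t (Y s)) = 0" by auto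
    have "dist (Y s) x < \<delta>" using s \<delta> unfolding dY by (auto simp: \<eta>_def)
    then show ?case using inW[OF s(1,2)] s(3) by blast
  qed
qed

end

section \<open>Transversality\<close>

lemma quadric_form_lin:
  "quadric_form e l (a + b) c = quadric_form e l a c + quadric_form e l b c"
  "quadric_form e l (a - b) c = quadric_form e l a c - quadric_form e l b c"
  "quadric_form e l c (a + b) = quadric_form e l c a + quadric_form e l c b"
  "quadric_form e l (z *s a) c = z * quadric_form e l a c"
  "quadric_form e l c (z *s a) = cnj z * quadric_form e l c a"
  by (simp_all add: quadric_form_def algebra_simps sum.distrib sum_subtractf sum_distrib_left)

lemma quadric_form_scaleR:
  "quadric_form e l (r *\<^sub>R a) c = of_real r * quadric_form e l a c"
  "quadric_form e l c (r *\<^sub>R a) = of_real r * quadric_form e l c a"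
  by (simp_all add: quadric_form_def scaleR_conv_of_real[where 'a=complex] right_diff_distrib distrib_left sum_distrib_left mult_ac)

lemma quadric_form_cnj: "cnj (quadric_form e l a b) = quadric_form e l b a"
  by (simp add: quadric_form_def mult.commute)

lemma quadric_form_last:
  fixes e :: "nat \<Rightarrow> 'k::finite"
  assumes e: "inj_on e {1..CARD('k)}" and l: "l < CARD('k)"
  shows "quadric_form e l (axis (e CARD('k)) z) a = 0" "quadric_form e l a (axis (e CARD('k)) z) = 0"
proof -
  have "e j \<noteq> e CARD('k)" if "1 \<le> j" "j < CARD('k)" for j
    using inj_onD[OF e, of j "CARD('k)"] that by auto
  then have "axis (e CARD('k)) z $ e j = 0" if "1 \<le> j" "j < CARD('k)" for j
    using that by (simp add: axis_def)
  then show "quadric_form e l (axis (e CARD('k)) z) a = 0" "quadric_form e l a (axis (e CARD('k)) z) = 0"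
    using l by (auto simp: quadric_form_def intro!: sum.neutral)
qed

text \<open>It is enough to find a curve in the hyperquadric through q with velocity b. The term of
  second order in the last coordinate absorbs the form of b with itself.\<close>

lemma hyperquadric_tangent:
  fixes e :: "nat \<Rightarrow> 'k::finite"
  assumes e: "inj_on e {1..CARD('k)}" and l: "l < CARD('k)" and q: "q \<in> hyperquadric e l"
    and V: "open V" "q \<in> V" and f: "smooth_on V f" "\<And>z. z \<in> hyperquadric e l \<Longrightarrow> z \<in> V \<Longrightarrow> f z = (0::real)"
    and b: "Im (b $ e CARD('k)) = 2 * Re (quadric_form e l b q)"
  shows "dird b f q = 0"
proof -
  define w where "w = axis (e CARD('k)) (\<i> * quadric_form e l b b)"
  define \<gamma> where "\<gamma> s = q + s *\<^sub>R b + s\<^sup>2 *\<^sub>R w" for s :: real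
  have Qb: "quadric_form e l b b = of_real (Re (quadric_form e l b b))"
    using quadric_form_cnj[of e l b b] by (simp add: complex_eq_iff)
  have Qqb: "quadric_form e l q b = cnj (quadric_form e l b q)" by (simp add: quadric_form_cnj)
  have \<gamma>: "\<gamma> s \<in> hyperquadric e l" for s
  proof -
    have "quadric_form e l (\<gamma> s) (\<gamma> s) = quadric_form e l (q + s *\<^sub>R b) (q + s *\<^sub>R b)"
      unfolding \<gamma>_def w_def by (simp add: quadric_form_lin quadric_form_scaleR quadric_form_last[OF e l])
    also have "\<dots> = quadric_form e l q q + of_real s * (quadric_form e l b q + cnj (quadric_form e l b q)) + of_real (s\<^sup>2) * quadric_form e l b b"
      unfolding Qqb[symmetric] by (simp add: quadric_form_lin quadric_form_scaleR power2_eq_square algebra_simps)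
    also have "\<dots> = of_real (Im (q $ e CARD('k))) + of_real s * of_real (2 * Re (quadric_form e l b q)) + of_real (s\<^sup>2) * of_real (Re (quadric_form e l b b))"
      using q Qb by (simp add: hyperquadric_def complex_add_cnj)
    also have "\<dots> = of_real (Im (\<gamma> s $ e CARD('k)))"
      by (simp add: \<gamma>_def w_def b)
    finally show ?thesis by (simp add: hyperquadric_def)
  qed
  have d\<gamma>: "(\<gamma> has_derivative (\<lambda>h. h *\<^sub>R b)) (at 0)"
    unfolding \<gamma>_def[abs_def] by (auto intro!: derivative_eq_intros)
  have \<gamma>0: "\<gamma> 0 = q" by (simp add: \<gamma>_def)
  have "(f has_derivative (\<lambda>v. dird v f q)) (at (\<gamma> 0))"
    unfolding \<gamma>0 by (rule differentiable_dird[OF smooth_on_differentiable[OF f(1) V(2)]])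
  from has_derivative_compose[OF d\<gamma> this] have 1: "((\<lambda>s. f (\<gamma> s)) has_derivative (\<lambda>h. dird (h *\<^sub>R b) f q)) (at 0)" .
  have "isCont \<gamma> 0" unfolding \<gamma>_def[abs_def] by (intro continuous_intros)
  then have "\<forall>\<^sub>F s in at 0. \<gamma> s \<in> V"
    using V \<gamma>0 by (intro topological_tendstoD[of \<gamma> q]) (auto simp: isCont_def)
  then have "\<forall>\<^sub>F s in at 0. f (\<gamma> s) = 0" by (rule eventually_mono) (rule f(2)[OF \<gamma>])
  moreover have "f (\<gamma> 0) = 0" by (rule f(2)[OF \<gamma>]) (simp add: \<gamma>0 V)
  ultimately have "((\<lambda>s. f (\<gamma> s)) has_derivative (\<lambda>h. 0)) (at 0)"
    by (intro has_derivative_transform_eventually[OF has_derivative_const[of 0]]) (auto elim: eventually_mono)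
  from has_derivative_unique[OF 1 this] have "(\<lambda>h. dird (h *\<^sub>R b) f q) = (\<lambda>h. 0)" .
  from fun_cong[OF this, of 1] show ?thesis by simp
qed

text \<open>The condition on a makes both a and \<open>\<i> *s a\<close> real tangent vectors, and
  the real derivatives along these two determine the (1,0)-differential at a.\<close>

lemma T10_hyperquadric:
  fixes e :: "nat \<Rightarrow> 'k::finite"
  assumes e: "inj_on e {1..CARD('k)}" and l: "l < CARD('k)" and q: "q \<in> hyperquadric e l"
    and a: "a $ e CARD('k) = 2 * \<i> * quadric_form e l a q"
  shows "a \<in> T10 (hyperquadric e l) q"
  unfolding T10_def
proof (intro CollectI allI impI)
  fix V and f :: "complex^'k \<Rightarrow> real"
  assume A: "open V \<and> q \<in> V \<and> smooth_on V f \<and> (\<forall>z\<in>hyperquadric e l \<inter> V. f z = 0)"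
  have "dird a f q = 0"
    by (rule hyperquadric_tangent[OF e l q, of V]) (use A in \<open>auto simp: a\<close>)
  moreover have "dird (\<i> *s a) f q = 0"
    by (rule hyperquadric_tangent[OF e l q, of V]) (use A in \<open>auto simp: a quadric_form_lin\<close>)
  moreover have "f differentiable (at q)" using A smooth_on_differentiable by blast
  ultimately show "(\<Sum>j\<in>UNIV. a $ j * wirtinger j (\<lambda>z. complex_of_real (f z)) q) = 0"
    by (simp add: sum_wirtinger dbar_def)
qed

text \<open>The kernel of the complex linear functional \<Lambda> consists of (1,0)-tangent vectors.
  The hypothesis on \<nu> is the conjugate of \<Lambda>(dF \<nu>) divided by 2\<i>, so a multiple of
  dF \<nu> corrects any vector into that kernel.\<close>

lemma CR_transversal_hyperquadric:
  fixes e :: "nat \<Rightarrow> 'k::finite" and F :: "complex^'n::finite \<Rightarrow> complex^'k"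
  assumes e: "inj_on e {1..CARD('k)}" and l: "l < CARD('k)" and q: "F p \<in> hyperquadric e l"
    and F: "holomorphic_map_on U F" "p \<in> U"
    and \<nu>: "cnj (dird \<nu> F p $ e CARD('k)) / (2 * \<i>) + quadric_form e l (F p) (dird \<nu> F p) \<noteq> 0"
  shows "CR_transversal_at F (hyperquadric e l) p"
proof -
  define \<Lambda> where "\<Lambda> a = a $ e CARD('k) - 2 * \<i> * quadric_form e l a (F p)" for a
  have lin: "\<Lambda> (a - c *s b) = \<Lambda> a - c * \<Lambda> b" for a b c
    by (simp add: \<Lambda>_def quadric_form_lin algebra_simps)
  let ?w = "dird \<nu> F p"
  have "cnj (\<Lambda> ?w) = 2 * \<i> * (cnj (?w $ e CARD('k)) / (2 * \<i>) + quadric_form e l (F p) ?w)"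
    by (simp add: \<Lambda>_def quadric_form_cnj algebra_simps)
  then have nz: "\<Lambda> ?w \<noteq> 0" using \<nu> by auto
  have "\<exists>u v. z = u + dird v F p \<and> u \<in> T10 (hyperquadric e l) (F p)" for z
  proof (intro exI conjI)
    let ?c = "\<Lambda> z / \<Lambda> ?w"
    show "z = (z - ?c *s ?w) + dird (?c *s \<nu>) F p"
      by (simp add: holomorphic_map_deriv(2)[OF F])
    show "z - ?c *s ?w \<in> T10 (hyperquadric e l) (F p)"
    proof (rule T10_hyperquadric[OF e l q])
      have "\<Lambda> (z - ?c *s ?w) = 0" using nz by (simp add: lin)
      then show "(z - ?c *s ?w) $ e CARD('k) = 2 * \<i> * quadric_form e l (z - ?c *s ?w) (F p)"
        by (simp add: \<Lambda>_def)
    qed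
  qed
  then show ?thesis unfolding CR_transversal_at_def dird_def by blast
qed

section \<open>(1,0)-tangent spaces and frames of the given hypersurface\<close>

lemma T10_subspace: "vec.subspace (T10 M q)"
  by (rule vec.subspaceI)
    (simp_all add: T10_def distrib_right sum.distrib mult.assoc flip: sum_distrib_left)

lemma T10_dbar:
  assumes "local_defining_function M q V \<rho>" "q \<in> M" "a \<in> T10 M q"
  shows "dbar \<rho> q a = 0"
proof -
  have V: "open V" "q \<in> V" "smooth_on V \<rho>" "\<forall>z\<in>M \<inter> V. \<rho> z = 0"
    using assms(1) unfolding local_defining_function_def by blast+
  then have "(\<Sum>j\<in>UNIV. a $ j * wirtinger j (\<lambda>z. complex_of_real (\<rho> z)) q) = 0"
    using assms(3) unfolding T10_def by blast
  then show ?thesis using sum_wirtinger[OF smooth_on_differentiable[OF V(3,2)]] by simp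
qed

lemma local_defining_function_uminus:
  assumes "local_defining_function M q V \<rho>"
  shows "local_defining_function M q V (\<lambda>z. - \<rho> z)"
proof -
  have V: "open V" "q \<in> V" "smooth_on V \<rho>" "M \<inter> V = {z\<in>V. \<rho> z = 0}"
    "\<forall>z\<in>M \<inter> V. \<exists>v. frechet_derivative \<rho> (at z) v \<noteq> 0"
    using assms unfolding local_defining_function_def by blast+
  have "smooth_on V (\<lambda>z. - \<rho> z)"
    by (rule smooth_on_bounded_linear[OF _ V(1,3)]) (rule bounded_linear_minus[OF bounded_linear_ident])
  moreover have "frechet_derivative (\<lambda>z. - \<rho> z) (at z) v = - frechet_derivative \<rho> (at z) v" if "z \<in> V" for z v
    using dird_eq[OF has_derivative_minus[OF differentiable_dird[OF smooth_on_differentiable[OF V(3) that]]]]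
    by (simp add: dird_def)
  ultimately show ?thesis unfolding local_defining_function_def using V by fastforce
qed

text \<open>z = 1 gives the polarised equation at two points, z = 0 its derivative in the second
  slot along w.\<close>

lemma Rq_homog:
  fixes e :: "nat \<Rightarrow> 'k::finite"
  assumes "l < CARD('k)"
  shows "herm_form (Suc CARD('k)) (quad_matrix CARD('k) l) (\<lambda>c. if c = 0 then 1 else y $ e c) (\<lambda>c. if c = 0 then z else w $ e c)
    = (y $ e CARD('k) * cnj z - cnj (w $ e CARD('k))) / (2 * \<i>) - quadric_form e l y w"
proof -
  have "(\<Sum>c=1..l. (if c = 0 then 1 else y $ e c) * cnj (if c = 0 then z else w $ e c)) = (\<Sum>c=1..l. y $ e c * cnj (w $ e c))"
    "(\<Sum>c=l+1..CARD('k)-1. (if c = 0 then 1 else y $ e c) * cnj (if c = 0 then z else w $ e c)) = (\<Sum>c=l+1..CARD('k)-1. y $ e c * cnj (w $ e c))"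
    by (rule sum.cong; simp)+
  then show ?thesis unfolding herm_form_quad[OF assms] by (simp add: quadric_form_def)
qed

lemma defining_frame_exists:
  fixes M :: "(complex^'n::finite) set" and n0 :: 'n
  assumes l: "0 < l" "l \<le> CARD('n) - 1 - l" and M: "smooth_real_hypersurface M" "has_signature M l" "p \<in> M"
  shows "\<exists>\<sigma> V \<nu> u \<epsilon>. local_defining_function M p V \<sigma> \<and> defining_frame n0 p \<nu> u \<epsilon> \<sigma> V \<and> (\<forall>j. j \<noteq> n0 \<longrightarrow> u j \<in> T10 M p) \<and>
    l \<le> card {j. j \<noteq> n0 \<and> \<epsilon> j = 1} \<and> l \<le> card {j. j \<noteq> n0 \<and> \<epsilon> j = -1}"
proof -
  obtain V \<rho> where \<rho>: "local_defining_function M p V \<rho>"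
    using M(1,3) unfolding smooth_real_hypersurface_def by blast
  have "\<exists>\<sigma>\<in>{\<rho>, \<lambda>z. - \<rho> z}. num_neg_eigenvalues (levi_form \<sigma> p) (T10 M p) = l \<and>
        num_pos_eigenvalues (levi_form \<sigma> p) (T10 M p) = CARD('n) - 1 - l"
    using M(2,3) \<rho> unfolding has_signature_def by blast
  then obtain \<sigma> where \<sigma>: "\<sigma> \<in> {\<rho>, \<lambda>z. - \<rho> z}" "num_neg_eigenvalues (levi_form \<sigma> p) (T10 M p) = l"
    "num_pos_eigenvalues (levi_form \<sigma> p) (T10 M p) = CARD('n) - 1 - l" by blast
  have \<sigma>d: "local_defining_function M p V \<sigma>"
    using \<sigma>(1) \<rho> local_defining_function_uminus[OF \<rho>] by blast
  then have V: "open V" "p \<in> V" "smooth_on V \<sigma>" "M \<inter> V = {z\<in>V. \<sigma> z = 0}"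
    and gr: "\<exists>v. frechet_derivative \<sigma> (at p) v \<noteq> 0"
    using M(3) unfolding local_defining_function_def by blast+
  have lf: "levi_form \<sigma> p = hess11 \<sigma> p" by (intro ext) (rule levi_form_eq[OF V(1-3)])
  have df: "\<sigma> differentiable (at p)" by (rule smooth_on_differentiable[OF V(3,2)])
  obtain v where "frechet_derivative \<sigma> (at p) v \<noteq> 0" using gr by (rule exE)
  then have "dbar \<sigma> p v \<noteq> 0" using Re_dbar[of \<sigma> p v] by (auto simp: dird_def)
  then have "dbar \<sigma> p ((- \<i> / 2 / dbar \<sigma> p v) *s v) = - \<i> / 2"
    unfolding dbar_linear(2)[OF df] by simp
  then have \<nu>: "\<exists>\<nu>. dbar \<sigma> p \<nu> = - \<i> / 2" by (rule exI)
  obtain \<nu> where \<nu>: "dbar \<sigma> p \<nu> = - \<i> / 2" using \<nu> by (rule exE)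
  have ex: "\<exists>u \<epsilon>. (\<forall>j. j \<noteq> n0 \<longrightarrow> u j \<in> T10 M p \<and> (\<epsilon> j = 1 \<or> \<epsilon> j = (-1::real))) \<and>
    (\<forall>i j. i \<noteq> n0 \<longrightarrow> j \<noteq> n0 \<longrightarrow> hess11 \<sigma> p (u i) (u j) = (if i = j then - of_real (\<epsilon> j) else 0)) \<and>
    l \<le> card {j. j \<noteq> n0 \<and> \<epsilon> j = 1} \<and> l \<le> card {j. j \<noteq> n0 \<and> \<epsilon> j = -1}"
    by (rule eigenbasis[OF T10_subspace hess11_add_left[OF V(1-3)] hess11_scale_left[OF V(1-3)] hess11_cnj[OF V(1-3)]
          \<sigma>(2,3)[unfolded lf] l])
  obtain u where ex': "\<exists>\<epsilon>. (\<forall>j. j \<noteq> n0 \<longrightarrow> u j \<in> T10 M p \<and> (\<epsilon> j = 1 \<or> \<epsilon> j = (-1::real))) \<and>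
    (\<forall>i j. i \<noteq> n0 \<longrightarrow> j \<noteq> n0 \<longrightarrow> hess11 \<sigma> p (u i) (u j) = (if i = j then - of_real (\<epsilon> j) else 0)) \<and>
    l \<le> card {j. j \<noteq> n0 \<and> \<epsilon> j = 1} \<and> l \<le> card {j. j \<noteq> n0 \<and> \<epsilon> j = -1}" using ex by (rule exE)
  obtain \<epsilon> where E: "(\<forall>j. j \<noteq> n0 \<longrightarrow> u j \<in> T10 M p \<and> (\<epsilon> j = 1 \<or> \<epsilon> j = (-1::real))) \<and>
    (\<forall>i j. i \<noteq> n0 \<longrightarrow> j \<noteq> n0 \<longrightarrow> hess11 \<sigma> p (u i) (u j) = (if i = j then - of_real (\<epsilon> j) else 0)) \<and>
    l \<le> card {j. j \<noteq> n0 \<and> \<epsilon> j = 1} \<and> l \<le> card {j. j \<noteq> n0 \<and> \<epsilon> j = -1}" using ex' by (rule exE)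
  have "defining_frame n0 p \<nu> u \<epsilon> \<sigma> V"
  proof
    show "\<sigma> p = 0" using V M(3) by blast
    show "dbar \<sigma> p (u j) = 0" if "j \<noteq> n0" for j using T10_dbar[OF \<sigma>d M(3)] E that by blast
  qed (use E V \<nu> in blast)+
  with \<sigma>d E show ?thesis by blast
qed

section \<open>Degeneracy versus transversality and injectivity of the differential\<close>

theorem degenerate_or_transversal_immersion:
  fixes M :: "(complex^'n::finite) set" and F :: "complex^'n \<Rightarrow> complex^'k::finite" and e :: "nat \<Rightarrow> 'k"
  assumes card: "CARD('n) \<le> CARD('k)" and l: "0 < l" "real l \<le> (real CARD('n) - 1) / 2"
    and M: "smooth_real_hypersurface M" "has_signature M l" "p \<in> M"
    and U: "open U" "p \<in> U" and F: "holomorphic_map_on U F" "F ` (M \<inter> U) \<subseteq> hyperquadric e l"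
  shows "totally_degenerate_at F (hyperquadric e l) p \<or>
    (\<exists>\<nu>. cnj (dird \<nu> F p $ e CARD('k)) / (2 * \<i>) + quadric_form e l (F p) (dird \<nu> F p) \<noteq> 0) \<and> (\<forall>v. dird v F p = 0 \<longrightarrow> v = 0)"
proof -
  define n0 :: 'n where "n0 = undefined"
  have "real (2 * l + 1) \<le> real CARD('n)" using l(2) by (simp add: field_simps)
  then have "2 * l + 1 \<le> CARD('n)" by (simp only: of_nat_le_iff)
  then have l2: "l \<le> CARD('n) - 1 - l" and lN: "l < CARD('k)" using card by linarith+
  obtain \<sigma> V \<nu> u \<epsilon> where E: "local_defining_function M p V \<sigma>" "defining_frame n0 p \<nu> u \<epsilon> \<sigma> V"
    "l \<le> card {j. j \<noteq> n0 \<and> \<epsilon> j = 1}" "l \<le> card {j. j \<noteq> n0 \<and> \<epsilon> j = -1}"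
    using defining_frame_exists[OF l(1) l2 M, of n0] by (elim exE conjE)
  interpret Fr: defining_frame n0 p \<nu> u \<epsilon> \<sigma> V by (rule E(2))
  have V: "open V" "p \<in> V" "M \<inter> V = {z\<in>V. \<sigma> z = 0}"
    using E(1) unfolding local_defining_function_def by blast+
  \<comment> \<open>In the intersection a zero of \<sigma> is a point of M at which F is
    defined.\<close>
  define W where "W = U \<inter> V"
  have W: "open W" "p \<in> W" "W \<subseteq> V" "W \<subseteq> U" using U V by (auto simp: W_def)
  interpret Q: quadric_map n0 p \<nu> u Fr.S W F e l "CARD('k)" \<epsilon>
  proof
    show "holomorphic_map_on W F" by (rule holomorphic_map_subset[OF F(1) W(4)])
  qed (use E(3,4) W l lN Fr.eps' in blast)+
  have homog: "Q.homog y = (\<lambda>c. if c = 0 then 1 else y $ e c)" for y by (rule ext) (rule Q.homog_def)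
  have Rq: "Q.Rq (Q.homog y) (Q.homog y) = 0 \<longleftrightarrow> y \<in> hyperquadric e l" for y
  proof -
    have "- (\<i> * (z * \<i>)) = z" for z by (simp add: complex_eq_iff)
    then show ?thesis unfolding homog Rq_homog[OF lN] hyperquadric_def by (auto simp: complex_diff_cnj)
  qed
  have app: "\<forall>\<^sub>F t in at_right 0. \<exists>y. dist y x < \<delta> \<and> Q.Rq (Q.homog (F (par_dil n0 p u Fr.S \<nu> (of_real t) y))) (Q.homog (F (par_dil n0 p u Fr.S \<nu> (of_real t) y))) = 0"
    if "qrho \<epsilon> n0 x x = 0" "0 < \<delta>" for x \<delta>
  proof (rule eventually_mono[OF Fr.approach[OF that W(1-3)]])
    fix t assume "\<exists>y. dist y x < \<delta> \<and> par_dil n0 p u Fr.S \<nu> (complex_of_real t) y \<in> W \<and> \<sigma> (par_dil n0 p u Fr.S \<nu> (complex_of_real t) y) = 0"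
    then obtain y where y: "dist y x < \<delta>" "par_dil n0 p u Fr.S \<nu> (complex_of_real t) y \<in> W" "\<sigma> (par_dil n0 p u Fr.S \<nu> (complex_of_real t) y) = 0"
      by blast
    have "par_dil n0 p u Fr.S \<nu> (complex_of_real t) y \<in> M \<inter> U" using y V(3) W by blast
    then have "F (par_dil n0 p u Fr.S \<nu> (complex_of_real t) y) \<in> hyperquadric e l" using F(2) by blast
    then show "\<exists>y. dist y x < \<delta> \<and> Q.Rq (Q.homog (F (par_dil n0 p u Fr.S \<nu> (of_real t) y))) (Q.homog (F (par_dil n0 p u Fr.S \<nu> (of_real t) y))) = 0"
      unfolding Rq using y(1) by blast
  qed
  from Q.Kern_dichotomy[OF app] show ?thesis
  proof
    assume "\<forall>k x y. Q.Kern k x y = 0"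
    then have "Q.Kern k x y = 0" for k x y by simp
    from Q.flat_degenerate[OF this Fr.frame_injective] show ?thesis
      unfolding Rq totally_degenerate_at_def by blast
  next
    assume A: "Q.normal_deriv \<noteq> 0 \<and> (\<forall>k x y. k < 2 \<longrightarrow> Q.Kern k x y = 0) \<and> (\<forall>x. qrho \<epsilon> n0 x x = 0 \<longrightarrow> Q.Kern 2 x x = 0)"
    have "- (cnj (dird \<nu> F p $ e CARD('k)) / (2 * \<i>) + quadric_form e l (F p) (dird \<nu> F p)) \<noteq> 0"
      using conjunct1[OF A] unfolding Q.normal_deriv_def homog Rq_homog[OF lN] by simp
    then have 1: "cnj (dird \<nu> F p $ e CARD('k)) / (2 * \<i>) + quadric_form e l (F p) (dird \<nu> F p) \<noteq> 0" by simp
    have "v = 0" if v: "dird v F p = 0" for v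
    proof -
      let ?A = "\<lambda>z::complex^'n. (\<Sum>j\<in>UNIV-{n0}. z $ j *s u j) + z $ n0 *s \<nu>"
      have "inj ?A" unfolding linear_injective_0[OF linear_frame] by (intro allI impI) (rule Fr.frame_injective)
      then have "surj ?A" by (rule linear_inj_imp_surj[OF linear_frame])
      then obtain z where z: "v = ?A z" by (rule surjE)
      have "z = 0"
        by (rule Q.immersion) (use A v[unfolded z] in auto)
      then show ?thesis by (simp add: z)
    qed
    then show ?thesis using 1 by blast
  qed
qed

section \<open>Embeddings\<close>

lemma clinearI:
  fixes f :: "complex^'n::finite \<Rightarrow> complex^'k::finite"
  assumes "\<And>x y. f (x + y) = f x + f y" "\<And>c x. f (c *s x) = c *s f x"
  shows "Vector_Spaces.linear (*s) (*s) f"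
  unfolding Vector_Spaces.linear_iff by (intro conjI allI vec.vector_space_axioms assms)

lemma holomorphic_map_clinear:
  fixes f :: "complex^'n::finite \<Rightarrow> complex^'k::finite"
  assumes "Vector_Spaces.linear (*s) (*s) f"
  shows "holomorphic_map_on U f" "dird v f x = f v" "linear f"
proof -
  have sc: "f (c *s x) = c *s f x" and ad: "f (x + y) = f x + f y" for c x y
    using assms unfolding Vector_Spaces.linear_iff by blast+
  have r: "r *\<^sub>R x = complex_of_real r *s x" for r and x :: "complex^'m::finite"
    by (simp add: vec_eq_iff scaleR_conv_of_real[where 'a=complex])
  show "linear f" by (rule linearI) (simp_all add: ad sc r)
  then have d: "(f has_derivative f) (at x)" for x
    by (intro bounded_linear_imp_has_derivative) (simp add: linear_conv_bounded_linear)
  show "dird v f x = f v" by (rule dird_eq[OF d])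
  show "holomorphic_map_on U f" unfolding holomorphic_map_on_def using d sc by blast
qed

text \<open>The real inverse function theorem, together with the fact that the inverse of a complex
  linear bijection is complex linear. As the derivative at p is the identity, its inverse there is
  explicit.\<close>

lemma holomorphic_local_inverse:
  fixes h :: "complex^'n::finite \<Rightarrow> complex^'n"
  assumes U: "open U" "p \<in> U" and h: "holomorphic_map_on U h" and id: "\<And>v. dird v h p = v"
  shows "\<exists>A Y G. open A \<and> A \<subseteq> U \<and> p \<in> A \<and> open Y \<and> holomorphic_map_on Y G \<and> homeomorphism A Y h G"
proof -
  define h' where "h' x = Blinfun (\<lambda>v. dird v h x)" for x
  have h': "blinfun_apply (h' x) = (\<lambda>v. dird v h x)" if "x \<in> U" for x
    unfolding h'_def by (rule bounded_linear_Blinfun_apply[OF has_derivative_bounded_linear[OF holomorphic_map_deriv(1)[OF h that]]])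
  have sm: "C_k_on (Suc 0) U h" using holomorphic_map_smooth_on[OF U(1) h] by (simp add: smooth_on_def)
  have cont: "continuous_on U h'"
  proof (rule continuous_on_blinfun_componentwise)
    fix i :: "complex^'n"
    have "continuous_on U (dird i h)" using sm unfolding C_k_on_Suc_dird by simp
    then show "continuous_on U (\<lambda>x. blinfun_apply (h' x) i)"
      by (rule continuous_on_eq) (simp add: h')
  qed
  have "id_blinfun o\<^sub>L h' p = id_blinfun" by (rule blinfun_eqI) (simp add: h'[OF U(2)] id)
  from inverse_function_theorem[OF U(1) _ cont U(2) this, of h]
  obtain A Y G G' where A: "open A" "A \<subseteq> U" "p \<in> A" "open Y" "homeomorphism A Y h G"
    "\<And>y. y \<in> Y \<Longrightarrow> (G has_derivative G' y) (at y)" "\<And>y. y \<in> Y \<Longrightarrow> G' y = inv (blinfun_apply (h' (G y)))"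
    "\<And>y. y \<in> Y \<Longrightarrow> bij (blinfun_apply (h' (G y)))"
    using holomorphic_map_deriv(1)[OF h] h' by (metis (no_types, lifting))
  have "holomorphic_map_on Y G"
    unfolding holomorphic_map_on_def
  proof (intro ballI exI conjI allI)
    fix y c v assume y: "y \<in> Y"
    show "(G has_derivative G' y) (at y)" by (rule A(6)[OF y])
    have GU: "G y \<in> U" using A(2,5) y unfolding homeomorphism_def by blast
    have b: "bij (blinfun_apply (h' (G y)))" by (rule A(8)[OF y])
    have "blinfun_apply (h' (G y)) (c *s G' y v) = c *s blinfun_apply (h' (G y)) (G' y v)"
      unfolding h'[OF GU] by (rule holomorphic_map_deriv(2)[OF h GU])
    also have "blinfun_apply (h' (G y)) (G' y v) = v" unfolding A(7)[OF y] by (rule surj_f_inv_f[OF bij_is_surj[OF b]])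
    finally have "c *s G' y v = inv (blinfun_apply (h' (G y))) (c *s v)" using inv_f_eq[OF bij_is_inj[OF b]] by metis
    then show "G' y (c *s v) = c *s G' y v" unfolding A(7)[OF y] by simp
  qed
  with A(1-5) show ?thesis by blast
qed

lemma T10_iff_dbar:
  "a \<in> T10 S q \<longleftrightarrow> (\<forall>V f. open V \<and> q \<in> V \<and> smooth_on V f \<and> (\<forall>z\<in>S \<inter> V. f z = 0) \<longrightarrow> dbar f q a = 0)"
proof -
  have "(\<Sum>j\<in>UNIV. a $ j * wirtinger j (\<lambda>z. complex_of_real (f z)) q) = dbar f q a"
    if "open V \<and> q \<in> V \<and> smooth_on V f \<and> (\<forall>z\<in>S \<inter> V. f z = 0)" for V f
    using that by (intro sum_wirtinger smooth_on_differentiable[of V]) blast+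
  then show ?thesis unfolding T10_def mem_Collect_eq by (simp cong: imp_cong)
qed

lemma dird_compose:
  assumes "f differentiable (at (F q))" "F differentiable (at q)"
  shows "dird a (\<lambda>z. f (F z)) q = dird (dird a F q) f (F q)"
  by (rule dird_eq[OF has_derivative_compose[OF differentiable_dird[OF assms(2)] differentiable_dird[OF assms(1)]]])

text \<open>A function vanishing on S' pulls back to one vanishing on S near q, and since the
  differential of F commutes with \<i>, the (1,0)-differentials correspond.\<close>

lemma T10_push_forward:
  assumes A: "open A" "q \<in> A" and F: "holomorphic_map_on A F" and S: "F ` (S \<inter> A) \<subseteq> S'" and a: "a \<in> T10 S q"
  shows "dird a F q \<in> T10 S' (F q)"
  unfolding T10_iff_dbar
proof (intro allI impI)
  fix V and f :: "_ \<Rightarrow> real"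
  assume V: "open V \<and> F q \<in> V \<and> smooth_on V f \<and> (\<forall>z\<in>S' \<inter> V. f z = 0)"
  have sF: "smooth_on A F" by (rule holomorphic_map_smooth_on[OF A(1) F])
  have "continuous_on A F" using sF unfolding smooth_on_def by (metis C_k_on.simps(1))
  then have oA: "open (A \<inter> F -` V)" using A(1) V by (simp add: continuous_open_preimage)
  have "smooth_on (A \<inter> F -` V) (\<lambda>z. f (F z))"
    by (rule smooth_on_compose[OF oA, of V]) (use V smooth_on_subset[OF sF] in auto)
  then have "dbar (\<lambda>z. f (F z)) q a = 0"
    using a oA A(2) V S unfolding T10_iff_dbar by blast
  moreover have "dird b (\<lambda>z. f (F z)) q = dird (dird b F q) f (F q)" for b
    by (rule dird_compose) (use V sF A smooth_on_differentiable in blast)+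
  ultimately show "dbar f (F q) (dird a F q) = 0"
    unfolding dbar_def by (simp add: holomorphic_map_deriv(2)[OF F A(2)])
qed

lemma T10_open_Int:
  assumes "open A" "q \<in> A"
  shows "T10 (M \<inter> A) q = T10 M q"
proof
  show "T10 (M \<inter> A) q \<subseteq> T10 M q" unfolding T10_iff_dbar subset_iff by blast
  show "T10 M q \<subseteq> T10 (M \<inter> A) q"
  proof
    fix a assume a: "a \<in> T10 M q"
    show "a \<in> T10 (M \<inter> A) q"
      unfolding T10_iff_dbar
    proof (intro allI impI)
      fix V and f :: "_ \<Rightarrow> real"
      assume V: "open V \<and> q \<in> V \<and> smooth_on V f \<and> (\<forall>z\<in>M \<inter> A \<inter> V. f z = 0)"
      then have "open (V \<inter> A)" "smooth_on (V \<inter> A) f" using assms(1) smooth_on_subset by blast+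
      then show "dbar f q a = 0"
        using a V assms(2) unfolding T10_iff_dbar by (metis Int_iff)
    qed
  qed
qed

text \<open>A holomorphic left inverse P on a neighbourhood of the image makes F and its inverse
  symmetric: tangent vectors are pushed forward along F and along P alike.\<close>

locale holomorphic_retraction =
  fixes A :: "(complex^'n::finite) set" and Y :: "(complex^'k::finite) set"
    and F :: "complex^'n \<Rightarrow> complex^'k" and P :: "complex^'k \<Rightarrow> complex^'n"
  assumes open_A: "open A" and open_Y: "open Y" and F_hol: "holomorphic_map_on A F" and P_hol: "holomorphic_map_on Y P"
    and F_Y: "F ` A \<subseteq> Y" and P_A: "P ` Y \<subseteq> A" and PF: "\<And>z. z \<in> A \<Longrightarrow> P (F z) = z"
begin

lemma F_smooth: "smooth_on A F" by (rule holomorphic_map_smooth_on[OF open_A F_hol])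

lemma P_smooth: "smooth_on Y P" by (rule holomorphic_map_smooth_on[OF open_Y P_hol])

lemma dird_PF: assumes z: "z \<in> A" shows "dird (dird v F z) P (F z) = v"
proof -
  have 1: "((\<lambda>z. P (F z)) has_derivative (\<lambda>v. dird (dird v F z) P (F z))) (at z)"
    by (rule has_derivative_compose[OF holomorphic_map_deriv(1)[OF F_hol z] holomorphic_map_deriv(1)[OF P_hol]]) (use F_Y z in blast)
  have "((\<lambda>z. z) has_derivative (\<lambda>v. v)) (at z)" by (rule has_derivative_ident)
  then have "((\<lambda>z. P (F z)) has_derivative (\<lambda>v. v)) (at z)"
    by (rule has_derivative_transform_within_open[OF _ open_A z]) (simp add: PF)
  from has_derivative_unique[OF 1 this] show ?thesis by (rule fun_cong)
qed

lemma FP_hol: "holomorphic_map_on Y (\<lambda>y. F (P y))"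
  by (rule holomorphic_map_compose[OF P_hol F_hol]) (use P_A in blast)

text \<open>Within Y its zeros are exactly the points of the image of A, so its components serve as
  equations of that image.\<close>

definition "defect y = y - F (P y)"

lemma defect_hol: "holomorphic_map_on Y defect"
  unfolding holomorphic_map_on_def
proof (intro ballI exI conjI allI)
  fix y c v assume y: "y \<in> Y"
  show "(defect has_derivative (\<lambda>v. v - dird v (\<lambda>y. F (P y)) y)) (at y)"
    unfolding defect_def by (intro has_derivative_diff has_derivative_ident holomorphic_map_deriv(1)[OF FP_hol y])
  show "c *s v - dird (c *s v) (\<lambda>y. F (P y)) y = c *s (v - dird v (\<lambda>y. F (P y)) y)"
    unfolding holomorphic_map_deriv(2)[OF FP_hol y] by (simp add: vec_eq_iff right_diff_distrib)
qed

lemma dird_defect: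
  assumes y: "y \<in> Y"
  shows "dird v defect y = v - dird (dird v P y) F (P y)"
proof -
  have "dird v (\<lambda>y. F (P y)) y = dird (dird v P y) F (P y)"
    by (rule dird_eq[OF has_derivative_compose[OF holomorphic_map_deriv(1)[OF P_hol y] holomorphic_map_deriv(1)[OF F_hol]]])
      (use P_A y in blast)
  moreover have "dird v defect y = v - dird v (\<lambda>y. F (P y)) y"
    unfolding defect_def by (rule dird_eq) (intro has_derivative_diff has_derivative_ident holomorphic_map_deriv(1)[OF FP_hol y])
  ultimately show ?thesis by simp
qed

lemma homeo: "S \<subseteq> A \<Longrightarrow> homeomorphism S (F ` S) F P"
proof -
  assume S: "S \<subseteq> A"
  have "continuous_on A F" "continuous_on Y P"
    using F_smooth P_smooth unfolding smooth_on_def by (metis C_k_on.simps(1))+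
  moreover have "F ` S \<subseteq> Y" using S F_Y by blast
  ultimately have c: "continuous_on S F" "continuous_on (F ` S) P"
    using S by (auto intro: continuous_on_subset)
  have "P (F x) = x" if "x \<in> S" for x using PF S that by blast
  then show ?thesis unfolding homeomorphism_def using c by (auto simp: image_image)
qed

lemma F_embedding: "S \<subseteq> A \<Longrightarrow> F ` S \<subseteq> S' \<Longrightarrow> smooth_embedding S S' F"
  unfolding smooth_embedding_def
proof (intro conjI ballI)
  assume S: "S \<subseteq> A"
  show "\<exists>h. homeomorphism S (F ` S) F h" using homeo[OF S] by blast
  fix q assume "q \<in> S"
  then have q: "q \<in> A" using S by blast
  have "smooth_extension_at S F q F"
    unfolding smooth_extension_at_def using open_A q F_smooth by blast
  moreover have "inj_on (frechet_derivative F (at q)) (tangent_space S q)"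
    by (rule inj_on_inverseI[where g="\<lambda>w. dird w P (F q)"]) (use dird_PF[OF q] in \<open>simp add: dird_def\<close>)
  ultimately show "\<exists>g. smooth_extension_at S F q g \<and> inj_on (frechet_derivative g (at q)) (tangent_space S q)" by blast
qed

lemma F_CR_diffeomorphism:
  assumes S: "S \<subseteq> A"
  shows "CR_diffeomorphism S (F ` S) F"
proof -
  have inj: "inj_on F S" using PF S by (metis inj_on_inverseI subsetD)
  have inv: "inv_into S F (F z) = z" if "z \<in> S" for z by (rule inv_into_f_f[OF inj that])
  have "smooth_CR_map S (F ` S) F"
    unfolding smooth_CR_map_def
  proof (intro conjI ballI)
    fix q assume qS: "q \<in> S"
    then have q: "q \<in> A" using S by blast
    show "\<exists>g. smooth_extension_at S F q g \<and> (\<forall>a\<in>T10 S q. frechet_derivative g (at q) a \<in> T10 (F ` S) (F q) \<and>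
        frechet_derivative g (at q) (\<i> *s a) = \<i> *s frechet_derivative g (at q) a)"
    proof (intro exI[of _ F] conjI ballI)
      show "smooth_extension_at S F q F"
        unfolding smooth_extension_at_def using open_A q F_smooth by blast
      fix a assume a: "a \<in> T10 S q"
      show "frechet_derivative F (at q) a \<in> T10 (F ` S) (F q)"
        using T10_push_forward[OF open_A q F_hol _ a, of "F ` S"] by (simp add: dird_def image_mono)
      show "frechet_derivative F (at q) (\<i> *s a) = \<i> *s frechet_derivative F (at q) a"
        using holomorphic_map_deriv(2)[OF F_hol q] by (simp add: dird_def)
    qed
  qed simp
  moreover have "smooth_CR_map (F ` S) S (inv_into S F)"
    unfolding smooth_CR_map_def
  proof (intro conjI ballI)
    show "inv_into S F ` F ` S \<subseteq> S" by (auto simp: inv)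
    fix w assume "w \<in> F ` S"
    then obtain q where q: "w = F q" "q \<in> S" by blast
    then have wY: "w \<in> Y" using S F_Y by blast
    have iP: "inv_into S F w = P w" using q inv PF S by auto
    have PS: "P ` (F ` S \<inter> Y) \<subseteq> S" using PF S by auto
    show "\<exists>g. smooth_extension_at (F ` S) (inv_into S F) w g \<and> (\<forall>a\<in>T10 (F ` S) w. frechet_derivative g (at w) a \<in> T10 S (inv_into S F w) \<and>
        frechet_derivative g (at w) (\<i> *s a) = \<i> *s frechet_derivative g (at w) a)"
    proof (intro exI[of _ P] conjI ballI)
      have "P z = inv_into S F z" if "z \<in> F ` S" for z using that inv PF S by auto
      then show "smooth_extension_at (F ` S) (inv_into S F) w P"
        unfolding smooth_extension_at_def using open_Y wY P_smooth by blast
      fix a assume a: "a \<in> T10 (F ` S) w"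
      show "frechet_derivative P (at w) a \<in> T10 S (inv_into S F w)"
        using T10_push_forward[OF open_Y wY P_hol PS a] by (simp add: dird_def iP)
      show "frechet_derivative P (at w) (\<i> *s a) = \<i> *s frechet_derivative P (at w) a"
        using holomorphic_map_deriv(2)[OF P_hol wY] by (simp add: dird_def)
    qed
  qed
  ultimately show ?thesis unfolding CR_diffeomorphism_def using inj by (simp add: inj_on_imp_bij_betw)
qed

text \<open>For the harder inclusion, real parts of the components of \<open>defect\<close> vanish
  on the image, and their (1,0)-differentials are half the derivatives of these components. So a
  tangent vector b satisfies b = dF (dP b).\<close>

lemma T10_image:
  assumes S: "S \<subseteq> A" and z: "z \<in> S"
  shows "T10 (F ` S) (F z) = (\<lambda>a. dird a F z) ` T10 S z"
proof (intro equalityI subsetI)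
  have zA: "z \<in> A" and zY: "F z \<in> Y" using S z F_Y by blast+
  fix b
  {
    assume "b \<in> (\<lambda>a. dird a F z) ` T10 S z"
    then obtain a where a: "a \<in> T10 S z" "b = dird a F z" by blast
    have "F ` (S \<inter> A) \<subseteq> F ` S" by blast
    from T10_push_forward[OF open_A zA F_hol this a(1)] show "b \<in> T10 (F ` S) (F z)" by (simp add: a(2))
  }
  assume b: "b \<in> T10 (F ` S) (F z)"
  have PS: "P ` (F ` S \<inter> Y) \<subseteq> S" using PF S by auto
  have P: "dird b P (F z) \<in> T10 S z" using T10_push_forward[OF open_Y zY P_hol PS b] by (simp add: PF[OF zA])
  have "dird b defect (F z) $ i = 0" for i
  proof -
    let ?f = "\<lambda>y. Re (defect y $ i)"
    have bl: "bounded_linear (\<lambda>y::complex^'k. Re (y $ i))"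
      by (intro bounded_linear_compose[OF bounded_linear_Re] bounded_linear_vec_nth)
    have sm: "smooth_on Y ?f"
      by (rule smooth_on_bounded_linear[OF bl open_Y holomorphic_map_smooth_on[OF open_Y defect_hol]])
    have "\<forall>y\<in>F ` S \<inter> Y. ?f y = 0" using PF S by (auto simp: defect_def)
    then have 0: "dbar ?f (F z) b = 0" using b open_Y zY sm unfolding T10_iff_dbar by blast
    have dd: "dird v ?f (F z) = Re (dird v defect (F z) $ i)" for v
      by (rule dird_eq[OF bounded_linear.has_derivative[OF bl holomorphic_map_deriv(1)[OF defect_hol zY]]])
    have "dbar ?f (F z) b = dird b defect (F z) $ i / 2"
      unfolding dbar_def dd holomorphic_map_deriv(2)[OF defect_hol zY] by (simp add: complex_eq_iff)
    then show ?thesis using 0 by simp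
  qed
  then have "dird b defect (F z) = 0" by (simp add: vec_eq_iff)
  then have "b = dird (dird b P (F z)) F z" unfolding dird_defect[OF zY] PF[OF zA] by simp
  then show "b \<in> (\<lambda>a. dird a F z) ` T10 S z" using P by blast
qed

lemma dim_T10_image:
  assumes S: "S \<subseteq> A" and z: "z \<in> S"
  shows "vec.dim (T10 (F ` S) (F z)) = vec.dim (T10 S z)"
proof -
  have zA: "z \<in> A" using S z by blast
  have "Vector_Spaces.linear (*s) (*s) (\<lambda>a. dird a F z)"
    by (rule clinearI) (simp_all add: linear_add[OF has_derivative_linear[OF holomorphic_map_deriv(1)[OF F_hol zA]]] holomorphic_map_deriv(2)[OF F_hol zA])
  moreover have "inj_on (\<lambda>a. dird a F z) (vec.span (T10 S z))"
    by (rule inj_on_inverseI[where g="\<lambda>w. dird w P (F z)"]) (rule dird_PF[OF zA])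
  ultimately show ?thesis unfolding T10_image[OF S z] by (rule vec.dim_image_eq)
qed

text \<open>The defining functions of the image are \<open>\<rho> \<circ> P\<close> and the coordinates of \<open>y - F (P y)\<close> along the
  kernel of \<open>\<pi>\<close>, in which this difference takes its values.\<close>

lemma image_submanifold:
  fixes \<pi> :: "complex^'k \<Rightarrow> complex^'n"
  assumes \<pi>: "linear \<pi>" and \<pi>d: "\<And>y. y \<in> Y \<Longrightarrow> \<pi> (defect y) = 0" and \<pi>P: "\<And>y v. y \<in> Y \<Longrightarrow> \<pi> v = 0 \<Longrightarrow> dird v P y = 0" and surj: "surj \<pi>"
    and \<rho>: "smooth_on A \<rho>" "M \<inter> A = {z\<in>A. \<rho> z = (0::real)}" "\<And>z. z \<in> M \<inter> A \<Longrightarrow> \<exists>v. dird v \<rho> z \<noteq> 0"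
  shows "\<exists>d. smooth_submanifold d (F ` (M \<inter> A))"
proof -
  define K where "K = {v. \<pi> v = 0}"
  have K: "subspace K" unfolding K_def by (rule linear_subspace_kernel[OF \<pi>])
  \<comment> \<open>Leaves room for one equation besides the dim K ones, without exceeding the real
    dimension of the target.\<close>
  have "K \<noteq> UNIV"
  proof
    assume "K = UNIV"
    then have "\<pi> v = 0" for v unfolding K_def by blast
    then have "range \<pi> = {0}" by auto
    then have "axis undefined 1 \<in> {0::complex^'n}" using surj by auto
    then show False by (simp add: axis_eq_0_iff)
  qed
  then have "dim K \<noteq> DIM(complex^'k)" using dim_eq_full[of K] K by (metis span_eq_iff)
  then have dK: "dim K < DIM(complex^'k)" using dim_subset_UNIV[of K] by linarith
  have "\<exists>B. B \<subseteq> K \<and> pairwise orthogonal B \<and> (\<forall>x\<in>B. norm x = 1) \<and> independent B \<and> card B = dim K \<and> span B = K"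
    by (rule orthonormal_basis_subspace[OF K]) blast
  then obtain B where B: "B \<subseteq> K" "pairwise orthogonal B" "\<forall>x\<in>B. norm x = 1" "independent B" "card B = dim K" "span B = K"
    by (elim exE conjE)
  have "\<exists>b. bij_betw b {0..<card B} B" by (rule ex_bij_betw_nat_finite[OF independent_imp_finite[OF B(4)]])
  then obtain b where b: "bij_betw b {0..<dim K} B" unfolding B(5) by (rule exE)
  have bB: "b i \<in> B" if "i < dim K" for i using bij_betwE[OF b] that by simp
  have bb: "b i \<bullet> b j = (if i = j then 1 else 0)" if "i < dim K" "j < dim K" for i j
  proof (cases "i = j")
    case True
    then show ?thesis using B(3) bB[OF that(1)] by (simp add: norm_eq_1)
  next
    case False
    then have "b i \<noteq> b j" using bij_betw_imp_inj_on[OF b] that by (auto dest: inj_onD)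
    then show ?thesis using B(2) bB that False unfolding pairwise_def orthogonal_def by auto
  qed
  have Kzero: "v = 0" if "v \<in> K" "\<And>i. i < dim K \<Longrightarrow> v \<bullet> b i = 0" for v
  proof -
    have "orthogonal v x" if "x \<in> B" for x
      using \<open>\<And>i. i < dim K \<Longrightarrow> v \<bullet> b i = 0\<close> b that unfolding bij_betw_def orthogonal_def by force
    then have "orthogonal v v" using orthogonal_to_span[of v B v] that(1) B(6) by blast
    then show ?thesis by (simp add: orthogonal_def)
  qed
  define r where "r i = (if i < dim K then (\<lambda>y. defect y \<bullet> b i) else (\<lambda>y. \<rho> (P y)))" for i
  \<comment> \<open>There are dim K equations from \<open>defect\<close>, which takes its values in
    K, and one from \<rho>, stored at index dim K.\<close>
  define d where "d = DIM(complex^'k) - Suc (dim K)"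
  have dd: "DIM(complex^'k) - d = Suc (dim K)" using dK by (simp add: d_def)
  let ?S = "F ` (M \<inter> A)"
  have SY: "?S \<subseteq> Y" using F_Y by blast
  have defS: "defect y = 0" "P y \<in> M \<inter> A" if "y \<in> ?S" for y using that PF by (auto simp: defect_def)
  have bl: "bounded_linear (\<lambda>y::complex^'k. y \<bullet> c)" for c by (rule bounded_linear_inner_left)
  have sm: "smooth_on Y (r i)" for i
  proof (cases "i < dim K")
    case True
    then show ?thesis unfolding r_def
      using smooth_on_bounded_linear[OF bl open_Y holomorphic_map_smooth_on[OF open_Y defect_hol]] by simp
  next
    case False
    have "smooth_on Y (\<lambda>y. \<rho> (P y))"
      by (rule smooth_on_compose[OF open_Y open_A _ P_smooth \<rho>(1)]) (use P_A in blast)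
    then show ?thesis unfolding r_def using False by simp
  qed
  have zero: "?S \<inter> Y = {y\<in>Y. \<forall>i<Suc (dim K). r i y = 0}"
  proof (intro equalityI subsetI)
    fix y assume y: "y \<in> ?S \<inter> Y"
    then have "defect y = 0" "\<rho> (P y) = 0" using defS \<rho>(2) by blast+
    then show "y \<in> {y\<in>Y. \<forall>i<Suc (dim K). r i y = 0}" using y by (simp add: r_def)
  next
    fix y assume y: "y \<in> {y\<in>Y. \<forall>i<Suc (dim K). r i y = 0}"
    then have yY: "y \<in> Y" and ri: "\<And>i. i < Suc (dim K) \<Longrightarrow> r i y = 0" by simp_all
    have "\<rho> (P y) = 0" using ri[of "dim K"] by (simp add: r_def)
    then have PM: "P y \<in> M \<inter> A" using \<rho>(2) P_A yY by blast
    have "defect y = 0"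
    proof (rule Kzero)
      show "defect y \<in> K" using \<pi>d[OF yY] by (simp add: K_def)
      show "defect y \<bullet> b i = 0" if "i < dim K" for i using ri[of i] that by (simp add: r_def)
    qed
    then have "y = F (P y)" by (simp add: defect_def)
    then show "y \<in> ?S \<inter> Y" using PM yY by blast
  qed
  have indep: "\<forall>i<Suc (dim K). c i = 0"
    if y: "y \<in> ?S \<inter> Y" and c: "\<forall>v. (\<Sum>i<Suc (dim K). c i * frechet_derivative (r i) (at y) v) = 0" for y and c :: "nat \<Rightarrow> real"
  proof -
    have yY: "y \<in> Y" and Py: "P y \<in> M \<inter> A" "F (P y) = y" using y defS by (auto simp: defect_def)
    have PA: "P y \<in> A" using Py by blast
    have dr1: "dird v (r i) y = dird v defect y \<bullet> b i" if "i < dim K" for v i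
      unfolding r_def using that dird_eq[OF bounded_linear.has_derivative[OF bl holomorphic_map_deriv(1)[OF defect_hol yY]]] by simp
    have dr2: "dird v (r (dim K)) y = dird (dird v P y) \<rho> (P y)" for v
    proof -
      have "dird v (\<lambda>y. \<rho> (P y)) y = dird (dird v P y) \<rho> (P y)"
        by (rule dird_compose[OF smooth_on_differentiable[OF \<rho>(1) PA] smooth_on_differentiable[OF P_smooth yY]])
      then show ?thesis by (simp add: r_def)
    qed
    have sum: "(\<Sum>i<dim K. c i * (dird v defect y \<bullet> b i)) + c (dim K) * dird (dird v P y) \<rho> (P y) = 0" for v
      using spec[OF c, of v] by (simp add: dr1 dr2 flip: dird_def)
    \<comment> \<open>The vector b j is annihilated by dP, so testing with it isolates c j. A vector
      dF v with nonzero derivative of \<rho> along v isolates the last coefficient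
      afterwards.\<close>
    have c1: "c j = 0" if j: "j < dim K" for j
    proof -
      have "b j \<in> K" using bB[OF j] B(1) by blast
      then have 0: "dird (b j) P y = 0" using \<pi>P[OF yY] by (simp add: K_def)
      have z1: "dird 0 F (P y) = 0" by (rule linear_0[OF has_derivative_linear[OF holomorphic_map_deriv(1)[OF F_hol PA]]])
      have z2: "dird 0 \<rho> (P y) = 0"
        by (rule linear_0[OF has_derivative_linear[OF differentiable_dird[OF smooth_on_differentiable[OF \<rho>(1) PA]]]])
      have "(\<Sum>i<dim K. c i * (b j \<bullet> b i)) = 0" using sum[of "b j"] unfolding dird_defect[OF yY] 0 z1 z2 by simp
      moreover have "(\<Sum>i<dim K. c i * (b j \<bullet> b i)) = (\<Sum>i<dim K. if i = j then c i else 0)"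
        by (rule sum.cong) (use j in \<open>auto simp: bb\<close>)
      ultimately show ?thesis using j by simp
    qed
    obtain v where v: "dird v \<rho> (P y) \<noteq> 0" using \<rho>(3)[OF Py(1)] by (rule exE)
    have "dird (dird v F (P y)) P y = v" using dird_PF[OF PA, of v] unfolding Py(2) .
    then have "c (dim K) * dird v \<rho> (P y) = 0" using sum[of "dird v F (P y)"] c1 by simp
    then show ?thesis using c1 v by (simp add: less_Suc_eq)
  qed
  have "smooth_submanifold d ?S"
    unfolding smooth_submanifold_def dd
  proof (intro conjI ballI)
    show "d \<le> DIM(complex^'k)" by (simp add: d_def)
    fix q assume q: "q \<in> ?S"
    show "\<exists>V \<rho>. open V \<and> q \<in> V \<and> (\<forall>i<Suc (dim K). smooth_on V (\<rho> i)) \<and> ?S \<inter> V = {z\<in>V. \<forall>i<Suc (dim K). \<rho> i z = 0} \<and>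
      (\<forall>z\<in>?S \<inter> V. \<forall>c :: nat \<Rightarrow> real. (\<forall>v. (\<Sum>i<Suc (dim K). c i * frechet_derivative (\<rho> i) (at z) v) = 0) \<longrightarrow> (\<forall>i<Suc (dim K). c i = 0))"
    proof (intro exI[of _ Y] exI[of _ r] conjI ballI allI[where 'a="nat \<Rightarrow> real"] impI)
      show "q \<in> Y" using q SY by blast
    qed (use open_Y sm zero indep in blast)+
  qed
  then show ?thesis by blast
qed

end

section \<open>Constant rank and the local embedding\<close>

text \<open>The frame identifies the tangent space with a hyperplane that does not depend on q; this
  is the constant CR dimension required of the image.\<close>

lemma dim_T10_frame:
  fixes n0 :: "'n::finite"
  assumes fr: "defining_frame n0 q \<nu> u \<epsilon> \<sigma> V" and \<sigma>: "local_defining_function M q V \<sigma>" "q \<in> M"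
    and u: "\<And>j. j \<noteq> n0 \<Longrightarrow> u j \<in> T10 M q"
  shows "vec.dim (T10 M q) = vec.dim {z::complex^'n. z $ n0 = 0}"
proof -
  interpret defining_frame n0 q \<nu> u \<epsilon> \<sigma> V by (rule fr)
  let ?A = "\<lambda>z::complex^'n. (\<Sum>j\<in>UNIV-{n0}. z $ j *s u j) + z $ n0 *s \<nu>"
  have lin: "Vector_Spaces.linear (*s) (*s) ?A"
  proof (rule clinearI)
    show "?A (x + y) = ?A x + ?A y" for x y by (rule linear_add[OF linear_frame])
    show "?A (c *s x) = c *s ?A x" for c x
    proof -
      have "(\<Sum>j\<in>UNIV-{n0}. (c *s x) $ j *s u j) = c *s (\<Sum>j\<in>UNIV-{n0}. x $ j *s u j)"
        unfolding vec.scale_sum_right by (rule sum.cong) auto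
      then show ?thesis by (simp add: vec.scale_right_distrib)
    qed
  qed
  have inj: "inj ?A" unfolding linear_injective_0[OF linear_frame] by (intro allI impI) (rule frame_injective)
  have "T10 M q = ?A ` {z. z $ n0 = 0}"
  proof (intro equalityI subsetI)
    fix a assume a: "a \<in> T10 M q"
    obtain z where z: "a = ?A z" using linear_inj_imp_surj[OF linear_frame inj] by (rule surjE)
    have "dbar \<sigma> q (?A z) = 0" using T10_dbar[OF \<sigma> a] unfolding z .
    then have "z $ n0 * (- \<i> / 2) = 0" unfolding dbar_linear[OF \<sigma>_diff] dbar_sum dbar_\<nu> by simp
    then have "z $ n0 = 0" by simp
    then show "a \<in> ?A ` {z. z $ n0 = 0}" using z by blast
  next
    fix a assume "a \<in> ?A ` {z. z $ n0 = 0}"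
    then obtain z where z: "a = ?A z" "z $ n0 = 0" by blast
    have "(\<Sum>j\<in>UNIV-{n0}. z $ j *s u j) \<in> T10 M q"
      by (rule vec.subspace_sum[OF T10_subspace], rule vec.subspace_scale[OF T10_subspace]) (use u in simp)
    then show "a \<in> T10 M q" unfolding z by (simp add: z(2))
  qed
  then show ?thesis by (simp only:) (rule vec.dim_image_eq[OF lin inj_on_subset[OF inj subset_UNIV]])
qed

text \<open>Let \<pi> be a left inverse of dF at p. Then \<pi> \<circ> F has identity differential
  at p and hence a local inverse G, and P = G \<circ> \<pi> is a left inverse of F. P is constant
  along the kernel of \<pi>, and \<pi> annihilates y - F (P y), as \<open>image_submanifold\<close>
  requires.\<close>

theorem immersion_local_CR_embedding:
  fixes M :: "(complex^'n::finite) set" and F :: "complex^'n \<Rightarrow> complex^'k::finite"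
  assumes M: "smooth_real_hypersurface M" "p \<in> M" and dim: "\<And>q. q \<in> M \<Longrightarrow> vec.dim (T10 M q) = r"
    and U: "open U" "p \<in> U" and F: "holomorphic_map_on U F" "F ` (M \<inter> U) \<subseteq> S'"
    and imm: "\<And>v. dird v F p = 0 \<Longrightarrow> v = 0"
  shows "local_CR_embedding_near F M S' p"
proof -
  obtain V \<rho> where "local_defining_function M p V \<rho>"
    using M unfolding smooth_real_hypersurface_def by blast
  then have V: "open V" "p \<in> V" "smooth_on V \<rho>" "M \<inter> V = {z\<in>V. \<rho> z = 0}"
    "\<forall>z\<in>M \<inter> V. \<exists>v. dird v \<rho> z \<noteq> 0"
    unfolding local_defining_function_def dird_def by blast+
  have UV: "open (U \<inter> V)" "p \<in> U \<inter> V" using U V by auto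
  have FUV: "holomorphic_map_on (U \<inter> V) F" by (rule holomorphic_map_subset[OF F(1)]) blast
  have linD: "Vector_Spaces.linear (*s) (*s) (\<lambda>v. dird v F p)"
    by (rule clinearI) (simp_all add: linear_add[OF has_derivative_linear[OF holomorphic_map_deriv(1)[OF F(1) U(2)]]] holomorphic_map_deriv(2)[OF F(1) U(2)])
  have "inj (\<lambda>v. dird v F p)"
    unfolding linear_injective_0[OF holomorphic_map_clinear(3)[OF linD]] using imm by blast
  then have "\<exists>\<pi>. Vector_Spaces.linear (*s) (*s) \<pi> \<and> \<pi> \<circ> (\<lambda>v. dird v F p) = id"
    by (rule vec.linear_injective_left_inverse[OF linD])
  then obtain \<pi> where "Vector_Spaces.linear (*s) (*s) \<pi> \<and> \<pi> \<circ> (\<lambda>v. dird v F p) = id" by (rule exE)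
  then have \<pi>: "Vector_Spaces.linear (*s) (*s) \<pi>" and \<pi>D: "\<pi> (dird v F p) = v" for v
    by (auto simp: fun_eq_iff)
  note \<pi>_hol = holomorphic_map_clinear(1)[OF \<pi>] and \<pi>_lin = holomorphic_map_clinear(3)[OF \<pi>]
  define h where "h z = \<pi> (F z)" for z
  have h: "holomorphic_map_on (U \<inter> V) h" unfolding h_def
    by (rule holomorphic_map_compose[OF FUV \<pi>_hol[of UNIV]]) simp
  have dh: "dird v h p = v" for v
  proof -
    have "(\<pi> has_derivative (\<lambda>w. dird w \<pi> (F p))) (at (F p))" by (rule holomorphic_map_deriv(1)[OF \<pi>_hol[of UNIV]]) simp
    from has_derivative_compose[OF holomorphic_map_deriv(1)[OF F(1) U(2)] this]
    have "dird v (\<lambda>z. \<pi> (F z)) p = dird (dird v F p) \<pi> (F p)" by (rule dird_eq)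
    then show ?thesis unfolding holomorphic_map_clinear(2)[OF \<pi>] \<pi>D h_def .
  qed
  obtain A Y G where A: "open A" "A \<subseteq> U \<inter> V" "p \<in> A" "open Y" "holomorphic_map_on Y G" "homeomorphism A Y h G"
    using holomorphic_local_inverse[OF UV h dh] by (elim exE conjE)
  define P where "P y = G (\<pi> y)" for y
  have hG: "h (G y) = y" "G y \<in> A" if "y \<in> Y" for y using A(6) that unfolding homeomorphism_def by blast+
  have Gh: "G (h z) = z" "h z \<in> Y" if "z \<in> A" for z using A(6) that unfolding homeomorphism_def by blast+
  have oY: "open (\<pi> -` Y)" by (rule open_vimage[OF A(4) linear_continuous_on]) (simp add: linear_conv_bounded_linear[symmetric] \<pi>_lin)
  interpret R: holomorphic_retraction A "\<pi> -` Y" F P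
  proof
    show "holomorphic_map_on A F" by (rule holomorphic_map_subset[OF F(1)]) (use A(2) in blast)
    show "holomorphic_map_on (\<pi> -` Y) P" unfolding P_def by (rule holomorphic_map_compose[OF \<pi>_hol A(5)]) simp
    show "F ` A \<subseteq> \<pi> -` Y" using Gh(2) by (auto simp: h_def)
    show "P ` (\<pi> -` Y) \<subseteq> A" using hG(2) by (auto simp: P_def)
    show "P (F z) = z" if "z \<in> A" for z using Gh(1)[OF that] by (simp add: P_def h_def)
  qed (fact A oY)+
  have SM: "M \<inter> A \<subseteq> A" "F ` (M \<inter> A) \<subseteq> S'" using A(2) F(2) by blast+
  have "\<exists>d. smooth_submanifold d (F ` (M \<inter> A))"
  proof (rule R.image_submanifold[of \<pi> \<rho>])
    show "linear \<pi>" by (rule \<pi>_lin)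
    show "\<pi> (R.defect y) = 0" if "y \<in> \<pi> -` Y" for y
      using hG(1)[of "\<pi> y"] that by (simp add: R.defect_def linear_diff[OF \<pi>_lin] P_def h_def)
    show "dird v P y = 0" if y: "y \<in> \<pi> -` Y" and v: "\<pi> v = 0" for y v
    proof -
      have yY: "\<pi> y \<in> Y" using y by simp
      have "(\<pi> has_derivative (\<lambda>w. dird w \<pi> y)) (at y)" by (rule holomorphic_map_deriv(1)[OF \<pi>_hol[of UNIV]]) simp
      from has_derivative_compose[OF this holomorphic_map_deriv(1)[OF A(5) yY]]
      have "dird v P y = dird (dird v \<pi> y) G (\<pi> y)" unfolding P_def by (rule dird_eq)
      then show ?thesis unfolding holomorphic_map_clinear(2)[OF \<pi>] v
        using linear_0[OF has_derivative_linear[OF holomorphic_map_deriv(1)[OF A(5) yY]]] by simp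
    qed
    show "surj \<pi>" by (rule surjI[of _ "\<lambda>v. dird v F p"]) (rule \<pi>D)
    show "smooth_on A \<rho>" by (rule smooth_on_subset[OF V(3)]) (use A(2) in blast)
    show "M \<inter> A = {z\<in>A. \<rho> z = 0}" using V(4) A(2) by blast
    show "\<exists>v. dird v \<rho> z \<noteq> 0" if "z \<in> M \<inter> A" for z using V(5) A(2) that by blast
  qed
  moreover have "vec.dim (T10 (F ` (M \<inter> A)) q) = r" if q: "q \<in> F ` (M \<inter> A)" for q
  proof -
    obtain z where z: "q = F z" "z \<in> M \<inter> A" using q by blast
    have "vec.dim (T10 (F ` (M \<inter> A)) (F z)) = vec.dim (T10 (M \<inter> A) z)" by (rule R.dim_T10_image[OF SM(1) z(2)])
    also have "\<dots> = r" using T10_open_Int[OF A(1), of z M] dim z(2) by simp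
    finally show ?thesis by (simp add: z(1))
  qed
  ultimately have "CR_submanifold_of (F ` (M \<inter> A)) S'"
    unfolding CR_submanifold_of_def using SM(2) by blast
  then show ?thesis
    unfolding local_CR_embedding_near_def
    using A(1,3) R.F_embedding[OF SM] R.F_CR_diffeomorphism[OF SM(1)] by blast
qed

theorem theorem1p2:
  fixes M :: "(complex^'n::finite) set"
    and p :: "complex^'n"
    and U :: "(complex^'n) set"
    and F :: "complex^'n \<Rightarrow> complex^'k::finite"
    and e :: "nat \<Rightarrow> 'k"
    and l :: nat
  assumes "CARD('n) \<ge> 3"
    and "CARD('k) \<ge> CARD('n)"
    and "0 < l"
    and "real l \<le> (real CARD('n) - 1) / 2"
    and "bij_betw e {1..CARD('k)} UNIV"
    and "smooth_real_hypersurface M"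
    and "levi_nondegenerate M"
    and "has_signature M l"
    and "p \<in> M"
    and "open U"
    and "p \<in> U"
    and "holomorphic_map_on U F"
    and "F ` (M \<inter> U) \<subseteq> hyperquadric e l"
  shows "(CR_transversal_at F (hyperquadric e l) p
            \<or> totally_degenerate_at F (hyperquadric e l) p)
       \<and> (\<not> totally_degenerate_at F (hyperquadric e l) p
            \<longrightarrow> local_CR_embedding_near F M (hyperquadric e l) p)"
proof (cases "totally_degenerate_at F (hyperquadric e l) p")
  case False
  have "real (2 * l + 1) \<le> real CARD('n)" using assms(4) by (simp add: field_simps)
  then have "2 * l + 1 \<le> CARD('n)" by (simp only: of_nat_le_iff)
  then have l: "l \<le> CARD('n) - 1 - l" "l < CARD('k)" using assms(2) by linarith+
  have "(\<exists>\<nu>. cnj (dird \<nu> F p $ e CARD('k)) / (2 * \<i>) + quadric_form e l (F p) (dird \<nu> F p) \<noteq> 0) \<and> (\<forall>v. dird v F p = 0 \<longrightarrow> v = 0)"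
    by (rule mp[OF iffD1[OF disj_imp degenerate_or_transversal_immersion[OF assms(2,3,4,6,8-13)]] False])
  then obtain \<nu> where \<nu>: "cnj (dird \<nu> F p $ e CARD('k)) / (2 * \<i>) + quadric_form e l (F p) (dird \<nu> F p) \<noteq> 0"
    and imm: "\<And>v. dird v F p = 0 \<Longrightarrow> v = 0" by blast
  have "F p \<in> hyperquadric e l" using assms(9,11,13) by blast
  from CR_transversal_hyperquadric[OF bij_betw_imp_inj_on[OF assms(5)] l(2) this assms(12,11) \<nu>]
  have tr: "CR_transversal_at F (hyperquadric e l) p" .
  \<comment> \<open>The right-hand side is the same for all q; \<open>undefined\<close> merely names
    some coordinate as the normal one.\<close>
  have dim: "vec.dim (T10 M q) = vec.dim {z::complex^'n. z $ undefined = 0}" if q: "q \<in> M" for q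
  proof -
    obtain \<sigma> V \<nu> u \<epsilon> where E: "local_defining_function M q V \<sigma>" "defining_frame undefined q \<nu> u \<epsilon> \<sigma> V"
      "\<forall>j. j \<noteq> undefined \<longrightarrow> u j \<in> T10 M q"
      using defining_frame_exists[OF assms(3) l(1) assms(6,8) q, of undefined] by (elim exE conjE)
    show ?thesis by (rule dim_T10_frame[OF E(2,1) q]) (use E(3) in blast)
  qed
  have "local_CR_embedding_near F M (hyperquadric e l) p"
    by (rule immersion_local_CR_embedding[OF assms(6,9) dim assms(10-13) imm])
  then show ?thesis using tr False by simp
qed simp

end
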